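(* Let $p\in(1,\infty]$. Let $\Omega\subset\mathbb{R}^N$ be a domain with boundary $\Gamma$ such that $\Gamma=\partial(\mathbb{R}^N\setminus\overline{\Omega})$, and let $u$ be the bounded viscosity solution of $$u_t=\Delta_p^G u \ \text{ in } \Omega\times(0,\infty),\qquad u=0 \ \text{ on } \Omega\times\{0\},\qquad u=1\ \text{ on } \Gamma\times(0,\infty).$$ Then $$\lim_{t\to0^+}4t\log u(x,t)=-p'\,d_\Gamma(x)^2\quad\text{for every } x\in\overline{\Omega}.$$
   Context: $N\ge2$; a domain is a connected open set, not necessarily bounded, with nonempty boundary $\Gamma$; $d_\Gamma(x)=\inf\{|x-y|:y\in\Gamma\}$. $p'=p/(p-1)$ for $1<p<\infty$ and $p'=1$ for $p=\infty$. Game-theoretic $p$-laplacian: $\Delta_p^Gu=\frac1p\Delta u+\left(1-\frac2p\right)\frac{\langle\nabla^2u\,\nabla u,\nabla u\rangle}{|\nabla u|^2}$ (with $1/p=0$ if $p=\infty$), i.e. $\Delta_p^Gu=-F(\nabla u,\nabla^2u)$ where, for $\xi\in\mathbb{R}^N\setminus\{0\}$ and $X$ a symmetric $N\times N$ matrix, $F(\xi,X)=-\mathrm{tr}[A(\xi)X]$, $A(\xi)=\frac1pI+\left(1-\frac2p\right)\frac{\xi\otimes\xi}{|\xi|^2}$. The semicontinuous envelopes are $F_*(\xi,X)=\lim_{\delta\to0^+}\inf\{F(\eta,Y):\eta\ne0,|\eta-\xi|<\delta,|Y-X|<\delta\}$ and $F^*=-(-F)_*$. Viscosity solutions of $u_t=\Delta_p^Gu$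 in $\Omega\times(0,\infty)$: an upper semicontinuous $u$ is a subsolution if $\phi_t+F_*(\nabla\phi,\nabla^2\phi)\le0$ at $(x,t)$ whenever $\phi\in C^2(\Omega\times(0,\infty))$ and $u-\phi$ attains its maximum at $(x,t)$; a lower semicontinuous $v$ is a supersolution if $\psi_t+F^*(\nabla\psi,\nabla^2\psi)\ge0$ at $(x,t)$ whenever $\psi\in C^2(\Omega\times(0,\infty))$ and $v-\psi$ attains its minimum at $(x,t)$; a solution is both. The initial and boundary values are attained continuously on $\Omega\times\{0\}$ and $\Gamma\times(0,\infty)$; the bounded viscosity solution of the problem is unique by comparison. *)

theory Defs
  imports "HOL-Analysis.Analysis"
begin

section \<open>The game-theoretic p-Laplacian\<close>

text \<open>
  The exponent is an extended real number \<open>p > 1\<close>. In \<^typ>\<open>ereal\<close> we have \<open>1 / \<infinity> = 0\<close>,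
  so that \<open>recip p = 0\<close> for \<open>p = \<infinity>\<close>.
\<close>

definition recip :: "ereal \<Rightarrow> real" where
  "recip p = real_of_ereal (1 / p)"

definition conj_exponent :: "ereal \<Rightarrow> real" where
  "conj_exponent p = (if p = \<infinity> then 1 else real_of_ereal p / (real_of_ereal p - 1))"

definition tensor :: "real^'n \<Rightarrow> real^'n \<Rightarrow> real^'n^'n" where
  "tensor a b = (\<chi> i j. a $ i * b $ j)"

definition Amat :: "ereal \<Rightarrow> real^'n \<Rightarrow> real^'n^'n" where
  "Amat p \<xi> = recip p *\<^sub>R mat 1 + ((1 - 2 * recip p) / (norm \<xi>)\<^sup>2) *\<^sub>R tensor \<xi> \<xi>"

definition Fop :: "ereal \<Rightarrow> real^'n \<Rightarrow> real^'n^'n \<Rightarrow> real" where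
  "Fop p \<xi> X = - trace (Amat p \<xi> ** X)"

text \<open>
  The value of \<open>G\<close> at \<open>\<xi> = 0\<close> is never used, and the matrices \<open>Y\<close> range over the symmetric
  ones. The norm on \<^typ>\<open>real^'n^'n\<close> is the Frobenius norm. For \<open>G = Fop p\<close> and
  \<open>G = - Fop p\<close> and symmetric \<open>X\<close> the infimum is over a nonempty set that is bounded below and it is
  monotone in \<open>\<delta>\<close>, so that \<open>Inf\<close> and \<open>Lim\<close> have their usual meaning.
\<close>

definition lower_envelope ::
    "(real^'n \<Rightarrow> real^'n^'n \<Rightarrow> real) \<Rightarrow> real^'n \<Rightarrow> real^'n^'n \<Rightarrow> real" where
  "lower_envelope G \<xi> X =
     Lim (at_right 0) (\<lambda>\<delta>::real. Inf {G \<eta> Y | \<eta> Y.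
       \<eta> \<noteq> 0 \<and> transpose Y = Y \<and> norm (\<eta> - \<xi>) < \<delta> \<and> norm (Y - X) < \<delta>})"

definition upper_envelope ::
    "(real^'n \<Rightarrow> real^'n^'n \<Rightarrow> real) \<Rightarrow> real^'n \<Rightarrow> real^'n^'n \<Rightarrow> real" where
  "upper_envelope G \<xi> X = - lower_envelope (\<lambda>\<eta> Y. - G \<eta> Y) \<xi> X"


section \<open>Test functions and their derivatives\<close>

definition C2_on :: "('a::real_normed_vector \<Rightarrow> real) \<Rightarrow> 'a set \<Rightarrow> bool" where
  "C2_on f S \<longleftrightarrow>
     (\<exists>(f' :: 'a \<Rightarrow> 'a \<Rightarrow>\<^sub>L real) (f'' :: 'a \<Rightarrow> 'a \<Rightarrow>\<^sub>L 'a \<Rightarrow>\<^sub>L real).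
        (\<forall>z\<in>S. (f has_derivative blinfun_apply (f' z)) (at z)) \<and>
        (\<forall>z\<in>S. (f' has_derivative blinfun_apply (f'' z)) (at z)) \<and>
        continuous_on S f'')"

definition grad :: "(real^'n \<Rightarrow> real) \<Rightarrow> real^'n \<Rightarrow> real^'n" where
  "grad g x = (\<chi> i. frechet_derivative g (at x) (axis i 1))"

definition hessian :: "(real^'n \<Rightarrow> real) \<Rightarrow> real^'n \<Rightarrow> real^'n^'n" where
  "hessian g x = (\<chi> i j. frechet_derivative (\<lambda>y. grad g y $ j) (at x) (axis i 1))"

text \<open>Functions of space and time take a pair \<open>(x, t)\<close>; \<open>grad\<close> and \<open>hessian\<close> act on \<open>x\<close> only.\<close>

definition dt :: "((real^'n) \<times> real \<Rightarrow> real) \<Rightarrow> real^'n \<Rightarrow> real \<Rightarrow> real" where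
  "dt \<phi> x t = deriv (\<lambda>s. \<phi> (x, s)) t"

definition dx :: "((real^'n) \<times> real \<Rightarrow> real) \<Rightarrow> real^'n \<Rightarrow> real \<Rightarrow> real^'n" where
  "dx \<phi> x t = grad (\<lambda>y. \<phi> (y, t)) x"

definition dxx :: "((real^'n) \<times> real \<Rightarrow> real) \<Rightarrow> real^'n \<Rightarrow> real \<Rightarrow> real^'n^'n" where
  "dxx \<phi> x t = hessian (\<lambda>y. \<phi> (y, t)) x"


section \<open>Viscosity solutions\<close>

definition usc_on :: "'a::topological_space set \<Rightarrow> ('a \<Rightarrow> real) \<Rightarrow> bool" where
  "usc_on S u \<longleftrightarrow> (\<forall>z\<in>S. \<forall>a > u z. \<forall>\<^sub>F w in at z within S. u w < a)"

definition lsc_on :: "'a::topological_space set \<Rightarrow> ('a \<Rightarrow> real) \<Rightarrow> bool" where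
  "lsc_on S u \<longleftrightarrow> (\<forall>z\<in>S. \<forall>a < u z. \<forall>\<^sub>F w in at z within S. a < u w)"

definition visc_subsolution ::
    "ereal \<Rightarrow> (real^'n) set \<Rightarrow> ((real^'n) \<times> real \<Rightarrow> real) \<Rightarrow> bool" where
  "visc_subsolution p \<Omega> u \<longleftrightarrow>
     usc_on (\<Omega> \<times> {0<..}) u \<and>
     (\<forall>\<phi>. \<forall>x\<in>\<Omega>. \<forall>t>0.
        C2_on \<phi> (\<Omega> \<times> {0<..}) \<longrightarrow>
        (\<forall>z \<in> \<Omega> \<times> {0<..}. u z - \<phi> z \<le> u (x, t) - \<phi> (x, t)) \<longrightarrow>
        dt \<phi> x t + lower_envelope (Fop p) (dx \<phi> x t) (dxx \<phi> x t) \<le> 0)"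

definition visc_supersolution ::
    "ereal \<Rightarrow> (real^'n) set \<Rightarrow> ((real^'n) \<times> real \<Rightarrow> real) \<Rightarrow> bool" where
  "visc_supersolution p \<Omega> v \<longleftrightarrow>
     lsc_on (\<Omega> \<times> {0<..}) v \<and>
     (\<forall>\<psi>. \<forall>x\<in>\<Omega>. \<forall>t>0.
        C2_on \<psi> (\<Omega> \<times> {0<..}) \<longrightarrow>
        (\<forall>z \<in> \<Omega> \<times> {0<..}. v (x, t) - \<psi> (x, t) \<le> v z - \<psi> z) \<longrightarrow>
        dt \<psi> x t + upper_envelope (Fop p) (dx \<psi> x t) (dxx \<psi> x t) \<ge> 0)"

definition visc_solution ::
    "ereal \<Rightarrow> (real^'n) set \<Rightarrow> ((real^'n) \<times> real \<Rightarrow> real) \<Rightarrow> bool" where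
  "visc_solution p \<Omega> u \<longleftrightarrow> visc_subsolution p \<Omega> u \<and> visc_supersolution p \<Omega> u"

text \<open>
  Zero initial values and unit boundary values, attained continuously. Nothing is required on
  the edge \<open>frontier \<Omega> \<times> {0}\<close>, where the two data are incompatible.
\<close>

definition attains_data :: "(real^'n) set \<Rightarrow> ((real^'n) \<times> real \<Rightarrow> real) \<Rightarrow> bool" where
  "attains_data \<Omega> u \<longleftrightarrow>
     (\<forall>x\<in>\<Omega>. u (x, 0) = 0) \<and>
     (\<forall>x\<in>frontier \<Omega>. \<forall>t>0. u (x, t) = 1) \<and>
     continuous_on (closure \<Omega> \<times> {0..} - frontier \<Omega> \<times> {0}) u"

end

theory Submission
  imports Defs "HOL-Complex_Analysis.Great_Picard"
begin

text \<open>
  With \<open>a = 1 / p\<close> the operator is \<open>a\<close> times the Laplacian plus \<open>1 - 2 * a\<close> times the second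
  derivative in the direction of the gradient. On a function of \<open>|x - z|\<close> the gradient is radial, so the
  radial second derivative is multiplied by \<open>1 - a = 1 / p'\<close>, and up to lower-order terms
  \<open>exp (- \<nu> * |x - z|\<^sup>2 / (4 * t))\<close> is a subsolution when \<open>\<nu> > p'\<close> and a supersolution when
  \<open>\<nu> < p'\<close>. The limit is obtained by placing such barriers above and below \<open>u\<close>.

  Upper bound (\<open>heat_kernel_upper_bound\<close>): in a ball of radius \<open>R\<close> slightly smaller than the distance
  \<open>d\<close> of its centre to the boundary, \<open>u\<close> is bounded and vanishes initially. The barrier is Gaussian in a rounded
  version of the distance to the sphere, which is smooth at the centre. Lower bound
  (\<open>heat_kernel_lower_bound\<close>): the hypothesis on the boundary gives points \<open>z\<close> outside the closure
  of the domain that are arbitrarily close to a nearest boundary point. A ball around \<open>z\<close> lies outside as well,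
  so the Gaussian centred at \<open>z\<close> starts from zero on the domain and never exceeds the boundary value 1.
  Since the domain may be unbounded, this comparison needs to know that \<open>u\<close> is nonnegative at infinity.

  That \<open>u \<ge> 0\<close> (\<open>solution_nonneg\<close>) is the difficult point: it is a comparison principle on a possibly
  unbounded domain, for an operator that is singular where the gradient vanishes, and with data that jump at the
  initial boundary. Let \<open>V\<close> be the negative part of \<open>u\<close>, extended by zero and normalised to
  supremum 1. One compares \<open>V (x, t + \<eta>)\<close> with \<open>V (y, t + \<tau>)\<close> for two very different small shifts
  \<open>\<eta>\<close> and \<open>\<tau>\<close>. At \<open>t = 0\<close> and for \<open>x\<close> close to \<open>y\<close> one of the two values is small: the second one
  near the boundary, where \<open>V\<close> vanishes for positive times, and the first one away from the boundary, where the
  initial values are zero. Hence the sum starts below \<open>1 + 1 / 8\<close> plus a kernel that is large where \<open>x\<close> and \<open>y\<close>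
  are far apart. If the sum stays below that, then letting both shifts tend to zero gives \<open>2 * V \<le> 3 / 2\<close>,
  which contradicts \<open>sup V = 1\<close>.

  That the sum stays below the kernel is shown by coupling (\<open>doubled_kernel_max_absurd\<close>): at a first contact the two
  functions are tested along the displacements \<open>T\<^sub>1 * w\<close> and \<open>T\<^sub>2 * w\<close> of \<open>x\<close> and \<open>y\<close>, where the
  matrices \<open>T\<^sub>1\<close> and \<open>T\<^sub>2\<close> turn the two frozen operators into the Laplacian in \<open>w\<close>. When \<open>x\<close> and \<open>y\<close> are far apart
  on the scale of the kernel, one reflects one of them, and the kernel is strictly
  concave in the direction \<open>x - y\<close>; at smaller distances one moves them in parallel; and where the gradient
  may vanish one uses the two functions separately, with an error that the kernel absorbs by its growth in time.

  The tool that permits to test two nonsmooth functions at once replaces the Jensen--Ishii lemma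
  (\<open>coupled_max\<close>, \<open>doubled_max\<close>). After sup-convolution both functions are semiconvex, hence
  once differentiable at a common maximum. Blowing both of them up parabolically, the first one has a continuous limit
  on the initial slice; the caloric function with these initial values lies above the first
  function, and its negative plus a quadratic caloric polynomial lies above the second one. Adding the two bounds at the
  origin cancels the caloric function and leaves the trace of the Hessian of the test function.
\<close>

section \<open>The operator on gradients and Hessians\<close>

definition Lop :: "real \<Rightarrow> real^'n \<Rightarrow> real^'n^'n \<Rightarrow> real" where
  "Lop a \<xi> X = a * trace X + (1 - 2 * a) * (\<xi> \<bullet> (X *v \<xi>)) / (norm \<xi>)\<^sup>2"

lemma norm_matrix_vector_le:
  fixes A :: "real^'n^'m"
  shows "norm (A *v x) \<le> norm A * norm x"
proof -
  have "norm (A *v x) = L2_set (\<lambda>i. \<bar>A $ i \<bullet> x\<bar>) UNIV"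
    by (simp add: norm_vec_def matrix_vector_mul_component)
  also have "\<dots> \<le> L2_set (\<lambda>i. norm (A $ i) * norm x) UNIV"
    by (intro L2_set_mono) (auto simp: Cauchy_Schwarz_ineq2)
  also have "\<dots> = norm A * norm x"
    by (simp add: norm_vec_def L2_set_left_distrib)
  finally show ?thesis .
qed

lemma abs_quadratic_form_le:
  fixes A :: "real^'n^'n"
  shows "\<bar>x \<bullet> (A *v y)\<bar> \<le> norm A * norm x * norm y"
proof -
  have "\<bar>x \<bullet> (A *v y)\<bar> \<le> norm x * norm (A *v y)" by (rule Cauchy_Schwarz_ineq2)
  also have "\<dots> \<le> norm x * (norm A * norm y)"
    by (intro mult_left_mono norm_matrix_vector_le) auto
  finally show ?thesis by (simp add: ac_simps)
qed

lemma abs_trace_le: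
  fixes A :: "real^'n^'n"
  shows "\<bar>trace A\<bar> \<le> real CARD('n) * norm A"
proof -
  have "\<bar>A $ i $ i\<bar> \<le> norm A" for i
    using component_le_norm_cart[of "A $ i" i] Finite_Cartesian_Product.norm_nth_le[of A i] by linarith
  then have "\<bar>trace A\<bar> \<le> (\<Sum>i\<in>(UNIV::'n set). norm A)"
    unfolding trace_def by (intro order_trans[OF sum_abs] sum_mono) auto
  then show ?thesis by simp
qed

lemma abs_Lop_le:
  fixes X :: "real^'n^'n"
  assumes "0 \<le> a" "a < 1"
  shows "\<bar>Lop a \<xi> X\<bar> \<le> (real CARD('n) + 1) * norm X"
proof -
  have "\<bar>(\<xi> \<bullet> (X *v \<xi>)) / (norm \<xi>)\<^sup>2\<bar> \<le> norm X"
  proof (cases "\<xi> = 0")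
    case False
    then show ?thesis
      using abs_quadratic_form_le[of \<xi> X \<xi>] by (simp add: divide_simps power2_eq_square ac_simps)
  qed auto
  then have 1: "\<bar>(1 - 2 * a) * ((\<xi> \<bullet> (X *v \<xi>)) / (norm \<xi>)\<^sup>2)\<bar> \<le> 1 * norm X"
    unfolding abs_mult using assms by (intro mult_mono) auto
  have 2: "\<bar>a * trace X\<bar> \<le> 1 * (real CARD('n) * norm X)"
    unfolding abs_mult using assms by (intro mult_mono abs_trace_le) auto
  have "\<bar>Lop a \<xi> X\<bar> \<le> \<bar>a * trace X\<bar> + \<bar>(1 - 2 * a) * ((\<xi> \<bullet> (X *v \<xi>)) / (norm \<xi>)\<^sup>2)\<bar>"
    unfolding Lop_def using abs_triangle_ineq[of "a * trace X" "(1 - 2 * a) * ((\<xi> \<bullet> (X *v \<xi>)) / (norm \<xi>)\<^sup>2)"] by simp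
  then show ?thesis using 1 2 by (simp add: algebra_simps)
qed

lemma Lop_uminus_left [simp]: "Lop a (- \<xi>) X = Lop a \<xi> X"
  unfolding Lop_def by (simp add: vec.neg)

lemma trace_uminus [simp]: "trace (- X) = - trace (X :: real^'n^'n)"
  by (simp add: trace_def sum_negf)

lemma trace_scaleR [simp]: "trace (r *\<^sub>R X) = r * trace (X :: real^'n^'n)"
  by (simp add: trace_def sum_distrib_left)

lemma matrix_vector_mult_uminus [simp]: "(- X) *v y = - (X *v (y :: real^'n))"
  by (simp add: vec_eq_iff matrix_vector_mult_def sum_negf)

lemma Lop_uminus_right [simp]: "Lop a \<xi> (- X) = - Lop a \<xi> X"
  unfolding Lop_def by simp

lemma Lop_add: "Lop a \<xi> (X + Y) = Lop a \<xi> X + Lop a \<xi> Y"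
  unfolding Lop_def
  by (simp add: trace_add matrix_vector_mult_add_rdistrib inner_add_right add_divide_distrib distrib_left)

lemma Lop_diff: "Lop a \<xi> (X - Y) = Lop a \<xi> X - Lop a \<xi> Y"
  using Lop_add[of a \<xi> X "- Y"] by simp

lemma Lop_scaleR: "Lop a \<xi> (r *\<^sub>R X) = r * Lop a \<xi> X"
  unfolding Lop_def
  by (simp add: scaleR_matrix_vector_assoc[symmetric] algebra_simps)

lemma Fop_eq_Lop:
  fixes X :: "real^'n^'n"
  assumes "transpose X = X"
  shows "Fop p \<xi> X = - Lop (recip p) \<xi> X"
proof -
  have sym: "X $ i $ j = X $ j $ i" for i j
    using arg_cong[OF assms, of "\<lambda>M. M $ i $ j"] by (simp add: transpose_def)
  have "trace (tensor \<xi> \<xi> ** X) = (\<Sum>i\<in>UNIV. \<Sum>k\<in>UNIV. \<xi> $ i * (\<xi> $ k * X $ k $ i))"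
    by (simp add: trace_def matrix_matrix_mult_def tensor_def mult.assoc)
  also have "\<dots> = (\<Sum>i\<in>UNIV. \<xi> $ i * (\<Sum>k\<in>UNIV. X $ i $ k * \<xi> $ k))"
    unfolding sum_distrib_left
    by (intro sum.cong refl) (subst sym, simp add: mult.commute)
  also have "\<dots> = \<xi> \<bullet> (X *v \<xi>)"
    by (simp add: inner_vec_def matrix_vector_mult_def)
  finally have t: "trace (tensor \<xi> \<xi> ** X) = \<xi> \<bullet> (X *v \<xi>)" .
  have sc: "trace ((r *\<^sub>R A) ** X) = r * trace (A ** X)" for r and A :: "real^'n^'n"
    by (simp add: trace_def matrix_matrix_mult_def sum_distrib_left mult.assoc)
  have ad: "trace ((A + B) ** X) = trace (A ** X) + trace (B ** X)" for A B :: "real^'n^'n"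
    by (simp add: trace_def matrix_matrix_mult_def distrib_right sum.distrib)
  show ?thesis
    unfolding Fop_def Amat_def Lop_def by (simp add: ad sc t)
qed

text \<open>
  A one-sided bound near \<open>(\<xi>, X)\<close> is all that is ever used of the envelope, so that the limit in its
  definition is evaluated only here. The growth bound on \<open>G\<close> makes the infima finite.
\<close>

lemma lower_envelope_ge:
  fixes G :: "real^'n \<Rightarrow> real^'n^'n \<Rightarrow> real"
  assumes sym: "transpose X = X"
    and C: "\<And>\<eta> Y. \<eta> \<noteq> 0 \<Longrightarrow> transpose Y = Y \<Longrightarrow> \<bar>G \<eta> Y\<bar> \<le> C * norm Y" and "0 \<le> C"
    and d: "0 < d" and b: "\<And>\<eta> Y. \<eta> \<noteq> 0 \<Longrightarrow> transpose Y = Y \<Longrightarrow> norm (\<eta> - \<xi>) < d \<Longrightarrow>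
              norm (Y - X) < d \<Longrightarrow> b \<le> G \<eta> Y"
  shows "b \<le> lower_envelope G \<xi> X"
proof -
  define S where "S \<delta> = {G \<eta> Y | \<eta> Y.
       \<eta> \<noteq> 0 \<and> transpose Y = Y \<and> norm (\<eta> - \<xi>) < \<delta> \<and> norm (Y - X) < \<delta>}" for \<delta>
  define m where "m \<delta> = Inf (S \<delta>)" for \<delta>
  have ex: "\<exists>\<eta>. \<eta> \<noteq> 0 \<and> norm (\<eta> - \<xi>) < \<delta>" if "0 < \<delta>" for \<delta>
  proof (cases "\<xi> = 0")
    case True
    have "0 \<le> \<delta> / 2" using that by simp
    then obtain v :: "real^'n" where "norm v = \<delta> / 2" by (rule vector_choose_size)
    with True that show ?thesis by (intro exI[of _ v]) auto
  next
    case False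
    with that show ?thesis by (intro exI[of _ \<xi>]) auto
  qed
  have ne: "S \<delta> \<noteq> {}" if \<delta>: "0 < \<delta>" for \<delta>
  proof -
    obtain \<eta> where "\<eta> \<noteq> 0" "norm (\<eta> - \<xi>) < \<delta>" using ex[OF \<delta>] by auto
    then have "G \<eta> X \<in> S \<delta>" using sym \<delta> unfolding S_def by (auto intro!: exI[of _ \<eta>] exI[of _ X])
    then show ?thesis by auto
  qed
  have bdd: "bdd_below (S \<delta>)" for \<delta>
  proof (rule bdd_belowI)
    fix y assume "y \<in> S \<delta>"
    then obtain \<eta> Y where Y: "y = G \<eta> Y" "\<eta> \<noteq> 0" "transpose Y = Y" "norm (Y - X) < \<delta>"
      unfolding S_def by auto
    have "norm Y \<le> norm X + \<delta>" using Y(4) norm_triangle_sub[of Y X] by simp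
    then have "C * norm Y \<le> C * (norm X + \<delta>)" using \<open>0 \<le> C\<close> by (intro mult_left_mono)
    then show "- (C * (norm X + \<delta>)) \<le> y" using C[OF Y(2,3)] Y(1) by linarith
  qed
  have up: "m \<delta> \<le> C * norm X" if \<delta>: "0 < \<delta>" for \<delta>
  proof -
    obtain \<eta> where "\<eta> \<noteq> 0" "norm (\<eta> - \<xi>) < \<delta>" using ex[OF \<delta>] by auto
    then have "G \<eta> X \<in> S \<delta>"
      using sym \<delta> unfolding S_def by (auto intro!: exI[of _ \<eta>] exI[of _ X])
    then have "m \<delta> \<le> G \<eta> X" unfolding m_def by (intro cInf_lower bdd)
    also have "\<dots> \<le> C * norm X" using C[OF \<open>\<eta> \<noteq> 0\<close> sym] by simp
    finally show ?thesis .
  qed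
  have mono: "m \<delta>' \<le> m \<delta>" if "0 < \<delta>" "\<delta> \<le> \<delta>'" for \<delta> \<delta>'
    unfolding m_def
  proof (rule cInf_superset_mono[OF ne[OF that(1)] bdd])
    show "S \<delta> \<subseteq> S \<delta>'"
      unfolding S_def using that(2) by (auto intro: less_le_trans)
  qed
  define L where "L = Sup (m ` {0<..})"
  have bdd': "bdd_above (m ` {0<..})" using up by (intro bdd_aboveI[of _ "C * norm X"]) auto
  have mL: "m \<delta> \<le> L" if "0 < \<delta>" for \<delta>
    unfolding L_def using that by (intro cSup_upper bdd') auto
  have "(m \<longlongrightarrow> L) (at_right 0)"
  proof (rule order_tendstoI)
    fix y assume "y < L"
    then obtain \<delta> where \<delta>: "0 < \<delta>" "y < m \<delta>"
      unfolding L_def using less_cSup_iff[OF _ bdd', of y] by auto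
    have "\<forall>\<^sub>F x in at_right (0::real). x < \<delta> \<and> 0 < x"
      using \<delta>(1) by (auto simp: eventually_at_right_field intro!: exI[of _ \<delta>])
    then show "\<forall>\<^sub>F x in at_right 0. y < m x"
      by eventually_elim (use \<delta> mono[of _ \<delta>] in force)
  next
    fix y assume "L < y"
    have "\<forall>\<^sub>F x in at_right (0::real). 0 < x" by (simp add: eventually_at_right_less)
    then show "\<forall>\<^sub>F x in at_right 0. m x < y"
      by eventually_elim (use mL \<open>L < y\<close> in force)
  qed
  then have "Lim (at_right 0) m = L" by (intro tendsto_Lim) auto
  then have "lower_envelope G \<xi> X = L"
    unfolding lower_envelope_def m_def S_def .
  moreover have "b \<le> m d"
    unfolding m_def by (rule cInf_greatest[OF ne[OF d]]) (use b in \<open>auto simp: S_def\<close>)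
  ultimately show ?thesis using mL[OF d] by simp
qed

section \<open>From global test functions to local expansions\<close>

definition jet_poly :: "real \<Rightarrow> real^'n \<Rightarrow> real^'n^'n \<Rightarrow> real^'n \<Rightarrow> real \<Rightarrow> real" where
  "jet_poly c \<xi> X w s = c * s + \<xi> \<bullet> w + w \<bullet> (X *v w) / 2"

text \<open>
  The remainder allows an arbitrary multiple of \<open>s\<^sup>2\<close> because the equation is of first order in
  time, but only an arbitrarily small multiple of \<open>|w|\<^sup>2\<close>.
\<close>

definition touch_above ::
    "((real^'n) \<times> real \<Rightarrow> real) \<Rightarrow> (real^'n) \<times> real \<Rightarrow> real \<Rightarrow> real^'n \<Rightarrow> real^'n^'n \<Rightarrow> bool" where
  "touch_above v z c \<xi> X \<longleftrightarrow> (\<forall>\<theta>>0. \<exists>r>0. \<exists>C. \<forall>w s. norm w < r \<longrightarrow> \<bar>s\<bar> < r \<longrightarrow>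
     v (fst z + w, snd z + s) \<le> v z + jet_poly c \<xi> X w s + \<theta> * (norm w)\<^sup>2 + C * s\<^sup>2)"

text \<open>
  The subsolution property at one point. A bound \<open>b\<close> that holds for all nonzero gradients and all symmetric
  matrices close to \<open>(\<xi>, X)\<close> stands for the upper envelope of the operator; this treats
  vanishing gradients together with the others.
\<close>

definition jsub ::
    "real \<Rightarrow> ((real^'n) \<times> real \<Rightarrow> real) \<Rightarrow> (real^'n) \<times> real \<Rightarrow> bool" where
  "jsub a v z \<longleftrightarrow> (\<forall>c \<xi> X. transpose X = X \<longrightarrow> touch_above v z c \<xi> X \<longrightarrow>
     (\<forall>b. (\<exists>\<delta>>0. \<forall>\<eta> Y. \<eta> \<noteq> 0 \<longrightarrow> transpose Y = Y \<longrightarrow> norm (\<eta> - \<xi>) < \<delta> \<longrightarrow> norm (Y - X) < \<delta> \<longrightarrow>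
        Lop a \<eta> Y \<le> b) \<longrightarrow> c \<le> b))"

lemma recip_bounds:
  assumes "1 < p"
  shows "0 \<le> recip p" "recip p < 1" "conj_exponent p = 1 / (1 - recip p)" "0 < conj_exponent p"
proof -
  consider "p = \<infinity>" | r where "p = ereal r" "1 < r"
    using assms by (cases p) auto
  then have "0 \<le> recip p \<and> recip p < 1 \<and> conj_exponent p = 1 / (1 - recip p) \<and> 0 < conj_exponent p"
  proof cases
    case 1
    then show ?thesis by (simp add: recip_def conj_exponent_def)
  next
    case 2
    then have "recip p = 1 / r" unfolding recip_def by (simp add: one_ereal_def)
    moreover have "conj_exponent p = r / (r - 1)" using 2 by (simp add: conj_exponent_def)
    moreover have "1 / (1 - 1 / r) = r / (r - 1)" using 2 by (simp add: divide_simps)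
    ultimately show ?thesis using 2 by simp
  qed
  then show "0 \<le> recip p" "recip p < 1" "conj_exponent p = 1 / (1 - recip p)" "0 < conj_exponent p"
    by auto
qed

lemma transpose_component:
  assumes "transpose X = X"
  shows "X $ i $ j = X $ j $ i"
proof -
  have "transpose X $ i $ j = X $ i $ j" using assms by simp
  then show ?thesis by (simp add: transpose_def)
qed

lemma symmetric_inner:
  fixes X :: "real^'n^'n"
  assumes "transpose X = X"
  shows "x \<bullet> (X *v y) = y \<bullet> (X *v x)"
  by (metis assms dot_lmul_matrix inner_commute vector_transpose_matrix)

text \<open>
  The quartic term in all variables is there to turn a local maximum of a bounded function into a
  global one, as the definition of viscosity solutions requires.
\<close>

definition test_poly ::
    "(real^'n) \<times> real \<Rightarrow> real \<Rightarrow> real^'n \<Rightarrow> real^'n^'n \<Rightarrow> real \<Rightarrow> real \<Rightarrow> (real^'n) \<times> real \<Rightarrow> real" where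
  "test_poly z0 c \<xi> X k D z = jet_poly c \<xi> X (fst (z - z0)) (snd (z - z0)) + k * (snd (z - z0))\<^sup>2
     + D * ((z - z0) \<bullet> (z - z0))\<^sup>2"

definition test_grad ::
    "(real^'n) \<times> real \<Rightarrow> real \<Rightarrow> real^'n \<Rightarrow> real^'n^'n \<Rightarrow> real \<Rightarrow> real \<Rightarrow> (real^'n) \<times> real \<Rightarrow> (real^'n) \<times> real" where
  "test_grad z0 c \<xi> X k D z = (\<xi> + X *v fst (z - z0), c + 2 * k * snd (z - z0))
     + (4 * D * ((z - z0) \<bullet> (z - z0))) *\<^sub>R (z - z0)"

lemma has_derivative_matrix_vector [derivative_intros]:
  fixes X :: "real^'n^'m"
  assumes "(f has_derivative f') F"
  shows "((\<lambda>z. X *v f z) has_derivative (\<lambda>h. X *v f' h)) F"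
  using bounded_linear.has_derivative[OF matrix_vector_mul_bounded_linear assms] .

lemma half_mult: "(x::real) / 2 = inverse 2 * x"
  by simp

lemma test_poly_has_derivative:
  assumes "transpose X = X"
  shows "(test_poly z0 c \<xi> X k D has_derivative (\<lambda>h. h \<bullet> test_grad z0 c \<xi> X k D z)) (at z)"
  unfolding test_poly_def[abs_def] jet_poly_def test_grad_def half_mult
  apply (rule derivative_eq_intros refl)+
  apply (rule ext)
  subgoal for h
    using symmetric_inner[OF assms, of "fst z - fst z0" "fst h"]
    by (cases h) (simp add: inner_prod_def inner_add_right inner_add_left algebra_simps inner_commute power2_eq_square)
  done

lemma test_grad_has_derivative:
  "(test_grad z0 c \<xi> X k D has_derivative (\<lambda>h. (X *v fst h, 2 * k * snd h)
     + (4 * D * ((z - z0) \<bullet> (z - z0))) *\<^sub>R h + (8 * D * (h \<bullet> (z - z0))) *\<^sub>R (z - z0))) (at z)"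
  unfolding test_grad_def[abs_def]
  apply (rule derivative_eq_intros refl)+
  apply (rule ext)
  subgoal for h
    by (simp add: inner_commute algebra_simps)
  done

lemma C2_on_test_poly:
  assumes "transpose X = X"
  shows "C2_on (test_poly z0 c \<xi> X k D) S"
proof -
  define g where "g = test_grad z0 c \<xi> X k D"
  define H where "H z h = (X *v fst h, 2 * k * snd h)
     + (4 * D * ((z - z0) \<bullet> (z - z0))) *\<^sub>R h + (8 * D * (h \<bullet> (z - z0))) *\<^sub>R (z - z0)" for z h
  have g: "(g has_derivative H z) (at z)" for z
    unfolding g_def H_def by (rule test_grad_has_derivative)
  define f' where "f' z = blinfun_inner_left (g z)" for z
  have bl: "bounded_linear (\<lambda>h. blinfun_inner_left (H z h))" for z
    using bounded_linear_compose[OF bounded_linear_blinfun_inner_left has_derivative_bounded_linear[OF g]] .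
  define f'' where "f'' z = Blinfun (\<lambda>h. blinfun_inner_left (H z h))" for z
  have f'': "blinfun_apply (f'' z) = (\<lambda>h. blinfun_inner_left (H z h))" for z
    unfolding f''_def by (rule bounded_linear_Blinfun_apply[OF bl])
  have 1: "(test_poly z0 c \<xi> X k D has_derivative blinfun_apply (f' z)) (at z)" for z
    using test_poly_has_derivative[OF assms, of z0 c \<xi> k D z] unfolding f'_def g_def by simp
  have 2: "(f' has_derivative blinfun_apply (f'' z)) (at z)" for z
    unfolding f'' f'_def
    using bounded_linear.has_derivative[OF bounded_linear_blinfun_inner_left g] .
  have 3: "continuous_on S f''"
    by (intro continuous_on_blinfun_componentwise)
       (auto simp: f'' H_def intro!: continuous_intros)
  show ?thesis
    unfolding C2_on_def using 1 2 3 by blast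
qed

lemma test_poly_dt: "dt (test_poly (x0,t0) c \<xi> X k D) x0 t0 = c"
  unfolding dt_def test_poly_def jet_poly_def
  by (rule DERIV_imp_deriv) (auto intro!: derivative_eq_intros)

lemma test_poly_grad:
  assumes "transpose X = X"
  shows "grad (\<lambda>y. test_poly (x0,t0) c \<xi> X k D (y, t0)) y = fst (test_grad (x0,t0) c \<xi> X k D (y,t0))"
proof -
  have "((\<lambda>y. (y, t0)) has_derivative (\<lambda>h. (h, 0))) (at y)"
    by (auto intro!: derivative_eq_intros)
  from has_derivative_compose[OF this test_poly_has_derivative[OF assms]]
  have "frechet_derivative (\<lambda>y. test_poly (x0,t0) c \<xi> X k D (y, t0)) (at y)
      = (\<lambda>h. (h, 0) \<bullet> test_grad (x0,t0) c \<xi> X k D (y,t0))"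
    by (intro frechet_derivative_at[symmetric]) auto
  then show ?thesis
    unfolding grad_def by (simp add: vec_eq_iff inner_prod_def inner_axis')
qed

lemma test_poly_dx:
  assumes "transpose X = X"
  shows "dx (test_poly (x0,t0) c \<xi> X k D) x0 t0 = \<xi>"
  unfolding dx_def test_poly_grad[OF assms] test_grad_def by simp

lemma test_poly_dxx:
  assumes "transpose X = X"
  shows "dxx (test_poly (x0,t0) c \<xi> X k D) x0 t0 = X"
proof -
  have "X $ j $ i = frechet_derivative (\<lambda>y. fst (test_grad (x0,t0) c \<xi> X k D (y,t0)) $ j) (at x0) (axis i 1)" for i j
  proof -
    have "((\<lambda>y. (y, t0)) has_derivative (\<lambda>h. (h, 0))) (at x0)"
      by (auto intro!: derivative_eq_intros)
    from has_derivative_compose[OF this test_grad_has_derivative[of "(x0,t0)" c \<xi> X k D "(x0,t0)"]]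
    have "((\<lambda>y. test_grad (x0,t0) c \<xi> X k D (y,t0)) has_derivative (\<lambda>h. (X *v h, 0))) (at x0)"
      by (simp add: zero_prod_def)
    then have "((\<lambda>y. fst (test_grad (x0,t0) c \<xi> X k D (y,t0)) $ j) has_derivative (\<lambda>h. (X *v h) $ j)) (at x0)"
      using bounded_linear.has_derivative[OF bounded_linear_compose[OF bounded_linear_vec_nth[of j] bounded_linear_fst]]
      by fastforce
    then have "frechet_derivative (\<lambda>y. fst (test_grad (x0,t0) c \<xi> X k D (y,t0)) $ j) (at x0)
       = (\<lambda>h. (X *v h) $ j)"
      by (intro frechet_derivative_at[symmetric])
    then show ?thesis by (simp add: matrix_vector_mul_component inner_axis)
  qed
  then show ?thesis
    unfolding dxx_def hessian_def test_poly_grad[OF assms]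
    using transpose_component[OF assms] by (simp add: vec_eq_iff)
qed

text \<open>
  Near \<open>z0\<close> the terms with \<open>\<theta>\<close> and \<open>k\<close> absorb the remainder of the expansion. Away from \<open>z0\<close> the quartic term with a large
  \<open>D\<close> exceeds the bounded function \<open>u\<close> minus the polynomial.
\<close>

lemma touch_above_test_poly:
  fixes u :: "(real^'n) \<times> real \<Rightarrow> real"
  assumes touch: "touch_above u z0 c \<xi> X" and \<theta>: "0 < \<theta>"
    and M: "\<And>z. z \<in> S \<Longrightarrow> u z \<le> M" and z0: "z0 \<in> S"
  shows "\<exists>k D. \<forall>z\<in>S. u z - test_poly z0 c \<xi> (X + (2 * \<theta>) *\<^sub>R mat 1) k D z \<le> u z0"
proof -
  obtain r C where r: "0 < r" and C: "\<And>w s. norm w < r \<Longrightarrow> \<bar>s\<bar> < r \<Longrightarrow>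
     u (fst z0 + w, snd z0 + s) \<le> u z0 + jet_poly c \<xi> X w s + \<theta> * (norm w)\<^sup>2 + C * s\<^sup>2"
    using touch \<theta> unfolding touch_above_def by blast
  define Y where "Y = X + (2 * \<theta>) *\<^sub>R mat 1"
  have Y: "w \<bullet> (Y *v w) / 2 = w \<bullet> (X *v w) / 2 + \<theta> * (norm w)\<^sup>2" for w
    unfolding Y_def
    by (simp add: matrix_vector_mult_add_rdistrib scaleR_matrix_vector_assoc[symmetric] inner_add_right
        power2_norm_eq_inner add_divide_distrib)
  define A where "A = \<bar>c\<bar> + norm \<xi>"
  define B where "B = norm Y / 2 + \<bar>C\<bar>"
  define D where "D = A / r ^ 3 + B / r ^ 2 + (M - u z0) / r ^ 4"
  have pos: "0 \<le> A" "0 \<le> B" "0 \<le> M - u z0" unfolding A_def B_def using M[OF z0] by auto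
  then have "0 \<le> D" unfolding D_def using r by simp
  have "u z - test_poly z0 c \<xi> Y C D z \<le> u z0" if z: "z \<in> S" for z
  proof -
    define w s where "w = fst (z - z0)" and "s = snd (z - z0)"
    define n where "n = norm (z - z0)"
    have zeq: "z = (fst z0 + w, snd z0 + s)" unfolding w_def s_def by (simp add: prod_eq_iff)
    have nn: "(z - z0) \<bullet> (z - z0) = n\<^sup>2" unfolding n_def by (simp add: power2_norm_eq_inner)
    have tp: "test_poly z0 c \<xi> Y C D z = c * s + \<xi> \<bullet> w + w \<bullet> (Y *v w) / 2 + C * s\<^sup>2 + D * n ^ 4"
      unfolding test_poly_def jet_poly_def nn w_def[symmetric] s_def[symmetric] by simp
    have wn: "norm w \<le> n" "\<bar>s\<bar> \<le> n"
      using norm_fst_le[of "fst (z - z0)" "snd (z - z0)"] norm_snd_le[of "snd (z - z0)" "fst (z - z0)"]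
      unfolding w_def s_def n_def by (simp_all only: prod.collapse real_norm_def)
    show ?thesis
    proof (cases "n < r")
      case True
      then have "u z \<le> u z0 + jet_poly c \<xi> X w s + \<theta> * (norm w)\<^sup>2 + C * s\<^sup>2"
        using C[of w s] wn zeq by auto
      moreover have "0 \<le> D * n ^ 4" using \<open>0 \<le> D\<close> by simp
      ultimately show ?thesis unfolding tp jet_poly_def using Y[of w] by linarith
    next
      case False
      then have n: "r \<le> n" "0 < n" using r by auto
      have 1: "A * n \<le> A / r ^ 3 * n ^ 4"
      proof -
        have "r ^ 3 \<le> n ^ 3" using n r by (intro power_mono) auto
        then have "A * n * r ^ 3 \<le> A * n * n ^ 3" using pos n by (intro mult_left_mono) auto
        then show ?thesis using r by (simp add: field_simps power4_eq_xxxx power3_eq_cube)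
      qed
      have 2: "B * n\<^sup>2 \<le> B / r ^ 2 * n ^ 4"
      proof -
        have "r ^ 2 \<le> n ^ 2" using n r by (intro power_mono) auto
        then have "B * n\<^sup>2 * r ^ 2 \<le> B * n\<^sup>2 * n ^ 2" using pos n by (intro mult_left_mono) auto
        then show ?thesis using r by (simp add: field_simps power4_eq_xxxx power2_eq_square)
      qed
      have 3: "M - u z0 \<le> (M - u z0) / r ^ 4 * n ^ 4"
      proof -
        have "r ^ 4 \<le> n ^ 4" using n r by (intro power_mono) auto
        then have "(M - u z0) * r ^ 4 \<le> (M - u z0) * n ^ 4" using pos by (intro mult_left_mono) auto
        then show ?thesis using r by (simp add: field_simps)
      qed
      have 4: "- (A * n) \<le> c * s + \<xi> \<bullet> w"
      proof -
        have "\<bar>c * s\<bar> \<le> \<bar>c\<bar> * n" unfolding abs_mult using wn by (intro mult_left_mono) auto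
        moreover have "\<bar>\<xi> \<bullet> w\<bar> \<le> norm \<xi> * n"
          using Cauchy_Schwarz_ineq2[of \<xi> w] mult_left_mono[OF wn(1), of "norm \<xi>"] by simp
        ultimately show ?thesis unfolding A_def by (simp add: algebra_simps)
      qed
      have 5: "- (B * n\<^sup>2) \<le> w \<bullet> (Y *v w) / 2 + C * s\<^sup>2"
      proof -
        have "(norm w)\<^sup>2 \<le> n\<^sup>2" using wn by (intro power_mono) auto
        then have "norm Y * (norm w)\<^sup>2 \<le> norm Y * n\<^sup>2" by (intro mult_left_mono) auto
        moreover have "\<bar>w \<bullet> (Y *v w)\<bar> \<le> norm Y * (norm w)\<^sup>2"
          using abs_quadratic_form_le[of w Y w] by (simp add: power2_eq_square ac_simps)
        moreover have "s\<^sup>2 \<le> n\<^sup>2" using wn by (simp add: abs_le_square_iff[symmetric])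
        then have "\<bar>C\<bar> * s\<^sup>2 \<le> \<bar>C\<bar> * n\<^sup>2" by (intro mult_left_mono) auto
        moreover have "\<bar>C * s\<^sup>2\<bar> = \<bar>C\<bar> * s\<^sup>2" by (simp add: abs_mult)
        ultimately show ?thesis unfolding B_def by (simp add: algebra_simps)
      qed
      have "M - u z0 + A * n + B * n\<^sup>2 \<le> D * n ^ 4"
        unfolding D_def using 1 2 3 by (simp add: algebra_simps)
      then show ?thesis unfolding tp using 4 5 M[OF z] by linarith
    qed
  qed
  then show ?thesis unfolding Y_def by blast
qed

lemma test_poly_at [simp]: "test_poly z0 c \<xi> X k D z0 = 0"
  by (simp add: test_poly_def jet_poly_def)

lemma uminus_test_poly: "test_poly z0 (- c) (- \<xi>) (- X) (- k) (- D) z = - test_poly z0 c \<xi> X k D z"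
  by (simp add: test_poly_def jet_poly_def)

lemma abs_Fop_le:
  fixes Y :: "real^'n^'n"
  assumes "1 < p" "transpose Y = Y"
  shows "\<bar>Fop p \<eta> Y\<bar> \<le> (real CARD('n) + 1) * norm Y"
  unfolding Fop_eq_Lop[OF assms(2)] using abs_Lop_le[OF recip_bounds(1,2)[OF assms(1)], of \<eta> Y] by simp

lemma transpose_add_mat: "transpose X = X \<Longrightarrow> transpose (X + r *\<^sub>R mat 1) = X + r *\<^sub>R (mat 1 :: real^'n^'n)"
  by (auto simp: vec_eq_iff transpose_def mat_def)

lemma transpose_uminus: "transpose (- X) = - transpose (X :: real^'n^'n)"
  by (simp add: vec_eq_iff transpose_def)

text \<open>
  The correction \<open>2 * \<theta>\<close> of the Hessian is taken so small that the corrected matrix keeps a whole neighbourhood inside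
  the one on which \<open>b\<close> is a bound.
\<close>

lemma jsub_of_subsolution:
  fixes u :: "(real^'n) \<times> real \<Rightarrow> real"
  assumes p: "1 < p" and u: "visc_subsolution p \<Omega> u"
    and M: "\<And>z. z \<in> \<Omega> \<times> {0<..} \<Longrightarrow> u z \<le> M" and z0: "z0 \<in> \<Omega> \<times> {0<..}"
  shows "jsub (recip p) u z0"
  unfolding jsub_def
proof (intro allI impI, elim exE conjE)
  fix c \<xi> and X :: "real^'n^'n" and b \<delta>
  assume X: "transpose X = X" and t: "touch_above u z0 c \<xi> X" and \<delta>: "0 < \<delta>"
    and b: "\<forall>\<eta> Y. \<eta> \<noteq> 0 \<longrightarrow> transpose Y = Y \<longrightarrow> norm (\<eta> - \<xi>) < \<delta> \<longrightarrow> norm (Y - X) < \<delta> \<longrightarrow>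
        Lop (recip p) \<eta> Y \<le> b"
  obtain x0 t0 where z0': "z0 = (x0,t0)" "x0 \<in> \<Omega>" "0 < t0" using z0 by auto
  define \<theta> where "\<theta> = \<delta> / (8 * (norm (mat 1 :: real^'n^'n) + 1))"
  have \<theta>: "0 < \<theta>" unfolding \<theta>_def using \<delta> by (simp add: add_nonneg_pos)
  define Y where "Y = X + (2 * \<theta>) *\<^sub>R (mat 1 :: real^'n^'n)"
  have Ysym: "transpose Y = Y" unfolding Y_def by (rule transpose_add_mat[OF X])
  have YX: "norm (Y - X) < \<delta> / 2"
  proof -
    have "norm (Y - X) = 2 * \<theta> * norm (mat 1 :: real^'n^'n)" unfolding Y_def using \<theta> by simp
    also have "\<dots> \<le> 2 * \<theta> * (norm (mat 1 :: real^'n^'n) + 1)" using \<theta> by (intro mult_left_mono) auto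
    also have "\<dots> = \<delta> / 4"
    proof -
      have "norm (mat 1 :: real^'n^'n) + 1 \<noteq> 0" using norm_ge_zero[of "mat 1 :: real^'n^'n"] by linarith
      then show ?thesis unfolding \<theta>_def by (simp add: field_simps)
    qed
    also have "\<dots> < \<delta> / 2" using \<delta> by simp
    finally show ?thesis .
  qed
  obtain k D where kD: "\<And>z. z \<in> \<Omega> \<times> {0<..} \<Longrightarrow> u z - test_poly z0 c \<xi> Y k D z \<le> u z0"
    using touch_above_test_poly[OF t \<theta> M z0] unfolding Y_def by blast
  have "dt (test_poly z0 c \<xi> Y k D) x0 t0 +
      lower_envelope (Fop p) (dx (test_poly z0 c \<xi> Y k D) x0 t0) (dxx (test_poly z0 c \<xi> Y k D) x0 t0) \<le> 0"
    using u C2_on_test_poly[OF Ysym] kD z0' unfolding visc_subsolution_def by auto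
  then have 1: "c + lower_envelope (Fop p) \<xi> Y \<le> 0"
    unfolding z0' test_poly_dt test_poly_dx[OF Ysym] test_poly_dxx[OF Ysym] .
  have "- b \<le> lower_envelope (Fop p) \<xi> Y"
  proof (rule lower_envelope_ge[OF Ysym abs_Fop_le[OF p], where d = "\<delta> / 2"])
    fix \<eta> and Z :: "real^'n^'n"
    assume "\<eta> \<noteq> 0" "transpose Z = Z" "norm (\<eta> - \<xi>) < \<delta> / 2" "norm (Z - Y) < \<delta> / 2"
    moreover have "norm (Z - X) < \<delta>"
      using YX \<open>norm (Z - Y) < \<delta> / 2\<close> norm_triangle_ineq[of "Z - Y" "Y - X"] by simp
    ultimately show "- b \<le> Fop p \<eta> Z"
      using b \<delta> by (simp add: Fop_eq_Lop)
  qed (use \<delta> in auto)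
  then show "c \<le> b" using 1 by simp
qed

text \<open>
  The operator is odd in the Hessian and even in the gradient, so that \<open>- u\<close> has the one-sided expansions of a
  subsolution.
\<close>

lemma jsub_of_supersolution:
  fixes u :: "(real^'n) \<times> real \<Rightarrow> real"
  assumes p: "1 < p" and u: "visc_supersolution p \<Omega> u"
    and M: "\<And>z. z \<in> \<Omega> \<times> {0<..} \<Longrightarrow> - u z \<le> M" and z0: "z0 \<in> \<Omega> \<times> {0<..}"
  shows "jsub (recip p) (\<lambda>z. - u z) z0"
  unfolding jsub_def
proof (intro allI impI, elim exE conjE)
  fix c \<xi> and X :: "real^'n^'n" and b \<delta>
  assume X: "transpose X = X" and t: "touch_above (\<lambda>z. - u z) z0 c \<xi> X" and \<delta>: "0 < \<delta>"
    and b: "\<forall>\<eta> Y. \<eta> \<noteq> 0 \<longrightarrow> transpose Y = Y \<longrightarrow> norm (\<eta> - \<xi>) < \<delta> \<longrightarrow> norm (Y - X) < \<delta> \<longrightarrow>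
        Lop (recip p) \<eta> Y \<le> b"
  obtain x0 t0 where z0': "z0 = (x0,t0)" "x0 \<in> \<Omega>" "0 < t0" using z0 by auto
  define \<theta> where "\<theta> = \<delta> / (8 * (norm (mat 1 :: real^'n^'n) + 1))"
  have \<theta>: "0 < \<theta>" unfolding \<theta>_def using \<delta> by (simp add: add_nonneg_pos)
  define Y where "Y = X + (2 * \<theta>) *\<^sub>R (mat 1 :: real^'n^'n)"
  have Ysym: "transpose Y = Y" unfolding Y_def by (rule transpose_add_mat[OF X])
  then have Ysym': "transpose (- Y) = - Y" by (simp add: transpose_uminus)
  have YX: "norm (Y - X) < \<delta> / 2"
  proof -
    have "norm (Y - X) = 2 * \<theta> * norm (mat 1 :: real^'n^'n)" unfolding Y_def using \<theta> by simp
    also have "\<dots> \<le> 2 * \<theta> * (norm (mat 1 :: real^'n^'n) + 1)" using \<theta> by (intro mult_left_mono) auto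
    also have "\<dots> = \<delta> / 4"
    proof -
      have "norm (mat 1 :: real^'n^'n) + 1 \<noteq> 0" using norm_ge_zero[of "mat 1 :: real^'n^'n"] by linarith
      then show ?thesis unfolding \<theta>_def by (simp add: field_simps)
    qed
    also have "\<dots> < \<delta> / 2" using \<delta> by simp
    finally show ?thesis .
  qed
  obtain k D where kD: "\<And>z. z \<in> \<Omega> \<times> {0<..} \<Longrightarrow> - u z - test_poly z0 c \<xi> Y k D z \<le> - u z0"
    using touch_above_test_poly[OF t \<theta> M z0] unfolding Y_def by blast
  define q where "q = test_poly z0 (- c) (- \<xi>) (- Y) (- k) (- D)"
  have "dt q x0 t0 + upper_envelope (Fop p) (dx q x0 t0) (dxx q x0 t0) \<ge> 0"
  proof -
    have "C2_on q (\<Omega> \<times> {0<..})" unfolding q_def by (rule C2_on_test_poly[OF Ysym'])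
    moreover have "\<forall>z \<in> \<Omega> \<times> {0<..}. u (x0, t0) - q (x0, t0) \<le> u z - q z"
      using kD unfolding q_def z0' by (fastforce simp: uminus_test_poly)
    ultimately show ?thesis using u z0' unfolding visc_supersolution_def by blast
  qed
  then have 1: "0 \<le> - c + upper_envelope (Fop p) (- \<xi>) (- Y)"
    unfolding q_def z0' test_poly_dt test_poly_dx[OF Ysym'] test_poly_dxx[OF Ysym'] .
  have "- b \<le> lower_envelope (\<lambda>\<eta> Y. - Fop p \<eta> Y) (- \<xi>) (- Y)"
  proof (rule lower_envelope_ge[OF Ysym', where d = "\<delta> / 2"])
    fix \<eta> and Z :: "real^'n^'n"
    assume Z: "\<eta> \<noteq> 0" "transpose Z = Z" "norm (\<eta> - - \<xi>) < \<delta> / 2" "norm (Z - - Y) < \<delta> / 2"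
    have "norm (- \<eta> - \<xi>) < \<delta>"
      using Z(3) \<delta> norm_minus_cancel[of "\<eta> + \<xi>"] by simp
    moreover have "norm (- Z - X) < \<delta>"
      using YX Z(4) norm_triangle_ineq[of "- Z - Y" "Y - X"] norm_minus_cancel[of "Z + Y"] by simp
    moreover have "transpose (- Z) = - Z" using Z by (simp add: transpose_uminus)
    ultimately have "Lop (recip p) (- \<eta>) (- Z) \<le> b"
      using b Z(1) by (metis neg_equal_0_iff_equal)
    then show "- b \<le> - Fop p \<eta> Z"
      using Z(2) by (simp add: Fop_eq_Lop)
  qed (use \<delta> abs_Fop_le[OF p] in auto)
  then show "c \<le> b" using 1 unfolding upper_envelope_def by simp
qed

section \<open>Calculus of second-order expansions\<close>

text \<open>
  The remainders of two-sided expansions, with the same asymmetry between space and time as in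
  \<open>touch_above\<close>. Being quantitative and pointwise, this needs no differentiability away from the base point.
\<close>

definition small2 :: "(real^'n \<Rightarrow> real \<Rightarrow> real) \<Rightarrow> bool" where
  "small2 e \<longleftrightarrow> (\<forall>\<theta>>0. \<exists>r>0. \<exists>C. \<forall>w s. norm w < r \<longrightarrow> \<bar>s\<bar> < r \<longrightarrow>
     \<bar>e w s\<bar> \<le> \<theta> * (norm w)\<^sup>2 + C * s\<^sup>2)"

definition has_jet ::
    "((real^'n) \<times> real \<Rightarrow> real) \<Rightarrow> (real^'n) \<times> real \<Rightarrow> real \<Rightarrow> real^'n \<Rightarrow> real^'n^'n \<Rightarrow> bool" where
  "has_jet f z c \<xi> X \<longleftrightarrow> small2 (\<lambda>w s. f (fst z + w, snd z + s) - f z - jet_poly c \<xi> X w s)"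

definition taylor2 :: "(real \<Rightarrow> real) \<Rightarrow> real \<Rightarrow> real \<Rightarrow> real \<Rightarrow> bool" where
  "taylor2 h y h1 h2 \<longleftrightarrow> (\<forall>\<theta>>0. \<exists>r>0. \<forall>d. \<bar>d\<bar> < r \<longrightarrow>
     \<bar>h (y + d) - h y - h1 * d - h2 * d\<^sup>2 / 2\<bar> \<le> \<theta> * d\<^sup>2)"

lemma small2E:
  assumes "small2 e" "0 < \<theta>"
  obtains r C where "0 < r" "\<And>w s. norm w < r \<Longrightarrow> \<bar>s\<bar> < r \<Longrightarrow> \<bar>e w s\<bar> \<le> \<theta> * (norm w)\<^sup>2 + C * s\<^sup>2"
  using assms unfolding small2_def by blast

lemma local_bound_exI:
  assumes "0 < r" "\<And>w s. norm w < r \<Longrightarrow> \<bar>s\<bar> < r \<Longrightarrow> P w s C"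
  shows "\<exists>r>(0::real). \<exists>C::real. \<forall>w s. norm w < r \<longrightarrow> \<bar>s\<bar> < r \<longrightarrow> P w s C"
  using assms by blast

lemma small2_zero [simp]: "small2 (\<lambda>w s. 0)"
  unfolding small2_def
proof (intro allI impI)
  fix \<theta> :: real assume "0 < \<theta>"
  then show "\<exists>r>0. \<exists>C. \<forall>w s. norm w < r \<longrightarrow> \<bar>s\<bar> < r \<longrightarrow> \<bar>0\<bar> \<le> \<theta> * (norm w)\<^sup>2 + C * s\<^sup>2"
    by (intro local_bound_exI[of 1 _ 0]) auto
qed

lemma small2_add:
  fixes e f :: "real^'n \<Rightarrow> real \<Rightarrow> real"
  assumes "small2 e" "small2 f"
  shows "small2 (\<lambda>w s. e w s + f w s)"
  unfolding small2_def
proof (intro allI impI)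
  fix \<theta> :: real assume "0 < \<theta>"
  then have "0 < \<theta> / 2" by simp
  obtain r C where r: "0 < r" "\<And>w s. norm w < r \<Longrightarrow> \<bar>s\<bar> < r \<Longrightarrow> \<bar>e w s\<bar> \<le> \<theta> / 2 * (norm w)\<^sup>2 + C * s\<^sup>2"
    by (rule small2E[OF assms(1) \<open>0 < \<theta> / 2\<close>]) blast
  obtain r' C' where r': "0 < r'" "\<And>w s. norm w < r' \<Longrightarrow> \<bar>s\<bar> < r' \<Longrightarrow> \<bar>f w s\<bar> \<le> \<theta> / 2 * (norm w)\<^sup>2 + C' * s\<^sup>2"
    by (rule small2E[OF assms(2) \<open>0 < \<theta> / 2\<close>]) blast
  show "\<exists>r>0. \<exists>C. \<forall>w s. norm w < r \<longrightarrow> \<bar>s\<bar> < r \<longrightarrow> \<bar>e w s + f w s\<bar> \<le> \<theta> * (norm w)\<^sup>2 + C * s\<^sup>2"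
  proof (rule local_bound_exI[of "min r r'" _ "C + C'"])
    fix w :: "real^'n" and s :: real assume "norm w < min r r'" "\<bar>s\<bar> < min r r'"
    then show "\<bar>e w s + f w s\<bar> \<le> \<theta> * (norm w)\<^sup>2 + (C + C') * s\<^sup>2"
      using r(2)[of w s] r'(2)[of w s] abs_triangle_ineq[of "e w s" "f w s"] by (simp add: algebra_simps)
  qed (use r r' in auto)
qed

lemma small2_cmult:
  fixes e :: "real^'n \<Rightarrow> real \<Rightarrow> real"
  assumes "small2 e"
  shows "small2 (\<lambda>w s. k * e w s)"
  unfolding small2_def
proof (intro allI impI)
  fix \<theta> :: real assume "0 < \<theta>"
  define \<theta>' where "\<theta>' = \<theta> / (\<bar>k\<bar> + 1)"
  have "0 < \<theta>'" unfolding \<theta>'_def using \<open>0 < \<theta>\<close> by simp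
  have k: "\<bar>k\<bar> * \<theta>' \<le> \<theta>" unfolding \<theta>'_def using \<open>0 < \<theta>\<close> by (simp add: field_simps)
  obtain r C where r: "0 < r" "\<And>w s. norm w < r \<Longrightarrow> \<bar>s\<bar> < r \<Longrightarrow> \<bar>e w s\<bar> \<le> \<theta>' * (norm w)\<^sup>2 + C * s\<^sup>2"
    by (rule small2E[OF assms(1) \<open>0 < \<theta>'\<close>]) blast
  show "\<exists>r>0. \<exists>C. \<forall>w s. norm w < r \<longrightarrow> \<bar>s\<bar> < r \<longrightarrow> \<bar>k * e w s\<bar> \<le> \<theta> * (norm w)\<^sup>2 + C * s\<^sup>2"
  proof (rule local_bound_exI[of r _ "\<bar>k\<bar> * C"])
    fix w :: "real^'n" and s :: real assume ws: "norm w < r" "\<bar>s\<bar> < r"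
    have "\<bar>k * e w s\<bar> \<le> \<bar>k\<bar> * (\<theta>' * (norm w)\<^sup>2 + C * s\<^sup>2)"
      unfolding abs_mult by (intro mult_left_mono r(2) ws) auto
    also have "\<dots> = (\<bar>k\<bar> * \<theta>') * (norm w)\<^sup>2 + \<bar>k\<bar> * C * s\<^sup>2" by (simp add: algebra_simps)
    also have "\<dots> \<le> \<theta> * (norm w)\<^sup>2 + \<bar>k\<bar> * C * s\<^sup>2"
      by (intro add_right_mono mult_right_mono k) auto
    finally show "\<bar>k * e w s\<bar> \<le> \<theta> * (norm w)\<^sup>2 + \<bar>k\<bar> * C * s\<^sup>2" .
  qed (use r in auto)
qed

lemma small2_cubic:
  fixes e :: "real^'n \<Rightarrow> real \<Rightarrow> real"
  assumes "0 < r" and e: "\<And>w s. norm w < r \<Longrightarrow> \<bar>s\<bar> < r \<Longrightarrow> \<bar>e w s\<bar> \<le> K * (\<bar>s\<bar> * norm w + s\<^sup>2 + norm w ^ 3)"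
    and K: "0 < K"
  shows "small2 e"
  unfolding small2_def
proof (intro allI impI)
  fix \<theta> :: real assume \<theta>: "0 < \<theta>"
  define r' where "r' = min r (\<theta> / (2 * K))"
  have r': "0 < r'" "r' \<le> r" "K * r' \<le> \<theta> / 2"
    unfolding r'_def using assms(1) \<theta> K by (auto simp: min_def field_simps)
  show "\<exists>r>0. \<exists>C. \<forall>w s. norm w < r \<longrightarrow> \<bar>s\<bar> < r \<longrightarrow> \<bar>e w s\<bar> \<le> \<theta> * (norm w)\<^sup>2 + C * s\<^sup>2"
  proof (rule local_bound_exI[of r' _ "K + K\<^sup>2 / (2 * \<theta>)"])
    fix w :: "real^'n" and s :: real assume ws: "norm w < r'" "\<bar>s\<bar> < r'"
    have 1: "\<bar>e w s\<bar> \<le> K * (\<bar>s\<bar> * norm w + s\<^sup>2 + norm w ^ 3)" using e ws r' by auto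
    have 2: "K * norm w ^ 3 \<le> \<theta> / 2 * (norm w)\<^sup>2"
    proof -
      have "K * norm w \<le> K * r'" using ws K by simp
      then have "K * norm w \<le> \<theta> / 2" using r' by simp
      then have "(K * norm w) * (norm w)\<^sup>2 \<le> \<theta> / 2 * (norm w)\<^sup>2" by (intro mult_right_mono) auto
      then show ?thesis by (simp add: power3_eq_cube power2_eq_square ac_simps)
    qed
    have 3: "K * (\<bar>s\<bar> * norm w) \<le> \<theta> / 2 * (norm w)\<^sup>2 + K\<^sup>2 / (2 * \<theta>) * s\<^sup>2"
    proof -
      have "0 \<le> (\<theta> * norm w - K * \<bar>s\<bar>)\<^sup>2" by simp
      then have "2 * \<theta> * (K * (\<bar>s\<bar> * norm w)) \<le> \<theta>\<^sup>2 * (norm w)\<^sup>2 + K\<^sup>2 * s\<^sup>2"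
        by (simp add: power2_eq_square algebra_simps)
      also have "\<dots> = 2 * \<theta> * (\<theta> / 2 * (norm w)\<^sup>2 + K\<^sup>2 / (2 * \<theta>) * s\<^sup>2)"
        using \<theta> by (simp add: field_simps power2_eq_square)
      finally show ?thesis using \<theta> by simp
    qed
    show "\<bar>e w s\<bar> \<le> \<theta> * (norm w)\<^sup>2 + (K + K\<^sup>2 / (2 * \<theta>)) * s\<^sup>2"
      using 1 2 3 by (simp add: algebra_simps)
  qed (use r' in auto)
qed

lemma small2_bounded:
  fixes e :: "real^'n \<Rightarrow> real \<Rightarrow> real"
  assumes "small2 e"
  shows "\<exists>r>0. r \<le> 1 \<and> (\<exists>C>0. \<forall>w s. norm w < r \<longrightarrow> \<bar>s\<bar> < r \<longrightarrow> \<bar>e w s\<bar> \<le> (norm w)\<^sup>2 + C * s\<^sup>2)"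
proof -
  obtain r C where r: "0 < r" "\<And>w s. norm w < r \<Longrightarrow> \<bar>s\<bar> < r \<Longrightarrow> \<bar>e w s\<bar> \<le> 1 * (norm w)\<^sup>2 + C * s\<^sup>2"
    by (rule small2E[OF assms zero_less_one]) blast
  have "\<bar>e w s\<bar> \<le> (norm w)\<^sup>2 + (\<bar>C\<bar> + 1) * s\<^sup>2" if "norm w < r" "\<bar>s\<bar> < r" for w s
  proof -
    have "C * s\<^sup>2 \<le> (\<bar>C\<bar> + 1) * s\<^sup>2" by (intro mult_right_mono) auto
    then show ?thesis using r(2)[OF that] by simp
  qed
  then show ?thesis using r(1) by (intro exI[of _ "min r 1"]) (auto intro!: exI[of _ "\<bar>C\<bar> + 1"])
qed

lemma has_jet_const [simp]: "has_jet (\<lambda>z. k) z 0 0 0"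
  unfolding has_jet_def jet_poly_def by simp

lemma jet_poly_add: "jet_poly (c + d) (\<xi> + \<eta>) (X + Y) w s = jet_poly c \<xi> X w s + jet_poly d \<eta> Y w s"
  unfolding jet_poly_def
  by (simp add: matrix_vector_mult_add_rdistrib inner_add_left inner_add_right distrib_right add_divide_distrib)

lemma jet_poly_scaleR: "jet_poly (k * c) (k *\<^sub>R \<xi>) (k *\<^sub>R X) w s = k * jet_poly c \<xi> X w s"
  unfolding jet_poly_def by (simp add: scaleR_matrix_vector_assoc[symmetric] algebra_simps)

lemma has_jet_add:
  assumes "has_jet f z c \<xi> X" "has_jet g z d \<eta> Y"
  shows "has_jet (\<lambda>z. f z + g z) z (c + d) (\<xi> + \<eta>) (X + Y)"
  using small2_add[OF assms[unfolded has_jet_def]]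
  unfolding has_jet_def jet_poly_add by (simp add: algebra_simps)

lemma has_jet_cmult:
  assumes "has_jet f z c \<xi> X"
  shows "has_jet (\<lambda>z. k * f z) z (k * c) (k *\<^sub>R \<xi>) (k *\<^sub>R X)"
  using small2_cmult[OF assms[unfolded has_jet_def], of k]
  unfolding has_jet_def jet_poly_scaleR by (simp add: algebra_simps)

lemma has_jet_uminus:
  assumes "has_jet f z c \<xi> X"
  shows "has_jet (\<lambda>z. - f z) z (- c) (- \<xi>) (- X)"
  using has_jet_cmult[OF assms, of "-1"] by simp

lemma has_jet_time: "has_jet snd z 1 0 0"
  unfolding has_jet_def jet_poly_def by simp

lemma has_jet_inner: "has_jet (\<lambda>z. \<xi> \<bullet> fst z) z 0 \<xi> 0"
  unfolding has_jet_def jet_poly_def by (simp add: inner_add_right)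

lemma has_jet_dist_square:
  "has_jet (\<lambda>z. (fst z - a) \<bullet> (fst z - a)) z 0 (2 *\<^sub>R (fst z - a)) (2 *\<^sub>R mat 1)"
proof -
  have "(fst z + w - a) \<bullet> (fst z + w - a) - (fst z - a) \<bullet> (fst z - a)
      - jet_poly 0 (2 *\<^sub>R (fst z - a)) (2 *\<^sub>R mat 1) w s = 0" for w s
  proof -
    have "(p + w) \<bullet> (p + w) - p \<bullet> p = (2 *\<^sub>R p) \<bullet> w + w \<bullet> (2 *\<^sub>R w) / 2" for p
      by (simp add: inner_add_left inner_add_right inner_commute)
    from this[of "fst z - a"] show ?thesis
      unfolding jet_poly_def scaleR_matrix_vector_assoc[symmetric] matrix_vector_mul_lid
      by (simp add: algebra_simps)
  qed
  then show ?thesis unfolding has_jet_def by simp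
qed

lemma tensor_vector: "tensor \<xi> \<eta> *v w = (\<eta> \<bullet> w) *\<^sub>R \<xi>"
  by (simp add: vec_eq_iff tensor_def matrix_vector_mult_def inner_vec_def sum_distrib_right[symmetric] mult.assoc)
     (simp add: sum_distrib_right[symmetric] sum_distrib_left[symmetric] mult.assoc mult.commute)

lemma trace_tensor: "trace (tensor \<xi> \<eta>) = \<xi> \<bullet> \<eta>"
  by (simp add: trace_def tensor_def inner_vec_def)

lemma transpose_tensor: "transpose (tensor \<xi> \<xi>) = tensor \<xi> \<xi>"
  by (simp add: vec_eq_iff transpose_def tensor_def mult.commute)

lemma transpose_plus: "transpose (X + Y) = transpose X + transpose (Y :: real^'n^'m)"
  by (simp add: vec_eq_iff transpose_def)

lemma transpose_scale: "transpose (k *\<^sub>R X) = k *\<^sub>R transpose (X :: real^'n^'m)"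
  by (simp add: vec_eq_iff transpose_def)

lemma jet_bound_aux2:
  fixes d A Q E cc q C n2 \<sigma> :: real
  assumes "d = A + Q / 2 + E" "\<bar>A\<bar> \<le> cc * \<sigma>" "\<bar>Q\<bar> \<le> q * n2"
    "s2 \<le> \<sigma>" "\<bar>E\<bar> \<le> n2 + C * s2" "0 \<le> cc" "0 \<le> q" "0 < C" "0 \<le> n2" "0 \<le> \<sigma>"
  shows "\<bar>d\<bar> \<le> (cc + q + 1 + C) * (\<sigma> + n2)"
proof -
  have "C * s2 \<le> C * \<sigma>" using assms by (intro mult_left_mono) auto
  moreover have "0 \<le> cc * n2" "0 \<le> q * \<sigma>" "0 \<le> C * n2" "0 \<le> q * n2" using assms by auto
  moreover have "\<bar>d\<bar> \<le> \<bar>A\<bar> + \<bar>Q\<bar> / 2 + \<bar>E\<bar>" unfolding assms(1) by arith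
  moreover have "(cc + q + 1 + C) * (\<sigma> + n2) = cc * \<sigma> + cc * n2 + q * \<sigma> + q * n2 + \<sigma> + n2 + C * n2 + C * \<sigma>"
    by (simp add: algebra_simps)
  ultimately show ?thesis using assms by linarith
qed

text \<open>
  The chain rule to second order: apart from \<open>(\<xi> \<bullet> w)\<^sup>2\<close>, the terms of the square of the inner increment
  are remainders, because they contain a factor \<open>s\<close> or are of third order in \<open>w\<close>.
\<close>

lemma has_jet_compose:
  fixes f :: "(real^'n) \<times> real \<Rightarrow> real"
  assumes f: "has_jet f z c \<xi> X" and h: "taylor2 h (f z) h1 h2"
  shows "has_jet (\<lambda>z. h (f z)) z (h1 * c) (h1 *\<^sub>R \<xi>) (h1 *\<^sub>R X + h2 *\<^sub>R tensor \<xi> \<xi>)"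
proof -
  define e where "e w s = f (fst z + w, snd z + s) - f z - jet_poly c \<xi> X w s" for w s
  define D where "D w s = f (fst z + w, snd z + s) - f z" for w s
  have De: "D w s = jet_poly c \<xi> X w s + e w s" for w s unfolding D_def e_def by simp
  have se: "small2 e" using f unfolding has_jet_def e_def .
  obtain r C where r: "0 < r" "r \<le> 1" "0 < C"
    and e: "\<And>w s. norm w < r \<Longrightarrow> \<bar>s\<bar> < r \<Longrightarrow> \<bar>e w s\<bar> \<le> (norm w)\<^sup>2 + C * s\<^sup>2"
    using small2_bounded[OF se] by blast
  define K where "K = \<bar>c\<bar> + norm X + 1 + C"
  define L where "L = K + norm \<xi>"
  have K: "0 < K" unfolding K_def using r by (simp add: add_nonneg_pos add_pos_nonneg)
  have L: "0 < L" unfolding L_def using K by (simp add: add_pos_nonneg)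
  have D1: "\<bar>D w s - \<xi> \<bullet> w\<bar> \<le> K * (\<bar>s\<bar> + (norm w)\<^sup>2)" if "norm w < r" "\<bar>s\<bar> < r" for w s
  proof -
    have "D w s - \<xi> \<bullet> w = c * s + w \<bullet> (X *v w) / 2 + e w s" unfolding De jet_poly_def by simp
    moreover have "\<bar>c * s\<bar> \<le> \<bar>c\<bar> * \<bar>s\<bar>" by (simp add: abs_mult)
    moreover have "\<bar>w \<bullet> (X *v w)\<bar> \<le> norm X * (norm w)\<^sup>2"
      using abs_quadratic_form_le[of w X w] by (simp add: power2_eq_square ac_simps)
    moreover have "s\<^sup>2 \<le> \<bar>s\<bar>"
      using that r mult_right_mono[of "\<bar>s\<bar>" 1 "\<bar>s\<bar>"] by (simp add: power2_eq_square abs_mult[symmetric])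
    ultimately show ?thesis unfolding K_def
      by (rule jet_bound_aux2) (use e[OF that] r in auto)
  qed
  have D2: "\<bar>D w s\<bar> \<le> L * (\<bar>s\<bar> + norm w)" "\<bar>D w s + \<xi> \<bullet> w\<bar> \<le> 2 * L * (\<bar>s\<bar> + norm w)"
    if "norm w < r" "\<bar>s\<bar> < r" for w s
  proof -
    have "(norm w)\<^sup>2 \<le> norm w"
      using that r mult_right_mono[of "norm w" 1 "norm w"] by (simp add: power2_eq_square)
    then have "K * (\<bar>s\<bar> + (norm w)\<^sup>2) \<le> K * (\<bar>s\<bar> + norm w)" using K by (intro mult_left_mono) auto
    moreover have x: "\<bar>\<xi> \<bullet> w\<bar> \<le> norm \<xi> * norm w" by (rule Cauchy_Schwarz_ineq2)
    moreover have "0 \<le> norm \<xi> * \<bar>s\<bar>" "0 \<le> K * (\<bar>s\<bar> + norm w)" using K by auto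
    ultimately show "\<bar>D w s\<bar> \<le> L * (\<bar>s\<bar> + norm w)" "\<bar>D w s + \<xi> \<bullet> w\<bar> \<le> 2 * L * (\<bar>s\<bar> + norm w)"
      using D1[OF that] unfolding L_def distrib_left distrib_right by linarith+
  qed
  have s1: "small2 (\<lambda>w s. (D w s)\<^sup>2 - (\<xi> \<bullet> w)\<^sup>2)"
  proof (rule small2_cubic[OF \<open>0 < r\<close>, where K = "4 * K * L"])
    fix w :: "real^'n" and s :: real assume ws: "norm w < r" "\<bar>s\<bar> < r"
    have "\<bar>(D w s)\<^sup>2 - (\<xi> \<bullet> w)\<^sup>2\<bar> = \<bar>D w s - \<xi> \<bullet> w\<bar> * \<bar>D w s + \<xi> \<bullet> w\<bar>"
      by (simp add: abs_mult[symmetric] power2_eq_square algebra_simps)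
    also have "\<dots> \<le> (K * (\<bar>s\<bar> + (norm w)\<^sup>2)) * (2 * L * (\<bar>s\<bar> + norm w))"
      using D1[OF ws] D2(2)[OF ws] K L by (intro mult_mono) auto
    also have "\<dots> = 2 * K * L * ((\<bar>s\<bar> + (norm w)\<^sup>2) * (\<bar>s\<bar> + norm w))" by (simp only: mult_ac)
    also have "\<dots> \<le> 2 * K * L * (2 * (\<bar>s\<bar> * norm w + s\<^sup>2 + norm w ^ 3))"
    proof (intro mult_left_mono)
      have "\<bar>s\<bar> * (norm w)\<^sup>2 \<le> \<bar>s\<bar> * norm w"
        using ws r mult_right_mono[of "norm w" 1 "norm w"] by (intro mult_left_mono) (auto simp: power2_eq_square)
      moreover have "0 \<le> s\<^sup>2" "0 \<le> norm w ^ 3" by auto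
      ultimately have "s\<^sup>2 + \<bar>s\<bar> * norm w + \<bar>s\<bar> * (norm w)\<^sup>2 + norm w ^ 3 \<le> 2 * (\<bar>s\<bar> * norm w + s\<^sup>2 + norm w ^ 3)"
        unfolding distrib_left by linarith
      moreover have "(\<bar>s\<bar> + (norm w)\<^sup>2) * (\<bar>s\<bar> + norm w) = s\<^sup>2 + \<bar>s\<bar> * norm w + \<bar>s\<bar> * (norm w)\<^sup>2 + norm w ^ 3"
        by (simp add: power2_eq_square power3_eq_cube algebra_simps)
      ultimately show "(\<bar>s\<bar> + (norm w)\<^sup>2) * (\<bar>s\<bar> + norm w) \<le> 2 * (\<bar>s\<bar> * norm w + s\<^sup>2 + norm w ^ 3)"
        by (simp only:)
    qed (use K L in auto)
    also have "2 * K * L * (2 * x) = 4 * K * L * x" for x :: real by simp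
    finally show "\<bar>(D w s)\<^sup>2 - (\<xi> \<bullet> w)\<^sup>2\<bar> \<le> 4 * K * L * (\<bar>s\<bar> * norm w + s\<^sup>2 + norm w ^ 3)" .
  qed (use K L in auto)
  have s2: "small2 (\<lambda>w s. h (f z + D w s) - h (f z) - h1 * D w s - h2 * (D w s)\<^sup>2 / 2)"
    unfolding small2_def
  proof (intro allI impI)
    fix \<theta> :: real assume \<theta>: "0 < \<theta>"
    define \<theta>' where "\<theta>' = \<theta> / (2 * L\<^sup>2)"
    have \<theta>': "0 < \<theta>'" "\<theta>' * (2 * L\<^sup>2) = \<theta>" unfolding \<theta>'_def using \<theta> L by auto
    obtain \<rho> where \<rho>: "0 < \<rho>" "\<And>d. \<bar>d\<bar> < \<rho> \<Longrightarrow> \<bar>h (f z + d) - h (f z) - h1 * d - h2 * d\<^sup>2 / 2\<bar> \<le> \<theta>' * d\<^sup>2"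
      using h \<theta>'(1) unfolding taylor2_def by meson
    define r' where "r' = min r (\<rho> / (2 * L))"
    have r': "0 < r'" "r' \<le> r" "L * (r' + r') \<le> \<rho>"
      unfolding r'_def using r L \<rho> by (auto simp: min_def field_simps)
    show "\<exists>r>0. \<exists>C. \<forall>w s. norm w < r \<longrightarrow> \<bar>s\<bar> < r \<longrightarrow>
       \<bar>h (f z + D w s) - h (f z) - h1 * D w s - h2 * (D w s)\<^sup>2 / 2\<bar> \<le> \<theta> * (norm w)\<^sup>2 + C * s\<^sup>2"
    proof (rule local_bound_exI[of r' _ \<theta>])
      fix w :: "real^'n" and s :: real assume ws: "norm w < r'" "\<bar>s\<bar> < r'"
      then have "norm w < r" "\<bar>s\<bar> < r" using r' by auto
      note D2 = D2(1)[OF this]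
      have "L * (\<bar>s\<bar> + norm w) < L * (r' + r')" using ws L by (intro mult_strict_left_mono) auto
      then have "\<bar>h (f z + D w s) - h (f z) - h1 * D w s - h2 * (D w s)\<^sup>2 / 2\<bar> \<le> \<theta>' * (D w s)\<^sup>2"
        using \<rho>(2) D2 r' by auto
      also have "\<dots> \<le> \<theta>' * (2 * L\<^sup>2 * (s\<^sup>2 + (norm w)\<^sup>2))"
      proof (intro mult_left_mono)
        have "(D w s)\<^sup>2 \<le> (L * (\<bar>s\<bar> + norm w))\<^sup>2"
          using D2 by (intro abs_le_square_iff[THEN iffD1]) auto
        also have "\<dots> = L\<^sup>2 * (\<bar>s\<bar> + norm w)\<^sup>2" by (simp add: power_mult_distrib)
        also have "\<dots> \<le> L\<^sup>2 * (2 * (s\<^sup>2 + (norm w)\<^sup>2))"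
        proof (intro mult_left_mono)
          show "(\<bar>s\<bar> + norm w)\<^sup>2 \<le> 2 * (s\<^sup>2 + (norm w)\<^sup>2)"
            using sum_squares_ge_zero[of 0 "\<bar>s\<bar> - norm w"] by (simp add: power2_eq_square algebra_simps)
        qed auto
        finally show "(D w s)\<^sup>2 \<le> 2 * L\<^sup>2 * (s\<^sup>2 + (norm w)\<^sup>2)" by (simp only: mult_ac)
      qed (use \<theta>' in auto)
      also have "\<dots> = (\<theta>' * (2 * L\<^sup>2)) * (s\<^sup>2 + (norm w)\<^sup>2)" by (simp only: mult.assoc)
      also have "\<dots> = \<theta> * (norm w)\<^sup>2 + \<theta> * s\<^sup>2" unfolding \<theta>'(2) by (simp add: algebra_simps)
      finally show "\<bar>h (f z + D w s) - h (f z) - h1 * D w s - h2 * (D w s)\<^sup>2 / 2\<bar> \<le> \<theta> * (norm w)\<^sup>2 + \<theta> * s\<^sup>2" .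
    qed (use r' in auto)
  qed
  have eq: "h (f (fst z + w, snd z + s)) - h (f z)
      - jet_poly (h1 * c) (h1 *\<^sub>R \<xi>) (h1 *\<^sub>R X + h2 *\<^sub>R tensor \<xi> \<xi>) w s
     = (h (f z + D w s) - h (f z) - h1 * D w s - h2 * (D w s)\<^sup>2 / 2)
       + (h1 * e w s + h2 / 2 * ((D w s)\<^sup>2 - (\<xi> \<bullet> w)\<^sup>2))" for w s
  proof -
    have "jet_poly (h1 * c) (h1 *\<^sub>R \<xi>) (h1 *\<^sub>R X + h2 *\<^sub>R tensor \<xi> \<xi>) w s
        = h1 * jet_poly c \<xi> X w s + h2 / 2 * (\<xi> \<bullet> w)\<^sup>2"
      unfolding jet_poly_def
      by (simp add: matrix_vector_mult_add_rdistrib scaleR_matrix_vector_assoc[symmetric] tensor_vector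
          inner_add_right inner_commute[of w \<xi>] power2_eq_square algebra_simps add_divide_distrib)
    moreover have "f z + D w s = f (fst z + w, snd z + s)" unfolding D_def by simp
    ultimately show ?thesis using De[of w s] by (simp add: algebra_simps)
  qed
  show ?thesis
    unfolding has_jet_def eq by (intro small2_add small2_cmult s1 s2 se)
qed

lemma taylor2_DERIV:
  assumes d: "0 < d" and h1: "\<And>x. \<bar>x - y\<bar> < d \<Longrightarrow> (h has_real_derivative h1 x) (at x)"
    and h2: "(h1 has_real_derivative h2) (at y)"
  shows "taylor2 h y (h1 y) h2"
  unfolding taylor2_def
proof (intro allI impI)
  fix \<theta> :: real assume \<theta>: "0 < \<theta>"
  have "(\<lambda>k. (h1 (y + k) - h1 y) / k) \<midarrow>0\<rightarrow> h2" using h2 by (simp add: DERIV_def)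
  then obtain r where r: "0 < r" "\<And>k. k \<noteq> 0 \<Longrightarrow> \<bar>k\<bar> < r \<Longrightarrow> \<bar>(h1 (y + k) - h1 y) / k - h2\<bar> < \<theta>"
    using \<theta> unfolding LIM_def by (auto simp: dist_real_def)
  have b: "\<bar>h1 (y + k) - h1 y - h2 * k\<bar> \<le> \<theta> * \<bar>k\<bar>" if "\<bar>k\<bar> < r" for k
  proof (cases "k = 0")
    case False
    have "h1 (y + k) - h1 y - h2 * k = ((h1 (y + k) - h1 y) / k - h2) * k"
      using False by (simp add: field_simps)
    then have "\<bar>h1 (y + k) - h1 y - h2 * k\<bar> = \<bar>(h1 (y + k) - h1 y) / k - h2\<bar> * \<bar>k\<bar>"
      by (simp only: abs_mult)
    also have "\<dots> \<le> \<theta> * \<bar>k\<bar>" using r(2)[OF False that] by (intro mult_right_mono) auto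
    finally show ?thesis .
  qed auto
  show "\<exists>r>0. \<forall>k. \<bar>k\<bar> < r \<longrightarrow> \<bar>h (y + k) - h y - h1 y * k - h2 * k\<^sup>2 / 2\<bar> \<le> \<theta> * k\<^sup>2"
  proof (intro exI[of _ "min r d"] conjI allI impI)
    fix k assume k: "\<bar>k\<bar> < min r d"
    define g where "g x = h (y + x) - h1 y * x - h2 * x\<^sup>2 / 2" for x
    have g': "(g has_real_derivative (h1 (y + x) - h1 y - h2 * x)) (at x)" if "\<bar>x\<bar> < d" for x
      unfolding g_def
      using that by (auto intro!: derivative_eq_intros DERIV_chain2[OF h1])
    have "\<bar>g k - g 0\<bar> \<le> (\<theta> * \<bar>k\<bar>) * \<bar>k - 0\<bar>"
      using field_differentiable_bound[where S = "closed_segment 0 k" and f = g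
          and f' = "\<lambda>x. h1 (y + x) - h1 y - h2 * x" and B = "\<theta> * \<bar>k\<bar>" and x = k and y = 0]
    proof -
      have seg: "\<bar>x\<bar> \<le> \<bar>k\<bar>" if "x \<in> closed_segment 0 k" for x
        using that segment_bound(1)[OF that] by simp
      have "norm (g k - g 0) \<le> (\<theta> * \<bar>k\<bar>) * norm (k - 0)"
      proof (rule field_differentiable_bound[where S = "closed_segment 0 k" and f' = "\<lambda>x. h1 (y + x) - h1 y - h2 * x"])
        fix x assume x: "x \<in> closed_segment 0 k"
        show "(g has_field_derivative (h1 (y + x) - h1 y - h2 * x)) (at x within closed_segment 0 k)"
          using seg[OF x] k by (intro has_field_derivative_at_within[OF g']) auto
        have "\<bar>h1 (y + x) - h1 y - h2 * x\<bar> \<le> \<theta> * \<bar>x\<bar>" using seg[OF x] k by (intro b) auto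
        also have "\<dots> \<le> \<theta> * \<bar>k\<bar>" using seg[OF x] \<theta> by (intro mult_left_mono) auto
        finally show "norm (h1 (y + x) - h1 y - h2 * x) \<le> \<theta> * \<bar>k\<bar>" by simp
      qed auto
      then show ?thesis by simp
    qed
    then show "\<bar>h (y + k) - h y - h1 y * k - h2 * k\<^sup>2 / 2\<bar> \<le> \<theta> * k\<^sup>2"
      unfolding g_def by (simp add: power2_eq_square algebra_simps abs_mult[symmetric])
  qed (use r d in auto)
qed

lemma has_jet_square:
  assumes "has_jet f z c \<xi> X"
  shows "has_jet (\<lambda>z. (f z)\<^sup>2) z (2 * f z * c) ((2 * f z) *\<^sub>R \<xi>) ((2 * f z) *\<^sub>R X + 2 *\<^sub>R tensor \<xi> \<xi>)"
  by (rule has_jet_compose[OF assms, of "\<lambda>x. x\<^sup>2"])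
     (rule taylor2_DERIV[of 1 _ _ "\<lambda>x. 2 * x"]; auto intro!: derivative_eq_intros)

lemma has_jet_cong:
  assumes "has_jet f z c \<xi> X" "f = g" "c = d" "\<xi> = \<eta>" "X = Y"
  shows "has_jet g z d \<eta> Y"
  using assms by simp

lemma tensor_scaleR_left: "tensor (k *\<^sub>R a) c = k *\<^sub>R tensor a c"
  and tensor_scaleR_right: "tensor c (k *\<^sub>R a) = k *\<^sub>R tensor c a"
  and tensor_zero_left [simp]: "tensor 0 c = 0"
  and tensor_zero_right [simp]: "tensor c 0 = 0"
  by (simp_all add: tensor_def vec_eq_iff algebra_simps)

text \<open>
  Polarisation reduces products to squares.
\<close>

lemma has_jet_mult:
  assumes f: "has_jet f z c \<xi> X" and g: "has_jet g z d \<eta> Y"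
  shows "has_jet (\<lambda>z. f z * g z) z (f z * d + g z * c) (f z *\<^sub>R \<eta> + g z *\<^sub>R \<xi>)
     (f z *\<^sub>R Y + g z *\<^sub>R X + tensor \<xi> \<eta> + tensor \<eta> \<xi>)"
proof -
  note p = has_jet_cmult[OF has_jet_square[OF has_jet_add[OF f g]], of "1/4"]
  note m = has_jet_cmult[OF has_jet_square[OF has_jet_add[OF f has_jet_uminus[OF g]]], of "-1/4"]
  show ?thesis
    by (rule has_jet_cong[OF has_jet_add[OF p m]])
       (auto simp: fun_eq_iff vec_eq_iff tensor_def power2_eq_square algebra_simps)
qed

lemma has_jet_affine:
  fixes B :: "real^'n^'n"
  assumes f: "has_jet f (o1 + B *v x0, m + k * t0) c \<xi> X"
  shows "has_jet (\<lambda>z. f (o1 + B *v fst z, m + k * snd z)) (x0, t0) (k * c) (transpose B *v \<xi>)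
     (transpose B ** X ** B)"
proof -
  define e where "e w s = f (o1 + B *v x0 + w, m + k * t0 + s) - f (o1 + B *v x0, m + k * t0) - jet_poly c \<xi> X w s" for w s
  have se: "small2 e" using f unfolding has_jet_def e_def by simp
  have eq: "f (o1 + B *v (x0 + w), m + k * (t0 + s)) - f (o1 + B *v x0, m + k * t0)
      - jet_poly (k * c) (transpose B *v \<xi>) (transpose B ** X ** B) w s = e (B *v w) (k * s)" for w s
  proof -
    have "jet_poly (k * c) (transpose B *v \<xi>) (transpose B ** X ** B) w s = jet_poly c \<xi> X (B *v w) (k * s)"
    proof -
      have "(transpose B *v \<xi>) \<bullet> w = \<xi> \<bullet> (B *v w)"
        by (simp add: dot_lmul_matrix)
      moreover have "w \<bullet> ((transpose B ** X ** B) *v w) = (B *v w) \<bullet> (X *v (B *v w))"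
      proof -
        have "(transpose B ** X ** B) *v w = transpose B *v (X *v (B *v w))"
          by (simp only: matrix_vector_mul_assoc[symmetric])
        then show ?thesis by (metis dot_lmul_matrix inner_commute transpose_matrix_vector)
      qed
      ultimately show ?thesis unfolding jet_poly_def by simp
    qed
    then show ?thesis unfolding e_def by (simp add: matrix_vector_right_distrib distrib_left add.assoc)
  qed
  have "small2 (\<lambda>w s. e (B *v w) (k * s))"
    unfolding small2_def
  proof (intro allI impI)
    fix \<theta> :: real assume \<theta>: "0 < \<theta>"
    define N where "N = norm B + \<bar>k\<bar> + 1"
    have N: "0 < N" "norm B \<le> N" "\<bar>k\<bar> \<le> N" unfolding N_def by (auto simp: add_nonneg_pos)
    have "0 < \<theta> / N\<^sup>2" using \<theta> N by simp
    then obtain r C where r: "0 < r" and C: "\<And>w s. norm w < r \<Longrightarrow> \<bar>s\<bar> < r \<Longrightarrow> \<bar>e w s\<bar> \<le> \<theta> / N\<^sup>2 * (norm w)\<^sup>2 + C * s\<^sup>2"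
      using se unfolding small2_def by blast
    show "\<exists>r>0. \<exists>C. \<forall>w s. norm w < r \<longrightarrow> \<bar>s\<bar> < r \<longrightarrow> \<bar>e (B *v w) (k * s)\<bar> \<le> \<theta> * (norm w)\<^sup>2 + C * s\<^sup>2"
    proof (rule local_bound_exI[of "r / N" _ "C * k\<^sup>2"])
      fix w :: "real^'n" and s :: real assume ws: "norm w < r / N" "\<bar>s\<bar> < r / N"
      have Bw: "norm (B *v w) \<le> N * norm w"
        using norm_matrix_vector_le[of B w] mult_right_mono[OF N(2), of "norm w"] by simp
      then have 1: "norm (B *v w) < r" using ws(1) N by (simp add: field_simps)
      have "\<bar>k * s\<bar> \<le> N * \<bar>s\<bar>" unfolding abs_mult using N by (intro mult_right_mono) auto
      then have 2: "\<bar>k * s\<bar> < r" using ws(2) N by (simp add: field_simps)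
      have "\<bar>e (B *v w) (k * s)\<bar> \<le> \<theta> / N\<^sup>2 * (norm (B *v w))\<^sup>2 + C * (k * s)\<^sup>2" by (rule C[OF 1 2])
      also have "\<theta> / N\<^sup>2 * (norm (B *v w))\<^sup>2 \<le> \<theta> / N\<^sup>2 * (N * norm w)\<^sup>2"
        using Bw \<theta> by (intro mult_left_mono power_mono) auto
      also have "\<dots> = \<theta> * (norm w)\<^sup>2" using N by (simp add: power_mult_distrib)
      finally show "\<bar>e (B *v w) (k * s)\<bar> \<le> \<theta> * (norm w)\<^sup>2 + C * k\<^sup>2 * s\<^sup>2"
        by (simp add: power_mult_distrib)
    qed (use r N in auto)
  qed
  then show ?thesis unfolding has_jet_def by (simp only: eq fst_conv snd_conv)
qed

lemma jet_bound_aux: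
  fixes d A B Q E cc x q C n \<sigma> :: real
  assumes "d = A + B + Q / 2 + E" "\<bar>A\<bar> \<le> cc * \<sigma>" "\<bar>B\<bar> \<le> x * n" "n2 \<le> n" "\<bar>Q\<bar> \<le> q * n"
    "s2 \<le> \<sigma>" "\<bar>E\<bar> \<le> n2 + C * s2" "0 \<le> cc" "0 \<le> x" "0 \<le> q" "0 < C" "0 \<le> n" "0 \<le> \<sigma>"
  shows "\<bar>d\<bar> \<le> (cc + x + q + 1 + C) * (n + \<sigma>)"
proof -
  have "C * s2 \<le> C * \<sigma>" using assms by (intro mult_left_mono) auto
  moreover have "0 \<le> cc * n" "0 \<le> x * \<sigma>" "0 \<le> q * \<sigma>" "0 \<le> C * n" "0 \<le> q * n" using assms by auto
  moreover have "\<bar>d\<bar> \<le> \<bar>A\<bar> + \<bar>B\<bar> + \<bar>Q\<bar> / 2 + \<bar>E\<bar>" unfolding assms(1) by arith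
  moreover have "(cc + x + q + 1 + C) * (n + \<sigma>) = cc * n + cc * \<sigma> + x * n + x * \<sigma> + q * n + q * \<sigma> + n + \<sigma> + C * n + C * \<sigma>"
    by (simp add: algebra_simps)
  ultimately show ?thesis using assms by linarith
qed

lemma has_jet_bound_near:
  fixes f :: "(real^'n) \<times> real \<Rightarrow> real"
  assumes "has_jet f z c \<xi> X"
  shows "\<exists>r>0. \<exists>K>0. \<forall>w s. norm w < r \<longrightarrow> \<bar>s\<bar> < r \<longrightarrow>
     \<bar>f (fst z + w, snd z + s) - f z\<bar> \<le> K * (norm w + \<bar>s\<bar>)"
proof -
  define e where "e w s = f (fst z + w, snd z + s) - f z - jet_poly c \<xi> X w s" for w s
  have "small2 e" using assms unfolding has_jet_def e_def .
  then obtain r C where r: "0 < r" "r \<le> 1" "0 < C"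
    and e: "\<And>w s. norm w < r \<Longrightarrow> \<bar>s\<bar> < r \<Longrightarrow> \<bar>e w s\<bar> \<le> (norm w)\<^sup>2 + C * s\<^sup>2"
    using small2_bounded by blast
  define K where "K = \<bar>c\<bar> + norm \<xi> + norm X + 1 + C"
  have "\<bar>f (fst z + w, snd z + s) - f z\<bar> \<le> K * (norm w + \<bar>s\<bar>)" if ws: "norm w < r" "\<bar>s\<bar> < r" for w s
  proof -
    have "f (fst z + w, snd z + s) - f z = c * s + \<xi> \<bullet> w + w \<bullet> (X *v w) / 2 + e w s"
      unfolding e_def jet_poly_def by simp
    moreover have "\<bar>c * s\<bar> \<le> \<bar>c\<bar> * \<bar>s\<bar>" by (simp add: abs_mult)
    moreover have "\<bar>\<xi> \<bullet> w\<bar> \<le> norm \<xi> * norm w" by (rule Cauchy_Schwarz_ineq2)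
    moreover have nw: "(norm w)\<^sup>2 \<le> norm w"
      using ws r mult_right_mono[of "norm w" 1 "norm w"] by (simp add: power2_eq_square)
    moreover have "\<bar>w \<bullet> (X *v w)\<bar> \<le> norm X * norm w"
      using abs_quadratic_form_le[of w X w] mult_left_mono[OF nw, of "norm X"]
      by (simp add: power2_eq_square ac_simps)
    moreover have "s\<^sup>2 \<le> \<bar>s\<bar>"
      using ws r mult_right_mono[of "\<bar>s\<bar>" 1 "\<bar>s\<bar>"] by (simp add: power2_eq_square abs_mult[symmetric])
    ultimately show ?thesis unfolding K_def
      by (rule jet_bound_aux) (use e[OF ws] r in auto)
  qed
  moreover have "0 < K" unfolding K_def using r by (simp add: add_nonneg_pos add_pos_nonneg)
  ultimately show ?thesis using r by blast
qed

lemma has_jet_isCont: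
  fixes f :: "(real^'n) \<times> real \<Rightarrow> real"
  assumes "has_jet f z c \<xi> X"
  shows "isCont f z"
proof -
  obtain r K where r: "0 < r" "0 < K" and K: "\<And>w s. norm w < r \<Longrightarrow> \<bar>s\<bar> < r \<Longrightarrow>
     \<bar>f (fst z + w, snd z + s) - f z\<bar> \<le> K * (norm w + \<bar>s\<bar>)"
    using has_jet_bound_near[OF assms] by blast
  have 1: "\<forall>\<^sub>F y in at z. norm (f y - f z) \<le> K * (norm (fst y - fst z) + \<bar>snd y - snd z\<bar>)"
  proof -
    have "\<forall>\<^sub>F y in at z. dist y z < r" using r by (simp add: eventually_at) blast
    then show ?thesis
    proof eventually_elim
      case (elim y)
      have "norm (fst y - fst z) < r" "\<bar>snd y - snd z\<bar> < r"
        using elim dist_fst_le[of y z] dist_snd_le[of y z] by (auto simp: dist_norm)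
      from K[OF this] show ?case by simp
    qed
  qed
  have "((\<lambda>y. K * (norm (fst y - fst z) + \<bar>snd y - snd z\<bar>)) \<longlongrightarrow> K * (norm (fst z - fst z) + \<bar>snd z - snd z\<bar>)) (at z)"
    by (intro tendsto_intros)
  then have "((\<lambda>y. K * (norm (fst y - fst z) + \<bar>snd y - snd z\<bar>)) \<longlongrightarrow> 0) (at z)" by simp
  from Lim_null_comparison[OF 1 this] show ?thesis
    unfolding isCont_def by (rule LIM_zero_cancel)
qed

text \<open>
  This is how smooth barriers meet nonsmooth functions: a local maximum of the difference transfers the
  expansion of the barrier.
\<close>

lemma touch_above_local_max:
  fixes f :: "(real^'n) \<times> real \<Rightarrow> real"
  assumes f: "has_jet f z c \<xi> X" and r: "0 < r"
    and le: "\<And>w s. norm w < r \<Longrightarrow> \<bar>s\<bar> < r \<Longrightarrow>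
      v (fst z + w, snd z + s) - f (fst z + w, snd z + s) \<le> v z - f z"
  shows "touch_above v z c \<xi> X"
  unfolding touch_above_def
proof (intro allI impI)
  fix \<theta> :: real assume "0 < \<theta>"
  then obtain r' C where r': "0 < r'" and C: "\<And>w s. norm w < r' \<Longrightarrow> \<bar>s\<bar> < r' \<Longrightarrow>
     \<bar>f (fst z + w, snd z + s) - f z - jet_poly c \<xi> X w s\<bar> \<le> \<theta> * (norm w)\<^sup>2 + C * s\<^sup>2"
    by (rule small2E[OF f[unfolded has_jet_def]]) blast
  show "\<exists>r>0. \<exists>C. \<forall>w s. norm w < r \<longrightarrow> \<bar>s\<bar> < r \<longrightarrow>
     v (fst z + w, snd z + s) \<le> v z + jet_poly c \<xi> X w s + \<theta> * (norm w)\<^sup>2 + C * s\<^sup>2"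
  proof (rule local_bound_exI[of "min r r'" _ C])
    fix w :: "real^'n" and s :: real assume ws: "norm w < min r r'" "\<bar>s\<bar> < min r r'"
    show "v (fst z + w, snd z + s) \<le> v z + jet_poly c \<xi> X w s + \<theta> * (norm w)\<^sup>2 + C * s\<^sup>2"
      using le[of w s] C[of w s] ws by auto
  qed (use r r' in auto)
qed

text \<open>
  A linear term bounded by a quadratic one near zero has the sign of its coefficient. This extracts first-order
  conditions from one-sided expansions.
\<close>

lemma nonpos_of_little:
  fixes a :: real
  assumes r: "0 < r" and le: "\<And>h. 0 < h \<Longrightarrow> h < r \<Longrightarrow> a * h \<le> K * h\<^sup>2"
  shows "a \<le> 0"
proof (rule ccontr)
  assume "\<not> a \<le> 0"
  then have a: "0 < a" by simp
  define h where "h = min (r / 2) (a / (2 * (\<bar>K\<bar> + 1)))"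
  have h: "0 < h" "h < r" unfolding h_def using r a by (auto intro: min.strict_coboundedI1)
  have "K * h \<le> (\<bar>K\<bar> + 1) * h" using h by (intro mult_right_mono) auto
  also have "\<dots> \<le> (\<bar>K\<bar> + 1) * (a / (2 * (\<bar>K\<bar> + 1)))" unfolding h_def by (intro mult_left_mono) auto
  also have "\<dots> = a / 2" by (simp add: field_simps)
  finally have "K * h < a" using a by simp
  then have "(K * h) * h < a * h" using h by (intro mult_strict_right_mono) auto
  then show False using le[OF h] by (simp add: power2_eq_square)
qed

lemma has_jet_max:
  fixes X :: "real^'n^'n" and f :: "(real^'n) \<times> real \<Rightarrow> real"
  assumes f: "has_jet f z c \<xi> X" and r: "0 < r"
    and le: "\<And>w s. norm w < r \<Longrightarrow> \<bar>s\<bar> < r \<Longrightarrow> f (fst z + w, snd z + s) \<le> f z"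
  shows "c = 0" "\<xi> = 0" "\<And>w. w \<bullet> (X *v w) \<le> 0" "trace X \<le> 0"
proof -
  have ex: "\<exists>r'>0. r' \<le> r \<and> (\<exists>C. \<forall>w s. norm w < r' \<longrightarrow> \<bar>s\<bar> < r' \<longrightarrow>
     jet_poly c \<xi> X w s \<le> \<theta> * (norm w)\<^sup>2 + C * s\<^sup>2)" if \<theta>: "0 < \<theta>" for \<theta>
  proof -
    obtain r' C where r': "0 < r'" and C: "\<And>w s. norm w < r' \<Longrightarrow> \<bar>s\<bar> < r' \<Longrightarrow>
     \<bar>f (fst z + w, snd z + s) - f z - jet_poly c \<xi> X w s\<bar> \<le> \<theta> * (norm w)\<^sup>2 + C * s\<^sup>2"
      by (rule small2E[OF f[unfolded has_jet_def] \<theta>]) blast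
    have "jet_poly c \<xi> X w s \<le> \<theta> * (norm w)\<^sup>2 + C * s\<^sup>2" if "norm w < min r r'" "\<bar>s\<bar> < min r r'" for w s
      using C[of w s] le[of w s] that by auto
    then show ?thesis using r r' by (intro exI[of _ "min r r'"]) auto
  qed
  obtain r1 C1 where r1: "0 < r1" and C1: "\<And>w s. norm w < r1 \<Longrightarrow> \<bar>s\<bar> < r1 \<Longrightarrow>
     jet_poly c \<xi> X w s \<le> 1 * (norm w)\<^sup>2 + C1 * s\<^sup>2"
    using ex[OF zero_less_one] by blast
  have "c \<le> 0"
    by (rule nonpos_of_little[OF r1, of _ C1]) (use C1[of 0] r1 in \<open>force simp: jet_poly_def\<close>)
  moreover have "- c \<le> 0"
  proof (rule nonpos_of_little[OF r1, of _ C1])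
    fix h :: real assume "0 < h" "h < r1"
    then show "- c * h \<le> C1 * h\<^sup>2" using C1[of 0 "- h"] r1 by (simp add: jet_poly_def)
  qed
  ultimately show c: "c = 0" by simp
  show \<xi>: "\<xi> = 0"
  proof (rule ccontr)
    assume "\<xi> \<noteq> 0"
    then have n: "0 < norm \<xi>" by simp
    have "norm \<xi> \<le> 0"
    proof (rule nonpos_of_little[OF r1, of _ "1 + norm X"])
      fix h :: real assume h: "0 < h" "h < r1"
      define w where "w = (h / norm \<xi>) *\<^sub>R \<xi>"
      have nw: "norm w = h" unfolding w_def using h n by simp
      have xw: "\<xi> \<bullet> w = norm \<xi> * h" unfolding w_def using n by (simp add: power2_norm_eq_inner[symmetric] power2_eq_square)
      have "\<bar>w \<bullet> (X *v w)\<bar> \<le> norm X * h\<^sup>2"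
        using abs_quadratic_form_le[of w X w] nw by (simp add: power2_eq_square ac_simps)
      then show "norm \<xi> * h \<le> (1 + norm X) * h\<^sup>2"
      proof -
        have "\<xi> \<bullet> w + w \<bullet> (X *v w) / 2 \<le> h\<^sup>2" using C1[of w 0] nw h r1 unfolding jet_poly_def by simp
        moreover have "0 \<le> norm X * h\<^sup>2" by simp
        moreover have "(1 + norm X) * h\<^sup>2 = h\<^sup>2 + norm X * h\<^sup>2" by (simp add: algebra_simps)
        ultimately show ?thesis
          using \<open>\<xi> \<bullet> w = norm \<xi> * h\<close> \<open>\<bar>w \<bullet> (X *v w)\<bar> \<le> norm X * h\<^sup>2\<close> by linarith
      qed
    qed
    then show False using n by simp
  qed
  show X: "w \<bullet> (X *v w) \<le> 0" for w
  proof (rule ccontr)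
    assume "\<not> w \<bullet> (X *v w) \<le> 0"
    then have q: "0 < w \<bullet> (X *v w)" by simp
    then have w: "0 < norm w" by auto
    define \<theta> where "\<theta> = w \<bullet> (X *v w) / (4 * (norm w)\<^sup>2)"
    have \<theta>: "0 < \<theta>" unfolding \<theta>_def using q w by simp
    obtain r2 C2 where r2: "0 < r2" and C2: "\<And>w s. norm w < r2 \<Longrightarrow> \<bar>s\<bar> < r2 \<Longrightarrow>
      jet_poly c \<xi> X w s \<le> \<theta> * (norm w)\<^sup>2 + C2 * s\<^sup>2"
      using ex[OF \<theta>] by blast
    define h where "h = r2 / (2 * norm w)"
    have h: "0 < h" unfolding h_def using r2 w by simp
    have "norm (h *\<^sub>R w) < r2" unfolding h_def using r2 w by simp
    from C2[OF this, of 0] have "h\<^sup>2 * (w \<bullet> (X *v w)) / 2 \<le> \<theta> * (h\<^sup>2 * (norm w)\<^sup>2)"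
      using r2 h unfolding jet_poly_def c \<xi>
      by (simp add: matrix_vector_mult_scaleR power2_eq_square ac_simps)
    also have "\<dots> = h\<^sup>2 * (w \<bullet> (X *v w)) / 4" unfolding \<theta>_def using w by simp
    finally show False using q h by simp
  qed
  have "X $ i $ i \<le> 0" for i
  proof -
    have "axis i 1 \<bullet> (X *v axis i 1) = X $ i $ i"
      by (simp add: inner_axis' matrix_vector_mul_component inner_axis)
    then show ?thesis using X[of "axis i 1"] by simp
  qed
  then show "trace X \<le> 0" unfolding trace_def by (intro sum_nonpos) auto
qed

section \<open>Parabolic maxima and caloric functions\<close>

text \<open>
  The penalty \<open>\<delta> / (T - t)\<close> keeps the maximum away from the final time, so that it is a genuine two-sided
  maximum in time, and it makes every comparison strict.
\<close>

lemma parabolic_max: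
  fixes \<Phi> :: "'a::euclidean_space \<times> real \<Rightarrow> real"
  assumes K: "compact K" and cont: "continuous_on (K \<times> {t0..<T}) \<Phi>"
    and R: "\<And>x t. x \<in> K \<Longrightarrow> t0 \<le> t \<Longrightarrow> t < T \<Longrightarrow> \<Phi> (x, t) \<le> R" and \<delta>: "0 < \<delta>"
    and lat: "\<And>x t. x \<in> K - U \<Longrightarrow> t0 \<le> t \<Longrightarrow> t < T \<Longrightarrow> \<Phi> (x, t) \<le> 0"
    and ini: "\<And>x. x \<in> K \<Longrightarrow> \<Phi> (x, t0) \<le> 0"
    and x1: "x1 \<in> K" "t0 \<le> t1" "t1 < T" and pos: "\<delta> / (T - t1) < \<Phi> (x1, t1)"
  obtains x0 s0 where "x0 \<in> K" "x0 \<in> U" "t0 < s0" "s0 < T" "0 < \<Phi> (x0, s0) - \<delta> / (T - s0)"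
    "\<And>x t. x \<in> K \<Longrightarrow> t0 \<le> t \<Longrightarrow> t < T \<Longrightarrow> \<Phi> (x, t) - \<delta> / (T - t) \<le> \<Phi> (x0, s0) - \<delta> / (T - s0)"
proof -
  define T1 where "T1 = max t1 (T - \<delta> / (\<bar>R\<bar> + 1))"
  have T1: "t1 \<le> T1" "T1 < T" "t0 \<le> T1" unfolding T1_def using x1 \<delta> by (auto simp: add_nonneg_pos)
  define S where "S = K \<times> {t0..T1}"
  have S: "compact S" unfolding S_def by (intro compact_Times K compact_Icc)
  have ne: "(x1, t1) \<in> S" unfolding S_def using x1 T1 by auto
  have "continuous_on S (\<lambda>z. \<Phi> z - \<delta> / (T - snd z))"
  proof (intro continuous_intros)
    show "continuous_on S \<Phi>" using cont by (rule continuous_on_subset) (use T1 in \<open>auto simp: S_def\<close>)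
    show "\<forall>x\<in>S. T - snd x \<noteq> 0" using T1 by (auto simp: S_def)
  qed
  then obtain z0 where z0: "z0 \<in> S" "\<And>z. z \<in> S \<Longrightarrow> \<Phi> z - \<delta> / (T - snd z) \<le> \<Phi> z0 - \<delta> / (T - snd z0)"
    using continuous_attains_sup[OF S] ne by blast
  obtain x0 s0 where z0': "z0 = (x0, s0)" by (cases z0)
  have x0: "x0 \<in> K" "t0 \<le> s0" "s0 \<le> T1" using z0(1) unfolding z0' S_def by auto
  have p: "0 < \<Phi> (x0, s0) - \<delta> / (T - s0)" using z0(2)[OF ne] pos unfolding z0' by simp
  have q: "0 < \<delta> / (T - s0)" using x0 T1 \<delta> by simp
  show thesis
  proof (rule that[OF x0(1) _ _ _ p])
    show "x0 \<in> U" using lat[of x0 s0] x0 T1 p q by force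
    show "t0 < s0" using ini[of x0] x0 p q by (cases "t0 = s0") auto
    show "s0 < T" using x0 T1 by simp
    fix x t assume xt: "x \<in> K" "t0 \<le> t" "t < T"
    show "\<Phi> (x, t) - \<delta> / (T - t) \<le> \<Phi> (x0, s0) - \<delta> / (T - s0)"
    proof (cases "t \<le> T1")
      case True
      then show ?thesis using z0(2)[of "(x, t)"] xt unfolding z0' S_def by auto
    next
      case False
      then have "T - t < \<delta> / (\<bar>R\<bar> + 1)" unfolding T1_def by auto
      then have "(T - t) * (\<bar>R\<bar> + 1) < \<delta>" by (simp add: pos_less_divide_eq add_nonneg_pos)
      then have "\<bar>R\<bar> + 1 < \<delta> / (T - t)" using xt by (simp add: pos_less_divide_eq mult.commute)
      then show ?thesis using R[OF xt] p by linarith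
    qed
  qed
qed

text \<open>
  Finite sums of plane waves; each term solves the heat equation and is started at time \<open>- 1\<close>.
\<close>

definition trig :: "(real \<times> (real^'n) \<times> real) list \<Rightarrow> (real^'n) \<times> real \<Rightarrow> real" where
  "trig l z = (\<Sum>(a, k, \<phi>)\<leftarrow>l. a * (exp (- (k \<bullet> k) * (snd z + 1)) * cos (k \<bullet> fst z + \<phi>)))"

text \<open>
  The bound \<open>R\<close> on gradient and Hessian is part of the notion because subsolutions after a blow-up satisfy the heat
  inequality only up to an error that is uniform on bounded sets of test data.
\<close>

definition caloric :: "real \<Rightarrow> real \<Rightarrow> ((real^'n) \<times> real \<Rightarrow> real) \<Rightarrow> bool" where
  "caloric L R g \<longleftrightarrow> (\<forall>z. norm (fst z) \<le> L \<and> -1 \<le> snd z \<and> snd z \<le> 2 \<longrightarrow>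
     (\<exists>c \<xi> X. has_jet g z c \<xi> X \<and> transpose X = X \<and> c = trace X \<and> norm \<xi> \<le> R \<and> norm X \<le> R))"

lemma trace_plus: "trace (X + Y) = trace X + trace (Y :: real^'n^'n)"
  by (rule trace_add)

lemma transpose_zero [simp]: "transpose (0 :: real^'n^'m) = 0"
  by (simp add: vec_eq_iff transpose_def)

lemma trace_zero [simp]: "trace (0 :: real^'n^'n) = 0"
  by (simp add: trace_def)

lemma caloric_add:
  fixes f g :: "(real^'n) \<times> real \<Rightarrow> real"
  assumes "caloric L R f" "caloric L R' g"
  shows "caloric L (R + R') (\<lambda>z. f z + g z)"
  unfolding caloric_def
proof (intro allI impI)
  fix z :: "(real^'n) \<times> real" assume z: "norm (fst z) \<le> L \<and> -1 \<le> snd z \<and> snd z \<le> 2"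
  obtain c \<xi> X where 1: "has_jet f z c \<xi> X" "transpose X = X" "c = trace X" "norm \<xi> \<le> R" "norm X \<le> R"
    using assms(1) z unfolding caloric_def by blast
  obtain d \<eta> Y where 2: "has_jet g z d \<eta> Y" "transpose Y = Y" "d = trace Y" "norm \<eta> \<le> R'" "norm Y \<le> R'"
    using assms(2) z unfolding caloric_def by blast
  show "\<exists>c \<xi> X. has_jet (\<lambda>z. f z + g z) z c \<xi> X \<and> transpose X = X \<and> c = trace X \<and> norm \<xi> \<le> R + R' \<and> norm X \<le> R + R'"
    by (intro exI conjI, rule has_jet_add[OF 1(1) 2(1)])
       (use 1 2 in \<open>auto simp: transpose_plus trace_plus intro: norm_triangle_mono\<close>)
qed

lemma caloric_cmult:
  fixes f :: "(real^'n) \<times> real \<Rightarrow> real"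
  assumes "caloric L R f"
  shows "caloric L (\<bar>k\<bar> * R) (\<lambda>z. k * f z)"
  unfolding caloric_def
proof (intro allI impI)
  fix z :: "(real^'n) \<times> real" assume z: "norm (fst z) \<le> L \<and> -1 \<le> snd z \<and> snd z \<le> 2"
  obtain c \<xi> X where 1: "has_jet f z c \<xi> X" "transpose X = X" "c = trace X" "norm \<xi> \<le> R" "norm X \<le> R"
    using assms(1) z unfolding caloric_def by blast
  show "\<exists>c \<xi> X. has_jet (\<lambda>z. k * f z) z c \<xi> X \<and> transpose X = X \<and> c = trace X \<and> norm \<xi> \<le> \<bar>k\<bar> * R \<and> norm X \<le> \<bar>k\<bar> * R"
    by (intro exI conjI, rule has_jet_cmult[OF 1(1)])
       (use 1 in \<open>auto simp: transpose_scale intro: mult_left_mono\<close>)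
qed

lemma caloric_const: "caloric L 0 (\<lambda>z. k)"
  unfolding caloric_def by (intro allI impI exI conjI, rule has_jet_const) auto

lemma taylor2_exp: "taylor2 exp y (exp y) (exp y)"
  by (rule taylor2_DERIV[of 1 _ _ exp]) (auto intro!: derivative_eq_intros)

lemma taylor2_cos: "taylor2 cos y (- sin y) (- cos y)"
  by (rule taylor2_DERIV[of 1 _ _ "\<lambda>x. - sin x"]) (auto intro!: derivative_eq_intros)

lemma has_jet_add_const:
  fixes f :: "(real^'n) \<times> real \<Rightarrow> real"
  assumes "has_jet f z c \<xi> X"
  shows "has_jet (\<lambda>z. f z + k) z c \<xi> X"
  using has_jet_add[OF assms has_jet_const[of k]] by simp

lemma norm_tensor: "norm (tensor \<xi> \<eta>) = norm \<xi> * norm \<eta>"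
proof -
  have "(tensor \<xi> \<eta>) $ i = (\<xi> $ i) *\<^sub>R \<eta>" for i by (simp add: tensor_def vec_eq_iff)
  then have "norm (tensor \<xi> \<eta>) = L2_set (\<lambda>i. norm (\<xi> $ i) * norm \<eta>) UNIV"
    unfolding norm_vec_def[of "tensor \<xi> \<eta>"] by simp
  also have "\<dots> = norm \<xi> * norm \<eta>"
    unfolding norm_vec_def[of \<xi>] by (rule L2_set_left_distrib[symmetric]) simp
  finally show ?thesis .
qed

lemma caloric_wave:
  fixes k :: "real^'n"
  shows "caloric L (norm k + k \<bullet> k) (\<lambda>z. exp (- (k \<bullet> k) * (snd z + 1)) * cos (k \<bullet> fst z + \<phi>))"
  unfolding caloric_def
proof (intro allI impI)
  fix z :: "(real^'n) \<times> real" assume z: "norm (fst z) \<le> L \<and> -1 \<le> snd z \<and> snd z \<le> 2"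
  define E where "E = exp (- (k \<bullet> k) * (snd z + 1))"
  define g where "g = k \<bullet> fst z + \<phi>"
  have "- (k \<bullet> k) * (snd z + 1) \<le> 0" using z by (intro mult_nonpos_nonneg) auto
  then have E: "0 < E" "E \<le> 1" unfolding E_def by auto
  have 1: "has_jet (\<lambda>z. exp (- (k \<bullet> k) * (snd z + 1))) z (E * - (k \<bullet> k)) 0 0"
    using has_jet_compose[OF has_jet_cmult[OF has_jet_add_const[OF has_jet_time, where k = 1], of "- (k \<bullet> k)"] taylor2_exp]
    unfolding E_def by simp
  have 2: "has_jet (\<lambda>z. cos (k \<bullet> fst z + \<phi>)) z 0 (- sin g *\<^sub>R k) (- cos g *\<^sub>R tensor k k)"
    using has_jet_compose[OF has_jet_add_const[OF has_jet_inner, where k = \<phi>] taylor2_cos]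
    unfolding g_def by simp
  have 3: "has_jet (\<lambda>z. exp (- (k \<bullet> k) * (snd z + 1)) * cos (k \<bullet> fst z + \<phi>)) z (- (E * cos g * (k \<bullet> k)))
     ((- E * sin g) *\<^sub>R k) ((- (E * cos g)) *\<^sub>R tensor k k)"
    by (rule has_jet_cong[OF has_jet_mult[OF 1 2]]) (auto simp: E_def g_def)
  have b: "\<bar>E * sin g\<bar> \<le> 1" "\<bar>E * cos g\<bar> \<le> 1"
    using E mult_mono[of E 1 "\<bar>sin g\<bar>" 1] mult_mono[of E 1 "\<bar>cos g\<bar>" 1] by (auto simp: abs_mult)
  show "\<exists>c \<xi> X. has_jet (\<lambda>z. exp (- (k \<bullet> k) * (snd z + 1)) * cos (k \<bullet> fst z + \<phi>)) z c \<xi> X \<and>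
     transpose X = X \<and> c = trace X \<and> norm \<xi> \<le> norm k + k \<bullet> k \<and> norm X \<le> norm k + k \<bullet> k"
  proof (intro exI conjI, rule 3)
    have "norm ((- E * sin g) *\<^sub>R k) \<le> norm k"
      using mult_right_mono[OF b(1), of "norm k"] by (simp add: abs_mult)
    then show "norm ((- E * sin g) *\<^sub>R k) \<le> norm k + k \<bullet> k"
      using inner_ge_zero[of k] by linarith
    have "norm ((- (E * cos g)) *\<^sub>R tensor k k) \<le> k \<bullet> k"
      using mult_right_mono[OF b(2), of "k \<bullet> k"]
      by (simp add: abs_mult norm_tensor power2_norm_eq_inner[symmetric] power2_eq_square)
    then show "norm ((- (E * cos g)) *\<^sub>R tensor k k) \<le> norm k + k \<bullet> k"
      using norm_ge_zero[of k] by linarith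
  qed (auto simp: transpose_scale transpose_tensor transpose_uminus trace_tensor)
qed

lemma caloric_trig:
  fixes l :: "(real \<times> (real^'n) \<times> real) list"
  shows "\<exists>R. \<forall>L. caloric L R (trig l)"
proof (induction l)
  case Nil
  have "trig [] = (\<lambda>z::(real^'n) \<times> real. 0)" by (simp add: trig_def fun_eq_iff)
  then have "caloric L 0 (trig [] :: (real^'n) \<times> real \<Rightarrow> real)" for L
    using caloric_const[of L 0] by metis
  then show ?case by blast
next
  case (Cons p l)
  obtain a k \<phi> where p: "p = (a, k, \<phi>)" by (cases p)
  obtain R where R: "\<And>L. caloric L R (trig l)" using Cons.IH by blast
  have eq: "trig (p # l) = (\<lambda>z. a * (exp (- (k \<bullet> k) * (snd z + 1)) * cos (k \<bullet> fst z + \<phi>)) + trig l z)"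
    by (simp add: trig_def p fun_eq_iff)
  have "caloric L (\<bar>a\<bar> * (norm k + k \<bullet> k) + R) (trig (p # l))" for L
    unfolding eq by (rule caloric_add[OF caloric_cmult[OF caloric_wave] R])
  then show ?case by blast
qed

lemma abs_trig_bounded:
  fixes l :: "(real \<times> (real^'n) \<times> real) list"
  shows "\<exists>R. \<forall>z. -1 \<le> snd z \<longrightarrow> \<bar>trig l z\<bar> \<le> R"
proof (induction l)
  case Nil
  then show ?case by (auto simp: trig_def)
next
  case (Cons p l)
  obtain a k \<phi> where p: "p = (a, k, \<phi>)" by (cases p)
  obtain R where R: "\<And>z. -1 \<le> snd z \<Longrightarrow> \<bar>trig l z\<bar> \<le> R" using Cons.IH by blast
  have "\<bar>trig (p # l) z\<bar> \<le> \<bar>a\<bar> + R" if z: "-1 \<le> snd z" for z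
  proof -
    have "- (k \<bullet> k) * (snd z + 1) \<le> 0" using z by (intro mult_nonpos_nonneg) auto
    then have "exp (- (k \<bullet> k) * (snd z + 1)) \<le> 1" by simp
    then have "\<bar>exp (- (k \<bullet> k) * (snd z + 1)) * cos (k \<bullet> fst z + \<phi>)\<bar> \<le> 1"
      unfolding abs_mult using mult_mono[of "exp (- (k \<bullet> k) * (snd z + 1))" 1 "\<bar>cos (k \<bullet> fst z + \<phi>)\<bar>" 1] by simp
    then have "\<bar>a * (exp (- (k \<bullet> k) * (snd z + 1)) * cos (k \<bullet> fst z + \<phi>))\<bar> \<le> \<bar>a\<bar>"
      unfolding abs_mult[of a] using mult_left_mono[of _ 1 "\<bar>a\<bar>"] by fastforce
    then show ?thesis using R[OF z] by (simp add: trig_def p)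
  qed
  then show ?case by blast
qed

lemma caloric_isCont:
  fixes g :: "(real^'n) \<times> real \<Rightarrow> real"
  assumes "caloric L R g" "norm (fst z) \<le> L" "-1 \<le> snd z" "snd z \<le> 2"
  shows "isCont g z"
  using assms has_jet_isCont unfolding caloric_def by blast

lemma caloric_continuous_on:
  fixes g :: "(real^'n) \<times> real \<Rightarrow> real"
  assumes "caloric L R g"
  shows "continuous_on (cball 0 L \<times> {-1..1}) g"
  using caloric_isCont[OF assms] by (auto intro!: continuous_at_imp_continuous_on)

lemma has_jet_end_penalty:
  fixes z :: "(real^'n) \<times> real"
  assumes "snd z < T"
  shows "has_jet (\<lambda>z. \<delta> / (T - snd z)) z (\<delta> / (T - snd z)\<^sup>2) 0 0"
proof -
  have inv: "((\<lambda>s. inverse (T - s)) has_real_derivative (inverse (T - x))\<^sup>2) (at x)" if "x < T" for x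
    using that by (auto intro!: derivative_eq_intros simp: power2_eq_square)
  have "taylor2 (\<lambda>s. \<delta> / (T - s)) (snd z) (\<delta> * (inverse (T - snd z))\<^sup>2)
      (\<delta> * (2 * inverse (T - snd z) * (inverse (T - snd z))\<^sup>2))"
  proof (rule taylor2_DERIV[of "T - snd z" _ _ "\<lambda>s. \<delta> * (inverse (T - s))\<^sup>2"])
    fix x assume "\<bar>x - snd z\<bar> < T - snd z"
    then have "x < T" by simp
    from DERIV_cmult[OF inv[OF this], of \<delta>]
    show "((\<lambda>s. \<delta> / (T - s)) has_real_derivative \<delta> * (inverse (T - x))\<^sup>2) (at x)"
      by (simp add: divide_inverse)
  next
    from DERIV_cmult[OF DERIV_power[OF inv[OF assms], of 2], of \<delta>]
    show "((\<lambda>s. \<delta> * (inverse (T - s))\<^sup>2) has_real_derivative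
        \<delta> * (2 * inverse (T - snd z) * (inverse (T - snd z))\<^sup>2)) (at (snd z))"
      by (simp add: ac_simps)
  qed (use assms in auto)
  from has_jet_compose[OF has_jet_time this] show ?thesis
    by (simp add: divide_inverse power_inverse)
qed

lemma interior_box:
  assumes "norm x0 < L" "a < s0" "s0 < (b::real)"
  shows "\<exists>r>0. \<forall>w s. norm w < r \<longrightarrow> \<bar>s\<bar> < r \<longrightarrow> norm (x0 + w) < L \<and> a < s0 + s \<and> s0 + s < b"
proof (intro exI[of _ "min (L - norm x0) (min (s0 - a) (b - s0))"] conjI allI impI)
  fix w :: 'a and s :: real
  assume *: "norm w < min (L - norm x0) (min (s0 - a) (b - s0))" "\<bar>s\<bar> < min (L - norm x0) (min (s0 - a) (b - s0))"
  show "norm (x0 + w) < L" using * norm_triangle_ineq[of x0 w] by simp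
  show "a < s0 + s" "s0 + s < b" using * by auto
qed (use assms in auto)

text \<open>
  Comparison with an error: \<open>B\<close> is a subsolution of the heat equation with source \<open>e\<close>, which over the unit time from
  \<open>- 1\<close> to 0 contributes \<open>e\<close>. Only test data bounded by \<open>R\<close> are needed of \<open>B\<close>.
\<close>

lemma heat_compare:
  fixes B g :: "(real^'n) \<times> real \<Rightarrow> real"
  assumes L: "0 < L" and B: "continuous_on (cball 0 L \<times> {-1..1}) B" and g: "caloric L R g"
    and ini: "\<And>w. norm w \<le> L \<Longrightarrow> B (w, -1) \<le> g (w, -1)"
    and lat: "\<And>w s. norm w = L \<Longrightarrow> -1 \<le> s \<Longrightarrow> s \<le> 1 \<Longrightarrow> B (w, s) \<le> g (w, s) + e * (s + 1)"
    and sub: "\<And>w0 s0 c \<xi> X. norm w0 < L \<Longrightarrow> -1 < s0 \<Longrightarrow> s0 < 1 \<Longrightarrow> transpose X = X \<Longrightarrow>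
       norm \<xi> \<le> R \<Longrightarrow> norm X \<le> R \<Longrightarrow> touch_above B (w0, s0) c \<xi> X \<Longrightarrow> c \<le> trace X + e"
  shows "B (0, 0) \<le> g (0, 0) + e"
proof (rule ccontr)
  assume "\<not> ?thesis"
  then have pos: "0 < B (0, 0) - g (0, 0) - e" by simp
  define \<delta> where "\<delta> = (B (0, 0) - g (0, 0) - e) / 2"
  have \<delta>: "0 < \<delta>" "\<delta> < B (0, 0) - g (0, 0) - e" unfolding \<delta>_def using pos by auto
  define \<Phi> where "\<Phi> z = B z - g z - e * (snd z + 1)" for z
  have cont: "continuous_on (cball 0 L \<times> {-1..1}) \<Phi>"
    unfolding \<Phi>_def by (intro continuous_intros B caloric_continuous_on[OF g])
  have "bounded (\<Phi> ` (cball 0 L \<times> {-1..1}))"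
    by (intro compact_imp_bounded compact_continuous_image[OF cont] compact_Times) auto
  then obtain M where M: "\<And>z. z \<in> cball 0 L \<times> {-1..1} \<Longrightarrow> \<bar>\<Phi> z\<bar> \<le> M"
    unfolding bounded_iff by auto
  obtain w0 s0 where z0: "w0 \<in> cball 0 L" "w0 \<in> ball 0 L" "-1 < s0" "s0 < 1"
    and mx: "\<And>w s. w \<in> cball 0 L \<Longrightarrow> -1 \<le> s \<Longrightarrow> s < 1 \<Longrightarrow> \<Phi> (w, s) - \<delta> / (1 - s) \<le> \<Phi> (w0, s0) - \<delta> / (1 - s0)"
  proof (rule parabolic_max[of "cball 0 L" "-1" 1 \<Phi> M \<delta> "ball 0 L" 0 0])
    show "continuous_on (cball 0 L \<times> {- 1..<1}) \<Phi>" by (rule continuous_on_subset[OF cont]) auto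
    show "\<Phi> (x, t) \<le> M" if "x \<in> cball 0 L" "- 1 \<le> t" "t < 1" for x t
      using M[of "(x, t)"] that by auto
    show "\<Phi> (x, t) \<le> 0" if "x \<in> cball 0 L - ball 0 L" "- 1 \<le> t" "t < 1" for x t
      using lat[of x t] that unfolding \<Phi>_def by auto
    show "\<Phi> (x, - 1) \<le> 0" if "x \<in> cball 0 L" for x
      using ini[of x] that unfolding \<Phi>_def by auto
    show "\<delta> / (1 - 0) < \<Phi> (0, 0)" using \<delta> unfolding \<Phi>_def by simp
  qed (use L \<delta> in \<open>auto\<close>)
  obtain c \<xi> X where jet: "has_jet g (w0, s0) c \<xi> X" "transpose X = X" "c = trace X" "norm \<xi> \<le> R" "norm X \<le> R"
  proof -
    have "norm (fst (w0, s0)) \<le> L \<and> -1 \<le> snd (w0, s0) \<and> snd (w0, s0) \<le> 2" using z0 by auto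
    then show ?thesis using g that unfolding caloric_def by blast
  qed
  have "has_jet (\<lambda>z. e * (snd z + 1)) (w0, s0) e 0 0"
    using has_jet_cmult[OF has_jet_add_const[OF has_jet_time, where k = 1], of e] by simp
  then have jet': "has_jet (\<lambda>z. g z + e * (snd z + 1) + \<delta> / (1 - snd z)) (w0, s0) (c + e + \<delta> / (1 - s0)\<^sup>2) \<xi> X"
    using has_jet_add[OF has_jet_add[OF jet(1)] has_jet_end_penalty[of "(w0,s0)" 1 \<delta>]] z0 by fastforce
  obtain r where r: "0 < r" "\<And>w s. norm w < r \<Longrightarrow> \<bar>s\<bar> < r \<Longrightarrow> norm (w0 + w) < L \<and> -1 < s0 + s \<and> s0 + s < 1"
    using interior_box[of w0 L "-1" s0 1] z0 by auto
  have "touch_above B (w0, s0) (c + e + \<delta> / (1 - s0)\<^sup>2) \<xi> X"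
  proof (rule touch_above_local_max[OF jet' r(1)])
    fix w s assume "norm (w :: real^'n) < r" "\<bar>s\<bar> < r"
    from r(2)[OF this] mx[of "w0 + w" "s0 + s"]
    show "B (fst (w0, s0) + w, snd (w0, s0) + s) -
           (g (fst (w0, s0) + w, snd (w0, s0) + s) + e * (snd (fst (w0, s0) + w, snd (w0, s0) + s) + 1) +
            \<delta> / (1 - snd (fst (w0, s0) + w, snd (w0, s0) + s)))
           \<le> B (w0, s0) - (g (w0, s0) + e * (snd (w0, s0) + 1) + \<delta> / (1 - snd (w0, s0)))"
      unfolding \<Phi>_def by (simp add: algebra_simps)
  qed
  from sub[OF _ z0(3,4) jet(2,4,5) this] z0 have "\<delta> / (1 - s0)\<^sup>2 \<le> 0" using jet(3) by simp
  moreover have "0 < \<delta> / (1 - s0)\<^sup>2" using \<delta> z0 by simp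
  ultimately show False by simp
qed

section \<open>Caloric extension of continuous data\<close>

text \<open>
  The maximum principle on the whole space: since the sum is bounded, subtracting a small
  multiple of \<open>w \<bullet> w + (2 * N + 1) * (s + 1)\<close> makes it attain its maximum and makes it a strict subsolution.
\<close>

lemma trig_le:
  fixes l :: "(real \<times> (real^'n) \<times> real) list"
  assumes S: "\<And>w. trig l (w, -1) \<le> S" and s1: "-1 \<le> s1" "s1 \<le> 1"
  shows "trig l (w1, s1) \<le> S"
proof (rule ccontr)
  assume "\<not> ?thesis"
  then have pos: "0 < trig l (w1, s1) - S" by simp
  define N where "N = real CARD('n)"
  define d where "d = trig l (w1, s1) - S"
  define A where "A = w1 \<bullet> w1 + (2 * N + 1) * (s1 + 1) + 1"
  have N: "0 \<le> N" unfolding N_def by simp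
  have A: "1 \<le> A" unfolding A_def using s1 N by simp
  define \<delta> where "\<delta> = d / (2 * (A + 1))"
  have d: "0 < d" unfolding d_def using pos .
  have "\<delta> * (A + 1) = d / 2" unfolding \<delta>_def using A by (simp add: field_simps)
  then have "\<delta> * (A + 1) < d" using d by linarith
  moreover have "0 < \<delta>" unfolding \<delta>_def using d A by simp
  ultimately have \<delta>: "0 < \<delta>" "\<delta> * (A + 1) < d" by auto
  obtain R where R: "\<And>z. -1 \<le> snd z \<Longrightarrow> \<bar>trig l z\<bar> \<le> R" using abs_trig_bounded[of l] by blast
  have R0: "0 \<le> R" using R[of "(0, 0)"] by auto
  obtain Rc where Rc: "\<And>L. caloric L Rc (trig l)" using caloric_trig[of l] by blast
  define \<Phi> where "\<Phi> z = trig l z - S - \<delta> * (fst z \<bullet> fst z + (2 * N + 1) * (snd z + 1))" for z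
  define \<rho> where "\<rho> = max (norm w1 + 1) (sqrt ((R + \<bar>S\<bar>) / \<delta>) + 1)"
  have \<rho>: "norm w1 < \<rho>" "0 < \<rho>" unfolding \<rho>_def by (auto simp: less_max_iff_disj add_nonneg_pos)
  have nn: "0 \<le> \<delta> * (w \<bullet> w + (2 * N + 1) * (s + 1))" if "-1 \<le> s" for w :: "real^'n" and s
    using that \<delta> N by simp
  have lat: "\<Phi> (w, s) \<le> 0" if "norm w = \<rho>" "-1 \<le> s" for w s
  proof -
    have "sqrt ((R + \<bar>S\<bar>) / \<delta>) \<le> \<rho>" unfolding \<rho>_def by simp
    then have "(R + \<bar>S\<bar>) / \<delta> \<le> \<rho>\<^sup>2" by (rule sqrt_le_D)
    then have "R + \<bar>S\<bar> \<le> \<delta> * \<rho>\<^sup>2" using \<delta> by (simp add: field_simps)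
    moreover have "\<rho>\<^sup>2 = w \<bullet> w" using that by (simp add: power2_norm_eq_inner[symmetric])
    moreover have "0 \<le> \<delta> * ((2 * N + 1) * (s + 1))" using that \<delta> N by simp
    moreover have "trig l (w, s) \<le> R" using R[of "(w, s)"] that by auto
    ultimately show ?thesis unfolding \<Phi>_def by (simp add: algebra_simps)
  qed
  obtain w0 s0 where z0: "w0 \<in> cball 0 \<rho>" "w0 \<in> ball 0 \<rho>" "-1 < s0" "s0 < 2"
    and mx: "\<And>w s. w \<in> cball 0 \<rho> \<Longrightarrow> -1 \<le> s \<Longrightarrow> s < 2 \<Longrightarrow> \<Phi> (w, s) - \<delta> / (2 - s) \<le> \<Phi> (w0, s0) - \<delta> / (2 - s0)"
  proof (rule parabolic_max[of "cball 0 \<rho>" "-1" 2 \<Phi> "R + \<bar>S\<bar>" \<delta> "ball 0 \<rho>" w1 s1])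
    show "continuous_on (cball 0 \<rho> \<times> {- 1..<2}) \<Phi>"
      unfolding \<Phi>_def
      by (intro continuous_intros continuous_at_imp_continuous_on ballI caloric_isCont[OF Rc]) auto
    show "\<Phi> (x, t) \<le> R + \<bar>S\<bar>" if "x \<in> cball 0 \<rho>" "- 1 \<le> t" "t < 2" for x t
      using R[of "(x, t)"] nn[of t x] that unfolding \<Phi>_def by auto
    show "\<Phi> (x, t) \<le> 0" if "x \<in> cball 0 \<rho> - ball 0 \<rho>" "- 1 \<le> t" "t < 2" for x t
      using lat[of x t] that by auto
    show "\<Phi> (x, - 1) \<le> 0" if "x \<in> cball 0 \<rho>" for x
      using S[of x] nn[of "-1" x] unfolding \<Phi>_def by auto
    have "\<delta> / (2 - s1) \<le> \<delta> * 1" using \<delta> s1 by (simp add: divide_simps)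
    moreover have "\<delta> * (w1 \<bullet> w1 + (2 * N + 1) * (s1 + 1)) = \<delta> * (A + 1) - \<delta> * 2"
      unfolding A_def by (simp add: algebra_simps)
    ultimately show "\<delta> / (2 - s1) < \<Phi> (w1, s1)"
      using \<delta> unfolding \<Phi>_def d_def by simp
  qed (use \<rho> \<delta> s1 in \<open>auto\<close>)
  obtain c \<xi> X where jet: "has_jet (trig l) (w0, s0) c \<xi> X" "c = trace X"
  proof -
    have "norm (fst (w0, s0)) \<le> \<rho> \<and> -1 \<le> snd (w0, s0) \<and> snd (w0, s0) \<le> 2" using z0 by auto
    then show ?thesis using Rc[of \<rho>] that unfolding caloric_def by blast
  qed
  have 1: "has_jet (\<lambda>z. - (\<delta> * ((fst z - 0) \<bullet> (fst z - 0) + (2 * N + 1) * (snd z + 1)))) (w0, s0)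
     (- (\<delta> * (2 * N + 1))) (- (\<delta> *\<^sub>R 2 *\<^sub>R w0)) (- (\<delta> *\<^sub>R 2 *\<^sub>R mat 1))"
    using has_jet_uminus[OF has_jet_cmult[OF has_jet_add[OF has_jet_dist_square[of 0 "(w0,s0)"]
        has_jet_cmult[OF has_jet_add_const[OF has_jet_time, where k = 1]]], of \<delta>]]
    by simp
  have 2: "has_jet (\<lambda>z. \<Phi> z - \<delta> / (2 - snd z)) (w0, s0)
      (c - \<delta> * (2 * N + 1) - \<delta> / (2 - s0)\<^sup>2) (\<xi> - \<delta> *\<^sub>R 2 *\<^sub>R w0) (X - \<delta> *\<^sub>R 2 *\<^sub>R mat 1)"
    by (rule has_jet_cong[OF has_jet_add[OF has_jet_add_const[OF has_jet_add[OF jet(1) 1], where k = "- S"]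
          has_jet_uminus[OF has_jet_end_penalty[of "(w0,s0)" 2 \<delta>]]]])
       (use z0 in \<open>auto simp: \<Phi>_def fun_eq_iff\<close>)
  obtain r where r: "0 < r" "\<And>w s. norm w < r \<Longrightarrow> \<bar>s\<bar> < r \<Longrightarrow> norm (w0 + w) < \<rho> \<and> -1 < s0 + s \<and> s0 + s < 2"
    using interior_box[of w0 \<rho> "-1" s0 2] z0 by auto
  have le: "\<Phi> (fst (w0, s0) + w, snd (w0, s0) + s) - \<delta> / (2 - snd (fst (w0, s0) + w, snd (w0, s0) + s))
      \<le> \<Phi> (w0, s0) - \<delta> / (2 - snd (w0, s0))" if "norm w < r" "\<bar>s\<bar> < r" for w s
    using r(2)[OF that] mx[of "w0 + w" "s0 + s"] by auto
  have "c - \<delta> * (2 * N + 1) - \<delta> / (2 - s0)\<^sup>2 = 0" by (rule has_jet_max(1)[OF 2 r(1) le])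
  moreover have "trace (X - \<delta> *\<^sub>R 2 *\<^sub>R mat 1) \<le> 0" by (rule has_jet_max(4)[OF 2 r(1) le])
  then have "trace X \<le> \<delta> * (2 * N)" by (simp add: trace_sub trace_I N_def)
  moreover have "0 \<le> \<delta> / (2 - s0)\<^sup>2" using \<delta> by simp
  ultimately show False using jet(2) \<delta>(1) by (simp add: algebra_simps)
qed

text \<open>
  The functions that can be prescribed at time \<open>- 1\<close>. They form an algebra, by the addition formulas for the
  cosine.
\<close>

definition trig_slice :: "(real^'n \<Rightarrow> real) \<Rightarrow> bool" where
  "trig_slice f \<longleftrightarrow> (\<exists>l. \<forall>w. f w = trig l (w, -1))"

lemma trig_append: "trig (l @ m) z = trig l z + trig m z"
  by (simp add: trig_def)

lemma trig_Nil [simp]: "trig [] z = 0"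
  by (simp add: trig_def)

lemma trig_Cons: "trig ((a, k, \<phi>) # l) z = a * (exp (- (k \<bullet> k) * (snd z + 1)) * cos (k \<bullet> fst z + \<phi>)) + trig l z"
  by (simp add: trig_def)

lemma trig_slice_add: "trig_slice f \<Longrightarrow> trig_slice g \<Longrightarrow> trig_slice (\<lambda>w. f w + g w)"
  unfolding trig_slice_def by (metis trig_append)

lemma trig_slice_cos: "trig_slice (\<lambda>w. a * cos (k \<bullet> w + \<phi>))"
  unfolding trig_slice_def by (rule exI[of _ "[(a, k, \<phi>)]"]) (simp add: trig_Cons)

lemma trig_slice_const: "trig_slice (\<lambda>w. a)"
  using trig_slice_cos[of a 0 0] by simp

lemma trig_slice_sum: "finite I \<Longrightarrow> (\<And>i. i \<in> I \<Longrightarrow> trig_slice (f i)) \<Longrightarrow> trig_slice (\<lambda>w. \<Sum>i\<in>I. f i w)"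
  by (induction I rule: finite_induct) (auto intro: trig_slice_const trig_slice_add)

lemma trig_slice_cos_mult:
  "trig_slice (\<lambda>w. (a * cos (k \<bullet> w + \<phi>)) * trig l (w, -1))"
proof (induction l)
  case Nil
  then show ?case by (simp add: trig_slice_const)
next
  case (Cons p l)
  obtain b j \<psi> where p: "p = (b, j, \<psi>)" by (cases p)
  have "(a * cos (k \<bullet> w + \<phi>)) * trig (p # l) (w, -1)
     = (a * b / 2) * cos ((k - j) \<bullet> w + (\<phi> - \<psi>)) + (a * b / 2) * cos ((k + j) \<bullet> w + (\<phi> + \<psi>))
       + (a * cos (k \<bullet> w + \<phi>)) * trig l (w, -1)" for w
  proof -
    have "cos (k \<bullet> w + \<phi>) * cos (j \<bullet> w + \<psi>)
       = (cos ((k \<bullet> w + \<phi>) - (j \<bullet> w + \<psi>)) + cos ((k \<bullet> w + \<phi>) + (j \<bullet> w + \<psi>))) / 2"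
      by (rule cos_times_cos)
    moreover have "(k \<bullet> w + \<phi>) - (j \<bullet> w + \<psi>) = (k - j) \<bullet> w + (\<phi> - \<psi>)"
        "(k \<bullet> w + \<phi>) + (j \<bullet> w + \<psi>) = (k + j) \<bullet> w + (\<phi> + \<psi>)"
      by (auto simp: inner_diff_left inner_add_left)
    ultimately have e: "cos (k \<bullet> w + \<phi>) * cos (j \<bullet> w + \<psi>)
       = (cos ((k - j) \<bullet> w + (\<phi> - \<psi>)) + cos ((k + j) \<bullet> w + (\<phi> + \<psi>))) / 2" by simp
    have "(a * cos (k \<bullet> w + \<phi>)) * (b * cos (j \<bullet> w + \<psi>))
        = a * b * (cos (k \<bullet> w + \<phi>) * cos (j \<bullet> w + \<psi>))" by simp
    then show ?thesis unfolding e p trig_Cons by (simp add: distrib_left)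
  qed
  then show ?case by (simp only:) (intro trig_slice_add trig_slice_cos Cons.IH)
qed

lemma trig_slice_mult:
  assumes "trig_slice f" "trig_slice g"
  shows "trig_slice (\<lambda>w. f w * g w)"
proof -
  obtain l m where f: "\<And>w. f w = trig l (w, -1)" and g: "\<And>w. g w = trig m (w, -1)"
    using assms unfolding trig_slice_def by auto
  have "trig_slice (\<lambda>w. trig l (w, -1) * trig m (w, -1))"
  proof (induction l)
    case Nil
    then show ?case by (simp add: trig_slice_const)
  next
    case (Cons p l)
    obtain a k \<phi> where p: "p = (a, k, \<phi>)" by (cases p)
    have "trig (p # l) (w, -1) * trig m (w, -1)
       = (a * cos (k \<bullet> w + \<phi>)) * trig m (w, -1) + trig l (w, -1) * trig m (w, -1)" for w
      unfolding p trig_Cons by (simp add: distrib_right)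
    then show ?case by (simp only:) (intro trig_slice_add trig_slice_cos_mult Cons.IH)
  qed
  then show ?thesis using f g by simp
qed

lemma trig_slice_polynomial:
  fixes g :: "real^'n \<Rightarrow> real"
  assumes "real_polynomial_function g"
  shows "trig_slice (\<lambda>w. g (\<chi> i. sin (k * w $ i)))"
  using assms
proof (induction rule: real_polynomial_function.induct)
  case (linear f)
  then interpret bounded_linear f .
  have "f (\<chi> i. sin (k * w $ i)) = (\<Sum>i\<in>UNIV. f (axis i 1) * cos ((k *\<^sub>R axis i 1) \<bullet> w + - (pi / 2)))" for w
  proof -
    have e: "cos ((k *\<^sub>R axis i 1) \<bullet> w + - (pi / 2)) = sin (k * w $ i)" for i
      by (simp add: inner_axis' cos_sin_eq[symmetric] cos_diff)
    have "(\<chi> i. sin (k * w $ i)) = (\<Sum>i\<in>UNIV. sin (k * w $ i) *\<^sub>R axis i 1)"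
      using basis_expansion[of "\<chi> i. sin (k * w $ i)"] by (simp add: scalar_mult_eq_scaleR)
    then have "f (\<chi> i. sin (k * w $ i)) = f (\<Sum>i\<in>UNIV. sin (k * w $ i) *\<^sub>R axis i 1)" by simp
    also have "\<dots> = (\<Sum>i\<in>UNIV. f (axis i 1) * sin (k * w $ i))"
      by (simp add: sum scaleR mult.commute)
    finally show ?thesis unfolding e .
  qed
  then show ?case by (simp only:) (intro trig_slice_sum trig_slice_cos finite)
qed (auto intro: trig_slice_const trig_slice_add trig_slice_mult)

text \<open>
  Solving the heat equation for arbitrary continuous data without a heat kernel: the Stone--Weierstrass theorem in
  the variables \<open>sin (w $ i / L)\<close> approximates \<open>b\<close> by a trigonometric polynomial, which is extended explicitly. Composing \<open>b\<close>
  with the projection to the ball keeps the approximation bounded by \<open>S + e\<close> everywhere, hence also at later times.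
\<close>

lemma caloric_approximation:
  fixes b :: "real^'n \<Rightarrow> real"
  assumes L: "0 < L" and b: "continuous_on (cball 0 L) b" and S: "\<And>w. norm w \<le> L \<Longrightarrow> \<bar>b w\<bar> \<le> S"
    and e: "0 < e"
  obtains v R where "\<And>M. caloric M R v" "\<And>w. norm w \<le> L \<Longrightarrow> \<bar>v (w, -1) - b w\<bar> \<le> e"
    "\<And>w s. -1 \<le> s \<Longrightarrow> s \<le> 1 \<Longrightarrow> \<bar>v (w, s)\<bar> \<le> S + e"
proof -
  define P :: "real^'n \<Rightarrow> real^'n" where "P = closest_point (cball 0 L)"
  have P: "continuous_on UNIV P" "\<And>x. P x \<in> cball 0 L" "\<And>x. x \<in> cball 0 L \<Longrightarrow> P x = x"
  proof -
    have ne: "cball 0 L \<noteq> ({} :: (real^'n) set)" using L by auto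
    show "continuous_on UNIV P"
      unfolding P_def by (rule continuous_on_closest_point[OF convex_cball closed_cball ne])
    show "P x \<in> cball 0 L" for x
      unfolding P_def by (rule closest_point_in_set[OF closed_cball ne])
    show "P x = x" if "x \<in> cball 0 L" for x
      unfolding P_def by (rule closest_point_self[OF that])
  qed
  define Q where "Q = (cbox (\<chi> i. -1) (\<chi> i. 1) :: (real^'n) set)"
  have Q: "compact Q" "\<And>y. y \<in> Q \<longleftrightarrow> (\<forall>i. -1 \<le> y $ i \<and> y $ i \<le> 1)"
    unfolding Q_def by (auto simp: mem_box_cart)
  define A :: "real^'n \<Rightarrow> real^'n" where "A y = (\<chi> i. L * arcsin (y $ i))" for y
  have "continuous_on Q A"
    unfolding A_def
    by (intro continuous_on_vec_lambda continuous_on_mult_left continuous_on_compose2[OF continuous_on_arcsin'] continuous_intros)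
       (auto simp: Q(2))
  have "continuous_on Q (\<lambda>y. b (P (A y)))"
  proof (rule continuous_on_compose2[OF b])
    show "continuous_on Q (\<lambda>y. P (A y))"
      by (rule continuous_on_compose2[OF P(1) \<open>continuous_on Q A\<close>]) auto
  qed (use P(2) in auto)
  then obtain g where g: "real_polynomial_function g" "\<And>y. y \<in> Q \<Longrightarrow> \<bar>b (P (A y)) - g y\<bar> < e"
    using Stone_Weierstrass_real_polynomial_function[OF Q(1) _ e] by blast
  define \<sigma> :: "real^'n \<Rightarrow> real^'n" where "\<sigma> w = (\<chi> i. sin ((1 / L) * w $ i))" for w
  have \<sigma>: "\<sigma> w \<in> Q" for w unfolding Q(2) \<sigma>_def by simp
  obtain l where l: "\<And>w. g (\<sigma> w) = trig l (w, -1)"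
    using trig_slice_polynomial[OF g(1), of "1 / L"] unfolding trig_slice_def \<sigma>_def by blast
  have bd: "\<bar>trig l (w, -1)\<bar> \<le> S + e" for w
  proof -
    have "\<bar>b (P (A (\<sigma> w)))\<bar> \<le> S" using S P(2) by auto
    then show ?thesis using g(2)[OF \<sigma>[of w]] l[of w] by linarith
  qed
  have A\<sigma>: "A (\<sigma> w) = w" if "norm w \<le> L" for w
  proof -
    have "arcsin (sin ((1 / L) * w $ i)) = (1 / L) * w $ i" for i
    proof -
      have "\<bar>w $ i\<bar> \<le> L" using component_le_norm_cart[of w i] that by simp
      then have "\<bar>(1 / L) * w $ i\<bar> \<le> 1" using L by (simp add: abs_mult divide_simps)
      then have "- (pi / 2) \<le> (1 / L) * w $ i" "(1 / L) * w $ i \<le> pi / 2" using pi_gt3 by linarith+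
      then show ?thesis by (rule arcsin_sin)
    qed
    then show ?thesis unfolding A_def \<sigma>_def using L by (simp add: vec_eq_iff)
  qed
  obtain R where R: "\<And>M. caloric M R (trig l)" using caloric_trig[of l] by blast
  define l' where "l' = map (\<lambda>(a, k, \<phi>). (- a, k, \<phi>)) l"
  have l': "trig l' z = - trig l z" for z
  proof -
    have "trig (map (\<lambda>(a, k, \<phi>). (- a, k, \<phi>)) l) z = - trig l z"
      by (induction l) (auto simp: trig_Cons)
    then show ?thesis unfolding l'_def .
  qed
  show thesis
  proof (rule that[OF R])
    fix w :: "real^'n" assume w: "norm w \<le> L"
    then show "\<bar>trig l (w, -1) - b w\<bar> \<le> e"
      using g(2)[OF \<sigma>[of w]] l[of w] A\<sigma>[OF w] P(3)[of w] by (simp add: abs_minus_commute)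
  next
    fix w s assume s: "-1 \<le> (s::real)" "s \<le> 1"
    have "trig l (w, s) \<le> S + e"
      by (rule trig_le[OF _ s]) (use bd in \<open>auto simp: abs_le_iff\<close>)
    moreover have "trig l' (w, s) \<le> S + e"
    proof (rule trig_le[OF _ s])
      show "trig l' (x, -1) \<le> S + e" for x using bd[of x] unfolding l' by linarith
    qed
    ultimately show "\<bar>trig l (w, s)\<bar> \<le> S + e" unfolding l' by linarith
  qed
qed

lemma has_jet_quadratic:
  fixes H :: "real^'n^'n"
  assumes "transpose H = H"
  shows "has_jet (\<lambda>z. fst z \<bullet> (H *v fst z) / 2) z 0 (H *v fst z) H"
proof -
  have "(fst z + w) \<bullet> (H *v (fst z + w)) / 2 - fst z \<bullet> (H *v fst z) / 2 - jet_poly 0 (H *v fst z) H w s = 0" for w s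
    unfolding jet_poly_def
    using symmetric_inner[OF assms, of "fst z" w]
    by (simp add: matrix_vector_right_distrib inner_add_left inner_add_right add_divide_distrib inner_commute)
  then show ?thesis unfolding has_jet_def by simp
qed

lemma caloric_quadratic:
  fixes H :: "real^'n^'n"
  assumes "transpose H = H"
  shows "\<exists>R. caloric L R (\<lambda>z. fst z \<bullet> (H *v fst z) / 2 + trace H * (snd z + 1))"
proof (intro exI[of _ "norm H * L + norm H"], unfold caloric_def, intro allI impI)
  fix z :: "(real^'n) \<times> real" assume z: "norm (fst z) \<le> L \<and> -1 \<le> snd z \<and> snd z \<le> 2"
  then have L: "0 \<le> L" using norm_ge_zero[of "fst z"] by linarith
  have "has_jet (\<lambda>z. fst z \<bullet> (H *v fst z) / 2 + trace H * (snd z + 1)) z (trace H) (H *v fst z) H"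
    using has_jet_add[OF has_jet_quadratic[OF assms, of z] has_jet_cmult[OF has_jet_add_const[OF has_jet_time, where k = 1], of "trace H"]]
    by simp
  moreover have "norm (H *v fst z) \<le> norm H * L"
    using norm_matrix_vector_le[of H "fst z"] z mult_left_mono[of "norm (fst z)" L "norm H"] by simp
  moreover have "0 \<le> norm H * L" using L by simp
  ultimately show "\<exists>c \<xi> X. has_jet (\<lambda>z. fst z \<bullet> (H *v fst z) / 2 + trace H * (snd z + 1)) z c \<xi> X \<and>
      transpose X = X \<and> c = trace X \<and> norm \<xi> \<le> norm H * L + norm H \<and> norm X \<le> norm H * L + norm H"
    using assms norm_ge_zero[of H] by (intro exI conjI) (assumption | linarith | simp)+
qed

text \<open>
  The caloric polynomial with initial values \<open>|w|\<^sup>4\<close>. It dominates functions of quadratic growth on large spheres and, when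
  divided by \<open>L\<^sup>2\<close>, is negligible at the origin.
\<close>

definition quartic_barrier :: "(real^'n) \<times> real \<Rightarrow> real" where
  "quartic_barrier z = (fst z \<bullet> fst z)\<^sup>2 + (4 * (real CARD('n) + 2)) * ((fst z \<bullet> fst z) * (snd z + 1))
     + (4 * real CARD('n) * (real CARD('n) + 2)) * (snd z + 1)\<^sup>2"

lemma caloric_quartic_barrier: "\<exists>R. caloric L R (quartic_barrier :: (real^'n) \<times> real \<Rightarrow> real)"
proof -
  define N where "N = real CARD('n)"
  define I where "I = norm (mat 1 :: real^'n^'n)"
  define R where "R = 4 * L\<^sup>2 * L + 24 * (N + 2) * L + (4 * L\<^sup>2 * I + 8 * L\<^sup>2 + 24 * (N + 2) * I)"
  show ?thesis
  proof (intro exI[of _ R], unfold caloric_def, intro allI impI)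
    fix z :: "(real^'n) \<times> real" assume z: "norm (fst z) \<le> L \<and> -1 \<le> snd z \<and> snd z \<le> 2"
    then have L: "0 \<le> L" using norm_ge_zero[of "fst z"] by linarith
    have N: "0 \<le> N" "0 \<le> I" unfolding N_def I_def by auto
    define q where "q = fst z \<bullet> fst z"
    define \<tau> where "\<tau> = snd z + 1"
    have \<tau>: "0 \<le> \<tau>" "\<tau> \<le> 3" unfolding \<tau>_def using z by auto
    have q: "0 \<le> q" "q \<le> L\<^sup>2" unfolding q_def using z power_mono[of "norm (fst z)" L 2]
      by (auto simp: power2_norm_eq_inner)
    have jq: "has_jet (\<lambda>z. fst z \<bullet> fst z) z 0 (2 *\<^sub>R fst z) (2 *\<^sub>R mat 1)"
      using has_jet_dist_square[of 0 z] by simp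
    have jt: "has_jet (\<lambda>z. snd z + 1) z 1 0 0" by (rule has_jet_add_const[OF has_jet_time])
    define X where "X = (4 * q) *\<^sub>R mat 1 + 8 *\<^sub>R tensor (fst z) (fst z) + (8 * (N + 2) * \<tau>) *\<^sub>R (mat 1 :: real^'n^'n)"
    define \<xi> where "\<xi> = (4 * q) *\<^sub>R fst z + (8 * (N + 2) * \<tau>) *\<^sub>R fst z"
    have "has_jet quartic_barrier z (4 * (N + 2) * q + 8 * N * (N + 2) * \<tau>) \<xi> X"
      unfolding quartic_barrier_def[abs_def]
      by (rule has_jet_cong[OF has_jet_add[OF has_jet_add[OF has_jet_square[OF jq]
            has_jet_cmult[OF has_jet_mult[OF jq jt], of "4 * (N + 2)"]] has_jet_cmult[OF has_jet_square[OF jt], of "4 * N * (N + 2)"]]])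
         (auto simp: N_def q_def \<tau>_def \<xi>_def X_def tensor_scaleR_left tensor_scaleR_right algebra_simps)
    moreover have "trace X = 4 * (N + 2) * q + 8 * N * (N + 2) * \<tau>"
      unfolding X_def by (simp add: trace_plus trace_I trace_tensor N_def[symmetric] q_def[symmetric] algebra_simps)
    moreover have "transpose X = X"
      unfolding X_def by (simp add: transpose_plus transpose_scale transpose_tensor)
    moreover have "norm \<xi> \<le> 4 * L\<^sup>2 * L + 24 * (N + 2) * L"
    proof -
      have "norm \<xi> \<le> norm ((4 * q) *\<^sub>R fst z) + norm ((8 * (N + 2) * \<tau>) *\<^sub>R fst z)"
        unfolding \<xi>_def by (rule norm_triangle_ineq)
      also have "\<dots> = 4 * q * norm (fst z) + 8 * (N + 2) * \<tau> * norm (fst z)"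
        using q N \<tau> by simp
      also have "\<dots> \<le> 4 * L\<^sup>2 * L + 8 * (N + 2) * 3 * L"
        using q N \<tau> z L by (intro add_mono mult_mono) auto
      finally show ?thesis by simp
    qed
    moreover have "norm X \<le> 4 * L\<^sup>2 * I + 8 * L\<^sup>2 + 24 * (N + 2) * I"
    proof -
      have "norm X \<le> norm ((4 * q) *\<^sub>R mat 1 + 8 *\<^sub>R tensor (fst z) (fst z)) + norm ((8 * (N + 2) * \<tau>) *\<^sub>R (mat 1 :: real^'n^'n))"
        unfolding X_def by (rule norm_triangle_ineq)
      also have "norm ((4 * q) *\<^sub>R mat 1 + 8 *\<^sub>R tensor (fst z) (fst z))
         \<le> norm ((4 * q) *\<^sub>R (mat 1 :: real^'n^'n)) + norm (8 *\<^sub>R tensor (fst z) (fst z))"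
        by (rule norm_triangle_ineq)
      also have "norm ((4 * q) *\<^sub>R (mat 1 :: real^'n^'n)) = 4 * q * I" using q unfolding I_def by simp
      also have "norm (8 *\<^sub>R tensor (fst z) (fst z)) = 8 * q"
        unfolding q_def by (simp add: norm_tensor power2_norm_eq_inner[symmetric] power2_eq_square)
      also have "norm ((8 * (N + 2) * \<tau>) *\<^sub>R (mat 1 :: real^'n^'n)) = 8 * (N + 2) * \<tau> * I"
        using N \<tau> unfolding I_def by simp
      also have "4 * q * I + 8 * q + 8 * (N + 2) * \<tau> * I \<le> 4 * L\<^sup>2 * I + 8 * L\<^sup>2 + 8 * (N + 2) * 3 * I"
        using q N \<tau> by (intro add_mono mult_mono) auto
      finally show ?thesis by simp
    qed
    moreover have "0 \<le> 4 * L\<^sup>2 * L + 24 * (N + 2) * L" "0 \<le> 4 * L\<^sup>2 * I + 8 * L\<^sup>2 + 24 * (N + 2) * I"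
      using L N by auto
    ultimately show "\<exists>c \<xi> X. has_jet quartic_barrier z c \<xi> X \<and> transpose X = X \<and> c = trace X \<and>
        norm \<xi> \<le> R \<and> norm X \<le> R"
      unfolding R_def by (intro exI[of _ "trace X"] exI[of _ \<xi>] exI[of _ X] conjI) (auto intro: order_trans)
  qed
qed

lemma quartic_barrier_ge:
  assumes "-1 \<le> snd z"
  shows "norm (fst z) ^ 4 \<le> quartic_barrier z" "0 \<le> quartic_barrier z"
proof -
  have "norm (fst z) ^ 4 = (fst z \<bullet> fst z)\<^sup>2"
    by (simp add: power2_norm_eq_inner[symmetric] power4_eq_xxxx power2_eq_square)
  then show "norm (fst z) ^ 4 \<le> quartic_barrier z" "0 \<le> quartic_barrier z"
    unfolding quartic_barrier_def using assms by (auto intro!: add_nonneg_nonneg)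
qed

section \<open>Semiconvex functions and their blow-up\<close>

text \<open>
  Support by a paraboloid from below at every point. In finite dimension this is convexity of \<open>v + K * |z|\<^sup>2\<close>; the
  present form hands over the subgradient \<open>l\<close> directly.
\<close>

definition semiconvex :: "real \<Rightarrow> ('a::real_inner \<Rightarrow> real) \<Rightarrow> bool" where
  "semiconvex K v \<longleftrightarrow> (\<forall>z0. \<exists>l. \<forall>z. v z0 + l \<bullet> (z - z0) - K * (norm (z - z0))\<^sup>2 \<le> v z)"

lemma norm_sgn_diff_le:
  fixes x y :: "'a::real_normed_vector"
  assumes "y \<noteq> 0"
  shows "norm (sgn x - sgn y) \<le> 2 * norm (x - y) / norm y"
proof -
  have y: "0 < norm y" using assms by simp
  have "norm v *\<^sub>R sgn v = v" for v :: 'a by (cases "v = 0") (auto simp: sgn_div_norm)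
  then have "norm y *\<^sub>R (sgn x - sgn y) = (x - y) + (norm y - norm x) *\<^sub>R sgn x"
    by (simp add: scaleR_diff_right scaleR_diff_left)
  then have "norm y * norm (sgn x - sgn y) = norm ((x - y) + (norm y - norm x) *\<^sub>R sgn x)"
    using y by (metis abs_of_pos norm_scaleR)
  also have "\<dots> \<le> norm (x - y) + \<bar>norm y - norm x\<bar> * norm (sgn x)"
    by (metis norm_scaleR norm_triangle_ineq)
  also have "\<dots> \<le> norm (x - y) + norm (x - y) * 1"
    using norm_triangle_ineq3[of y x] by (intro add_mono mult_mono) (auto simp: norm_minus_commute norm_sgn)
  finally show ?thesis using y by (simp add: field_simps)
qed

lemma Lop_sgn: "Lop a \<xi> X = a * trace X + (1 - 2 * a) * (sgn \<xi> \<bullet> (X *v sgn \<xi>))"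
  unfolding Lop_def sgn_div_norm
  by (simp add: matrix_vector_mult_scaleR power2_eq_square divide_inverse)

text \<open>
  The operator is Lipschitz in the direction of the gradient, which costs a factor \<open>1 / norm g\<close>. Hence coefficients may be
  frozen at a point with nonzero gradient.
\<close>

lemma Lop_gradient_diff:
  assumes a: "0 \<le> a" "a < 1" and g: "g \<noteq> 0"
  shows "\<bar>Lop a \<eta> Y - Lop a g Y\<bar> \<le> 4 * norm Y * norm (\<eta> - g) / norm g"
proof -
  define n m where "n = sgn \<eta>" and "m = sgn g"
  have nm: "norm n \<le> 1" "norm m \<le> 1" unfolding n_def m_def by (auto simp: norm_sgn)
  have d: "norm (n - m) \<le> 2 * norm (\<eta> - g) / norm g"
    unfolding n_def m_def by (rule norm_sgn_diff_le[OF g])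
  have "n \<bullet> (Y *v n) - m \<bullet> (Y *v m) = (n - m) \<bullet> (Y *v n) + m \<bullet> (Y *v (n - m))"
    by (simp add: inner_diff_left matrix_vector_mult_diff_distrib inner_diff_right)
  also have "\<bar>\<dots>\<bar> \<le> norm Y * norm (n - m) * norm n + norm Y * norm m * norm (n - m)"
    by (intro order_trans[OF abs_triangle_ineq] add_mono abs_quadratic_form_le)
  also have "\<dots> \<le> norm Y * norm (n - m) * 1 + norm Y * 1 * norm (n - m)"
    using nm by (intro add_mono mult_mono mult_nonneg_nonneg) auto
  also have "\<dots> = 2 * norm Y * norm (n - m)" by simp
  also have "\<dots> \<le> 2 * norm Y * (2 * norm (\<eta> - g) / norm g)"
    by (intro mult_left_mono d) auto
  finally have "\<bar>n \<bullet> (Y *v n) - m \<bullet> (Y *v m)\<bar> \<le> 4 * norm Y * norm (\<eta> - g) / norm g" by simp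
  then have "\<bar>1 - 2 * a\<bar> * \<bar>n \<bullet> (Y *v n) - m \<bullet> (Y *v m)\<bar> \<le> 1 * (4 * norm Y * norm (\<eta> - g) / norm g)"
    using a by (intro mult_mono) auto
  moreover have "Lop a \<eta> Y - Lop a g Y = (1 - 2 * a) * (n \<bullet> (Y *v n) - m \<bullet> (Y *v m))"
    unfolding Lop_sgn n_def m_def by (simp add: algebra_simps)
  ultimately show ?thesis by (simp add: abs_mult)
qed

lemma semiconvex_hessian_ge:
  fixes v :: "(real^'n) \<times> real \<Rightarrow> real"
  assumes v: "semiconvex K v" and t: "touch_above v z c \<xi> X"
  shows "- (2 * K) * (norm w)\<^sup>2 \<le> w \<bullet> (X *v w)"
proof (rule ccontr)
  assume "\<not> ?thesis"
  then have neg: "w \<bullet> (X *v w) + 2 * K * (norm w)\<^sup>2 < 0" by simp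
  then have w: "w \<noteq> 0" by auto
  define \<theta> where "\<theta> = - (w \<bullet> (X *v w) + 2 * K * (norm w)\<^sup>2) / (4 * (norm w)\<^sup>2)"
  have \<theta>: "0 < \<theta>" unfolding \<theta>_def using neg w by simp
  obtain r C where r: "0 < r" and C: "\<And>w s. norm w < r \<Longrightarrow> \<bar>s\<bar> < r \<Longrightarrow>
     v (fst z + w, snd z + s) \<le> v z + jet_poly c \<xi> X w s + \<theta> * (norm w)\<^sup>2 + C * s\<^sup>2"
    using t \<theta> unfolding touch_above_def by meson
  obtain l where l: "\<And>z'. v z + l \<bullet> (z' - z) - K * (norm (z' - z))\<^sup>2 \<le> v z'"
    using v unfolding semiconvex_def by blast
  define h where "h = r / (2 * norm w)"
  have h: "0 < h" "norm (h *\<^sub>R w) < r" "norm (- (h *\<^sub>R w)) < r" unfolding h_def using r w by auto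
  have e: "(fst z + y, snd z + 0) - z = (y, 0)" for y by (simp add: prod_eq_iff)
  have n: "(norm (y :: real^'n, 0 :: real))\<^sup>2 = (norm y)\<^sup>2" for y by (simp add: norm_Pair)
  have 1: "v z + l \<bullet> (y, 0) - K * (norm y)\<^sup>2 \<le> v z + \<xi> \<bullet> y + y \<bullet> (X *v y) / 2 + \<theta> * (norm y)\<^sup>2"
    if "norm y < r" for y
    using C[OF that, of 0] l[of "(fst z + y, snd z + 0)"] r
    unfolding e n jet_poly_def by simp
  have "- 2 * K * (norm (h *\<^sub>R w))\<^sup>2 \<le> (h *\<^sub>R w) \<bullet> (X *v (h *\<^sub>R w)) + 2 * \<theta> * (norm (h *\<^sub>R w))\<^sup>2"
  proof -
    have "l \<bullet> (- y, 0) = - (l \<bullet> (y, 0))" for y by (simp add: inner_prod_def)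
    then show ?thesis using 1[OF h(2)] 1[OF h(3)] by (simp add: vec.neg)
  qed
  then have "h\<^sup>2 * (- 2 * K * (norm w)\<^sup>2) \<le> h\<^sup>2 * (w \<bullet> (X *v w) + 2 * \<theta> * (norm w)\<^sup>2)"
    by (simp add: matrix_vector_mult_scaleR power_mult_distrib power2_eq_square algebra_simps)
  then have "- 2 * K * (norm w)\<^sup>2 \<le> w \<bullet> (X *v w) + 2 * \<theta> * (norm w)\<^sup>2"
    by (rule mult_left_le_imp_le) (use h in simp)
  moreover have "2 * \<theta> * (norm w)\<^sup>2 = - (w \<bullet> (X *v w) + 2 * K * (norm w)\<^sup>2) / 2"
    unfolding \<theta>_def using w by simp
  moreover have False if "- 2 * k * n \<le> q + 2 * t * n" "2 * t * n = - (q + 2 * k * n) / 2" "q + 2 * k * n < 0" for k n q t :: real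
    using that by argo
  ultimately show False using neg by blast
qed

text \<open>
  The bound from below on Hessians is what makes the regularising term \<open>\<epsilon> * trace\<close> harmless: it may be added to the
  operator at the cost of \<open>\<epsilon> * (2 * K * N)\<close>.
\<close>

lemma semiconvex_trace_ge:
  fixes v :: "(real^'n) \<times> real \<Rightarrow> real"
  assumes "semiconvex K v" "touch_above v z c \<xi> X"
  shows "- (2 * K * real CARD('n)) \<le> trace X"
proof -
  have "- (2 * K) \<le> X $ i $ i" for i
    using semiconvex_hessian_ge[OF assms, of "axis i 1"]
    by (simp add: inner_axis' matrix_vector_mul_component inner_axis norm_axis_1)
  then have "(\<Sum>i\<in>(UNIV::'n set). - (2 * K)) \<le> trace X" unfolding trace_def by (intro sum_mono) auto
  then show ?thesis by (simp add: ac_simps)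
qed

lemma touch_above_affine:
  fixes P :: "real^'n^'n" and B v :: "(real^'n) \<times> real \<Rightarrow> real"
  assumes v: "\<And>x t. v (x, t) = Ca + g \<bullet> x + c1 * t + h * B (ow + P *v x, m + q * t)" and h: "0 < h"
    and B: "touch_above B (ow + P *v x0, m + q * t0) c \<xi> X"
  shows "touch_above v (x0, t0) (c1 + h * (q * c)) (g + h *\<^sub>R (transpose P *v \<xi>)) (h *\<^sub>R (transpose P ** X ** P))"
  unfolding touch_above_def
proof (intro allI impI)
  fix \<theta> :: real assume \<theta>: "0 < \<theta>"
  define N where "N = norm P + \<bar>q\<bar> + 1"
  have N: "0 < N" "norm P \<le> N" "\<bar>q\<bar> \<le> N" unfolding N_def by (auto simp: add_nonneg_pos)
  have "0 < \<theta> / (h * N\<^sup>2)" using \<theta> N h by simp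
  then obtain r C where r: "0 < r" and C: "\<And>w s. norm w < r \<Longrightarrow> \<bar>s\<bar> < r \<Longrightarrow>
     B (ow + P *v x0 + w, m + q * t0 + s) \<le> B (ow + P *v x0, m + q * t0) + jet_poly c \<xi> X w s
        + \<theta> / (h * N\<^sup>2) * (norm w)\<^sup>2 + C * s\<^sup>2"
    using B unfolding touch_above_def fst_conv snd_conv by meson
  show "\<exists>r>0. \<exists>C. \<forall>w s. norm w < r \<longrightarrow> \<bar>s\<bar> < r \<longrightarrow>
      v (fst (x0, t0) + w, snd (x0, t0) + s) \<le> v (x0, t0) + jet_poly (c1 + h * (q * c))
        (g + h *\<^sub>R (transpose P *v \<xi>)) (h *\<^sub>R (transpose P ** X ** P)) w s + \<theta> * (norm w)\<^sup>2 + C * s\<^sup>2"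
  proof (rule local_bound_exI[of "r / N" _ "h * C * q\<^sup>2"])
    fix w :: "real^'n" and s :: real assume ws: "norm w < r / N" "\<bar>s\<bar> < r / N"
    have Pw: "norm (P *v w) \<le> N * norm w"
      using norm_matrix_vector_le[of P w] mult_right_mono[OF N(2), of "norm w"] by simp
    then have 1: "norm (P *v w) < r" using ws(1) N by (simp add: field_simps)
    have "\<bar>q * s\<bar> \<le> N * \<bar>s\<bar>" unfolding abs_mult using N by (intro mult_right_mono) auto
    then have 2: "\<bar>q * s\<bar> < r" using ws(2) N by (simp add: field_simps)
    have "\<theta> / (h * N\<^sup>2) * (norm (P *v w))\<^sup>2 \<le> \<theta> / (h * N\<^sup>2) * (N * norm w)\<^sup>2"
      using Pw \<theta> h by (intro mult_left_mono power_mono) auto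
    also have "\<dots> = \<theta> * (norm w)\<^sup>2 / h" using N h by (simp add: power_mult_distrib)
    finally have 3: "\<theta> / (h * N\<^sup>2) * (norm (P *v w))\<^sup>2 \<le> \<theta> * (norm w)\<^sup>2 / h" .
    have 4: "B (ow + P *v (x0 + w), m + q * (t0 + s)) \<le> B (ow + P *v x0, m + q * t0)
       + jet_poly c \<xi> X (P *v w) (q * s) + \<theta> * (norm w)\<^sup>2 / h + C * (q * s)\<^sup>2"
      using C[OF 1 2] 3 by (simp add: matrix_vector_right_distrib distrib_left add.assoc)
    have 5: "h * jet_poly c \<xi> X (P *v w) (q * s) + g \<bullet> w + c1 * s = jet_poly (c1 + h * (q * c))
        (g + h *\<^sub>R (transpose P *v \<xi>)) (h *\<^sub>R (transpose P ** X ** P)) w s"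
    proof -
      have a: "(transpose P *v \<xi>) \<bullet> w = \<xi> \<bullet> (P *v w)" by (simp add: dot_lmul_matrix)
      have b: "w \<bullet> ((transpose P ** X ** P) *v w) = (P *v w) \<bullet> (X *v (P *v w))"
      proof -
        have "(transpose P ** X ** P) *v w = transpose P *v (X *v (P *v w))"
          by (simp only: matrix_vector_mul_assoc[symmetric])
        then show ?thesis by (metis dot_lmul_matrix inner_commute transpose_matrix_vector)
      qed
      show ?thesis
        unfolding jet_poly_def inner_add_left scaleR_matrix_vector_assoc[symmetric] inner_scaleR_left inner_scaleR_right a b
        by (simp add: algebra_simps)
    qed
    have "v (x0 + w, t0 + s) = Ca + g \<bullet> x0 + g \<bullet> w + c1 * t0 + c1 * s + h * B (ow + P *v (x0 + w), m + q * (t0 + s))"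
      unfolding v by (simp add: inner_add_right distrib_left)
    also have "\<dots> \<le> Ca + g \<bullet> x0 + g \<bullet> w + c1 * t0 + c1 * s + h * (B (ow + P *v x0, m + q * t0)
       + jet_poly c \<xi> X (P *v w) (q * s) + \<theta> * (norm w)\<^sup>2 / h + C * (q * s)\<^sup>2)"
      using mult_left_mono[OF 4, of h] h by simp
    also have "\<dots> = v (x0, t0) + (h * jet_poly c \<xi> X (P *v w) (q * s) + g \<bullet> w + c1 * s) + \<theta> * (norm w)\<^sup>2 + h * C * q\<^sup>2 * s\<^sup>2"
      unfolding v using h by (simp add: field_simps)
    finally show "v (fst (x0, t0) + w, snd (x0, t0) + s) \<le> v (x0, t0) + jet_poly (c1 + h * (q * c))
        (g + h *\<^sub>R (transpose P *v \<xi>)) (h *\<^sub>R (transpose P ** X ** P)) w s + \<theta> * (norm w)\<^sup>2 + h * C * q\<^sup>2 * s\<^sup>2"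
      unfolding 5 by simp
  qed (use r N in auto)
qed

lemma norm_transpose: "norm (transpose B) = norm (B :: real^'n^'m)"
proof -
  have "(norm (transpose B))\<^sup>2 = (\<Sum>i\<in>UNIV. \<Sum>j\<in>UNIV. B $ j $ i * B $ j $ i)"
    unfolding power2_norm_eq_inner inner_vec_def by (simp add: transpose_def)
  also have "\<dots> = (\<Sum>j\<in>UNIV. \<Sum>i\<in>UNIV. B $ j $ i * B $ j $ i)" by (rule sum.swap)
  also have "\<dots> = (norm B)\<^sup>2" unfolding power2_norm_eq_inner inner_vec_def by simp
  finally show ?thesis by simp
qed

lemma norm_matrix_mult_le:
  fixes A :: "real^'n^'m" and B :: "real^'k^'n"
  shows "norm (A ** B) \<le> norm A * norm B"
proof -
  have row: "(A ** B) $ i = transpose B *v (A $ i)" for i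
    by (simp add: vec_eq_iff matrix_matrix_mult_def matrix_vector_mult_def transpose_def mult.commute)
  have "norm (A ** B) = L2_set (\<lambda>i. norm (transpose B *v (A $ i))) UNIV"
    by (simp only: norm_vec_def[of "A ** B"] row)
  also have "\<dots> \<le> L2_set (\<lambda>i. norm B * norm (A $ i)) UNIV"
    by (intro L2_set_mono) (metis norm_matrix_vector_le norm_transpose, simp)
  also have "\<dots> = norm B * norm A"
    unfolding norm_vec_def[of A] by (rule L2_set_right_distrib[symmetric]) simp
  finally show ?thesis by (simp add: mult.commute)
qed

lemma jsub_frozen:
  fixes X :: "real^'n^'n"
  assumes a: "0 \<le> a" "a < 1" and g: "g \<noteq> 0" and v: "jsub a v z" and t: "touch_above v z c \<xi> X" "transpose X = X"
  shows "c \<le> Lop a g X + 4 * norm X * norm (\<xi> - g) / norm g"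
proof (rule field_le_epsilon)
  fix e :: real assume e: "0 < e"
  define N where "N = real CARD('n) + 1"
  define A where "A = 4 * (norm X + norm (\<xi> - g) + 1) / norm g + N + 1"
  have N: "0 < N" unfolding N_def by (simp add: add_nonneg_pos)
  have ng: "0 < norm g" using g by simp
  have A: "0 < A" unfolding A_def using N ng by (simp add: add_nonneg_pos add_pos_nonneg)
  define \<delta> where "\<delta> = min 1 (e / A)"
  have \<delta>: "0 < \<delta>" "\<delta> \<le> 1" "\<delta> * A \<le> e" unfolding \<delta>_def using e A by (auto simp: min_def field_simps)
  show "c \<le> Lop a g X + 4 * norm X * norm (\<xi> - g) / norm g + e"
  proof (rule v[unfolded jsub_def, rule_format, OF t(2) t(1)], intro exI[of _ \<delta>] conjI allI impI)
    fix \<eta> and Y :: "real^'n^'n"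
    assume Y: "\<eta> \<noteq> 0" "transpose Y = Y" "norm (\<eta> - \<xi>) < \<delta>" "norm (Y - X) < \<delta>"
    have 1: "Lop a \<eta> Y \<le> Lop a g Y + 4 * norm Y * norm (\<eta> - g) / norm g"
      using Lop_gradient_diff[OF a g, of \<eta> Y] by simp
    have 2: "Lop a g Y \<le> Lop a g X + N * \<delta>"
    proof -
      have "Lop a g Y - Lop a g X = Lop a g (Y - X)" by (simp add: Lop_diff)
      also have "\<dots> \<le> N * norm (Y - X)" using abs_Lop_le[OF a, of g "Y - X"] unfolding N_def by simp
      also have "\<dots> \<le> N * \<delta>" using N Y(4) by (intro mult_left_mono) auto
      finally show ?thesis by simp
    qed
    have 3: "norm Y * norm (\<eta> - g) \<le> norm X * norm (\<xi> - g) + \<delta> * (norm X + norm (\<xi> - g) + 1)"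
    proof -
      have "norm Y \<le> norm X + \<delta>" using Y(4) norm_triangle_sub[of Y X] by simp
      moreover have "norm (\<eta> - g) \<le> norm (\<xi> - g) + \<delta>"
        using Y(3) norm_triangle_ineq[of "\<eta> - \<xi>" "\<xi> - g"] by simp
      ultimately have "norm Y * norm (\<eta> - g) \<le> (norm X + \<delta>) * (norm (\<xi> - g) + \<delta>)"
        using \<delta> by (intro mult_mono) auto
      also have "\<dots> = norm X * norm (\<xi> - g) + \<delta> * (norm X + norm (\<xi> - g) + \<delta>)" by (simp add: algebra_simps)
      also have "\<dots> \<le> norm X * norm (\<xi> - g) + \<delta> * (norm X + norm (\<xi> - g) + 1)"
        using \<delta> by (intro add_left_mono mult_left_mono) auto
      finally show ?thesis .
    qed
    have 4: "4 * norm Y * norm (\<eta> - g) / norm g \<le> 4 * norm X * norm (\<xi> - g) / norm g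
        + \<delta> * (4 * (norm X + norm (\<xi> - g) + 1) / norm g)"
      using 3 ng by (simp add: field_simps)
    have "\<delta> * (4 * (norm X + norm (\<xi> - g) + 1) / norm g) + N * \<delta> \<le> \<delta> * A"
      unfolding A_def using \<delta> by (simp add: algebra_simps)
    then show "Lop a \<eta> Y \<le> Lop a g X + 4 * norm X * norm (\<xi> - g) / norm g + e"
      using 1 2 4 \<delta>(3) by linarith
  qed (rule \<delta>(1))
qed

text \<open>
  The parabolic rescalings of a semiconvex function that vanishes to first order. The quadratic bound gives
  uniform bounds, semiconvexity gives a uniform Lipschitz constant on the slice at time \<open>- 1\<close>,
  and freezing the gradient at \<open>g\<close> gives the heat inequality in the coordinates \<open>T\<close>, up to errors that vanish
  as \<open>h\<close> tends to 0.
\<close>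

lemma blow_up:
  fixes b :: "(real^'n) \<times> real \<Rightarrow> real" and T U :: "real^'n^'n"
  assumes a: "0 \<le> a" "a < 1" and g: "g \<noteq> 0"
    and K: "0 \<le> K" and sc: "semiconvex K b" and C: "0 \<le> C" and r: "0 < r"
    and bC: "\<And>w s. norm w < r \<Longrightarrow> \<bar>s\<bar> < r \<Longrightarrow> \<bar>b (w, s)\<bar> \<le> C * ((norm w)\<^sup>2 + s\<^sup>2)"
    and sub: "\<And>w s c \<xi> X. norm w < r \<Longrightarrow> \<bar>s\<bar> < r \<Longrightarrow> touch_above b (w, s) c \<xi> X \<Longrightarrow> transpose X = X \<Longrightarrow>
        c + c1 \<le> Lop a g X + 4 * norm X * norm \<xi> / norm g"
    and UT: "U ** T = mat 1" and \<epsilon>: "0 \<le> \<epsilon>"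
    and tr: "\<And>X. transpose X = X \<Longrightarrow> Lop a g (transpose U ** X ** U) + \<epsilon> * trace (transpose U ** X ** U) = trace X"
    and L: "1 \<le> L"
  obtains C' h0 \<Lambda> where "0 \<le> C'" "0 < h0" "0 \<le> \<Lambda>"
    "C' = 2 * C * ((norm T)\<^sup>2 + 1)"
    "\<And>h w s. 0 < h \<Longrightarrow> h \<le> h0 \<Longrightarrow> norm w \<le> L \<Longrightarrow> \<bar>s\<bar> \<le> 1 \<Longrightarrow> \<bar>b (sqrt h *\<^sub>R (T *v w), h * s) / h\<bar> \<le> C' * L\<^sup>2"
    "\<And>h w w'. 0 < h \<Longrightarrow> h \<le> h0 \<Longrightarrow> norm w \<le> L \<Longrightarrow> norm w' \<le> L \<Longrightarrow>
       \<bar>b (sqrt h *\<^sub>R (T *v w), - h) / h - b (sqrt h *\<^sub>R (T *v w'), - h) / h\<bar> \<le> \<Lambda> * norm (w - w')"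
    "\<And>R e. 0 < e \<Longrightarrow> \<exists>h1>0. \<forall>h w s c \<xi> X. 0 < h \<longrightarrow> h \<le> h1 \<longrightarrow> norm w < L \<longrightarrow> \<bar>s\<bar> < 1 \<longrightarrow> transpose X = X \<longrightarrow>
       norm \<xi> \<le> R \<longrightarrow> norm X \<le> R \<longrightarrow> touch_above (\<lambda>z. b (sqrt h *\<^sub>R (T *v fst z), h * snd z) / h) (w, s) c \<xi> X \<longrightarrow>
       c \<le> trace X + (\<epsilon> * (2 * K * real CARD('n)) + e - c1)"
proof -
  define \<tau> where "\<tau> = norm T"
  have \<tau>: "0 \<le> \<tau>" unfolding \<tau>_def by simp
  have TU: "T ** U = mat 1" using UT matrix_left_right_inverse by blast
  define \<rho> where "\<rho> = \<tau> * L + 2"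
  have \<rho>: "2 \<le> \<rho>" unfolding \<rho>_def using \<tau> L by simp
  define h0 where "h0 = min 1 (min (r / 2) ((r / (2 * \<rho>))\<^sup>2))"
  have h0: "0 < h0" "h0 \<le> 1" "h0 < r" unfolding h0_def using r \<rho> by (auto simp: min_less_iff_disj)
  have sq: "sqrt h * \<rho> < r" if "0 < h" "h \<le> h0" for h
  proof -
    have "h \<le> (r / (2 * \<rho>))\<^sup>2" using that unfolding h0_def by simp
    then have "sqrt h \<le> r / (2 * \<rho>)" using r \<rho> by (intro real_le_lsqrt) auto
    then have "sqrt h * \<rho> \<le> r / (2 * \<rho>) * \<rho>" using \<rho> by (intro mult_right_mono) auto
    also have "\<dots> = r / 2" using \<rho> by simp
    finally show ?thesis using r by simp
  qed
  have TL: "norm (T *v w) \<le> \<tau> * L" if "norm w \<le> L" for w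
    using norm_matrix_vector_le[of T w] mult_left_mono[OF that \<tau>] unfolding \<tau>_def by simp
  have bh: "\<bar>b (sqrt h *\<^sub>R y, h * s)\<bar> \<le> C * (h * ((norm y)\<^sup>2 + 1))"
    if h: "0 < h" "h \<le> h0" and y: "norm y \<le> \<rho>" and s: "\<bar>s\<bar> \<le> 1" for h y s
  proof -
    have "norm (sqrt h *\<^sub>R y) \<le> sqrt h * \<rho>" using y h by simp
    then have n: "norm (sqrt h *\<^sub>R y) < r" using sq[OF h] by simp
    have "\<bar>h * s\<bar> \<le> h * 1" unfolding abs_mult using h s by (intro mult_mono) auto
    then have "\<bar>h * s\<bar> < r" using h h0 by simp
    from bC[OF n this] have "\<bar>b (sqrt h *\<^sub>R y, h * s)\<bar> \<le> C * (h * (norm y)\<^sup>2 + (h * s)\<^sup>2)"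
      using h by (simp add: power_mult_distrib)
    also have "\<dots> \<le> C * (h * (norm y)\<^sup>2 + h)"
    proof (intro mult_left_mono add_left_mono)
      have "(h * s)\<^sup>2 = h * (h * s\<^sup>2)" by (simp add: power2_eq_square)
      also have "\<dots> \<le> h * (1 * 1)"
        using h h0 s by (intro mult_left_mono mult_mono) (auto simp: abs_square_le_1)
      finally show "(h * s)\<^sup>2 \<le> h" by simp
    qed (use C in auto)
    finally show ?thesis by (simp add: algebra_simps)
  qed
  show thesis
  proof (rule that[of "2 * C * ((norm T)\<^sup>2 + 1)" h0 "2 * (2 * C * (\<rho>\<^sup>2 + 1) + K) * \<tau> + 2 * K * \<tau>\<^sup>2 * L"])
    show "0 \<le> 2 * C * ((norm T)\<^sup>2 + 1)" using C by simp
    show "0 < h0" by (rule h0)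
    show "0 \<le> 2 * (2 * C * (\<rho>\<^sup>2 + 1) + K) * \<tau> + 2 * K * \<tau>\<^sup>2 * L" using C K \<tau> L by simp
    show "2 * C * ((norm T)\<^sup>2 + 1) = 2 * C * ((norm T)\<^sup>2 + 1)" ..
  next
    fix h w and s :: real assume h: "0 < h" "h \<le> h0" and w: "norm (w :: real^'n) \<le> L" and s: "\<bar>s\<bar> \<le> 1"
    have "norm (T *v w) \<le> \<rho>" using TL[OF w] unfolding \<rho>_def by simp
    from bh[OF h this s] have "\<bar>b (sqrt h *\<^sub>R (T *v w), h * s)\<bar> \<le> C * (h * ((norm (T *v w))\<^sup>2 + 1))" .
    also have "\<dots> \<le> C * (h * ((\<tau> * L)\<^sup>2 + 1 * L\<^sup>2))"
    proof -
      have "(norm (T *v w))\<^sup>2 \<le> (\<tau> * L)\<^sup>2" using TL[OF w] by (intro power_mono) auto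
      moreover have "1 \<le> L\<^sup>2" using L by simp
      ultimately show ?thesis using C h by (intro mult_left_mono) auto
    qed
    also have "\<dots> = h * (C * (\<tau>\<^sup>2 + 1) * L\<^sup>2)" by (simp add: algebra_simps)
    finally have "\<bar>b (sqrt h *\<^sub>R (T *v w), h * s) / h\<bar> \<le> C * (\<tau>\<^sup>2 + 1) * L\<^sup>2"
      using h by (simp add: field_simps)
    also have "\<dots> \<le> 2 * C * (\<tau>\<^sup>2 + 1) * L\<^sup>2" using C by (intro mult_right_mono) auto
    finally show "\<bar>b (sqrt h *\<^sub>R (T *v w), h * s) / h\<bar> \<le> 2 * C * ((norm T)\<^sup>2 + 1) * L\<^sup>2"
      unfolding \<tau>_def .
  next
    fix h and w w' :: "real^'n" assume h: "0 < h" "h \<le> h0" and w: "norm (w :: real^'n) \<le> L" "norm w' \<le> L"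
    have key: "b (sqrt h *\<^sub>R (T *v w), - h) / h - b (sqrt h *\<^sub>R (T *v w'), - h) / h
       \<le> (2 * (2 * C * (\<rho>\<^sup>2 + 1) + K) * \<tau> + 2 * K * \<tau>\<^sup>2 * L) * norm (w - w')"
      if w: "norm (w :: real^'n) \<le> L" "norm w' \<le> L" for w w'
    proof -
      define y y' where "y = T *v w" and "y' = T *v w'"
      define z where "z = (sqrt h *\<^sub>R y, - h)"
      obtain l where l: "\<And>z'. b z + l \<bullet> (z' - z) - K * (norm (z' - z))\<^sup>2 \<le> b z'"
        using sc unfolding semiconvex_def by blast
      have l': "b (sqrt h *\<^sub>R y, - h) + sqrt h * (fst l \<bullet> d) - K * (h * (norm d)\<^sup>2) \<le> b (sqrt h *\<^sub>R (y + d), - h)" for d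
      proof -
        have e: "(sqrt h *\<^sub>R (y + d), - h) - z = (sqrt h *\<^sub>R d, 0)" unfolding z_def by (simp add: scaleR_add_right)
        have "l \<bullet> (sqrt h *\<^sub>R d, 0) = sqrt h * (fst l \<bullet> d)" by (simp add: inner_prod_def)
        moreover have "(norm (sqrt h *\<^sub>R d, 0::real))\<^sup>2 = h * (norm d)\<^sup>2"
          using h by (simp add: norm_Pair power_mult_distrib)
        ultimately show ?thesis using l[of "(sqrt h *\<^sub>R (y + d), - h)"] unfolding e by (simp add: z_def)
      qed
      have y: "norm y \<le> \<tau> * L" "norm y' \<le> \<tau> * L" unfolding y_def y'_def using TL w by auto
      have bb: "\<bar>b (sqrt h *\<^sub>R v, - h)\<bar> \<le> C * (h * (\<rho>\<^sup>2 + 1))" if "norm v \<le> \<rho>" for v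
      proof -
        have "(norm v)\<^sup>2 \<le> \<rho>\<^sup>2" using that by (intro power_mono) auto
        then have "C * (h * ((norm v)\<^sup>2 + 1)) \<le> C * (h * (\<rho>\<^sup>2 + 1))"
          using C h by (intro mult_left_mono) auto
        then show ?thesis using bh[OF h that, of "-1"] by simp
      qed
      have fl: "norm (fst l) \<le> sqrt h * (2 * C * (\<rho>\<^sup>2 + 1) + K)"
      proof (cases "fst l = 0")
        case True
        then show ?thesis using C K h by simp
      next
        case False
        define d where "d = sgn (fst l)"
        have nd: "norm d = 1" unfolding d_def using False by (simp add: norm_sgn)
        have ld: "fst l \<bullet> d = norm (fst l)"
          unfolding d_def sgn_div_norm using False by (simp add: power2_norm_eq_inner[symmetric] power2_eq_square)
        have "norm (y + d) \<le> \<rho>" using norm_triangle_ineq[of y d] y nd unfolding \<rho>_def by simp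
        moreover have "norm y \<le> \<rho>" using y unfolding \<rho>_def by simp
        ultimately have "sqrt h * norm (fst l) \<le> 2 * (C * (h * (\<rho>\<^sup>2 + 1))) + K * h"
          using l'[of d] bb[of "y + d"] bb[of y] nd ld by simp
        also have "\<dots> = h * (2 * C * (\<rho>\<^sup>2 + 1) + K)" by (simp add: algebra_simps)
        also have "\<dots> = sqrt h * (sqrt h * (2 * C * (\<rho>\<^sup>2 + 1) + K))"
          using h by (simp add: mult.assoc[symmetric])
        finally show ?thesis using h by simp
      qed
      have "b (sqrt h *\<^sub>R y, - h) - b (sqrt h *\<^sub>R y', - h) \<le> - (sqrt h * (fst l \<bullet> (y' - y))) + K * (h * (norm (y' - y))\<^sup>2)"
        using l'[of "y' - y"] by simp
      also have "\<dots> \<le> h * ((2 * C * (\<rho>\<^sup>2 + 1) + K) * norm (y' - y)) + h * (K * (norm (y' - y))\<^sup>2)"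
      proof (intro add_mono)
        have hh: "sqrt h * (sqrt h * x) = h * x" for x using h by (simp add: mult.assoc[symmetric])
        have "- (sqrt h * (fst l \<bullet> (y' - y))) \<le> sqrt h * (norm (fst l) * norm (y' - y))"
          using h Cauchy_Schwarz_ineq2[of "fst l" "y' - y"] mult_left_mono[of "- (fst l \<bullet> (y' - y))" "norm (fst l) * norm (y' - y)" "sqrt h"]
          by simp
        also have "\<dots> \<le> sqrt h * ((sqrt h * (2 * C * (\<rho>\<^sup>2 + 1) + K)) * norm (y' - y))"
          using fl h by (intro mult_left_mono mult_right_mono) auto
        also have "\<dots> = h * ((2 * C * (\<rho>\<^sup>2 + 1) + K) * norm (y' - y))" by (simp only: mult.assoc hh)
        finally show "- (sqrt h * (fst l \<bullet> (y' - y))) \<le> h * ((2 * C * (\<rho>\<^sup>2 + 1) + K) * norm (y' - y))" .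
      qed (simp add: ac_simps)
      finally have 1: "(b (sqrt h *\<^sub>R y, - h) - b (sqrt h *\<^sub>R y', - h)) / h
           \<le> (2 * C * (\<rho>\<^sup>2 + 1) + K) * norm (y' - y) + K * (norm (y' - y))\<^sup>2"
        using h by (simp add: field_simps)
      have d: "norm (y' - y) \<le> \<tau> * norm (w - w')"
        unfolding y_def y'_def matrix_vector_mult_diff_distrib[symmetric] \<tau>_def
        using norm_matrix_vector_le[of T "w' - w"] by (simp add: norm_minus_commute)
      have "norm (w - w') \<le> 2 * L" using norm_triangle_ineq4[of w w'] w by simp
      then have "norm (y' - y) * norm (y' - y) \<le> (\<tau> * norm (w - w')) * (\<tau> * (2 * L))"
        using d \<tau> by (intro mult_mono order_trans[OF d] mult_left_mono) auto
      then have d2: "(norm (y' - y))\<^sup>2 \<le> 2 * \<tau>\<^sup>2 * L * norm (w - w')" by (simp add: power2_eq_square ac_simps)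
      have "(2 * C * (\<rho>\<^sup>2 + 1) + K) * norm (y' - y) \<le> (2 * C * (\<rho>\<^sup>2 + 1) + K) * (\<tau> * norm (w - w'))"
        using d C K by (intro mult_left_mono) auto
      also have "\<dots> \<le> 2 * (2 * C * (\<rho>\<^sup>2 + 1) + K) * (\<tau> * norm (w - w'))"
        using C K \<tau> by (intro mult_right_mono) auto
      finally have d1: "(2 * C * (\<rho>\<^sup>2 + 1) + K) * norm (y' - y) \<le> 2 * (2 * C * (\<rho>\<^sup>2 + 1) + K) * (\<tau> * norm (w - w'))" .
      have "K * (norm (y' - y))\<^sup>2 \<le> K * (2 * \<tau>\<^sup>2 * L * norm (w - w'))"
        using d2 K by (intro mult_left_mono) auto
      with 1 d1 show ?thesis unfolding y_def[symmetric] y'_def[symmetric]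
        by (simp add: diff_divide_distrib algebra_simps)
    qed
    show "\<bar>b (sqrt h *\<^sub>R (T *v w), - h) / h - b (sqrt h *\<^sub>R (T *v w'), - h) / h\<bar>
        \<le> (2 * (2 * C * (\<rho>\<^sup>2 + 1) + K) * \<tau> + 2 * K * \<tau>\<^sup>2 * L) * norm (w - w')"
      using key[OF w] key[OF w(2,1)] by (simp add: norm_minus_commute abs_le_iff)
  next
    fix R e :: real assume e: "0 < e"
    define \<upsilon> where "\<upsilon> = norm U"
    define A where "A = 4 * (\<upsilon> * \<bar>R\<bar> * \<upsilon>) * (\<upsilon> * \<bar>R\<bar>) / norm g"
    have ng: "0 < norm g" using g by simp
    have A: "0 \<le> A" unfolding A_def \<upsilon>_def by simp
    define h1 where "h1 = min h0 ((e / (A + 1))\<^sup>2)"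
    have h1: "0 < h1" unfolding h1_def using h0 e A by simp
    show "\<exists>h1>0. \<forall>h w s c \<xi> X. 0 < h \<longrightarrow> h \<le> h1 \<longrightarrow> norm w < L \<longrightarrow> \<bar>s\<bar> < 1 \<longrightarrow> transpose X = X \<longrightarrow>
       norm \<xi> \<le> R \<longrightarrow> norm X \<le> R \<longrightarrow> touch_above (\<lambda>z. b (sqrt h *\<^sub>R (T *v fst z), h * snd z) / h) (w, s) c \<xi> X \<longrightarrow>
       c \<le> trace X + (\<epsilon> * (2 * K * real CARD('n)) + e - c1)"
    proof (intro exI[of _ h1] conjI allI impI, rule h1)
      fix h w s c \<xi> and X :: "real^'n^'n"
      assume h: "0 < h" "h \<le> h1" and w: "norm w < L" and s: "\<bar>s\<bar> < 1" and X: "transpose X = X"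
        and R: "norm \<xi> \<le> R" "norm X \<le> R"
        and touch: "touch_above (\<lambda>z. b (sqrt h *\<^sub>R (T *v fst z), h * snd z) / h) (w, s) c \<xi> X"
      define P where "P = (1 / sqrt h) *\<^sub>R U"
      have sh: "0 < sqrt h" using h by simp
      have PT: "P *v (sqrt h *\<^sub>R (T *v y)) = y" for y
      proof -
        have "P *v (sqrt h *\<^sub>R (T *v y)) = (sqrt h * (1 / sqrt h)) *\<^sub>R (U *v (T *v y))"
          unfolding P_def scaleR_matrix_vector_assoc[symmetric] matrix_vector_mult_scaleR by simp
        then show ?thesis unfolding matrix_vector_mul_assoc using sh UT by simp
      qed
      have TP: "sqrt h *\<^sub>R (T *v (P *v y)) = y" for y
      proof -
        have "sqrt h *\<^sub>R (T *v (P *v y)) = (sqrt h * (1 / sqrt h)) *\<^sub>R (T *v (U *v y))"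
          unfolding P_def scaleR_matrix_vector_assoc[symmetric] matrix_vector_mult_scaleR by simp
        then show ?thesis unfolding matrix_vector_mul_assoc using sh TU by simp
      qed
      define w' s' where "w' = sqrt h *\<^sub>R (T *v w)" and "s' = h * s"
      define \<xi>' where "\<xi>' = h *\<^sub>R (transpose P *v \<xi>)"
      define Z where "Z = transpose U ** X ** U"
      have hP: "h *\<^sub>R (transpose P ** X ** P) = Z"
      proof -
        have "transpose P ** X ** P = ((1 / sqrt h) * (1 / sqrt h)) *\<^sub>R Z"
          unfolding P_def Z_def transpose_scale
          by (simp add: matrix_scalar_ac scalar_matrix_assoc[symmetric])
        then show ?thesis using h by simp
      qed
      have Z: "transpose Z = Z" unfolding Z_def
        by (simp add: matrix_transpose_mul X matrix_mul_assoc)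
      have "touch_above b (w', s') (0 + h * ((1 / h) * c)) (0 + h *\<^sub>R (transpose P *v \<xi>)) (h *\<^sub>R (transpose P ** X ** P))"
      proof (rule touch_above_affine[where Ca = 0 and ow = 0 and m = 0 and B = "\<lambda>z. b (sqrt h *\<^sub>R (T *v fst z), h * snd z) / h"])
        show "b (x, t) = 0 + 0 \<bullet> x + 0 * t + h * (b (sqrt h *\<^sub>R (T *v fst (0 + P *v x, 0 + 1 / h * t)), h * snd (0 + P *v x, 0 + 1 / h * t)) / h)" for x t
          using h by (simp add: TP)
        show "touch_above (\<lambda>z. b (sqrt h *\<^sub>R (T *v fst z), h * snd z) / h) (0 + P *v w', 0 + 1 / h * s') c \<xi> X"
          using touch h unfolding w'_def s'_def PT by simp
      qed (rule h(1))
      then have tb: "touch_above b (w', s') c \<xi>' Z" using h unfolding hP \<xi>'_def by simp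
      have hh: "h \<le> h0" using h unfolding h1_def by simp
      have nw: "norm w' < r"
      proof -
        have "norm w' \<le> sqrt h * \<rho>" unfolding w'_def using TL[of w] w h \<rho>_def by simp
        then show ?thesis using sq[OF h(1) hh] by simp
      qed
      have ns: "\<bar>s'\<bar> < r"
      proof -
        have "\<bar>s'\<bar> \<le> h * 1" unfolding s'_def abs_mult using h s by (intro mult_mono) auto
        then show ?thesis using hh h0 by simp
      qed
      have n\<xi>: "norm \<xi>' \<le> sqrt h * (\<upsilon> * \<bar>R\<bar>)"
      proof -
        have "\<xi>' = sqrt h *\<^sub>R (transpose U *v \<xi>)"
          unfolding \<xi>'_def P_def transpose_scale scaleR_matrix_vector_assoc[symmetric] scaleR_scaleR
          using h by (simp add: real_div_sqrt)
        moreover have "norm (transpose U *v \<xi>) \<le> \<upsilon> * \<bar>R\<bar>"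
          unfolding \<upsilon>_def norm_transpose[of U, symmetric]
          by (rule order_trans[OF norm_matrix_vector_le mult_left_mono]) (use R(1) in linarith, simp)
        ultimately show ?thesis using h by (simp del: transpose_matrix_vector)
      qed
      have nZ: "norm Z \<le> \<upsilon> * \<bar>R\<bar> * \<upsilon>"
      proof -
        have "norm Z \<le> norm (transpose U ** X) * norm U" unfolding Z_def by (rule norm_matrix_mult_le)
        also have "\<dots> \<le> (norm (transpose U) * norm X) * norm U" by (intro mult_right_mono norm_matrix_mult_le) auto
        also have "\<dots> \<le> (\<upsilon> * \<bar>R\<bar>) * \<upsilon>" unfolding norm_transpose \<upsilon>_def using R by (intro mult_right_mono mult_left_mono) auto
        finally show ?thesis .
      qed
      have "c + c1 \<le> Lop a g Z + 4 * norm Z * norm \<xi>' / norm g" by (rule sub[OF nw ns tb Z])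
      also have "4 * norm Z * norm \<xi>' / norm g \<le> 4 * (\<upsilon> * \<bar>R\<bar> * \<upsilon>) * (sqrt h * (\<upsilon> * \<bar>R\<bar>)) / norm g"
        using nZ n\<xi> ng by (intro divide_right_mono mult_mono) (auto simp: \<upsilon>_def)
      also have "\<dots> = sqrt h * A" unfolding A_def by simp
      also have "\<dots> \<le> e"
      proof -
        have "h \<le> (e / (A + 1))\<^sup>2" using h unfolding h1_def by simp
        then have "sqrt h \<le> e / (A + 1)" using e A by (intro real_le_lsqrt) auto
        then have "sqrt h * (A + 1) \<le> e" using A by (simp add: pos_le_divide_eq)
        moreover have "sqrt h * A \<le> sqrt h * (A + 1)" using sh by (intro mult_left_mono) auto
        ultimately show ?thesis by simp
      qed
      finally have 1: "c + c1 \<le> Lop a g Z + e" by simp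
      have 2: "Lop a g Z = trace X - \<epsilon> * trace Z" using tr[OF X] unfolding Z_def by simp
      have "- (2 * K * real CARD('n)) \<le> trace Z" by (rule semiconvex_trace_ge[OF sc tb])
      then have "\<epsilon> * - (2 * K * real CARD('n)) \<le> \<epsilon> * trace Z" using \<epsilon> by (intro mult_left_mono)
      then show "c \<le> trace X + (\<epsilon> * (2 * K * real CARD('n)) + e - c1)" using 1 2 by simp
    qed
  qed
qed

section \<open>Coupled blow-up at a common maximum\<close>

text \<open>
  Adding \<open>K * |z|\<^sup>2\<close> gives a function with an affine support at every point, that is, a convex one.
\<close>

lemma semiconvex_continuous:
  fixes v :: "'a::euclidean_space \<Rightarrow> real"
  assumes "semiconvex K v"
  shows "continuous_on S v"
proof -
  define f where "f z = v z + K * (norm z)\<^sup>2" for z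
  have sub: "\<exists>l. \<forall>z. f z0 + l \<bullet> (z - z0) \<le> f z" for z0
  proof -
    obtain l where l: "\<And>z. v z0 + l \<bullet> (z - z0) - K * (norm (z - z0))\<^sup>2 \<le> v z"
      using assms unfolding semiconvex_def by blast
    have "f z0 + (l + (2 * K) *\<^sub>R z0) \<bullet> (z - z0) \<le> f z" for z
      using l[of z] unfolding f_def power2_norm_eq_inner
      by (simp add: algebra_simps inner_commute)
    then show ?thesis by blast
  qed
  have "convex_on UNIV f"
  proof (rule convex_onI)
    fix u :: real and x y :: 'a assume u: "0 < u" "u < 1"
    define z0 where "z0 = (1 - u) *\<^sub>R x + u *\<^sub>R y"
    obtain l where l: "\<And>z. f z0 + l \<bullet> (z - z0) \<le> f z" using sub by blast
    have x: "(1 - u) * (f z0 + l \<bullet> (x - z0)) \<le> (1 - u) * f x" using u l by (intro mult_left_mono) auto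
    have y: "u * (f z0 + l \<bullet> (y - z0)) \<le> u * f y" using u l by (intro mult_left_mono) auto
    have "(1 - u) * (l \<bullet> (x - z0)) + u * (l \<bullet> (y - z0)) = l \<bullet> ((1 - u) *\<^sub>R (x - z0) + u *\<^sub>R (y - z0))"
      by (simp add: inner_add_right)
    also have "(1 - u) *\<^sub>R (x - z0) + u *\<^sub>R (y - z0) = 0" unfolding z0_def by (simp add: algebra_simps)
    finally show "f ((1 - u) *\<^sub>R x + u *\<^sub>R y) \<le> (1 - u) * f x + u * f y"
      using x y unfolding z0_def[symmetric] by (simp add: algebra_simps)
  qed simp
  then have "continuous_on UNIV f" by (rule convex_on_continuous[OF open_UNIV])
  then have "continuous_on UNIV (\<lambda>z. f z - K * (norm z)\<^sup>2)" by (intro continuous_intros)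
  then show ?thesis unfolding f_def using continuous_on_subset by auto
qed

text \<open>
  The substitute for the theorem on sums. Let \<open>v\<close> be the caloric function whose initial values are a limit of the rescaled \<open>b1\<close>.
  Comparison puts \<open>v\<close> above \<open>b1\<close>. Since the sum of both functions is at most \<open>w \<bullet> (H *v w) / 2\<close> up to small terms, it also puts
  \<open>- v\<close> plus the caloric extension of this quadratic form above \<open>b2\<close>. Both functions vanish at the origin, so the sum of the two
  comparisons there contains neither \<open>v\<close> nor the functions.
\<close>

lemma coupled_max:
  fixes b1 b2 :: "(real^'n) \<times> real \<Rightarrow> real" and T1 U1 T2 U2 H :: "real^'n^'n"
  assumes a: "0 \<le> a" "a < 1" and K: "0 \<le> K" and C: "0 \<le> C" and r: "0 < r" and \<epsilon>: "0 \<le> \<epsilon>"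
    and g1: "g1 \<noteq> 0" and sc1: "semiconvex K b1"
    and bC1: "\<And>w s. norm w < r \<Longrightarrow> \<bar>s\<bar> < r \<Longrightarrow> \<bar>b1 (w, s)\<bar> \<le> C * ((norm w)\<^sup>2 + s\<^sup>2)"
    and sub1: "\<And>w s c \<xi> X. norm w < r \<Longrightarrow> \<bar>s\<bar> < r \<Longrightarrow> touch_above b1 (w, s) c \<xi> X \<Longrightarrow> transpose X = X \<Longrightarrow>
        c + c1 \<le> Lop a g1 X + 4 * norm X * norm \<xi> / norm g1"
    and UT1: "U1 ** T1 = mat 1"
    and tr1: "\<And>X. transpose X = X \<Longrightarrow> Lop a g1 (transpose U1 ** X ** U1) + \<epsilon> * trace (transpose U1 ** X ** U1) = trace X"
    and g2: "g2 \<noteq> 0" and sc2: "semiconvex K b2"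
    and bC2: "\<And>w s. norm w < r \<Longrightarrow> \<bar>s\<bar> < r \<Longrightarrow> \<bar>b2 (w, s)\<bar> \<le> C * ((norm w)\<^sup>2 + s\<^sup>2)"
    and sub2: "\<And>w s c \<xi> X. norm w < r \<Longrightarrow> \<bar>s\<bar> < r \<Longrightarrow> touch_above b2 (w, s) c \<xi> X \<Longrightarrow> transpose X = X \<Longrightarrow>
        c + c2 \<le> Lop a g2 X + 4 * norm X * norm \<xi> / norm g2"
    and UT2: "U2 ** T2 = mat 1"
    and tr2: "\<And>X. transpose X = X \<Longrightarrow> Lop a g2 (transpose U2 ** X ** U2) + \<epsilon> * trace (transpose U2 ** X ** U2) = trace X"
    and H: "transpose H = H"
    and touch: "touch_above (\<lambda>z. b1 (T1 *v fst z, snd z) + b2 (T2 *v fst z, snd z)) (0, 0) 0 0 H"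
  shows "c1 + c2 \<le> trace H + 4 * \<epsilon> * K * real CARD('n)"
proof (rule field_le_epsilon)
  fix \<eta> :: real assume \<eta>: "0 < \<eta>"
  define \<epsilon>1 where "\<epsilon>1 = \<eta> / 16"
  have \<epsilon>1: "0 < \<epsilon>1" unfolding \<epsilon>1_def using \<eta> by simp
  define E where "E = \<epsilon> * (2 * K * real CARD('n))"
  define e1 e2 where "e1 = E + \<epsilon>1 - c1" and "e2 = E + \<epsilon>1 - c2"
  define D1 D2 where "D1 = 2 * C * ((norm T1)\<^sup>2 + 1)" and "D2 = 2 * C * ((norm T2)\<^sup>2 + 1)"
  define M where "M = 2 * D1 + 2 * D2 + 2 * \<bar>e1\<bar> + 2 * \<bar>e2\<bar> + norm H + 2 * \<bar>trace H\<bar>"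
  have D: "0 \<le> D1" "0 \<le> D2" unfolding D1_def D2_def using C by auto
  have M: "0 \<le> M" unfolding M_def using D by simp
  define q0 where "q0 = quartic_barrier (0 :: real^'n, 0)"
  have q0: "0 \<le> q0" unfolding q0_def by (rule quartic_barrier_ge) simp
  \<comment> \<open>The quartic barrier contributes \<open>2 * M * q0 / L\<^sup>2\<close>, which a large \<open>L\<close> makes negligible.\<close>
  define L where "L = 1 + M * q0 / \<epsilon>1"
  have L: "1 \<le> L" unfolding L_def using M q0 \<epsilon>1 by simp
  have L1: "1 \<le> L\<^sup>2" "L \<le> L\<^sup>2" using L mult_mono[OF L L] by (auto simp: power2_eq_square)
  have Mq: "M / L\<^sup>2 * q0 \<le> \<epsilon>1"
  proof -
    have "M * q0 = \<epsilon>1 * (L - 1)" unfolding L_def using \<epsilon>1 by simp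
    also have "\<dots> \<le> \<epsilon>1 * L\<^sup>2" using \<epsilon>1 L1 by (intro mult_left_mono) auto
    finally show ?thesis using L by (simp add: field_simps)
  qed
  obtain C' h01 \<Lambda>1 where \<Lambda>1: "0 < h01" "0 \<le> \<Lambda>1" and C': "C' = 2 * C * ((norm T1)\<^sup>2 + 1)"
    and B1: "\<And>h w s. 0 < h \<Longrightarrow> h \<le> h01 \<Longrightarrow> norm w \<le> L \<Longrightarrow> \<bar>s\<bar> \<le> 1 \<Longrightarrow> \<bar>b1 (sqrt h *\<^sub>R (T1 *v w), h * s) / h\<bar> \<le> C' * L\<^sup>2"
    and Li1: "\<And>h w w'. 0 < h \<Longrightarrow> h \<le> h01 \<Longrightarrow> norm w \<le> L \<Longrightarrow> norm w' \<le> L \<Longrightarrow>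
       \<bar>b1 (sqrt h *\<^sub>R (T1 *v w), - h) / h - b1 (sqrt h *\<^sub>R (T1 *v w'), - h) / h\<bar> \<le> \<Lambda>1 * norm (w - w')"
    and tch1: "\<And>R e. 0 < e \<Longrightarrow> \<exists>h1>0. \<forall>h w s c \<xi> X. 0 < h \<longrightarrow> h \<le> h1 \<longrightarrow> norm w < L \<longrightarrow> \<bar>s\<bar> < 1 \<longrightarrow> transpose X = X \<longrightarrow>
       norm \<xi> \<le> R \<longrightarrow> norm X \<le> R \<longrightarrow> touch_above (\<lambda>z. b1 (sqrt h *\<^sub>R (T1 *v fst z), h * snd z) / h) (w, s) c \<xi> X \<longrightarrow>
       c \<le> trace X + (\<epsilon> * (2 * K * real CARD('n)) + e - c1)"
    by (rule blow_up[OF a g1 K sc1 C r bC1 sub1 UT1 \<epsilon> tr1 L]) blast+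
  obtain C'' h02 \<Lambda>2 where \<Lambda>2: "0 < h02" "0 \<le> \<Lambda>2" and C'': "C'' = 2 * C * ((norm T2)\<^sup>2 + 1)"
    and B2: "\<And>h w s. 0 < h \<Longrightarrow> h \<le> h02 \<Longrightarrow> norm w \<le> L \<Longrightarrow> \<bar>s\<bar> \<le> 1 \<Longrightarrow> \<bar>b2 (sqrt h *\<^sub>R (T2 *v w), h * s) / h\<bar> \<le> C'' * L\<^sup>2"
    and Li2: "\<And>h w w'. 0 < h \<Longrightarrow> h \<le> h02 \<Longrightarrow> norm w \<le> L \<Longrightarrow> norm w' \<le> L \<Longrightarrow>
       \<bar>b2 (sqrt h *\<^sub>R (T2 *v w), - h) / h - b2 (sqrt h *\<^sub>R (T2 *v w'), - h) / h\<bar> \<le> \<Lambda>2 * norm (w - w')"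
    and tch2: "\<And>R e. 0 < e \<Longrightarrow> \<exists>h1>0. \<forall>h w s c \<xi> X. 0 < h \<longrightarrow> h \<le> h1 \<longrightarrow> norm w < L \<longrightarrow> \<bar>s\<bar> < 1 \<longrightarrow> transpose X = X \<longrightarrow>
       norm \<xi> \<le> R \<longrightarrow> norm X \<le> R \<longrightarrow> touch_above (\<lambda>z. b2 (sqrt h *\<^sub>R (T2 *v fst z), h * snd z) / h) (w, s) c \<xi> X \<longrightarrow>
       c \<le> trace X + (\<epsilon> * (2 * K * real CARD('n)) + e - c2)"
    by (rule blow_up[OF a g2 K sc2 C r bC2 sub2 UT2 \<epsilon> tr2 L]) blast+
  have b0: "b1 (0, 0) = 0" "b2 (0, 0) = 0" using bC1[of 0 0] bC2[of 0 0] r by auto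
  define \<beta>1 where "\<beta>1 h z = b1 (sqrt h *\<^sub>R (T1 *v fst z), h * snd z) / h" for h z
  define \<beta>2 where "\<beta>2 h z = b2 (sqrt h *\<^sub>R (T2 *v fst z), h * snd z) / h" for h z
  define h0 where "h0 = min h01 h02"
  have h0: "0 < h0" unfolding h0_def using \<Lambda>1 \<Lambda>2 by simp
  define hs where "hs n = h0 / (real n + 1)" for n :: nat
  have hs: "0 < hs n" "hs n \<le> h0" for n
    unfolding hs_def using h0 by (auto simp: divide_le_eq)
  have hs1: "hs n \<le> h01" "hs n \<le> h02" for n using hs(2)[of n] unfolding h0_def by auto
  have hs_lim: "hs \<longlonglongrightarrow> 0" unfolding hs_def
    using tendsto_mult_left[OF LIMSEQ_inverse_real_of_nat, of h0] by (simp add: divide_inverse add.commute)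
  define F where "F n w = \<beta>1 (hs n) (w, -1)" for n w
  have F: "F n w = b1 (sqrt (hs n) *\<^sub>R (T1 *v w), - hs n) / hs n" for n w
    unfolding F_def \<beta>1_def by simp
  obtain b0 k where b0c: "continuous_on (cball 0 L) b0" and k: "strict_mono (k :: nat \<Rightarrow> nat)"
    and unif: "\<And>e. 0 < e \<Longrightarrow> \<exists>N. \<forall>n x. n \<ge> N \<and> x \<in> cball 0 L \<longrightarrow> norm (F (k n) x - b0 x) < e"
  proof (rule Arzela_Ascoli[of "cball (0 :: real^'n) L" F "C' * L\<^sup>2"])
    show "norm (F n x) \<le> C' * L\<^sup>2" if "x \<in> cball 0 L" for n x
      using B1[OF hs(1) hs1(1), where w = x and s = "-1"] that unfolding F by simp
    show "\<exists>d>0. \<forall>n y. y \<in> cball 0 L \<and> norm (x - y) < d \<longrightarrow> norm (F n x - F n y) < e"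
      if x: "x \<in> cball 0 L" and e: "0 < e" for x e
    proof (intro exI[of _ "e / (\<Lambda>1 + 1)"] conjI allI impI)
      show "0 < e / (\<Lambda>1 + 1)" using e \<Lambda>1 by simp
      fix n y assume y: "y \<in> cball 0 L \<and> norm (x - y) < e / (\<Lambda>1 + 1)"
      have "norm (F n x - F n y) \<le> \<Lambda>1 * norm (x - y)"
        using Li1[OF hs(1) hs1(1), of x y] x y unfolding F by simp
      also have "\<dots> \<le> (\<Lambda>1 + 1) * norm (x - y)" by (intro mult_right_mono) auto
      also have "\<dots> < e" using y \<Lambda>1 by (simp add: field_simps)
      finally show "norm (F n x - F n y) < e" .
    qed
  qed auto
  have b0b: "\<bar>b0 w\<bar> \<le> D1 * L\<^sup>2" if w: "norm w \<le> L" for w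
  proof (rule field_le_epsilon)
    fix e :: real assume "0 < e"
    from unif[OF this] obtain N where N: "norm (F (k N) w - b0 w) < e" using w by auto
    have "\<bar>F (k N) w\<bar> \<le> C' * L\<^sup>2"
      using B1[OF hs(1) hs1(1), where w = w and s = "-1"] w unfolding F by simp
    then show "\<bar>b0 w\<bar> \<le> D1 * L\<^sup>2 + e" using N unfolding D1_def C'[symmetric] by simp
  qed
  obtain v Rv where v: "\<And>m. caloric m Rv v" and vb: "\<And>w. norm w \<le> L \<Longrightarrow> \<bar>v (w, -1) - b0 w\<bar> \<le> \<epsilon>1"
    and vS: "\<And>w s. -1 \<le> s \<Longrightarrow> s \<le> 1 \<Longrightarrow> \<bar>v (w, s)\<bar> \<le> D1 * L\<^sup>2 + \<epsilon>1"
    using caloric_approximation[OF _ b0c b0b \<epsilon>1] L by (metis less_le_trans zero_less_one)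
  define G1 where "G1 z = v z + (2 * \<epsilon>1 + (M / L\<^sup>2) * quartic_barrier z)" for z
  define G2 where "G2 z = - 1 * v z + ((fst z \<bullet> (H *v fst z) / 2 + trace H * (snd z + 1)) + (4 * \<epsilon>1 + (M / L\<^sup>2) * quartic_barrier z))" for z
  obtain Rq where Rq: "caloric L Rq (quartic_barrier :: (real^'n) \<times> real \<Rightarrow> real)"
    using caloric_quartic_barrier by blast
  obtain RH where RH: "caloric L RH (\<lambda>z. fst z \<bullet> (H *v fst z) / 2 + trace H * (snd z + 1))"
    using caloric_quadratic[OF H] by blast
  obtain R1 where R1: "caloric L R1 G1" unfolding G1_def[abs_def]
    using caloric_add[OF v[of L] caloric_add[OF caloric_const caloric_cmult[OF Rq]]] by blast
  obtain R2 where R2: "caloric L R2 G2" unfolding G2_def[abs_def]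
    using caloric_add[OF caloric_cmult[OF v[of L]] caloric_add[OF RH caloric_add[OF caloric_const caloric_cmult[OF Rq]]]] by blast
  obtain h1 where h1: "0 < h1" and t1: "\<And>h w s c \<xi> X. 0 < h \<Longrightarrow> h \<le> h1 \<Longrightarrow> norm w < L \<Longrightarrow> \<bar>s\<bar> < 1 \<Longrightarrow> transpose X = X \<Longrightarrow>
       norm \<xi> \<le> R1 \<Longrightarrow> norm X \<le> R1 \<Longrightarrow> touch_above (\<beta>1 h) (w, s) c \<xi> X \<Longrightarrow> c \<le> trace X + e1"
    using tch1[OF \<epsilon>1, of R1] unfolding \<beta>1_def[abs_def] e1_def E_def by blast
  obtain h2 where h2: "0 < h2" and t2: "\<And>h w s c \<xi> X. 0 < h \<Longrightarrow> h \<le> h2 \<Longrightarrow> norm w < L \<Longrightarrow> \<bar>s\<bar> < 1 \<Longrightarrow> transpose X = X \<Longrightarrow>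
       norm \<xi> \<le> R2 \<Longrightarrow> norm X \<le> R2 \<Longrightarrow> touch_above (\<beta>2 h) (w, s) c \<xi> X \<Longrightarrow> c \<le> trace X + e2"
    using tch2[OF \<epsilon>1, of R2] unfolding \<beta>2_def[abs_def] e2_def E_def by blast
  have \<theta>: "0 < \<epsilon>1 / (2 * L\<^sup>2)" using \<epsilon>1 L by simp
  obtain r' Q where r': "0 < r'" and Q: "\<And>w s. norm w < r' \<Longrightarrow> \<bar>s\<bar> < r' \<Longrightarrow>
      b1 (T1 *v w, s) + b2 (T2 *v w, s) \<le> w \<bullet> (H *v w) / 2 + \<epsilon>1 / (2 * L\<^sup>2) * (norm w)\<^sup>2 + Q * s\<^sup>2"
  proof -
    from touch[unfolded touch_above_def, rule_format, OF \<theta>]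
    obtain r' Q where "0 < r'" "\<And>w s. norm w < r' \<Longrightarrow> \<bar>s\<bar> < r' \<Longrightarrow>
      b1 (T1 *v w, s) + b2 (T2 *v w, s) \<le> jet_poly 0 0 H w s + \<epsilon>1 / (2 * L\<^sup>2) * (norm w)\<^sup>2 + Q * s\<^sup>2"
      by (auto simp: b0)
    then show thesis by (intro that[of r' Q]) (simp_all add: jet_poly_def)
  qed
  define h3 where "h3 = min (min h1 h2) (min (min (r' / 2) ((r' / (2 * L))\<^sup>2)) (\<epsilon>1 / (2 * (\<bar>Q\<bar> + 1))))"
  have h3: "0 < h3" unfolding h3_def using h1 h2 r' L \<epsilon>1 by simp
  obtain N where N: "\<And>n x. n \<ge> N \<Longrightarrow> norm x \<le> L \<Longrightarrow> norm (F (k n) x - b0 x) < \<epsilon>1"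
    using unif[OF \<epsilon>1] by auto
  have "\<forall>\<^sub>F n in sequentially. (hs \<circ> k) n < h3"
    using LIMSEQ_subseq_LIMSEQ[OF hs_lim k] h3 by (rule order_tendstoD)
  then obtain n where n: "n \<ge> N" "hs (k n) < h3"
    unfolding eventually_sequentially comp_def by (meson max.cobounded1 max.cobounded2)
  define h where "h = hs (k n)"
  have h: "0 < h" "h \<le> h1" "h \<le> h2" "h < r'" "h \<le> (r' / (2 * L))\<^sup>2" "h \<le> \<epsilon>1 / (2 * (\<bar>Q\<bar> + 1))" "h \<le> h01" "h \<le> h02"
    using n(2) hs(1)[of "k n"] hs1[of "k n"] r' unfolding h_def[symmetric] h3_def by auto
  have ini: "\<bar>\<beta>1 h (w, -1) - b0 w\<bar> \<le> \<epsilon>1" if "norm w \<le> L" for w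
    using N[OF n(1) that] unfolding F_def h_def by simp
  have BB: "\<bar>\<beta>1 h (w, s)\<bar> \<le> D1 * L\<^sup>2" "\<bar>\<beta>2 h (w, s)\<bar> \<le> D2 * L\<^sup>2" if "norm w \<le> L" "\<bar>s\<bar> \<le> 1" for w s
    using B1[OF h(1,7) that] B2[OF h(1,8) that] unfolding \<beta>1_def \<beta>2_def D1_def D2_def C' C'' by auto
  have cont: "continuous_on S (\<beta>1 h)" "continuous_on S (\<beta>2 h)" for S
    unfolding \<beta>1_def[abs_def] \<beta>2_def[abs_def] using h(1)
    by (auto intro!: continuous_intros continuous_on_compose2[OF semiconvex_continuous[OF sc1, of UNIV]]
        continuous_on_compose2[OF semiconvex_continuous[OF sc2, of UNIV]]
        continuous_on_compose2[OF matrix_vector_mult_linear_continuous_on[of UNIV]])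
  have q: "0 \<le> M / L\<^sup>2 * quartic_barrier z" if "-1 \<le> snd z" for z :: "(real^'n) \<times> real"
    using M quartic_barrier_ge(2)[OF that] by (intro mult_nonneg_nonneg) auto
  have qL: "M * L\<^sup>2 \<le> M / L\<^sup>2 * quartic_barrier (w, s)" if "norm (w :: real^'n) = L" "-1 \<le> s" for w s
  proof -
    have "M * L\<^sup>2 = M / L\<^sup>2 * L ^ 4" using L by (simp add: power2_eq_square power4_eq_xxxx)
    also have "\<dots> \<le> M / L\<^sup>2 * quartic_barrier (w, s)"
      using M quartic_barrier_ge(1)[of "(w, s)"] that by (intro mult_left_mono) auto
    finally show ?thesis .
  qed
  have eL: "- (2 * \<bar>e\<bar> * L\<^sup>2) \<le> e * (s + 1)" if "-1 \<le> s" "s \<le> 1" for e s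
  proof -
    have "\<bar>e * (s + 1)\<bar> \<le> \<bar>e\<bar> * (2 * L\<^sup>2)"
      unfolding abs_mult using that L1 by (intro mult_left_mono) auto
    then show ?thesis by linarith
  qed
  have MD: "M * L\<^sup>2 = 2 * D1 * L\<^sup>2 + 2 * D2 * L\<^sup>2 + 2 * \<bar>e1\<bar> * L\<^sup>2 + 2 * \<bar>e2\<bar> * L\<^sup>2 + norm H * L\<^sup>2 + 2 * \<bar>trace H\<bar> * L\<^sup>2"
    unfolding M_def by (simp add: algebra_simps)
  have DL: "0 \<le> D1 * L\<^sup>2" "0 \<le> D2 * L\<^sup>2" "0 \<le> \<bar>e1\<bar> * L\<^sup>2" "0 \<le> \<bar>e2\<bar> * L\<^sup>2" "0 \<le> norm H * L\<^sup>2" "0 \<le> \<bar>trace H\<bar> * L\<^sup>2"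
    using D by auto
  have Hw: "\<bar>w \<bullet> (H *v w) / 2\<bar> \<le> norm H * L\<^sup>2" if "norm w \<le> L" for w
  proof -
    have "\<bar>w \<bullet> (H *v w)\<bar> \<le> norm H * norm w * norm w" by (rule abs_quadratic_form_le)
    also have "\<dots> \<le> norm H * L * L" using that L by (intro mult_mono mult_nonneg_nonneg) auto
    finally show ?thesis by (simp add: power2_eq_square)
  qed
  have 1: "\<beta>1 h (0, 0) \<le> G1 (0, 0) + e1"
  proof (rule heat_compare[OF _ cont(1) R1])
    show "0 < L" using L by simp
    show "\<beta>1 h (w, - 1) \<le> G1 (w, - 1)" if w: "norm w \<le> L" for w
      using ini[OF w] vb[OF w] q[of "(w, -1)"] unfolding G1_def by simp
    show "\<beta>1 h (w, s) \<le> G1 (w, s) + e1 * (s + 1)" if w: "norm w = L" and s: "-1 \<le> s" "s \<le> 1" for w s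
    proof -
      have "\<beta>1 h (w, s) \<le> D1 * L\<^sup>2" using BB(1)[of w s] w s by (simp add: abs_le_iff)
      moreover have "- (D1 * L\<^sup>2 + \<epsilon>1) \<le> v (w, s)" using vS[OF s, of w] by simp
      ultimately show ?thesis
        using qL[OF w s(1)] eL[OF s, of e1] DL MD \<epsilon>1 unfolding G1_def by linarith
    qed
    show "c \<le> trace X + e1" if "norm w0 < L" "- 1 < s0" "s0 < 1" "transpose X = X" "norm \<xi> \<le> R1" "norm X \<le> R1"
        "touch_above (\<beta>1 h) (w0, s0) c \<xi> X" for w0 s0 c \<xi> X
      by (rule t1[OF h(1,2) that(1) _ that(4,5,6,7)]) (use that in auto)
  qed
  have 2: "\<beta>2 h (0, 0) \<le> G2 (0, 0) + e2"
  proof (rule heat_compare[OF _ cont(2) R2])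
    show "0 < L" using L by simp
    show "\<beta>2 h (w, - 1) \<le> G2 (w, - 1)" if w: "norm w \<le> L" for w
    proof -
      have sq: "sqrt h \<le> r' / (2 * L)" using h(5) r' L by (intro real_le_lsqrt) auto
      have "norm (sqrt h *\<^sub>R w) = sqrt h * norm w" using h(1) by simp
      also have "\<dots> \<le> r' / (2 * L) * L" using w sq r' L by (intro mult_mono) auto
      also have "\<dots> < r'" using L r' by simp
      finally have "norm (sqrt h *\<^sub>R w) < r'" .
      from Q[OF this, of "- h"] h
      have "b1 (sqrt h *\<^sub>R (T1 *v w), - h) + b2 (sqrt h *\<^sub>R (T2 *v w), - h)
         \<le> h * (w \<bullet> (H *v w) / 2) + \<epsilon>1 / (2 * L\<^sup>2) * (h * (norm w)\<^sup>2) + Q * h\<^sup>2"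
        by (simp add: matrix_vector_mult_scaleR power_mult_distrib mult.assoc[symmetric])
      then have "\<beta>1 h (w, -1) + \<beta>2 h (w, -1) \<le> w \<bullet> (H *v w) / 2 + \<epsilon>1 / (2 * L\<^sup>2) * (norm w)\<^sup>2 + Q * h"
        unfolding \<beta>1_def \<beta>2_def using h(1)
        by (simp add: field_simps power2_eq_square)
      also have "\<epsilon>1 / (2 * L\<^sup>2) * (norm w)\<^sup>2 \<le> \<epsilon>1 / (2 * L\<^sup>2) * L\<^sup>2"
        using \<theta> w by (intro mult_left_mono power_mono) auto
      also have "\<epsilon>1 / (2 * L\<^sup>2) * L\<^sup>2 = \<epsilon>1 / 2" using L by simp
      also have "Q * h \<le> (\<bar>Q\<bar> + 1) * h" using h by (intro mult_right_mono) auto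
      also have "(\<bar>Q\<bar> + 1) * h \<le> \<epsilon>1 / 2" using h(6) by (simp add: field_simps)
      finally show ?thesis
        using ini[OF w] vb[OF w] q[of "(w, -1)"] \<epsilon>1 unfolding G2_def by simp
    qed
    show "\<beta>2 h (w, s) \<le> G2 (w, s) + e2 * (s + 1)" if w: "norm w = L" and s: "-1 \<le> s" "s \<le> 1" for w s
    proof -
      have "\<beta>2 h (w, s) \<le> D2 * L\<^sup>2" using BB(2)[of w s] w s by (simp add: abs_le_iff)
      moreover have "v (w, s) \<le> D1 * L\<^sup>2 + \<epsilon>1" using vS[OF s, of w] by simp
      moreover have "- (norm H * L\<^sup>2) \<le> w \<bullet> (H *v w) / 2" using Hw[of w] w by simp
      ultimately show ?thesis
        using qL[OF w s(1)] eL[OF s, of e2] eL[OF s, of "trace H"] DL MD \<epsilon>1 unfolding G2_def fst_conv snd_conv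
        by linarith
    qed
    show "c \<le> trace X + e2" if "norm w0 < L" "- 1 < s0" "s0 < 1" "transpose X = X" "norm \<xi> \<le> R2" "norm X \<le> R2"
        "touch_above (\<beta>2 h) (w0, s0) c \<xi> X" for w0 s0 c \<xi> X
      by (rule t2[OF h(1,3) that(1) _ that(4,5,6,7)]) (use that in auto)
  qed
  have "\<beta>1 h (0, 0) = 0" "\<beta>2 h (0, 0) = 0" unfolding \<beta>1_def \<beta>2_def using b0 by auto
  then have "0 \<le> trace H + 6 * \<epsilon>1 + 2 * (M / L\<^sup>2 * q0) + e1 + e2"
    using 1 2 unfolding G1_def G2_def q0_def by simp
  then have "c1 + c2 \<le> trace H + 10 * \<epsilon>1 + 2 * E" using Mq unfolding e1_def e2_def by simp
  then show "c1 + c2 \<le> trace H + 4 * \<epsilon> * K * real CARD('n) + \<eta>"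
    unfolding E_def \<epsilon>1_def using \<eta> by (simp add: algebra_simps)
qed

section \<open>Doubled maxima of semiconvex subsolutions\<close>

text \<open>
  Semiconvexity bounds the functions from below by their subgradients and the test function bounds the sum from above, so the
  first-order terms agree.
\<close>

lemma doubled_subgradient:
  fixes V1 V2 :: "(real^'n) \<times> real \<Rightarrow> real" and Ta Tb H :: "real^'n^'n"
  assumes l1: "\<And>z. V1 (x1, t0) + l1 \<bullet> (z - (x1, t0)) - K * (norm (z - (x1, t0)))\<^sup>2 \<le> V1 z"
    and l2: "\<And>z. V2 (x2, t0) + l2 \<bullet> (z - (x2, t0)) - K * (norm (z - (x2, t0)))\<^sup>2 \<le> V2 z"
    and t: "touch_above (\<lambda>z. V1 (x1 + Ta *v fst z, t0 + snd z) + V2 (x2 + Tb *v fst z, t0 + snd z)) (0, 0) \<tau> \<gamma> H"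
  shows "snd l1 + snd l2 = \<tau>" "transpose Ta *v fst l1 + transpose Tb *v fst l2 = \<gamma>"
proof -
  define D where "D = transpose Ta *v fst l1 + transpose Tb *v fst l2 - \<gamma>"
  define \<kappa> where "\<kappa> = snd l1 + snd l2 - \<tau>"
  obtain r C where r: "0 < r" and C: "\<And>w s. norm w < r \<Longrightarrow> \<bar>s\<bar> < r \<Longrightarrow>
      V1 (x1 + Ta *v w, t0 + s) + V2 (x2 + Tb *v w, t0 + s) \<le> V1 (x1, t0) + V2 (x2, t0) + jet_poly \<tau> \<gamma> H w s + (norm w)\<^sup>2 + C * s\<^sup>2"
  proof -
    from t[unfolded touch_above_def, rule_format, of 1]
    obtain r C where "0 < r" "\<And>w s. norm w < r \<Longrightarrow> \<bar>s\<bar> < r \<Longrightarrow>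
      V1 (x1 + Ta *v w, t0 + s) + V2 (x2 + Tb *v w, t0 + s) \<le> V1 (x1, t0) + V2 (x2, t0) + jet_poly \<tau> \<gamma> H w s + (norm w)\<^sup>2 + C * s\<^sup>2"
      by auto
    then show thesis by (rule that)
  qed
  have i: "fst l \<bullet> (T *v w) = (transpose T *v fst l) \<bullet> w" for T :: "real^'n^'n" and l :: "(real^'n) \<times> real" and w
    by (simp add: dot_lmul_matrix)
  have main: "\<kappa> * s + D \<bullet> w \<le> K * ((norm (Ta *v w))\<^sup>2 + (norm (Tb *v w))\<^sup>2 + 2 * s\<^sup>2) + w \<bullet> (H *v w) / 2 + (norm w)\<^sup>2 + C * s\<^sup>2"
    if "norm w < r" "\<bar>s\<bar> < r" for w s
  proof -
    have "V1 (x1, t0) + ((transpose Ta *v fst l1) \<bullet> w + snd l1 * s) - K * ((norm (Ta *v w))\<^sup>2 + s\<^sup>2) \<le> V1 (x1 + Ta *v w, t0 + s)"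
      using l1[of "(x1 + Ta *v w, t0 + s)"] unfolding i[symmetric] by (simp add: inner_prod_def norm_Pair)
    moreover have "V2 (x2, t0) + ((transpose Tb *v fst l2) \<bullet> w + snd l2 * s) - K * ((norm (Tb *v w))\<^sup>2 + s\<^sup>2) \<le> V2 (x2 + Tb *v w, t0 + s)"
      using l2[of "(x2 + Tb *v w, t0 + s)"] unfolding i[symmetric] by (simp add: inner_prod_def norm_Pair)
    ultimately show ?thesis using C[OF that] unfolding jet_poly_def D_def \<kappa>_def inner_add_left inner_diff_left
      by (simp add: algebra_simps del: transpose_matrix_vector)
  qed
  have "\<kappa> \<le> 0"
  proof (rule nonpos_of_little[OF r])
    fix h :: real assume "0 < h" "h < r"
    then show "\<kappa> * h \<le> (2 * K + C) * h\<^sup>2" using main[of 0 h] r by (simp add: algebra_simps)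
  qed
  moreover have "- \<kappa> \<le> 0"
  proof (rule nonpos_of_little[OF r])
    fix h :: real assume "0 < h" "h < r"
    then show "- \<kappa> * h \<le> (2 * K + C) * h\<^sup>2" using main[of 0 "-h"] r by (simp add: algebra_simps)
  qed
  ultimately show "snd l1 + snd l2 = \<tau>" unfolding \<kappa>_def by simp
  have "D \<bullet> D \<le> 0"
  proof (rule nonpos_of_little)
    show "0 < r / (norm D + 1)" using r by (simp add: add_nonneg_pos)
    fix h :: real assume h: "0 < h" "h < r / (norm D + 1)"
    then have "h * (norm D + 1) < r" by (simp add: pos_less_divide_eq add_nonneg_pos)
    then have "norm (h *\<^sub>R D) < r" using h by (simp add: algebra_simps)
    from main[OF this, of 0] r
    show "D \<bullet> D * h \<le> (K * ((norm (Ta *v D))\<^sup>2 + (norm (Tb *v D))\<^sup>2) + D \<bullet> (H *v D) / 2 + (norm D)\<^sup>2) * h\<^sup>2"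
      using h by (simp add: matrix_vector_mult_scaleR power_mult_distrib power2_eq_square algebra_simps)
  qed
  then have "D = 0" using inner_ge_zero[of D] inner_eq_zero_iff[of D] by linarith
  then show "transpose Ta *v fst l1 + transpose Tb *v fst l2 = \<gamma>" unfolding D_def by simp
qed

text \<open>
  No coupling: each function is tested with the other variable frozen. The time slopes of the two functions are known only
  through their sum \<open>\<tau>\<close>, and semiconvexity in time of the frozen function lets the sum be split. The
  bound does not see the gradients, which therefore may vanish.
\<close>

lemma doubled_max_degenerate:
  fixes V1 V2 :: "(real^'n) \<times> real \<Rightarrow> real" and H1 H2 :: "real^'n^'n"
  assumes a: "0 \<le> a" "a < 1" and sc: "semiconvex K V1" "semiconvex K V2"
    and j: "jsub a V1 (x1, t0)" "jsub a V2 (x2, t0)"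
    and t1: "touch_above (\<lambda>z. V1 (x1 + fst z, t0 + snd z) + V2 (x2, t0 + snd z)) (0, 0) \<tau> p1 H1" "transpose H1 = H1"
    and t2: "touch_above (\<lambda>z. V1 (x1, t0 + snd z) + V2 (x2 + fst z, t0 + snd z)) (0, 0) \<tau> p2 H2" "transpose H2 = H2"
  shows "\<tau> \<le> (real CARD('n) + 1) * (norm H1 + norm H2)"
proof -
  define N where "N = real CARD('n) + 1"
  have N: "0 < N" unfolding N_def by (simp add: add_nonneg_pos)
  obtain l1 where l1: "\<And>z. V1 (x1, t0) + l1 \<bullet> (z - (x1, t0)) - K * (norm (z - (x1, t0)))\<^sup>2 \<le> V1 z"
    using sc unfolding semiconvex_def by blast
  obtain l2 where l2: "\<And>z. V2 (x2, t0) + l2 \<bullet> (z - (x2, t0)) - K * (norm (z - (x2, t0)))\<^sup>2 \<le> V2 z"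
    using sc unfolding semiconvex_def by blast
  have one: "d \<le> N * norm H"
    if V: "jsub a V z" "touch_above V z d p H" "transpose H = H" for V :: "(real^'n) \<times> real \<Rightarrow> real" and z d p and H :: "real^'n^'n"
  proof (rule field_le_epsilon)
    fix e :: real assume e: "0 < e"
    show "d \<le> N * norm H + e"
    proof (rule V(1)[unfolded jsub_def, rule_format, OF V(3,2)], intro exI[of _ "e / N"] conjI allI impI)
      show "0 < e / N" using e N by simp
      fix \<eta> and Y :: "real^'n^'n" assume Y: "norm (Y - H) < e / N"
      have "Lop a \<eta> Y \<le> N * norm Y" using abs_Lop_le[OF a, of \<eta> Y] unfolding N_def by simp
      also have "\<dots> \<le> N * (norm H + e / N)" using Y N norm_triangle_sub[of Y H] by (intro mult_left_mono) auto
      also have "\<dots> = N * norm H + e" using N by (simp add: field_simps)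
      finally show "Lop a \<eta> Y \<le> N * norm H + e" .
    qed
  qed
  have \<tau>: "snd l1 + snd l2 = \<tau>"
    by (rule doubled_subgradient(1)[OF l1 l2, where Ta = "mat 1" and Tb = 0 and \<gamma> = p1 and H = H1]) (use t1 in simp)
  have drop: "touch_above V (x, t0) (\<tau> - snd l) p H"
    if l: "\<And>z. V' (x', t0) + l \<bullet> (z - (x', t0)) - K * (norm (z - (x', t0)))\<^sup>2 \<le> V' z"
      and t: "touch_above (\<lambda>z. V (x + fst z, t0 + snd z) + V' (x', t0 + snd z)) (0, 0) \<tau> p H"
    for V V' :: "(real^'n) \<times> real \<Rightarrow> real" and x x' p l and H :: "real^'n^'n"
    unfolding touch_above_def
  proof (intro allI impI)
    fix \<theta> :: real assume "0 < \<theta>"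
    from t[unfolded touch_above_def, rule_format, OF this] obtain r C where r: "0 < r" and C: "\<And>w s. norm w < r \<Longrightarrow> \<bar>s\<bar> < r \<Longrightarrow>
      V (x + w, t0 + s) + V' (x', t0 + s) \<le> V (x, t0) + V' (x', t0) + jet_poly \<tau> p H w s + \<theta> * (norm w)\<^sup>2 + C * s\<^sup>2"
      by auto
    show "\<exists>r>0. \<exists>C. \<forall>w s. norm w < r \<longrightarrow> \<bar>s\<bar> < r \<longrightarrow>
       V (fst (x, t0) + w, snd (x, t0) + s) \<le> V (x, t0) + jet_poly (\<tau> - snd l) p H w s + \<theta> * (norm w)\<^sup>2 + C * s\<^sup>2"
    proof (rule local_bound_exI[of r _ "C + K"])
      fix w :: "real^'n" and s :: real assume ws: "norm w < r" "\<bar>s\<bar> < r"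
      have "V' (x', t0) + snd l * s - K * s\<^sup>2 \<le> V' (x', t0 + s)"
        using l[of "(x', t0 + s)"] by (simp add: inner_prod_def norm_Pair)
      then show "V (fst (x, t0) + w, snd (x, t0) + s) \<le> V (x, t0) + jet_poly (\<tau> - snd l) p H w s + \<theta> * (norm w)\<^sup>2 + (C + K) * s\<^sup>2"
        using C[OF ws] unfolding jet_poly_def by (simp add: algebra_simps)
    qed (rule r)
  qed
  have "\<tau> - snd l2 \<le> N * norm H1" by (rule one[OF j(1) drop[OF l2 t1(1)] t1(2)])
  moreover have "\<tau> - snd l1 \<le> N * norm H2"
    by (rule one[OF j(2) drop[OF l1] t2(2)]) (use t2(1) in \<open>simp add: add.commute\<close>)
  ultimately show ?thesis using \<tau> unfolding N_def[symmetric] by (simp add: distrib_left)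
qed

text \<open>
  Subtracting subgradients reduces a doubled maximum to \<open>coupled_max\<close>. The three expansions belong to displacements of the
  first point only, of the second point only, and to the coupled displacement; the first two identify the
  gradients and give the quadratic bounds.
\<close>

lemma doubled_max:
  fixes V1 V2 :: "(real^'n) \<times> real \<Rightarrow> real" and Ta Ua Tb Ub H H1 H2 :: "real^'n^'n"
  assumes a: "0 \<le> a" "a < 1" and K: "0 \<le> K" and \<epsilon>: "0 \<le> \<epsilon>"
    and sc: "semiconvex K V1" "semiconvex K V2" and \<rho>: "0 < \<rho>"
    and j1: "\<And>w s. norm w < \<rho> \<Longrightarrow> \<bar>s\<bar> < \<rho> \<Longrightarrow> jsub a V1 (x1 + w, t0 + s)"
    and j2: "\<And>w s. norm w < \<rho> \<Longrightarrow> \<bar>s\<bar> < \<rho> \<Longrightarrow> jsub a V2 (x2 + w, t0 + s)"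
    and p: "p1 \<noteq> 0" "p2 \<noteq> 0"
    and t1: "touch_above (\<lambda>z. V1 (x1 + fst z, t0 + snd z) + V2 (x2, t0 + snd z)) (0, 0) \<tau> p1 H1"
    and t2: "touch_above (\<lambda>z. V1 (x1, t0 + snd z) + V2 (x2 + fst z, t0 + snd z)) (0, 0) \<tau> p2 H2"
    and t3: "touch_above (\<lambda>z. V1 (x1 + Ta *v fst z, t0 + snd z) + V2 (x2 + Tb *v fst z, t0 + snd z)) (0, 0) \<tau> \<gamma> H"
      "transpose H = H"
    and Ua: "Ua ** Ta = mat 1" "\<And>X. transpose X = X \<Longrightarrow> Lop a p1 (transpose Ua ** X ** Ua) + \<epsilon> * trace (transpose Ua ** X ** Ua) = trace X"
    and Ub: "Ub ** Tb = mat 1" "\<And>X. transpose X = X \<Longrightarrow> Lop a p2 (transpose Ub ** X ** Ub) + \<epsilon> * trace (transpose Ub ** X ** Ub) = trace X"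
  shows "\<tau> \<le> trace H + 4 * \<epsilon> * K * real CARD('n)"
proof -
  obtain l1 where l1: "\<And>z. V1 (x1, t0) + l1 \<bullet> (z - (x1, t0)) - K * (norm (z - (x1, t0)))\<^sup>2 \<le> V1 z"
    using sc unfolding semiconvex_def by blast
  obtain l2 where l2: "\<And>z. V2 (x2, t0) + l2 \<bullet> (z - (x2, t0)) - K * (norm (z - (x2, t0)))\<^sup>2 \<le> V2 z"
    using sc unfolding semiconvex_def by blast
  have g: "fst l1 = p1" "fst l2 = p2" 
    using doubled_subgradient(2)[OF l1 l2, where Ta = "mat 1" and Tb = 0 and \<gamma> = p1 and H = H1] t1
      doubled_subgradient(2)[OF l1 l2, where Ta = 0 and Tb = "mat 1" and \<gamma> = p2 and H = H2] t2
    by (auto simp: transpose_mat)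
  have \<tau>: "snd l1 + snd l2 = \<tau>" and \<gamma>: "transpose Ta *v p1 + transpose Tb *v p2 = \<gamma>"
    using doubled_subgradient[OF l1 l2 t3(1)] g by auto
  define c1 c2 where "c1 = snd l1" and "c2 = snd l2"
  have l: "l1 = (p1, c1)" "l2 = (p2, c2)" using g unfolding c1_def c2_def by (auto simp: prod_eq_iff)
  define b1 where "b1 z = V1 (x1 + fst z, t0 + snd z) - V1 (x1, t0) - p1 \<bullet> fst z - c1 * snd z" for z
  define b2 where "b2 z = V2 (x2 + fst z, t0 + snd z) - V2 (x2, t0) - p2 \<bullet> fst z - c2 * snd z" for z
  have lower: "- K * ((norm w)\<^sup>2 + s\<^sup>2) \<le> b1 (w, s)" "- K * ((norm w)\<^sup>2 + s\<^sup>2) \<le> b2 (w, s)" for w s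
    using l1[of "(x1 + w, t0 + s)"] l2[of "(x2 + w, t0 + s)"] unfolding b1_def b2_def l
    by (simp_all add: inner_prod_def norm_Pair)
  have sc_b: "semiconvex K b"
    if V: "semiconvex K V" and b: "\<And>z. b z = V (x + fst z, t0 + snd z) - V (x, t0) - q \<bullet> fst z - d * snd z"
    for V b :: "(real^'n) \<times> real \<Rightarrow> real" and x q d
    unfolding semiconvex_def
  proof
    fix z0
    obtain m where m: "\<And>z. V (x + fst z0, t0 + snd z0) + m \<bullet> (z - (x + fst z0, t0 + snd z0)) - K * (norm (z - (x + fst z0, t0 + snd z0)))\<^sup>2 \<le> V z"
      using V unfolding semiconvex_def by blast
    have e: "(x + fst z, t0 + snd z) - (x + fst z0, t0 + snd z0) = z - z0" for z by (simp add: prod_eq_iff)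
    have "b z0 + (m - (q, d)) \<bullet> (z - z0) - K * (norm (z - z0))\<^sup>2 \<le> b z" for z
      using m[of "(x + fst z, t0 + snd z)"] unfolding e b by (simp add: inner_diff_left inner_diff_right inner_prod_def algebra_simps)
    then show "\<exists>l. \<forall>z. b z0 + l \<bullet> (z - z0) - K * (norm (z - z0))\<^sup>2 \<le> b z" by blast
  qed
  obtain r1 C1 where r1: "0 < r1" and C1: "\<And>w s. norm w < r1 \<Longrightarrow> \<bar>s\<bar> < r1 \<Longrightarrow>
      V1 (x1 + w, t0 + s) + V2 (x2, t0 + s) \<le> V1 (x1, t0) + V2 (x2, t0) + jet_poly \<tau> p1 H1 w s + 1 * (norm w)\<^sup>2 + C1 * s\<^sup>2"
    using t1[unfolded touch_above_def, rule_format, of 1] by auto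
  obtain r2 C2 where r2: "0 < r2" and C2: "\<And>w s. norm w < r2 \<Longrightarrow> \<bar>s\<bar> < r2 \<Longrightarrow>
      V1 (x1, t0 + s) + V2 (x2 + w, t0 + s) \<le> V1 (x1, t0) + V2 (x2, t0) + jet_poly \<tau> p2 H2 w s + 1 * (norm w)\<^sup>2 + C2 * s\<^sup>2"
    using t2[unfolded touch_above_def, rule_format, of 1] by auto
  define C where "C = \<bar>C1\<bar> + \<bar>C2\<bar> + norm H1 + norm H2 + 1 + 2 * K"
  have C: "0 \<le> C" unfolding C_def using K by simp
  define r where "r = min \<rho> (min r1 r2)"
  have r: "0 < r" unfolding r_def using \<rho> r1 r2 by simp
  have Hb: "w \<bullet> (X *v w) / 2 \<le> norm X * (norm w)\<^sup>2" for w and X :: "real^'n^'n"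
    using abs_quadratic_form_le[of w X w] mult_nonneg_nonneg[of "norm X" "(norm w)\<^sup>2"]
    by (simp add: power2_eq_square abs_le_iff)
  have ub: "b1 (w, s) \<le> C * ((norm w)\<^sup>2 + s\<^sup>2)" "b2 (w, s) \<le> C * ((norm w)\<^sup>2 + s\<^sup>2)" if ws: "norm w < r" "\<bar>s\<bar> < r" for w s
  proof -
    have n: "0 \<le> k * (norm w)\<^sup>2" "0 \<le> k * s\<^sup>2" if "0 \<le> k" for k using that by auto
    have c: "C1 * s\<^sup>2 \<le> \<bar>C1\<bar> * s\<^sup>2" "C2 * s\<^sup>2 \<le> \<bar>C2\<bar> * s\<^sup>2" by (intro mult_right_mono; simp)+
    have eq: "C * ((norm w)\<^sup>2 + s\<^sup>2) = \<bar>C1\<bar> * (norm w)\<^sup>2 + \<bar>C1\<bar> * s\<^sup>2 + \<bar>C2\<bar> * (norm w)\<^sup>2 + \<bar>C2\<bar> * s\<^sup>2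
        + norm H1 * (norm w)\<^sup>2 + norm H1 * s\<^sup>2 + norm H2 * (norm w)\<^sup>2 + norm H2 * s\<^sup>2
        + (norm w)\<^sup>2 + s\<^sup>2 + 2 * (K * (norm w)\<^sup>2) + 2 * (K * s\<^sup>2)" unfolding C_def by (simp add: algebra_simps)
    have nn: "0 \<le> \<bar>C1\<bar> * (norm w)\<^sup>2" "0 \<le> \<bar>C2\<bar> * (norm w)\<^sup>2" "0 \<le> norm H1 * (norm w)\<^sup>2" "0 \<le> norm H2 * (norm w)\<^sup>2"
      "0 \<le> K * (norm w)\<^sup>2" "0 \<le> \<bar>C1\<bar> * s\<^sup>2" "0 \<le> \<bar>C2\<bar> * s\<^sup>2" "0 \<le> norm H1 * s\<^sup>2" "0 \<le> norm H2 * s\<^sup>2"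
      "0 \<le> K * s\<^sup>2" "0 \<le> s\<^sup>2" using n K by auto
    have \<tau>s: "\<tau> * s = c1 * s + c2 * s" using \<tau> unfolding c1_def c2_def by (simp add: distrib_right[symmetric])
    have "V1 (x1 + w, t0 + s) + V2 (x2, t0 + s) \<le> V1 (x1, t0) + V2 (x2, t0) + jet_poly \<tau> p1 H1 w s + (norm w)\<^sup>2 + C1 * s\<^sup>2"
      using C1[of w s] ws unfolding r_def by simp
    then have 1: "b1 (w, s) + b2 (0, s) \<le> w \<bullet> (H1 *v w) / 2 + (norm w)\<^sup>2 + C1 * s\<^sup>2"
      unfolding b1_def b2_def jet_poly_def using \<tau>s by simp
    have "V1 (x1, t0 + s) + V2 (x2 + w, t0 + s) \<le> V1 (x1, t0) + V2 (x2, t0) + jet_poly \<tau> p2 H2 w s + (norm w)\<^sup>2 + C2 * s\<^sup>2"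
      using C2[of w s] ws unfolding r_def by simp
    then have 2: "b1 (0, s) + b2 (w, s) \<le> w \<bullet> (H2 *v w) / 2 + (norm w)\<^sup>2 + C2 * s\<^sup>2"
      unfolding b1_def b2_def jet_poly_def using \<tau>s by simp
    have lo: "- (K * s\<^sup>2) \<le> b1 (0, s)" "- (K * s\<^sup>2) \<le> b2 (0, s)" using lower(1)[of 0 s] lower(2)[of 0 s] by auto
    show "b1 (w, s) \<le> C * ((norm w)\<^sup>2 + s\<^sup>2)" using 1 lo Hb[of w H1] c nn unfolding eq by linarith
    show "b2 (w, s) \<le> C * ((norm w)\<^sup>2 + s\<^sup>2)" using 2 lo Hb[of w H2] c nn unfolding eq by linarith
  qed
  have bC: "\<bar>b1 (w, s)\<bar> \<le> C * ((norm w)\<^sup>2 + s\<^sup>2)" "\<bar>b2 (w, s)\<bar> \<le> C * ((norm w)\<^sup>2 + s\<^sup>2)" if ws: "norm w < r" "\<bar>s\<bar> < r" for w s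
  proof -
    have "K * ((norm w)\<^sup>2 + s\<^sup>2) \<le> C * ((norm w)\<^sup>2 + s\<^sup>2)" unfolding C_def using K by (intro mult_right_mono) auto
    then show "\<bar>b1 (w, s)\<bar> \<le> C * ((norm w)\<^sup>2 + s\<^sup>2)" "\<bar>b2 (w, s)\<bar> \<le> C * ((norm w)\<^sup>2 + s\<^sup>2)"
      using ub[OF ws] lower(1)[of w s] lower(2)[of w s] by (simp_all add: abs_le_iff)
  qed
  have sub: "c + d \<le> Lop a q X + 4 * norm X * norm \<xi> / norm q"
    if V: "\<And>w s. norm w < \<rho> \<Longrightarrow> \<bar>s\<bar> < \<rho> \<Longrightarrow> jsub a V (x + w, t0 + s)"
      and b: "\<And>z. b z = V (x + fst z, t0 + snd z) - V (x, t0) - q \<bullet> fst z - d * snd z"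
      and q: "q \<noteq> 0" and ws: "norm w < r" "\<bar>s\<bar> < r" and tb: "touch_above b (w, s) c \<xi> X" "transpose X = X"
    for V b :: "(real^'n) \<times> real \<Rightarrow> real" and x q d w s c \<xi> and X :: "real^'n^'n"
  proof -
    have "touch_above V (x + w, t0 + s) (d + 1 * (1 * c)) (q + 1 *\<^sub>R (transpose (mat 1) *v \<xi>)) (1 *\<^sub>R (transpose (mat 1) ** X ** mat 1))"
    proof (rule touch_above_affine[where Ca = "V (x, t0) - q \<bullet> x - d * t0" and ow = "- x" and m = "- t0" and B = b])
      show "V (y, t) = V (x, t0) - q \<bullet> x - d * t0 + q \<bullet> y + d * t + 1 * b (- x + mat 1 *v y, - t0 + 1 * t)" for y t
        unfolding b by (simp add: inner_add_right algebra_simps)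
      show "touch_above b (- x + mat 1 *v (x + w), - t0 + 1 * (t0 + s)) c \<xi> X"
        using tb(1) by (simp add: matrix_vector_right_distrib)
    qed simp
    then have t: "touch_above V (x + w, t0 + s) (d + c) (q + \<xi>) X" by (simp add: transpose_mat)
    have "jsub a V (x + w, t0 + s)" using V[of w s] ws unfolding r_def by simp
    from jsub_frozen[OF a q this t tb(2)] show ?thesis by simp
  qed
  have touch: "touch_above (\<lambda>z. b1 (Ta *v fst z, snd z) + b2 (Tb *v fst z, snd z)) (0, 0) 0 0 H"
  proof -
    have i: "p \<bullet> (T *v w) = (transpose T *v p) \<bullet> w" for T :: "real^'n^'n" and p w
      by (simp add: dot_lmul_matrix)
    have "touch_above (\<lambda>z. b1 (Ta *v fst z, snd z) + b2 (Tb *v fst z, snd z)) (0, 0)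
        (- \<tau> + 1 * (1 * \<tau>)) (- \<gamma> + 1 *\<^sub>R (transpose (mat 1) *v \<gamma>)) (1 *\<^sub>R (transpose (mat 1) ** H ** mat 1))"
    proof (rule touch_above_affine[where Ca = "- V1 (x1, t0) - V2 (x2, t0)" and ow = 0 and m = 0 and
          B = "\<lambda>z. V1 (x1 + Ta *v fst z, t0 + snd z) + V2 (x2 + Tb *v fst z, t0 + snd z)"])
      show "b1 (Ta *v fst (x, t), snd (x, t)) + b2 (Tb *v fst (x, t), snd (x, t)) = - V1 (x1, t0) - V2 (x2, t0) + - \<gamma> \<bullet> x + - \<tau> * t +
         1 * (V1 (x1 + Ta *v fst (0 + mat 1 *v x, 0 + 1 * t), t0 + snd (0 + mat 1 *v x, 0 + 1 * t)) +
              V2 (x2 + Tb *v fst (0 + mat 1 *v x, 0 + 1 * t), t0 + snd (0 + mat 1 *v x, 0 + 1 * t)))" for x t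
        unfolding b1_def b2_def \<gamma>[symmetric] \<tau>[symmetric] c1_def c2_def fst_conv snd_conv i
        by (simp add: inner_add_left algebra_simps del: transpose_matrix_vector)
      show "touch_above (\<lambda>z. V1 (x1 + Ta *v fst z, t0 + snd z) + V2 (x2 + Tb *v fst z, t0 + snd z)) (0 + mat 1 *v 0, 0 + 1 * 0) \<tau> \<gamma> H"
        using t3(1) by simp
    qed simp
    then show ?thesis by (simp add: transpose_mat)
  qed
  have "c1 + c2 \<le> trace H + 4 * \<epsilon> * K * real CARD('n)"
    by (rule coupled_max[OF a K C r \<epsilon> p(1) sc_b[OF sc(1) b1_def] bC(1) sub[OF j1 b1_def p(1)] Ua
          p(2) sc_b[OF sc(2) b2_def] bC(2) sub[OF j2 b2_def p(2)] Ub t3(2) touch])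
  then show ?thesis using \<tau> unfolding c1_def c2_def by simp
qed

section \<open>Sup-convolution\<close>

text \<open>
  Translation, time shift, addition of constants and passing to a larger function with the same value all preserve the subsolution property at a point;
  one statement serves for all of them.
\<close>

lemma jsub_translate:
  fixes v v' :: "(real^'n) \<times> real \<Rightarrow> real"
  assumes j: "jsub a v y" and d: "0 < d" and eq: "v y + k = v' z"
    and le: "\<And>w s. norm w < d \<Longrightarrow> \<bar>s\<bar> < d \<Longrightarrow> v (fst y + w, snd y + s) + k \<le> v' (fst z + w, snd z + s)"
  shows "jsub a v' z"
  unfolding jsub_def
proof (intro allI impI)
  fix c \<xi> and X :: "real^'n^'n" and b
  assume X: "transpose X = X" and t: "touch_above v' z c \<xi> X"
    and b: "\<exists>\<delta>>0. \<forall>\<eta> Y. \<eta> \<noteq> 0 \<longrightarrow> transpose Y = Y \<longrightarrow> norm (\<eta> - \<xi>) < \<delta> \<longrightarrow> norm (Y - X) < \<delta> \<longrightarrow> Lop a \<eta> Y \<le> b"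
  have "touch_above v y c \<xi> X"
    unfolding touch_above_def
  proof (intro allI impI)
    fix \<theta> :: real assume "0 < \<theta>"
    then obtain r C where r: "0 < r" and C: "\<And>w s. norm w < r \<Longrightarrow> \<bar>s\<bar> < r \<Longrightarrow>
       v' (fst z + w, snd z + s) \<le> v' z + jet_poly c \<xi> X w s + \<theta> * (norm w)\<^sup>2 + C * s\<^sup>2"
      using t unfolding touch_above_def by meson
    show "\<exists>r>0. \<exists>C. \<forall>w s. norm w < r \<longrightarrow> \<bar>s\<bar> < r \<longrightarrow>
       v (fst y + w, snd y + s) \<le> v y + jet_poly c \<xi> X w s + \<theta> * (norm w)\<^sup>2 + C * s\<^sup>2"
    proof (rule local_bound_exI[of "min r d" _ C])
      fix w :: "real^'n" and s :: real assume ws: "norm w < min r d" "\<bar>s\<bar> < min r d"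
      show "v (fst y + w, snd y + s) \<le> v y + jet_poly c \<xi> X w s + \<theta> * (norm w)\<^sup>2 + C * s\<^sup>2"
        using le[of w s] C[of w s] ws eq by simp
    qed (use r d in simp)
  qed
  then show "c \<le> b" using j X b unfolding jsub_def by blast
qed

text \<open>
  The sup-convolution of viscosity theory; the penalty is the squared distance in space and time.
\<close>

definition sup_conv :: "real \<Rightarrow> ('a::euclidean_space \<Rightarrow> real) \<Rightarrow> 'a \<Rightarrow> real" where
  "sup_conv \<alpha> W z = (SUP y. W y - (norm (z - y))\<^sup>2 / (2 * \<alpha>))"

lemma sup_conv_attained:
  fixes W :: "'a::euclidean_space \<Rightarrow> real"
  assumes W: "continuous_on UNIV W" "\<And>z. 0 \<le> W z" "\<And>z. W z \<le> 1" and \<alpha>: "0 < \<alpha>"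
  obtains y where "sup_conv \<alpha> W z = W y - (norm (z - y))\<^sup>2 / (2 * \<alpha>)" "(norm (z - y))\<^sup>2 \<le> 2 * \<alpha>"
    "\<And>y'. W y' - (norm (z - y'))\<^sup>2 / (2 * \<alpha>) \<le> sup_conv \<alpha> W z"
proof -
  define f where "f y = W y - (norm (z - y))\<^sup>2 / (2 * \<alpha>)" for y
  have "continuous_on (cball z (sqrt (2 * \<alpha>))) f"
    unfolding f_def using \<alpha> by (intro continuous_intros continuous_on_subset[OF W(1)]) auto
  then obtain y where y: "y \<in> cball z (sqrt (2 * \<alpha>))" "\<And>y'. y' \<in> cball z (sqrt (2 * \<alpha>)) \<Longrightarrow> f y' \<le> f y"
    using continuous_attains_sup[of "cball z (sqrt (2 * \<alpha>))" f] \<alpha> by (auto simp del: mem_cball)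
  have mx: "f y' \<le> f y" for y'
  proof (cases "y' \<in> cball z (sqrt (2 * \<alpha>))")
    case False
    then have "sqrt (2 * \<alpha>) < norm (z - y')" by (simp add: dist_norm)
    then have "(sqrt (2 * \<alpha>))\<^sup>2 < (norm (z - y'))\<^sup>2" using \<alpha> by (intro power_strict_mono) auto
    then have "1 < (norm (z - y'))\<^sup>2 / (2 * \<alpha>)" using \<alpha> by (simp add: pos_less_divide_eq)
    then have "f y' < 0" unfolding f_def using W(3)[of y'] by linarith
    moreover have "0 \<le> f z" unfolding f_def using W by simp
    moreover have "f z \<le> f y" using y(2)[of z] \<alpha> by simp
    ultimately show ?thesis by linarith
  qed (rule y(2))
  have eq: "sup_conv \<alpha> W z = f y"
    unfolding sup_conv_def f_def[symmetric] by (rule cSup_eq_maximum) (use mx in auto)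
  have "(norm (z - y))\<^sup>2 \<le> (sqrt (2 * \<alpha>))\<^sup>2"
    using y(1) by (intro power_mono) (auto simp: dist_norm)
  then show thesis using that[of y] eq mx \<alpha> unfolding f_def by auto
qed

lemma sup_conv_bounds:
  fixes W :: "'a::euclidean_space \<Rightarrow> real"
  assumes W: "continuous_on UNIV W" "\<And>z. 0 \<le> W z" "\<And>z. W z \<le> 1" and \<alpha>: "0 < \<alpha>"
  shows "W z \<le> sup_conv \<alpha> W z" "0 \<le> sup_conv \<alpha> W z" "sup_conv \<alpha> W z \<le> 1"
proof -
  obtain y where y: "sup_conv \<alpha> W z = W y - (norm (z - y))\<^sup>2 / (2 * \<alpha>)" "(norm (z - y))\<^sup>2 \<le> 2 * \<alpha>"
    "\<And>y'. W y' - (norm (z - y'))\<^sup>2 / (2 * \<alpha>) \<le> sup_conv \<alpha> W z"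
    by (rule sup_conv_attained[OF W \<alpha>]) blast
  show 1: "W z \<le> sup_conv \<alpha> W z" using y(3)[of z] by simp
  then show "0 \<le> sup_conv \<alpha> W z" using W(2)[of z] by linarith
  have "0 \<le> (norm (z - y))\<^sup>2 / (2 * \<alpha>)" using \<alpha> by simp
  then show "sup_conv \<alpha> W z \<le> 1" using y(1) W(3)[of y] by linarith
qed

lemma semiconvex_sup_conv:
  fixes W :: "'a::euclidean_space \<Rightarrow> real"
  assumes W: "continuous_on UNIV W" "\<And>z. 0 \<le> W z" "\<And>z. W z \<le> 1" and \<alpha>: "0 < \<alpha>"
  shows "semiconvex (1 / (2 * \<alpha>)) (sup_conv \<alpha> W)"
  unfolding semiconvex_def
proof
  fix z0
  obtain y where y: "sup_conv \<alpha> W z0 = W y - (norm (z0 - y))\<^sup>2 / (2 * \<alpha>)"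
    by (rule sup_conv_attained[OF W \<alpha>]) blast
  have "sup_conv \<alpha> W z0 + (- (1 / \<alpha>) *\<^sub>R (z0 - y)) \<bullet> (z - z0) - 1 / (2 * \<alpha>) * (norm (z - z0))\<^sup>2 \<le> sup_conv \<alpha> W z" for z
  proof -
    have "(norm (z - y))\<^sup>2 = (norm (z0 - y))\<^sup>2 + 2 * ((z0 - y) \<bullet> (z - z0)) + (norm (z - z0))\<^sup>2"
      unfolding power2_norm_eq_inner by (simp add: algebra_simps inner_commute)
    then have "W y - (norm (z - y))\<^sup>2 / (2 * \<alpha>) = sup_conv \<alpha> W z0 + (- (1 / \<alpha>) *\<^sub>R (z0 - y)) \<bullet> (z - z0) - 1 / (2 * \<alpha>) * (norm (z - z0))\<^sup>2"
      using \<alpha> unfolding y by (simp add: add_divide_distrib)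
    moreover obtain y' where "\<And>y'. W y' - (norm (z - y'))\<^sup>2 / (2 * \<alpha>) \<le> sup_conv \<alpha> W z"
      by (rule sup_conv_attained[OF W \<alpha>, of z]) blast
    ultimately show ?thesis by metis
  qed
  then show "\<exists>l. \<forall>z. sup_conv \<alpha> W z0 + l \<bullet> (z - z0) - 1 / (2 * \<alpha>) * (norm (z - z0))\<^sup>2 \<le> sup_conv \<alpha> W z" by blast
qed

text \<open>
  Translating by the vector to a maximising point \<open>y\<close> moves a function touching the sup-convolution at \<open>z\<close> to one touching \<open>W\<close> at
  \<open>y\<close>.
\<close>

lemma jsub_sup_conv:
  fixes W :: "(real^'n) \<times> real \<Rightarrow> real"
  assumes W: "continuous_on UNIV W" "\<And>z. 0 \<le> W z" "\<And>z. W z \<le> 1" and \<alpha>: "0 < \<alpha>"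
    and pos: "0 < sup_conv \<alpha> W z"
    and j: "\<And>y. (norm (z - y))\<^sup>2 \<le> 2 * \<alpha> \<Longrightarrow> 0 < W y \<Longrightarrow> jsub a W y"
  shows "jsub a (sup_conv \<alpha> W) z"
proof -
  obtain y where y: "sup_conv \<alpha> W z = W y - (norm (z - y))\<^sup>2 / (2 * \<alpha>)" "(norm (z - y))\<^sup>2 \<le> 2 * \<alpha>"
    by (rule sup_conv_attained[OF W \<alpha>]) blast
  have "0 \<le> (norm (z - y))\<^sup>2 / (2 * \<alpha>)" using \<alpha> by simp
  then have "0 < W y" using y(1) pos by linarith
  show ?thesis
  proof (rule jsub_translate[OF j[OF y(2) \<open>0 < W y\<close>], of 1 "- ((norm (z - y))\<^sup>2 / (2 * \<alpha>))"])
    fix w :: "real^'n" and s :: real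
    obtain y' where "\<And>y'. W y' - (norm ((fst z + w, snd z + s) - y'))\<^sup>2 / (2 * \<alpha>) \<le> sup_conv \<alpha> W (fst z + w, snd z + s)"
      by (rule sup_conv_attained[OF W \<alpha>, of "(fst z + w, snd z + s)"]) blast
    from this[of "(fst y + w, snd y + s)"]
    show "W (fst y + w, snd y + s) + - ((norm (z - y))\<^sup>2 / (2 * \<alpha>)) \<le> sup_conv \<alpha> W (fst z + w, snd z + s)"
      by (simp add: norm_prod_def)
  qed (use y in auto)
qed

text \<open>
  The choice of scales. Near \<open>\<Gamma>\<close> uniform continuity at the fixed times around \<open>\<tau>\<close> makes \<open>V\<close> small after the shift \<open>\<tau>\<close>, which determines
  \<open>\<rho>\<close>. Away from \<open>\<Gamma>\<close> the initial condition makes \<open>V\<close> small after the shift \<open>\<eta>\<close>, where \<open>\<eta>\<close> may depend on \<open>\<rho>\<close> and may be taken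
  arbitrarily small. The parameter of the sup-convolution is chosen last, so that its range stays below both scales. Before the
  sup-convolution \<open>V\<close> is frozen for times below \<open>\<eta> / 2\<close>, which avoids the discontinuity at time 0.
\<close>

lemma doubling_data:
  fixes V :: "(real^'n) \<times> real \<Rightarrow> real" and \<Gamma> :: "(real^'n) set"
  assumes V01: "\<And>z. 0 \<le> V z" "\<And>z. V z \<le> 1" and cont: "continuous_on (UNIV \<times> {0<..}) V"
    and jV: "\<And>x t. 0 < t \<Longrightarrow> 0 < V (x, t) \<Longrightarrow> jsub a V (x, t)"
    and \<Gamma>: "\<Gamma> \<noteq> {}" and V\<Gamma>: "\<And>x t. x \<in> \<Gamma> \<Longrightarrow> 0 < t \<Longrightarrow> V (x, t) = 0"
    and ini: "\<And>K e. compact K \<Longrightarrow> K \<inter> \<Gamma> = {} \<Longrightarrow> 0 < e \<Longrightarrow> \<exists>\<tau>>0. \<forall>x\<in>K. \<forall>t. 0 < t \<longrightarrow> t < \<tau> \<longrightarrow> V (x, t) \<le> e"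
    and \<tau>: "0 < \<tau>" and e: "0 < e" and L: "0 < L"
  obtains \<rho> where "0 < \<rho>" "\<And>\<eta>0. 0 < \<eta>0 \<Longrightarrow> \<exists>\<eta> S1 S2 K. 0 < \<eta> \<and> \<eta> < \<eta>0 \<and> 0 \<le> K \<and> semiconvex K S1 \<and> semiconvex K S2 \<and>
     (\<forall>z. S1 z \<le> 1 \<and> S2 z \<le> 1) \<and> (\<forall>x t. 0 < t \<longrightarrow> V (x, t + \<eta>) \<le> S1 (x, t) \<and> V (x, t + \<tau>) \<le> S2 (x, t)) \<and>
     (\<forall>x t. 0 \<le> t \<longrightarrow> (0 < S1 (x, t) \<longrightarrow> jsub a S1 (x, t)) \<and> (0 < S2 (x, t) \<longrightarrow> jsub a S2 (x, t))) \<and>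
     (\<forall>x y. norm (x - x1) \<le> L \<longrightarrow> norm (x - y) < \<rho> \<longrightarrow> S1 (x, 0) \<le> e \<or> S2 (y, 0) \<le> e)"
proof -
  define Q where "Q = cball x1 (L + 3) \<times> {\<tau>/2..2*\<tau>}"
  have "uniformly_continuous_on Q V"
    unfolding Q_def using \<tau>
    by (intro compact_uniformly_continuous continuous_on_subset[OF cont] compact_Times) auto
  then obtain \<delta>0 where \<delta>0: "0 < \<delta>0" "\<And>z z'. z \<in> Q \<Longrightarrow> z' \<in> Q \<Longrightarrow> dist z' z < \<delta>0 \<Longrightarrow> dist (V z') (V z) < e"
    unfolding uniformly_continuous_on_def using e by metis
  define \<delta> where "\<delta> = min \<delta>0 1"
  have \<delta>: "0 < \<delta>" "\<delta> \<le> 1" "\<delta> \<le> \<delta>0" unfolding \<delta>_def using \<delta>0 by auto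
  define G where "G = {x \<in> cball x1 (L + 1). \<delta> / 8 \<le> infdist x \<Gamma>}"
  have "closed {x. \<delta> / 8 \<le> infdist x \<Gamma>}" by (intro closed_Collect_le continuous_intros)
  moreover have "G = cball x1 (L + 1) \<inter> {x. \<delta> / 8 \<le> infdist x \<Gamma>}" unfolding G_def by auto
  ultimately have "compact G" by (metis compact_Int_closed compact_cball)
  moreover have "G \<inter> \<Gamma> = {}" unfolding G_def using \<delta> by (auto simp: infdist_zero)
  ultimately obtain \<tau>0 where \<tau>0: "0 < \<tau>0" "\<And>x t. x \<in> G \<Longrightarrow> 0 < t \<Longrightarrow> t < \<tau>0 \<Longrightarrow> V (x, t) \<le> e"
    using ini[of G e] e by auto
  show thesis
  proof (rule that[of "\<delta> / 4"])
    show "0 < \<delta> / 4" using \<delta> by simp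
    fix \<eta>0 :: real assume \<eta>0: "0 < \<eta>0"
    define \<eta> where "\<eta> = min (\<eta>0 / 2) (min (\<tau>0 / 4) (\<tau> / 2))"
    have \<eta>: "0 < \<eta>" "\<eta> < \<eta>0" "\<eta> \<le> \<tau>0 / 4" "\<eta> \<le> \<tau> / 2" unfolding \<eta>_def using \<eta>0 \<tau>0 \<tau> by auto
    define m where "m = min (\<eta> / 4) (\<delta> / 8)"
    have m: "0 < m" "m \<le> \<eta> / 4" "m \<le> \<delta> / 8" unfolding m_def using \<eta> \<delta> by auto
    define \<alpha> where "\<alpha> = m\<^sup>2 / 2"
    have \<alpha>: "0 < \<alpha>" unfolding \<alpha>_def using m by simp
    define W where "W z = V (fst z, max (snd z) (\<eta> / 2))" for z
    have W: "continuous_on UNIV W" "\<And>z. 0 \<le> W z" "\<And>z. W z \<le> 1"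
    proof -
      show "continuous_on UNIV W" unfolding W_def[abs_def]
        by (rule continuous_on_compose2[OF cont]) (use \<eta> in \<open>auto intro!: continuous_intros\<close>)
    qed (use V01 in \<open>auto simp: W_def\<close>)
    define S where "S = sup_conv \<alpha> W"
    have near: "norm (z - y) \<le> m" if "(norm (z - y))\<^sup>2 \<le> 2 * \<alpha>" for z y :: "(real^'n) \<times> real"
      by (rule power2_le_imp_le) (use that m in \<open>simp_all add: \<alpha>_def\<close>)
    have near12: "norm (fst z - fst y) \<le> m" "\<bar>snd z - snd y\<bar> \<le> m" if "(norm (z - y))\<^sup>2 \<le> 2 * \<alpha>" for z y :: "(real^'n) \<times> real"
      using near[OF that] norm_fst_le[of "fst z - fst y" "snd z - snd y"] norm_snd_le[of "snd z - snd y" "fst z - fst y"]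
      by (auto simp: minus_prod_def)
    have jW: "jsub a W y" if y: "\<eta> / 2 < snd y" "0 < W y" for y
    proof (rule jsub_translate[of a V y "snd y - \<eta> / 2" 0])
      show "jsub a V y" using jV[of "snd y" "fst y"] y \<eta> unfolding W_def by (simp add: max_def split: if_splits)
    qed (use y in \<open>auto simp: W_def abs_less_iff max_def\<close>)
    have jS: "jsub a S z" if z: "\<eta> \<le> snd z" "0 < S z" for z
      unfolding S_def
    proof (rule jsub_sup_conv[OF W \<alpha>])
      show "0 < sup_conv \<alpha> W z" using z unfolding S_def by simp
      fix y assume y: "(norm (z - y))\<^sup>2 \<le> 2 * \<alpha>" "0 < W y"
      show "jsub a W y" by (rule jW[OF _ y(2)]) (use near12(2)[OF y(1)] z m \<eta> in \<open>auto simp: abs_le_iff\<close>)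
    qed
    have S_le: "\<exists>y s. norm (x - y) \<le> m \<and> \<bar>t - s\<bar> \<le> m \<and> S (x, t) \<le> V (y, max s (\<eta> / 2))" for x t
    proof -
      obtain y where y: "sup_conv \<alpha> W (x, t) = W y - (norm ((x, t) - y))\<^sup>2 / (2 * \<alpha>)" "(norm ((x, t) - y))\<^sup>2 \<le> 2 * \<alpha>"
        by (rule sup_conv_attained[OF W \<alpha>]) blast
      have "0 \<le> (norm ((x, t) - y))\<^sup>2 / (2 * \<alpha>)" using \<alpha> by simp
      then have "S (x, t) \<le> W y" unfolding S_def using y(1) by linarith
      then show ?thesis using near12[OF y(2)] unfolding W_def by auto
    qed
    define S1 where "S1 z = S (fst z, snd z + \<eta>)" for z
    define S2 where "S2 z = S (fst z, snd z + \<tau>)" for z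
    have sc: "semiconvex (1 / (2 * \<alpha>)) (\<lambda>z. S (fst z, snd z + k))" for k
      unfolding semiconvex_def
    proof
      fix z0
      obtain l where l: "\<And>z. S (fst z0, snd z0 + k) + l \<bullet> (z - (fst z0, snd z0 + k)) - 1 / (2 * \<alpha>) * (norm (z - (fst z0, snd z0 + k)))\<^sup>2 \<le> S z"
        using semiconvex_sup_conv[OF W \<alpha>] unfolding semiconvex_def S_def by blast
      have "(fst z, snd z + k) - (fst z0, snd z0 + k) = z - z0" for z by (simp add: prod_eq_iff)
      then have "S (fst z0, snd z0 + k) + l \<bullet> (z - z0) - 1 / (2 * \<alpha>) * (norm (z - z0))\<^sup>2 \<le> S (fst z, snd z + k)" for z
        using l[of "(fst z, snd z + k)"] by simp
      then show "\<exists>l. \<forall>z. S (fst z0, snd z0 + k) + l \<bullet> (z - z0) - 1 / (2 * \<alpha>) * (norm (z - z0))\<^sup>2 \<le> S (fst z, snd z + k)" by blast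
    qed
    have jT: "jsub a (\<lambda>z. S (fst z, snd z + k)) (x, t)" if "\<eta> \<le> t + k" "0 < S (x, t + k)" for k x t
      by (rule jsub_translate[of a S "(x, t + k)" 1 0]) (use that jS in \<open>auto simp: ac_simps\<close>)
    show "\<exists>\<eta> S1 S2 K. 0 < \<eta> \<and> \<eta> < \<eta>0 \<and> 0 \<le> K \<and> semiconvex K S1 \<and> semiconvex K S2 \<and>
     (\<forall>z. S1 z \<le> 1 \<and> S2 z \<le> 1) \<and> (\<forall>x t. 0 < t \<longrightarrow> V (x, t + \<eta>) \<le> S1 (x, t) \<and> V (x, t + \<tau>) \<le> S2 (x, t)) \<and>
     (\<forall>x t. 0 \<le> t \<longrightarrow> (0 < S1 (x, t) \<longrightarrow> jsub a S1 (x, t)) \<and> (0 < S2 (x, t) \<longrightarrow> jsub a S2 (x, t))) \<and>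
     (\<forall>x y. norm (x - x1) \<le> L \<longrightarrow> norm (x - y) < \<delta> / 4 \<longrightarrow> S1 (x, 0) \<le> e \<or> S2 (y, 0) \<le> e)"
    proof (rule exI[of _ \<eta>], rule exI[of _ S1], rule exI[of _ S2], rule exI[of _ "1 / (2 * \<alpha>)"], intro conjI allI impI)
      show "semiconvex (1 / (2 * \<alpha>)) S1" "semiconvex (1 / (2 * \<alpha>)) S2"
        unfolding S1_def[abs_def] S2_def[abs_def] by (rule sc)+
      show "S1 z \<le> 1" "S2 z \<le> 1" for z
        unfolding S1_def S2_def S_def by (rule sup_conv_bounds(3)[OF W \<alpha>])+
      show "jsub a S1 (x, t)" if "0 \<le> t" "0 < S1 (x, t)" for x t
        using jT[of t \<eta> x] that unfolding S1_def[abs_def] by simp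
      show "jsub a S2 (x, t)" if "0 \<le> t" "0 < S2 (x, t)" for x t
        using jT[of t \<tau> x] that \<eta> \<tau> unfolding S2_def[abs_def] by simp
      show "V (x, t + \<eta>) \<le> S1 (x, t)" if "0 < t" for x t
        using sup_conv_bounds(1)[OF W \<alpha>, of "(x, t + \<eta>)"] that \<eta> unfolding S1_def S_def W_def by simp
      show "V (x, t + \<tau>) \<le> S2 (x, t)" if "0 < t" for x t
        using sup_conv_bounds(1)[OF W \<alpha>, of "(x, t + \<tau>)"] that \<eta> \<tau> unfolding S2_def S_def W_def by simp
      fix x y assume x: "norm (x - x1) \<le> L" and xy: "norm (x - y) < \<delta> / 4"
      show "S1 (x, 0) \<le> e \<or> S2 (y, 0) \<le> e"
      proof (cases "infdist y \<Gamma> < \<delta> / 2")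
        case True
        obtain y' s where y': "norm (y - y') \<le> m" "\<bar>\<tau> - s\<bar> \<le> m" "S (y, \<tau>) \<le> V (y', max s (\<eta> / 2))"
          using S_le by blast
        obtain q where q: "q \<in> \<Gamma>" "dist y q < \<delta> / 2"
        proof -
          show thesis
            using that cInf_lessD[of "dist y ` \<Gamma>" "\<delta> / 2"] True \<Gamma> unfolding infdist_notempty[OF \<Gamma>] by auto
        qed
        have s: "\<tau> / 2 \<le> s" "s \<le> 2 * \<tau>" "\<eta> / 2 \<le> s" using y'(2) m \<eta> \<tau> by (auto simp: abs_le_iff)
        have n1: "norm (y - x1) \<le> L + 1"
          using norm_triangle_ineq[of "y - x" "x - x1"] x xy \<delta> by (simp add: norm_minus_commute)
        have n2: "norm (y' - x1) \<le> L + 2"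
          using norm_triangle_ineq[of "y' - y" "y - x1"] n1 y'(1) m \<delta> by (simp add: norm_minus_commute)
        have n3: "norm (q - x1) \<le> L + 2"
          using norm_triangle_ineq[of "q - y" "y - x1"] n1 q(2) \<delta> by (simp add: norm_minus_commute dist_norm)
        have "dist (y', s) (q, s) = norm (y' - q)" by (simp add: dist_Pair_Pair dist_norm)
        also have "\<dots> \<le> norm (y' - y) + norm (y - q)" using norm_triangle_ineq[of "y' - y" "y - q"] by simp
        also have "\<dots> < \<delta>0" using y'(1) q(2) m \<delta> by (simp add: norm_minus_commute dist_norm)
        finally have "dist (V (y', s)) (V (q, s)) < e"
          by (intro \<delta>0(2)) (use n2 n3 s in \<open>auto simp: Q_def dist_norm norm_minus_commute\<close>)
        then have "V (y', s) \<le> e" using V\<Gamma>[OF q(1), of s] s \<tau> by (simp add: dist_real_def)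
        moreover have "max s (\<eta> / 2) = s" using s by simp
        ultimately show ?thesis using y'(3) unfolding S2_def by simp
      next
        case False
        obtain x' s where x': "norm (x - x') \<le> m" "\<bar>\<eta> - s\<bar> \<le> m" "S (x, \<eta>) \<le> V (x', max s (\<eta> / 2))"
          using S_le by blast
        have "infdist y \<Gamma> \<le> infdist x \<Gamma> + dist y x" "infdist x \<Gamma> \<le> infdist x' \<Gamma> + dist x x'"
          by (rule infdist_triangle)+
        then have "\<delta> / 8 \<le> infdist x' \<Gamma>" using False xy x'(1) m by (simp add: dist_norm norm_minus_commute)
        moreover have "norm (x' - x1) \<le> L + 1"
          using norm_triangle_ineq[of "x' - x" "x - x1"] x x'(1) m \<delta> by (simp add: norm_minus_commute)
        ultimately have "x' \<in> G" unfolding G_def by (simp add: dist_norm norm_minus_commute)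
        moreover have "max s (\<eta> / 2) < \<tau>0" using x'(2) m \<eta> \<tau>0(1) by (auto simp: abs_le_iff)
        ultimately have "V (x', max s (\<eta> / 2)) \<le> e" using \<eta> by (intro \<tau>0(2)) auto
        then show ?thesis using x'(3) unfolding S1_def by simp
      qed
    qed (use \<eta> \<alpha> in auto)
  qed
qed

section \<open>Frozen coefficients and the doubling kernel\<close>

text \<open>
  The symmetric matrix with eigenvalue \<open>c\<close> in the unit direction \<open>n\<close> and \<open>b\<close> on its orthogonal complement.
\<close>

definition stretch :: "real \<Rightarrow> real \<Rightarrow> real^'n \<Rightarrow> real^'n^'n" where
  "stretch b c n = b *\<^sub>R mat 1 + (c - b) *\<^sub>R tensor n n"

lemma transpose_stretch [simp]: "transpose (stretch b c n) = stretch b c n"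
  unfolding stretch_def by (simp add: transpose_plus transpose_scale transpose_tensor transpose_mat)

lemma stretch_vector: "stretch b c n *v w = b *\<^sub>R w + ((c - b) * (n \<bullet> w)) *\<^sub>R n"
  unfolding stretch_def
  by (simp add: matrix_vector_mult_add_rdistrib scaleR_matrix_vector_assoc[symmetric] tensor_vector)

lemma stretch_mult:
  assumes "norm n = 1"
  shows "stretch b c n ** stretch b' c' n = stretch (b * b') (c * c') n"
proof -
  have n: "n \<bullet> n = 1" using assms by (simp add: power2_norm_eq_inner[symmetric])
  have "(stretch b c n ** stretch b' c' n) *v w = stretch (b * b') (c * c') n *v w" for w
    unfolding matrix_vector_mul_assoc[symmetric] stretch_vector
    by (simp add: inner_add_right n scaleR_add_right algebra_simps)
  then show ?thesis by (simp add: matrix_eq)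
qed

lemma stretch_one: "stretch 1 1 n = mat 1"
  unfolding stretch_def by simp

lemma trace_cyclic: "trace ((A :: real^'n^'n) ** B) = trace (B ** A)"
  by (rule trace_mul_sym)

lemma trace_mult_tensor: "trace ((A :: real^'n^'n) ** tensor x y) = y \<bullet> (A *v x)"
proof -
  have "A ** tensor x y = tensor (A *v x) y"
    by (simp add: vec_eq_iff matrix_matrix_mult_def tensor_def matrix_vector_mult_def sum_distrib_right mult.assoc)
  then show ?thesis by (simp add: trace_tensor inner_commute)
qed

text \<open>
  The change of variables \<open>x = stretch b c n *v w\<close> turns the operator frozen at a gradient
  parallel to \<open>n\<close>, regularised by \<open>\<epsilon>\<close> times the Laplacian, into the Laplacian.
\<close>

lemma Lop_stretch:
  fixes X :: "real^'n^'n"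
  assumes n: "norm n = 1" and p: "p = k *\<^sub>R n" "k \<noteq> 0" and bc: "b \<noteq> 0" "c \<noteq> 0"
    and b: "b\<^sup>2 = a + \<epsilon>" and c: "c\<^sup>2 = 1 - a + \<epsilon>"
  shows "Lop a p (transpose (stretch (1 / b) (1 / c) n) ** X ** stretch (1 / b) (1 / c) n)
      + \<epsilon> * trace (transpose (stretch (1 / b) (1 / c) n) ** X ** stretch (1 / b) (1 / c) n) = trace X"
proof -
  define U where "U = stretch (1 / b) (1 / c) n"
  have nn: "n \<bullet> n = 1" using n by (simp add: power2_norm_eq_inner[symmetric])
  have tU: "transpose U = U" unfolding U_def by simp
  have Un: "U *v n = (1 / c) *\<^sub>R n" unfolding U_def stretch_vector by (simp add: nn scaleR_add_left[symmetric])
  have UU: "U ** U = stretch (1 / b\<^sup>2) (1 / c\<^sup>2) n"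
    unfolding U_def stretch_mult[OF n] by (simp add: power2_eq_square)
  have "trace (U ** X ** U) = trace (X ** (U ** U))"
    by (metis matrix_mul_assoc trace_cyclic)
  also have "X ** (U ** U) = (1 / b\<^sup>2) *\<^sub>R X + (1 / c\<^sup>2 - 1 / b\<^sup>2) *\<^sub>R (X ** tensor n n)"
    unfolding UU stretch_def by (simp add: matrix_add_ldistrib matrix_scalar_ac scalar_matrix_assoc[symmetric])
  finally have tr: "trace (U ** X ** U) = (1 / b\<^sup>2) * trace X + (1 / c\<^sup>2 - 1 / b\<^sup>2) * (n \<bullet> (X *v n))"
    by (simp add: trace_plus trace_mult_tensor)
  have nU: "n \<bullet> ((U ** X ** U) *v n) = (1 / c\<^sup>2) * (n \<bullet> (X *v n))"
  proof -
    have "(U ** X ** U) *v n = (1 / c) *\<^sub>R (U *v (X *v n))"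
      by (simp only: matrix_vector_mul_assoc[symmetric] Un matrix_vector_mult_scaleR)
    moreover have "n \<bullet> (U *v (X *v n)) = (U *v n) \<bullet> (X *v n)" using symmetric_inner[OF tU, of n "X *v n"] by (simp add: inner_commute)
    ultimately show ?thesis unfolding Un by (simp add: power2_eq_square)
  qed
  have sg: "sgn p \<bullet> (Y *v sgn p) = n \<bullet> (Y *v n)" for Y :: "real^'n^'n"
  proof -
    have "sgn p = sgn k *\<^sub>R n" unfolding p(1) by (simp add: sgn_scaleR sgn_div_norm[of n] n)
    moreover have "sgn k * sgn k = 1" using p(2) by (simp add: sgn_if)
    ultimately show ?thesis by (simp add: matrix_vector_mult_scaleR mult.assoc[symmetric])
  qed
  have b0: "b\<^sup>2 \<noteq> 0" "c\<^sup>2 \<noteq> 0" using bc by auto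
  have e1: "(a + \<epsilon>) * (1 / b\<^sup>2) = 1" using b b0 by simp
  have e2: "(a + \<epsilon>) * (1 / c\<^sup>2 - 1 / b\<^sup>2) + (1 - 2 * a) * (1 / c\<^sup>2) = 0"
  proof -
    have "(a + \<epsilon>) * (1 / c\<^sup>2) + (1 - 2 * a) * (1 / c\<^sup>2) = c\<^sup>2 * (1 / c\<^sup>2)" unfolding c by (simp add: algebra_simps add_divide_distrib[symmetric] diff_divide_distrib[symmetric])
    then show ?thesis using e1 b0 by (simp add: algebra_simps)
  qed
  have "Lop a p (U ** X ** U) + \<epsilon> * trace (U ** X ** U)
     = ((a + \<epsilon>) * (1 / b\<^sup>2)) * trace X + ((a + \<epsilon>) * (1 / c\<^sup>2 - 1 / b\<^sup>2) + (1 - 2 * a) * (1 / c\<^sup>2)) * (n \<bullet> (X *v n))"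
    unfolding Lop_sgn sg nU tr by (simp only: algebra_simps)
  then show ?thesis unfolding e1 e2 U_def[symmetric] tU by simp
qed

lemma matrix_add_right: "((A :: real^'n^'n) + B) ** C = A ** C + B ** C"
  by (simp add: vec_eq_iff matrix_matrix_mult_def sum.distrib distrib_right)

text \<open>
  Both traces are cyclic rearrangements: \<open>trace (M\<^sup>T M)\<close> is the squared Frobenius norm and the rank-one term becomes a
  quadratic form.
\<close>

lemma trace_congruence:
  fixes M :: "real^'n^'n"
  shows "trace (transpose M ** (\<alpha> *\<^sub>R mat 1 + \<beta> *\<^sub>R tensor q q) ** M) = \<alpha> * (norm M)\<^sup>2 + \<beta> * (norm (transpose M *v q))\<^sup>2"
proof -
  have "transpose M ** (\<alpha> *\<^sub>R mat 1 + \<beta> *\<^sub>R tensor q q) ** M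
      = \<alpha> *\<^sub>R (transpose M ** M) + \<beta> *\<^sub>R (transpose M ** tensor q q ** M)"
    by (simp add: matrix_add_ldistrib matrix_add_right matrix_scalar_ac scalar_matrix_assoc[symmetric])
  moreover have "trace (transpose M ** M) = (norm M)\<^sup>2"
  proof -
    have "trace (transpose M ** M) = (\<Sum>i\<in>UNIV. \<Sum>k\<in>UNIV. M $ k $ i * M $ k $ i)"
      unfolding trace_def by (simp add: matrix_matrix_mult_def transpose_def)
    also have "\<dots> = (\<Sum>k\<in>UNIV. \<Sum>i\<in>UNIV. M $ k $ i * M $ k $ i)" by (rule sum.swap)
    also have "\<dots> = (norm M)\<^sup>2" unfolding power2_norm_eq_inner inner_vec_def by simp
    finally show ?thesis .
  qed
  moreover have "trace (transpose M ** tensor q q ** M) = (norm (transpose M *v q))\<^sup>2"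
  proof -
    have "trace (transpose M ** tensor q q ** M) = trace (M ** transpose M ** tensor q q)"
      by (metis matrix_mul_assoc trace_cyclic)
    also have "\<dots> = q \<bullet> (M *v (transpose M *v q))" by (simp only: trace_mult_tensor matrix_vector_mul_assoc)
    also have "\<dots> = (transpose M *v q) \<bullet> (transpose M *v q)" by (simp add: dot_lmul_matrix[symmetric])
    finally show ?thesis by (simp add: power2_norm_eq_inner)
  qed
  ultimately show ?thesis by (simp add: trace_plus)
qed

lemma norm_tensor_diff_le:
  fixes m n :: "real^'n"
  assumes "norm m = 1" "norm n = 1"
  shows "norm (tensor m m - tensor n n) \<le> 2 * norm (m - n)"
proof -
  have "tensor m m - tensor n n = tensor (m - n) m + tensor n (m - n)"
    by (simp add: vec_eq_iff tensor_def algebra_simps)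
  then have "norm (tensor m m - tensor n n) \<le> norm (tensor (m - n) m) + norm (tensor n (m - n))"
    by (metis norm_triangle_ineq)
  then show ?thesis using assms by (simp add: norm_tensor)
qed

text \<open>
  The first summand depends on the distance \<open>r\<close> through \<open>r ^ 4 / s\<^sup>2\<close> with \<open>s = t + \<mu>\<close>, regularised by \<open>\<kappa> * sqrt s\<close>. It grows only like
  \<open>sqrt r\<close>, so that it is concave in the radial direction at distances that are large on the scale of the regularisation. The small exponent makes
  the radial second derivative, of relative size \<open>12 - 14 * z / G\<close>, negative there. The second summand has a time derivative that absorbs the errors in the
  remaining region.
\<close>

definition kernel :: "real \<Rightarrow> real \<Rightarrow> real \<Rightarrow> real \<Rightarrow> (real^'n) \<times> real \<Rightarrow> real" where
  "kernel C D \<kappa> \<mu> z = C * ((fst z \<bullet> fst z)\<^sup>2 / (snd z + \<mu>)\<^sup>2 + \<kappa> * sqrt (snd z + \<mu>)) powr (1 / 8)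
     + D * (\<kappa> * sqrt (snd z + \<mu>)) powr (1 / 8)"

lemma taylor2_powr:
  assumes y: "0 < y"
  shows "taylor2 (\<lambda>x. x powr (1 / 8)) y (y powr (- 7 / 8) / 8) (- 7 / 64 * (y powr (- 7 / 8) / y))"
proof -
  have d: "((\<lambda>x. x powr (1 / 8)) has_real_derivative x powr (- 7 / 8) / 8) (at x)" if "0 < x" for x :: real
    using that by (auto intro!: derivative_eq_intros)
  have d2: "((\<lambda>x. x powr (- 7 / 8) / 8) has_real_derivative - 7 / 64 * (y powr (- 7 / 8) / y)) (at y)"
    using y powr_diff[of y "- (7 / 8)" 1] by (auto intro!: derivative_eq_intros)
  show ?thesis
    by (rule taylor2_DERIV[of y y _ "\<lambda>x. x powr (- 7 / 8) / 8"]) (use y d d2 in \<open>auto simp: abs_less_iff\<close>)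
qed

text \<open>
  In the variable \<open>v = r\<^sup>2 / s\<close> all derivatives are multiples of \<open>Y\<close>; the coefficient of the rank-one part
  changes sign near \<open>v\<^sup>2 = 4 * G / 7\<close>.
\<close>

lemma kernel_jet:
  fixes q :: "real^'n"
  assumes s: "0 < t + \<mu>" and \<kappa>: "0 < \<kappa>"
    and k: "k = \<kappa> * sqrt (t + \<mu>)" and v: "v = (q \<bullet> q) / (t + \<mu>)" and G: "G = v\<^sup>2 + k"
    and Y: "Y = C / 8 * G powr (- 7 / 8) / (t + \<mu>)"
  shows "has_jet (kernel C D \<kappa> \<mu>) (q, t) (Y * (k / 2 - 2 * v\<^sup>2) + D / 16 * k powr (1 / 8) / (t + \<mu>))
     ((4 * Y * v) *\<^sub>R q) ((4 * Y * v) *\<^sub>R mat 1 + (Y / (t + \<mu>) * (8 - 14 * v\<^sup>2 / G)) *\<^sub>R tensor q q)"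
proof -
  define s where "s = t + \<mu>"
  have s0: "0 < s" unfolding s_def by (rule s)
  have k0: "0 < k" unfolding k using \<kappa> s by simp
  have G0: "0 < G" unfolding G using k0 by (simp add: add_nonneg_pos)
  have js: "has_jet (\<lambda>z. snd z + \<mu>) (q, t) 1 0 0"
    by (rule has_jet_add_const[OF has_jet_time])
  have ji: "has_jet (\<lambda>z :: (real^'n) \<times> real. 1 / (snd z + \<mu>)\<^sup>2) (q, t) (- 2 / s ^ 3) 0 0"
  proof -
    have d: "((\<lambda>x. 1 / x\<^sup>2) has_real_derivative - 2 / x ^ 3) (at x)" if "0 < x" for x :: real
      using that by (auto intro!: derivative_eq_intros simp: power2_eq_square power3_eq_cube field_simps)
    have d2: "((\<lambda>x. - 2 / x ^ 3) has_real_derivative 6 / s ^ 4) (at s)"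
      using s0 by (auto intro!: derivative_eq_intros simp: power4_eq_xxxx power2_eq_square power3_eq_cube field_simps)
    have "taylor2 (\<lambda>x. 1 / x\<^sup>2) (snd (q, t) + \<mu>) (- 2 / s ^ 3) (6 / s ^ 4)"
      unfolding snd_conv s_def[symmetric]
      by (rule taylor2_DERIV[of s s _ "\<lambda>x. - 2 / x ^ 3"]) (use s0 d d2 in \<open>auto simp: abs_less_iff\<close>)
    from has_jet_compose[OF js this] show ?thesis by (simp add: tensor_def zero_vec_def[symmetric])
  qed
  have jk: "has_jet (\<lambda>z :: (real^'n) \<times> real. \<kappa> * sqrt (snd z + \<mu>)) (q, t) (k / (2 * s)) 0 0"
  proof -
    have d: "(sqrt has_real_derivative (inverse (sqrt x) / 2)) (at x)" if "0 < x" for x :: real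
      by (rule DERIV_real_sqrt[OF that])
    have d2: "((\<lambda>x. inverse (sqrt x) / 2) has_real_derivative (- (inverse (sqrt s) * (inverse (sqrt s) / 2) * inverse (sqrt s)) / 2)) (at s)"
      using s0 by (auto intro!: derivative_eq_intros)
    have "taylor2 sqrt (snd (q, t) + \<mu>) (inverse (sqrt s) / 2) (- (inverse (sqrt s) * (inverse (sqrt s) / 2) * inverse (sqrt s)) / 2)"
      unfolding snd_conv s_def[symmetric]
      by (rule taylor2_DERIV[of s s _ "\<lambda>x. inverse (sqrt x) / 2"]) (use s0 d d2 in \<open>auto simp: abs_less_iff\<close>)
    from has_jet_cmult[OF has_jet_compose[OF js this], of \<kappa>]
    have "has_jet (\<lambda>z :: (real^'n) \<times> real. \<kappa> * sqrt (snd z + \<mu>)) (q, t) (\<kappa> * (inverse (sqrt s) / 2)) 0 0"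
      by (simp add: tensor_def zero_vec_def[symmetric])
    moreover have "\<kappa> * (inverse (sqrt s) / 2) = k / (2 * s)"
      unfolding k s_def[symmetric] using s0 by (simp add: field_simps)
    ultimately show ?thesis by (simp only:)
  qed
  define r where "r = q \<bullet> q"
  have jq: "has_jet (\<lambda>z. (fst z \<bullet> fst z)\<^sup>2) (q, t) 0 ((4 * r) *\<^sub>R q) ((4 * r) *\<^sub>R mat 1 + 8 *\<^sub>R tensor q q)"
  proof -
    have "has_jet (\<lambda>z. fst z \<bullet> fst z) (q, t) 0 (2 *\<^sub>R q) (2 *\<^sub>R mat 1)"
      using has_jet_dist_square[of 0 "(q, t)"] by simp
    from has_jet_square[OF this] show ?thesis
      by (simp add: r_def tensor_scaleR_left tensor_scaleR_right)
  qed
  have v2: "v\<^sup>2 = r\<^sup>2 / s\<^sup>2" unfolding v s_def[symmetric] r_def by (simp add: power_divide)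
  have t0: "tensor x (0 :: real^'n) = 0" "tensor (0 :: real^'n) x = 0" for x :: "real^'n" by (simp_all add: vec_eq_iff tensor_def)
  have jG: "has_jet (\<lambda>z. (fst z \<bullet> fst z)\<^sup>2 / (snd z + \<mu>)\<^sup>2 + \<kappa> * sqrt (snd z + \<mu>)) (q, t)
     ((k / 2 - 2 * v\<^sup>2) / s) ((4 * r / s\<^sup>2) *\<^sub>R q) ((4 * r / s\<^sup>2) *\<^sub>R mat 1 + (8 / s\<^sup>2) *\<^sub>R tensor q q)"
  proof (rule has_jet_cong[OF has_jet_add[OF has_jet_mult[OF jq ji] jk]], goal_cases)
    case 2
    show ?case unfolding fst_conv snd_conv s_def[symmetric] r_def[symmetric] v2
      using s0 by (simp add: field_simps power2_eq_square power3_eq_cube)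
  next
    case 3
    show ?case unfolding fst_conv snd_conv s_def[symmetric] r_def[symmetric] by simp
  next
    case 4
    show ?case unfolding fst_conv snd_conv s_def[symmetric] r_def[symmetric]
      by (simp add: t0 scaleR_add_right)
  qed simp
  have Geq: "(fst (q, t) \<bullet> fst (q, t))\<^sup>2 / (snd (q, t) + \<mu>)\<^sup>2 + \<kappa> * sqrt (snd (q, t) + \<mu>) = G"
    unfolding G v2 k by (simp add: r_def s_def)
  define g where "g = G powr (- 7 / 8)"
  have j1: "has_jet (\<lambda>z. C * ((fst z \<bullet> fst z)\<^sup>2 / (snd z + \<mu>)\<^sup>2 + \<kappa> * sqrt (snd z + \<mu>)) powr (1 / 8)) (q, t)
     (C * (g / 8 * ((k / 2 - 2 * v\<^sup>2) / s))) (C *\<^sub>R (g / 8) *\<^sub>R (4 * r / s\<^sup>2) *\<^sub>R q)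
     (C *\<^sub>R ((g / 8) *\<^sub>R ((4 * r / s\<^sup>2) *\<^sub>R mat 1 + (8 / s\<^sup>2) *\<^sub>R tensor q q) + (- 7 / 64 * (g / G)) *\<^sub>R tensor ((4 * r / s\<^sup>2) *\<^sub>R q) ((4 * r / s\<^sup>2) *\<^sub>R q)))"
    unfolding g_def by (intro has_jet_cmult has_jet_compose[OF jG]) (unfold Geq, rule taylor2_powr[OF G0])
  have j2: "has_jet (\<lambda>z. D * (\<kappa> * sqrt (snd z + \<mu>)) powr (1 / 8)) (q, t) (D * (k powr (- 7 / 8) / 8 * (k / (2 * s)))) 0 0"
  proof -
    have "taylor2 (\<lambda>x. x powr (1 / 8)) (\<kappa> * sqrt (snd (q, t) + \<mu>)) (k powr (- 7 / 8) / 8) (- 7 / 64 * (k powr (- 7 / 8) / k))"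
      unfolding snd_conv k[symmetric] by (rule taylor2_powr[OF k0])
    from has_jet_cmult[OF has_jet_compose[OF jk this], of D] show ?thesis by (simp add: t0)
  qed
  have kp: "k powr (- 7 / 8) * k = k powr (1 / 8)"
    using powr_add[of k "- 7 / 8" 1] k0 by simp
  have Yg: "Y = C / 8 * g / s" unfolding Y g_def s_def ..
  have vs: "v = r / s" unfolding v r_def s_def ..
  show ?thesis
    unfolding kernel_def[abs_def] s_def[symmetric]
  proof (rule has_jet_cong[OF has_jet_add[OF j1 j2]])
    show "C * (g / 8 * ((k / 2 - 2 * v\<^sup>2) / s)) + D * (k powr (- 7 / 8) / 8 * (k / (2 * s))) = Y * (k / 2 - 2 * v\<^sup>2) + D / 16 * k powr (1 / 8) / s"
      unfolding Yg kp[symmetric] by (simp add: field_simps)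
    show "C *\<^sub>R (g / 8) *\<^sub>R (4 * r / s\<^sup>2) *\<^sub>R q + 0 = (4 * Y * v) *\<^sub>R q"
      unfolding Yg vs by (simp add: power2_eq_square)
    have e1: "C * (g / 8 * (4 * r / s\<^sup>2)) = 4 * Y * v" unfolding Yg vs by (simp add: power2_eq_square)
    have e2: "C * (g / 8 * (8 / s\<^sup>2)) + C * (- 7 / 64 * (g / G) * ((4 * r / s\<^sup>2) * (4 * r / s\<^sup>2))) = Y / s * (8 - 14 * v\<^sup>2 / G)"
      unfolding Yg v2 using s0 G0 by (simp add: field_simps power2_eq_square)
    have "C *\<^sub>R ((g / 8) *\<^sub>R ((4 * r / s\<^sup>2) *\<^sub>R mat 1 + (8 / s\<^sup>2) *\<^sub>R tensor q q) + (- 7 / 64 * (g / G)) *\<^sub>R tensor ((4 * r / s\<^sup>2) *\<^sub>R q) ((4 * r / s\<^sup>2) *\<^sub>R q))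
       = (C * (g / 8 * (4 * r / s\<^sup>2))) *\<^sub>R mat 1 + (C * (g / 8 * (8 / s\<^sup>2)) + C * (- 7 / 64 * (g / G) * ((4 * r / s\<^sup>2) * (4 * r / s\<^sup>2)))) *\<^sub>R tensor q q"
      unfolding tensor_scaleR_left tensor_scaleR_right scaleR_add_right scaleR_add_left scaleR_scaleR by simp
    then show "C *\<^sub>R ((g / 8) *\<^sub>R ((4 * r / s\<^sup>2) *\<^sub>R mat 1 + (8 / s\<^sup>2) *\<^sub>R tensor q q) + (- 7 / 64 * (g / G)) *\<^sub>R tensor ((4 * r / s\<^sup>2) *\<^sub>R q) ((4 * r / s\<^sup>2) *\<^sub>R q)) + 0
       = (4 * Y * v) *\<^sub>R mat 1 + (Y / s * (8 - 14 * v\<^sup>2 / G)) *\<^sub>R tensor q q"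
      unfolding e1 e2 by simp
  qed (simp add: fun_eq_iff)
qed

section \<open>The doubling kernel admits no interior maximum\<close>

lemma transpose_congruence:
  fixes Z M :: "real^'n^'n"
  assumes "transpose Z = Z"
  shows "transpose (transpose M ** Z ** M) = transpose M ** Z ** M"
  by (simp add: matrix_transpose_mul assms matrix_mul_assoc)

text \<open>
  A local maximum of the doubled function yields an expansion along every pair of linear displacements, with the kernel entering
  through the difference of the displacements.
\<close>

lemma kernel_touch:
  fixes S1 S2 :: "(real^'n) \<times> real \<Rightarrow> real" and Ta Tb Z :: "real^'n^'n"
  assumes r: "0 < r" and t: "t < Te"
    and mx: "\<And>w w' s. norm w < r \<Longrightarrow> norm w' < r \<Longrightarrow> \<bar>s\<bar> < r \<Longrightarrow>
      S1 (x + w, t + s) + S2 (y + w', t + s) - (\<Psi> (x - y + (w - w'), t + s) + (x + w - xc) \<bullet> (x + w - xc) / L\<^sup>2 + \<delta> / (Te - (t + s)))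
      \<le> S1 (x, t) + S2 (y, t) - (\<Psi> (x - y, t) + (x - xc) \<bullet> (x - xc) / L\<^sup>2 + \<delta> / (Te - t))"
    and \<Psi>: "has_jet \<Psi> (x - y, t) c \<xi> Z"
  shows "touch_above (\<lambda>z. S1 (x + Ta *v fst z, t + snd z) + S2 (y + Tb *v fst z, t + snd z)) (0, 0)
     (c + \<delta> / (Te - t)\<^sup>2) (transpose (Ta - Tb) *v \<xi> + transpose Ta *v ((2 / L\<^sup>2) *\<^sub>R (x - xc)))
     (transpose (Ta - Tb) ** Z ** (Ta - Tb) + transpose Ta ** ((2 / L\<^sup>2) *\<^sub>R mat 1) ** Ta)"
proof -
  define f where "f z = \<Psi> (x - y + (Ta - Tb) *v fst z, t + 1 * snd z) + ((\<lambda>z. 1 / L\<^sup>2 * ((fst z - xc) \<bullet> (fst z - xc))) (x + Ta *v fst z, t + 1 * snd z)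
      + (\<lambda>z. \<delta> / (Te - snd z)) (0 + (0 :: real^'n^'n) *v fst z, t + 1 * snd z))" for z :: "(real^'n) \<times> real"
  have jq: "has_jet (\<lambda>z. 1 / L\<^sup>2 * ((fst z - xc) \<bullet> (fst z - xc))) (x, t) 0 ((2 / L\<^sup>2) *\<^sub>R (x - xc)) ((2 / L\<^sup>2) *\<^sub>R mat 1)"
    using has_jet_cmult[OF has_jet_dist_square[of xc "(x, t)"], of "1 / L\<^sup>2"] by simp
  have jp: "has_jet (\<lambda>z. \<delta> / (Te - snd z)) (0 :: real^'n, t) (\<delta> / (Te - t)\<^sup>2) 0 0"
    using has_jet_end_penalty[of "(0, t)" Te \<delta>] t by simp
  have j: "has_jet f (0, 0) (1 * c + (1 * 0 + 1 * (\<delta> / (Te - t)\<^sup>2)))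
     (transpose (Ta - Tb) *v \<xi> + (transpose Ta *v ((2 / L\<^sup>2) *\<^sub>R (x - xc)) + transpose (0 :: real^'n^'n) *v 0))
     (transpose (Ta - Tb) ** Z ** (Ta - Tb) + (transpose Ta ** ((2 / L\<^sup>2) *\<^sub>R mat 1) ** Ta + transpose (0 :: real^'n^'n) ** (0 :: real^'n^'n) ** 0))"
  proof -
    have 1: "has_jet \<Psi> (x - y + (Ta - Tb) *v 0, t + 1 * 0) c \<xi> Z" using \<Psi> by simp
    have 2: "has_jet (\<lambda>z. 1 / L\<^sup>2 * ((fst z - xc) \<bullet> (fst z - xc))) (x + Ta *v 0, t + 1 * 0) 0 ((2 / L\<^sup>2) *\<^sub>R (x - xc)) ((2 / L\<^sup>2) *\<^sub>R mat 1)"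
      using jq by simp
    have 3: "has_jet (\<lambda>z. \<delta> / (Te - snd z)) (0 + (0 :: real^'n^'n) *v 0, t + 1 * 0) (\<delta> / (Te - t)\<^sup>2) 0 0" using jp by simp
    show ?thesis unfolding f_def[abs_def]
      by (rule has_jet_add[OF has_jet_affine[OF 1] has_jet_add[OF has_jet_affine[OF 2] has_jet_affine[OF 3]]])
  qed
  define A where "A = norm Ta + norm Tb + 1"
  have A: "0 < A" "1 \<le> A" unfolding A_def by (auto simp: add_nonneg_pos)
  have bnd: "norm (Ta *v w) < r" "norm (Tb *v w) < r" if "norm w < r / A" for w
  proof -
    have w: "A * norm w < r" using that A by (simp add: field_simps)
    have "norm (Ta *v w) \<le> A * norm w" "norm (Tb *v w) \<le> A * norm w"
      using norm_matrix_vector_le[of Ta w] norm_matrix_vector_le[of Tb w]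
        mult_right_mono[of "norm Ta" A "norm w"] mult_right_mono[of "norm Tb" A "norm w"] unfolding A_def by auto
    then show "norm (Ta *v w) < r" "norm (Tb *v w) < r" using w by auto
  qed
  have "touch_above (\<lambda>z. S1 (x + Ta *v fst z, t + snd z) + S2 (y + Tb *v fst z, t + snd z)) (0, 0)
     (1 * c + (1 * 0 + 1 * (\<delta> / (Te - t)\<^sup>2)))
     (transpose (Ta - Tb) *v \<xi> + (transpose Ta *v ((2 / L\<^sup>2) *\<^sub>R (x - xc)) + transpose (0 :: real^'n^'n) *v 0))
     (transpose (Ta - Tb) ** Z ** (Ta - Tb) + (transpose Ta ** ((2 / L\<^sup>2) *\<^sub>R mat 1) ** Ta + transpose (0 :: real^'n^'n) ** (0 :: real^'n^'n) ** 0))"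
  proof (rule touch_above_local_max[OF j, of "r / A"])
    fix w :: "real^'n" and s :: real assume w: "norm w < r / A" and s: "\<bar>s\<bar> < r / A"
    have "r / A \<le> r" using r A by (simp add: field_simps)
    then have "\<bar>s\<bar> < r" using s by simp
    from mx[OF bnd[OF w] this]
    show "S1 (x + Ta *v fst (fst (0, 0) + w, snd (0, 0) + s), t + snd (fst (0, 0) + w, snd (0, 0) + s)) +
         S2 (y + Tb *v fst (fst (0, 0) + w, snd (0, 0) + s), t + snd (fst (0, 0) + w, snd (0, 0) + s)) - f (fst (0, 0) + w, snd (0, 0) + s)
       \<le> S1 (x + Ta *v fst (0, 0), t + snd (0, 0)) + S2 (y + Tb *v fst (0, 0), t + snd (0, 0)) - f (0, 0)"
      unfolding f_def by (simp add: matrix_vector_mult_diff_rdistrib add.commute)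
  qed (use r A in simp)
  then show ?thesis by simp
qed

text \<open>
  The errors have to be compared with powers of \<open>k = \<kappa> * sqrt s\<close> divided by \<open>s\<close>, uniformly down to small times \<open>s\<close>. Such quotients
  are smallest at the final time \<open>S\<close>.
\<close>

lemma powr_time_mono:
  assumes "0 < \<kappa>" "0 < s" "s \<le> S" "0 < \<beta>" "\<beta> \<le> 2"
  shows "(\<kappa> * sqrt S) powr \<beta> / S \<le> (\<kappa> * sqrt s) powr \<beta> / s"
proof -
  have e: "(\<kappa> * sqrt x) powr \<beta> / x = \<kappa> powr \<beta> * x powr (\<beta> / 2 - 1)" if "0 < x" for x
  proof -
    have "(\<kappa> * sqrt x) powr \<beta> = \<kappa> powr \<beta> * x powr (\<beta> / 2)"
      using assms(1) that by (simp add: powr_mult powr_half_sqrt[symmetric] powr_powr)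
    then show ?thesis using that by (simp add: powr_diff)
  qed
  have "S powr (\<beta> / 2 - 1) \<le> s powr (\<beta> / 2 - 1)" by (rule powr_mono2') (use assms in auto)
  then show ?thesis using e[of s] e[of S] assms by (simp add: mult_left_mono)
qed

lemma divide_le_divide_of_cross:
  fixes x y z w :: real
  assumes "x * w \<le> z * y" "0 < y" "0 < w"
  shows "x / y \<le> z / w"
  using assms by (simp add: field_simps)

lemma norm_stretch_le:
  fixes n :: "real^'n"
  assumes "norm n = 1" "0 \<le> b" "b \<le> 3/2" "0 \<le> c" "c \<le> 3/2"
  shows "norm (stretch b c n) \<le> 2 * norm (mat 1 :: real^'n^'n) + 2"
proof -
  have "norm (stretch b c n) \<le> \<bar>b\<bar> * norm (mat 1 :: real^'n^'n) + \<bar>c - b\<bar> * norm (tensor n n)"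
    unfolding stretch_def by (metis norm_scaleR norm_triangle_ineq)
  also have "\<dots> \<le> 2 * norm (mat 1 :: real^'n^'n) + 2"
    using assms by (intro add_mono mult_right_mono) (auto simp: norm_tensor)
  finally show ?thesis .
qed

text \<open>
  Write \<open>v\<close>, \<open>k\<close>, \<open>G\<close>, \<open>Y\<close> as in \<open>kernel_jet\<close>; \<open>\<gamma>'\<close> is the time derivative of the second summand of the kernel.

  If \<open>v \<le> G\<close>, the spatial derivatives of the kernel are of order \<open>Y * v \<le> Y * G\<close>, which \<open>\<gamma>'\<close> dominates because \<open>D\<close> is a large multiple
  of \<open>C\<close>; the uncoupled bound suffices. If \<open>v > G\<close>, the gradient of the kernel is bounded below, and the gradient of the
  localising term \<open>|x - xc|\<^sup>2 / L\<^sup>2\<close> turns its direction only by a small angle \<open>d\<close>. For \<open>v\<^sup>2 \<le> 12 * k\<close> the points are moved in parallel,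
  with a loss of order \<open>Y * v * d\<^sup>2\<close>. For \<open>v\<^sup>2 > 12 * k\<close> they are moved by reflection in the direction \<open>n\<close>, and concavity of
  the kernel gives a gain of order \<open>Y * v\<close> that exceeds the decrease \<open>2 * Y * v\<^sup>2\<close> in time since \<open>v\<close> is small.
\<close>

lemma doubled_kernel_max_absurd:
  fixes S1 S2 :: "(real^'n) \<times> real \<Rightarrow> real"
  assumes a: "0 \<le> a" "a < 1" and K: "0 \<le> K" and sc: "semiconvex K S1" "semiconvex K S2"
    and r: "0 < r"
    and j1: "\<And>w s. norm w < r \<Longrightarrow> \<bar>s\<bar> < r \<Longrightarrow> jsub a S1 (x + w, t + s)"
    and j2: "\<And>w s. norm w < r \<Longrightarrow> \<bar>s\<bar> < r \<Longrightarrow> jsub a S2 (y + w, t + s)"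
    and mx: "\<And>w w' s. norm w < r \<Longrightarrow> norm w' < r \<Longrightarrow> \<bar>s\<bar> < r \<Longrightarrow>
      S1 (x + w, t + s) + S2 (y + w', t + s) - (kernel C D \<kappa> \<mu> (x - y + (w - w'), t + s) + (x + w - xc) \<bullet> (x + w - xc) / L\<^sup>2 + \<delta> / (Te - (t + s)))
      \<le> S1 (x, t) + S2 (y, t) - (kernel C D \<kappa> \<mu> (x - y, t) + (x - xc) \<bullet> (x - xc) / L\<^sup>2 + \<delta> / (Te - t))"
    and tTe: "t < Te" and \<delta>: "0 \<le> \<delta>" and s: "0 < t + \<mu>" "t + \<mu> \<le> S" and \<kappa>: "0 < \<kappa>" and C: "1 \<le> C"
    and v1: "(x - y) \<bullet> (x - y) / (t + \<mu>) \<le> (1 - a) / 2" and v2: "(x - y) \<bullet> (x - y) / (t + \<mu>) < 12 / 13"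
    and L: "0 < L" and xL: "norm (x - xc) \<le> L"
    and D: "8 * C * (2 * (real CARD('n) + 1) * (4 * norm (mat 1 :: real^'n^'n) + 8) + 2) \<le> D"
    and L1: "2 / L\<^sup>2 * ((real CARD('n) + 1) * norm (mat 1 :: real^'n^'n) + (2 * norm (mat 1 :: real^'n^'n) + 2)\<^sup>2) < D / 128 * ((\<kappa> * sqrt S) powr (1 / 8) / S)"
    and L2: "16 / (L\<^sup>2 * (C\<^sup>2 / 4 * ((\<kappa> * sqrt S) powr (5 / 4) / S))) \<le> (1 - a) / 22500"
    and L3: "108 * 8 * 128 / (L\<^sup>2 * C * D) \<le> (\<kappa> * sqrt S) powr (5 / 4) / S"
  shows False
proof -
  define N1 NI where "N1 = real CARD('n) + 1" and "NI = norm (mat 1 :: real^'n^'n)"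
  define Q where "Q = 2 * N1 * (4 * NI + 8) + 2"
  have N1: "1 \<le> N1" "0 \<le> NI" unfolding N1_def NI_def by auto
  have Q: "2 \<le> Q" unfolding Q_def using N1 by simp
  have D8: "8 * C * Q \<le> D" using D unfolding Q_def N1_def NI_def .
  have "0 < 8 * C * Q" using C Q by simp
  then have D0: "0 < D" using D8 by simp
  define \<sigma> where "\<sigma> = t + \<mu>"
  have \<sigma>: "0 < \<sigma>" "\<sigma> \<le> S" using s unfolding \<sigma>_def by auto
  have S0: "0 < S" using \<sigma> by simp
  define q where "q = x - y"
  define k where "k = \<kappa> * sqrt (t + \<mu>)"
  define v where "v = (q \<bullet> q) / (t + \<mu>)"
  define G where "G = v\<^sup>2 + k"
  define Y where "Y = C / 8 * G powr (- 7 / 8) / (t + \<mu>)"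
  define \<gamma>' where "\<gamma>' = D / 16 * k powr (1 / 8) / (t + \<mu>)"
  define \<gamma>0 where "\<gamma>0 = D / 16 * ((\<kappa> * sqrt S) powr (1 / 8) / S)"
  have k: "0 < k" unfolding k_def using \<kappa> s by simp
  have v: "0 \<le> v" "v \<le> (1 - a) / 2" "v < 12 / 13" using v1 v2 s unfolding v_def q_def by auto
  have G: "0 < G" "k \<le> G" "v\<^sup>2 \<le> G" unfolding G_def using k by (auto simp: add_nonneg_pos)
  have Y: "0 < Y" unfolding Y_def using C G s by simp
  have qv: "(norm q)\<^sup>2 = v * \<sigma>" unfolding v_def \<sigma>_def power2_norm_eq_inner using s by simp
  have \<gamma>0: "0 < \<gamma>0" unfolding \<gamma>0_def using D0 \<kappa> S0 by simp
  have \<gamma>': "\<gamma>0 \<le> \<gamma>'"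
  proof -
    have "(\<kappa> * sqrt S) powr (1 / 8) / S \<le> (\<kappa> * sqrt \<sigma>) powr (1 / 8) / \<sigma>"
      by (rule powr_time_mono) (use \<kappa> \<sigma> in auto)
    then have "\<gamma>0 \<le> D / 16 * ((\<kappa> * sqrt \<sigma>) powr (1 / 8) / \<sigma>)"
      unfolding \<gamma>0_def using D0 by (intro mult_left_mono) auto
    then show ?thesis unfolding \<gamma>'_def k_def \<sigma>_def by simp
  qed
  define \<xi> where "\<xi> = (4 * Y * v) *\<^sub>R q"
  define \<beta> where "\<beta> = Y / (t + \<mu>) * (8 - 14 * v\<^sup>2 / G)"
  define Z where "Z = (4 * Y * v) *\<^sub>R mat 1 + \<beta> *\<^sub>R tensor q q"
  have jet: "has_jet (kernel C D \<kappa> \<mu>) (x - y, t) (Y * (k / 2 - 2 * v\<^sup>2) + \<gamma>') \<xi> Z"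
    unfolding \<xi>_def Z_def \<beta>_def \<gamma>'_def q_def
    by (rule kernel_jet[OF s(1) \<kappa> k_def v_def[unfolded q_def] G_def Y_def])
  define p where "p = (2 / L\<^sup>2) *\<^sub>R (x - xc)"
  define \<tau> where "\<tau> = Y * (k / 2 - 2 * v\<^sup>2) + \<gamma>' + \<delta> / (Te - t)\<^sup>2"
  have touch: "touch_above (\<lambda>z. S1 (x + Ta *v fst z, t + snd z) + S2 (y + Tb *v fst z, t + snd z)) (0, 0)
     \<tau> (transpose (Ta - Tb) *v \<xi> + transpose Ta *v p)
     (transpose (Ta - Tb) ** Z ** (Ta - Tb) + transpose Ta ** ((2 / L\<^sup>2) *\<^sub>R mat 1) ** Ta)" for Ta Tb :: "real^'n^'n"
    unfolding \<tau>_def p_def by (rule kernel_touch[where \<Psi> = "kernel C D \<kappa> \<mu>", OF r tTe mx jet])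
  have tZ: "transpose Z = Z" unfolding Z_def by (simp add: transpose_plus transpose_scale transpose_tensor transpose_mat)
  define H1 where "H1 = Z + (2 / L\<^sup>2) *\<^sub>R mat 1"
  have t1: "touch_above (\<lambda>z. S1 (x + fst z, t + snd z) + S2 (y, t + snd z)) (0, 0) \<tau> (\<xi> + p) H1"
    using touch[of "mat 1" 0] by (simp add: transpose_mat H1_def)
  have t2: "touch_above (\<lambda>z. S1 (x, t + snd z) + S2 (y + fst z, t + snd z)) (0, 0) \<tau> (- \<xi>) Z"
  proof -
    have m: "0 - mat 1 = (-1) *\<^sub>R (mat 1 :: real^'n^'n)" by simp
    have "transpose (0 - mat 1) *v \<xi> + transpose 0 *v p = - \<xi>"
      unfolding m transpose_scale transpose_mat scaleR_matrix_vector_assoc[symmetric] by simp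
    moreover have "transpose (0 - mat 1) ** Z ** (0 - mat 1) + transpose 0 ** ((2 / L\<^sup>2) *\<^sub>R mat 1) ** 0 = Z"
    proof -
      have "- mat 1 ** A = - A" "A ** - mat 1 = - A" for A :: "real^'n^'n"
        using scalar_matrix_assoc[of "-1" "mat 1" A] matrix_scalar_ac[of A "-1" "mat 1"] by auto
      then show ?thesis unfolding m transpose_scale transpose_mat by simp
    qed
    ultimately show ?thesis using touch[of 0 "mat 1"] by simp
  qed
  have tH1: "transpose H1 = H1" unfolding H1_def by (simp add: transpose_plus transpose_scale transpose_mat tZ)
  have \<tau>_ge: "\<gamma>' - 2 * Y * v\<^sup>2 \<le> \<tau>"
  proof -
    have "0 \<le> Y * k" "0 \<le> \<delta> / (Te - t)\<^sup>2" using Y k \<delta> by auto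
    then show ?thesis unfolding \<tau>_def by (simp add: algebra_simps)
  qed
  have abs8: "\<bar>8 - 14 * v\<^sup>2 / G\<bar> \<le> 8"
  proof -
    have "0 \<le> v\<^sup>2 / G" "v\<^sup>2 / G \<le> 1" using G by auto
    then show ?thesis by (simp add: abs_le_iff)
  qed
  have \<beta>: "\<bar>\<beta>\<bar> \<le> 8 * Y / \<sigma>"
  proof -
    have "\<bar>\<beta>\<bar> = Y / \<sigma> * \<bar>8 - 14 * v\<^sup>2 / G\<bar>" unfolding \<beta>_def \<sigma>_def[symmetric] abs_mult using Y \<sigma> by simp
    also have "\<dots> \<le> Y / \<sigma> * 8" using abs8 Y \<sigma> by (intro mult_left_mono) auto
    finally show ?thesis by (simp add: mult.commute)
  qed
  have Lq: "2 / L\<^sup>2 * (N1 * NI) < \<gamma>0 / 8" "2 / L\<^sup>2 * (2 * NI + 2)\<^sup>2 < \<gamma>0 / 8"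
  proof -
    have "2 / L\<^sup>2 * (N1 * NI) + 2 / L\<^sup>2 * (2 * NI + 2)\<^sup>2 < \<gamma>0 / 8"
      using L1 unfolding distrib_left[symmetric] N1_def NI_def \<gamma>0_def by simp
    moreover have "0 \<le> 2 / L\<^sup>2 * (N1 * NI)" "0 \<le> 2 / L\<^sup>2 * (2 * NI + 2)\<^sup>2" using N1 by auto
    ultimately show "2 / L\<^sup>2 * (N1 * NI) < \<gamma>0 / 8" "2 / L\<^sup>2 * (2 * NI + 2)\<^sup>2 < \<gamma>0 / 8"
      by linarith+
  qed
  have YG: "2 * Q * (Y * G) \<le> \<gamma>'" if "v\<^sup>2 \<le> 12 * k"
  proof -
    have "G powr (1 / 8) \<le> (256 * k) powr (1 / 8)" using that G k unfolding G_def by (intro powr_mono2) auto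
    also have "\<dots> = 2 * k powr (1 / 8)"
    proof -
      have "(256::real) powr (1 / 8) = (2 ^ 8) powr (1 / 8)" by simp
      also have "\<dots> = (2 powr 8) powr (1 / 8)" by (simp add: powr_numeral)
      also have "\<dots> = 2" by (simp only: powr_powr) simp
      finally show ?thesis using k by (simp add: powr_mult)
    qed
    finally have g: "G powr (1 / 8) \<le> 2 * k powr (1 / 8)" .
    have "G powr (- 7 / 8) * G = G powr (1 / 8)" using powr_add[of G "- 7 / 8" 1] G by simp
    then have "2 * Q * (Y * G) = 8 * C * Q / 32 * (G powr (1 / 8) / \<sigma>)" unfolding Y_def \<sigma>_def[symmetric] by (simp add: field_simps)
    also have "\<dots> \<le> D / 32 * (2 * k powr (1 / 8) / \<sigma>)"
      using D8 C Q g \<sigma> D0 by (intro mult_mono divide_right_mono) auto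
    also have "\<dots> = \<gamma>'" unfolding \<gamma>'_def \<sigma>_def by simp
    finally show ?thesis .
  qed
  have kS: "(\<kappa> * sqrt S) powr (5 / 4) / S \<le> k powr (5 / 4) / \<sigma>"
    unfolding k_def \<sigma>_def[symmetric] by (rule powr_time_mono) (use \<kappa> \<sigma> in auto)
  consider (degenerate) "v \<le> G" | (regular) "G < v" by linarith
  then show False
  proof cases
    case degenerate
    have "v\<^sup>2 \<le> 12 * k"
    proof (rule ccontr)
      assume "\<not> ?thesis"
      then have "12 * v < 13 * (v * v)" using degenerate unfolding G_def power2_eq_square by linarith
      then have "12 * v < (13 * v) * v" by simp
      moreover have "(13 * v) * v \<le> 12 * v" using v by (intro mult_right_mono) auto
      ultimately show False by simp
    qed
    note YG = YG[OF this]
    have nZ: "norm Z \<le> Y * v * (4 * NI + 8)"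
    proof -
      have "norm Z \<le> \<bar>4 * Y * v\<bar> * NI + \<bar>\<beta>\<bar> * norm (tensor q q)"
        unfolding Z_def NI_def by (metis norm_scaleR norm_triangle_ineq)
      also have "\<bar>\<beta>\<bar> * norm (tensor q q) \<le> (8 * Y / \<sigma>) * (v * \<sigma>)"
        using \<beta> v \<sigma> Y unfolding norm_tensor power2_eq_square[symmetric] qv by (intro mult_right_mono) auto
      finally show ?thesis using Y v \<sigma> by (simp add: algebra_simps)
    qed
    have nH1: "norm H1 \<le> norm Z + 2 / L\<^sup>2 * NI"
    proof -
      have "norm H1 \<le> norm Z + norm ((2 / L\<^sup>2) *\<^sub>R (mat 1 :: real^'n^'n))" unfolding H1_def by (rule norm_triangle_ineq)
      then show ?thesis unfolding NI_def by simp
    qed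
    have "\<tau> \<le> N1 * (norm H1 + norm Z)"
      unfolding N1_def using doubled_max_degenerate[OF a sc _ _ t1 tH1 t2 tZ] j1[of 0 0] j2[of 0 0] r by simp
    also have "\<dots> \<le> N1 * (2 * (Y * v * (4 * NI + 8)) + 2 / L\<^sup>2 * NI)"
      using nZ nH1 N1 by (intro mult_left_mono) auto
    also have "\<dots> = (Y * v) * (2 * N1 * (4 * NI + 8)) + 2 / L\<^sup>2 * (N1 * NI)" by (simp add: algebra_simps)
    also have "(Y * v) * (2 * N1 * (4 * NI + 8)) \<le> (Y * G) * (2 * N1 * (4 * NI + 8))"
      using degenerate Y N1 by (intro mult_right_mono mult_left_mono) auto
    finally have "\<gamma>' - 2 * Y * v\<^sup>2 \<le> (Y * G) * (2 * N1 * (4 * NI + 8)) + 2 / L\<^sup>2 * (N1 * NI)"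
      using \<tau>_ge by linarith
    moreover have "Y * v\<^sup>2 \<le> Y * G" using G Y by (intro mult_left_mono) auto
    moreover have "Q * (Y * G) = (Y * G) * (2 * N1 * (4 * NI + 8)) + 2 * (Y * G)" unfolding Q_def by (simp add: algebra_simps)
    ultimately have "\<gamma>' \<le> Q * (Y * G) + 2 / L\<^sup>2 * (N1 * NI)" by linarith
    then show False using YG Lq \<gamma>0 \<gamma>' by linarith
  next
    case regular
    have v0: "0 < v" using regular G by simp
    have q0: "q \<noteq> 0" using v0 unfolding v_def by auto
    have \<xi>0: "\<xi> \<noteq> 0" unfolding \<xi>_def using q0 Y v0 by simp
    have n\<xi>: "(norm \<xi>)\<^sup>2 = 16 * Y\<^sup>2 * v ^ 3 * \<sigma>"
    proof -
      have "(norm \<xi>)\<^sup>2 = (4 * Y * v)\<^sup>2 * (norm q)\<^sup>2" unfolding \<xi>_def by (simp add: power_mult_distrib)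
      also have "\<dots> = 16 * Y\<^sup>2 * v ^ 3 * \<sigma>" unfolding qv by (simp add: power2_eq_square power3_eq_cube)
      finally show ?thesis .
    qed
    have \<xi>_ge: "C\<^sup>2 / 4 * ((\<kappa> * sqrt S) powr (5 / 4) / S) \<le> (norm \<xi>)\<^sup>2"
    proof -
      have "C\<^sup>2 / 4 * ((\<kappa> * sqrt S) powr (5 / 4) / S) \<le> C\<^sup>2 / 4 * (k powr (5 / 4) / \<sigma>)"
        using kS by (intro mult_left_mono) auto
      also have "\<dots> \<le> C\<^sup>2 / 4 * (G powr (5 / 4) / \<sigma>)"
        using G k \<sigma> by (intro mult_left_mono divide_right_mono powr_mono2) auto
      also have "G powr (5 / 4) = (G powr (- 7 / 8))\<^sup>2 * G ^ 3"
      proof -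
        have "(G powr (- 7 / 8))\<^sup>2 * G ^ 3 = G powr (- 7 / 8) * G powr (- 7 / 8) * G powr 3"
          using G by (simp add: power2_eq_square powr_numeral)
        also have "\<dots> = G powr (5 / 4)" by (simp only: powr_add[symmetric]) simp
        finally show ?thesis ..
      qed
      also have "C\<^sup>2 / 4 * ((G powr (- 7 / 8))\<^sup>2 * G ^ 3 / \<sigma>) \<le> C\<^sup>2 / 4 * ((G powr (- 7 / 8))\<^sup>2 * v ^ 3 / \<sigma>)"
        using regular G \<sigma> by (intro mult_left_mono divide_right_mono power_mono) auto
      also have "\<dots> = (norm \<xi>)\<^sup>2"
        unfolding n\<xi> Y_def \<sigma>_def[symmetric] using \<sigma> by (simp add: field_simps power2_eq_square)
      finally show ?thesis .
    qed
    have q0sq: "0 < C\<^sup>2 / 4 * ((\<kappa> * sqrt S) powr (5 / 4) / S)" using C \<kappa> S0 by simp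
    have np: "norm p \<le> 2 / L"
    proof -
      have "norm p \<le> 2 / L\<^sup>2 * L" unfolding p_def using xL L by (auto intro!: mult_left_mono divide_right_mono)
      then show ?thesis using L by (simp add: power2_eq_square)
    qed
    have np2: "(norm p)\<^sup>2 \<le> 4 / L\<^sup>2"
      using power_mono[OF np, of 2] by (simp add: power_divide)
    define n where "n = sgn \<xi>"
    define n1 where "n1 = sgn (\<xi> + p)"
    define d where "d = norm (n1 - n)"
    have d2: "d\<^sup>2 \<le> 16 / (L\<^sup>2 * (norm \<xi>)\<^sup>2)"
    proof -
      have "d \<le> 2 * norm p / norm \<xi>" unfolding d_def n1_def n_def using norm_sgn_diff_le[OF \<xi>0, of "\<xi> + p"] by simp
      then have "d\<^sup>2 \<le> (2 * norm p / norm \<xi>)\<^sup>2" by (intro power_mono) (auto simp: d_def)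
      also have "\<dots> = 4 * (norm p)\<^sup>2 / (norm \<xi>)\<^sup>2" by (simp add: power_divide power_mult_distrib)
      also have "\<dots> \<le> 4 * (4 / L\<^sup>2) / (norm \<xi>)\<^sup>2" using np2 by (intro divide_right_mono mult_left_mono) auto
      finally show ?thesis by simp
    qed
    have small: "16 / (L\<^sup>2 * (norm \<xi>)\<^sup>2) \<le> (1 - a) / 22500"
    proof -
      have "16 / (L\<^sup>2 * z) \<le> 16 / (L\<^sup>2 * w)" if "0 < w" "w \<le> z" for w z :: real
        using that L by (intro divide_left_mono mult_left_mono mult_pos_pos) auto
      from this[OF q0sq \<xi>_ge] show ?thesis using L2 by linarith
    qed
    have p1: "\<xi> + p \<noteq> 0"
    proof
      assume "\<xi> + p = 0"
      then have "p = - \<xi>" by (simp add: add_eq_0_iff)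
      then have "(norm \<xi>)\<^sup>2 \<le> 4 / L\<^sup>2" using np2 by simp
      then have "L\<^sup>2 * (norm \<xi>)\<^sup>2 \<le> 4" using L by (simp add: field_simps)
      moreover have "0 < L\<^sup>2 * (norm \<xi>)\<^sup>2" using L \<xi>0 by simp
      ultimately have "4 \<le> 16 / (L\<^sup>2 * (norm \<xi>)\<^sup>2)" by (simp add: field_simps)
      then show False using small a by simp
    qed
    have n: "norm n = 1" "norm n1 = 1" unfolding n_def n1_def using \<xi>0 p1 by (auto simp: norm_sgn)
    have \<xi>n: "\<xi> = norm \<xi> *\<^sub>R n" "\<xi> + p = norm (\<xi> + p) *\<^sub>R n1" unfolding n_def n1_def using \<xi>0 p1 by (auto simp: sgn_div_norm)
    have qn: "q = norm q *\<^sub>R n"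
    proof -
      have "n = sgn q" unfolding n_def \<xi>_def using Y v0 by (simp add: sgn_scaleR)
      then show ?thesis using q0 by (simp add: sgn_div_norm)
    qed
    \<comment> \<open>The regularisation \<open>\<epsilon>\<close> makes the change of variables invertible also when \<open>a = 0\<close>.\<close>
    define \<epsilon> where "\<epsilon> = min 1 (\<gamma>0 / (8 * (4 * K * real CARD('n) + 1)))"
    have KN: "0 \<le> 4 * K * real CARD('n)" using K by simp
    have \<epsilon>: "0 < \<epsilon>" "\<epsilon> \<le> 1" unfolding \<epsilon>_def using \<gamma>0 KN by (auto simp: add_nonneg_pos)
    have \<epsilon>K: "4 * \<epsilon> * K * real CARD('n) \<le> \<gamma>0 / 8"
    proof -
      have "4 * \<epsilon> * K * real CARD('n) \<le> \<epsilon> * (4 * K * real CARD('n) + 1)" using \<epsilon> by (simp add: algebra_simps)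
      also have "\<dots> \<le> \<gamma>0 / (8 * (4 * K * real CARD('n) + 1)) * (4 * K * real CARD('n) + 1)"
        unfolding \<epsilon>_def using KN by (intro mult_right_mono) auto
      also have "\<dots> = \<gamma>0 / 8" using KN by (simp add: field_simps)
      finally show ?thesis .
    qed
    define b c where "b = sqrt (a + \<epsilon>)" and "c = sqrt (1 - a + \<epsilon>)"
    have bc: "0 < b" "0 < c" "b\<^sup>2 = a + \<epsilon>" "c\<^sup>2 = 1 - a + \<epsilon>" unfolding b_def c_def using a \<epsilon> by auto
    have bc2: "b \<le> 3 / 2" "c \<le> 3 / 2"
    proof -
      have "b\<^sup>2 \<le> (3 / 2)\<^sup>2" "c\<^sup>2 \<le> (3 / 2)\<^sup>2" unfolding bc(3,4) using a \<epsilon> by (simp_all add: power2_eq_square)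
      then show "b \<le> 3 / 2" "c \<le> 3 / 2" using power2_le_imp_le[of b "3 / 2"] power2_le_imp_le[of c "3 / 2"] by auto
    qed
    have inv: "stretch (1 / b) (1 / c') m ** stretch b c' m = mat 1" if "norm m = 1" "c' \<noteq> 0" for c' and m :: "real^'n"
      using stretch_mult[OF that(1), of "1 / b" "1 / c'" b c'] bc that(2) by (simp add: stretch_one)
    have main: "\<tau> \<le> (4 * Y * v) * (norm M)\<^sup>2 + \<beta> * (norm (transpose M *v q))\<^sup>2 + \<gamma>0 / 4"
      if M: "M = stretch b c n1 - stretch b c' n" and c': "c' \<noteq> 0" "c'\<^sup>2 = c\<^sup>2" for M c'
    proof -
      define H where "H = transpose M ** Z ** M + transpose (stretch b c n1) ** ((2 / L\<^sup>2) *\<^sub>R mat 1) ** stretch b c n1"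
      have tH: "transpose H = H" unfolding H_def transpose_plus
        by (subst transpose_congruence[OF tZ], subst transpose_congruence) (simp_all add: transpose_scale transpose_mat)
      have t3: "touch_above (\<lambda>z. S1 (x + stretch b c n1 *v fst z, t + snd z) + S2 (y + stretch b c' n *v fst z, t + snd z)) (0, 0)
          \<tau> (transpose M *v \<xi> + transpose (stretch b c n1) *v p) H"
        unfolding H_def M by (rule touch)
      have "\<tau> \<le> trace H + 4 * \<epsilon> * K * real CARD('n)"
      proof (rule doubled_max[OF a K _ sc r j1 j2 p1 _ t1 t2 t3 tH inv _ inv])
        show "Lop a (\<xi> + p) (transpose (stretch (1 / b) (1 / c) n1) ** X ** stretch (1 / b) (1 / c) n1)
           + \<epsilon> * trace (transpose (stretch (1 / b) (1 / c) n1) ** X ** stretch (1 / b) (1 / c) n1) = trace X" for X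
          by (rule Lop_stretch[OF n(2) \<xi>n(2)]) (use bc p1 in auto)
        show "Lop a (- \<xi>) (transpose (stretch (1 / b) (1 / c') n) ** X ** stretch (1 / b) (1 / c') n)
           + \<epsilon> * trace (transpose (stretch (1 / b) (1 / c') n) ** X ** stretch (1 / b) (1 / c') n) = trace X" for X
          unfolding Lop_uminus_left by (rule Lop_stretch[OF n(1) \<xi>n(1)]) (use bc \<xi>0 c' in auto)
      qed (use \<epsilon> \<xi>0 n bc c' in auto)
      moreover have "trace H = (4 * Y * v) * (norm M)\<^sup>2 + \<beta> * (norm (transpose M *v q))\<^sup>2 + 2 / L\<^sup>2 * (norm (stretch b c n1))\<^sup>2"
        unfolding H_def trace_plus
        using trace_congruence[of M "4 * Y * v" \<beta> q] trace_congruence[of "stretch b c n1" "2 / L\<^sup>2" 0 q]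
        unfolding Z_def[symmetric] by simp
      moreover have "2 / L\<^sup>2 * (norm (stretch b c n1))\<^sup>2 \<le> 2 / L\<^sup>2 * (2 * NI + 2)\<^sup>2"
        unfolding NI_def using norm_stretch_le[OF n(2), of b c] bc bc2 by (intro mult_left_mono power_mono) auto
      ultimately show ?thesis using \<epsilon>K Lq by linarith
    qed
    define E where "E = (c - b) *\<^sub>R (tensor n1 n1 - tensor n n)"
    have cb: "\<bar>c - b\<bar> \<le> 3 / 2" using bc(1,2) bc2 by linarith
    have nE: "norm E \<le> 3 * d"
    proof -
      have "norm E = \<bar>c - b\<bar> * norm (tensor n1 n1 - tensor n n)" unfolding E_def by simp
      also have "\<dots> \<le> 3 / 2 * (2 * d)"
        unfolding d_def using cb norm_tensor_diff_le[OF n(2,1)] by (intro mult_mono) auto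
      finally show ?thesis by simp
    qed
    have d0: "0 \<le> d" unfolding d_def by simp
    show False
    proof (cases "v\<^sup>2 \<le> 12 * k")
      case True
      have ME: "E = stretch b c n1 - stretch b c n" unfolding E_def stretch_def by (simp add: algebra_simps)
      have "\<tau> \<le> (4 * Y * v) * (norm E)\<^sup>2 + \<beta> * (norm (transpose E *v q))\<^sup>2 + \<gamma>0 / 4"
        by (rule main[OF ME]) (use bc in auto)
      also have "\<beta> * (norm (transpose E *v q))\<^sup>2 \<le> (8 * Y / \<sigma>) * ((norm E)\<^sup>2 * (v * \<sigma>))"
      proof (rule mult_mono)
        have "norm (transpose E *v q) \<le> norm E * norm q"
          using norm_matrix_vector_le[of "transpose E" q] unfolding norm_transpose .
        then have "(norm (transpose E *v q))\<^sup>2 \<le> (norm E * norm q)\<^sup>2" by (intro power_mono) auto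
        then show "(norm (transpose E *v q))\<^sup>2 \<le> (norm E)\<^sup>2 * (v * \<sigma>)" by (simp only: power_mult_distrib qv)
      qed (use \<beta> Y \<sigma> in auto)
      also have "(8 * Y / \<sigma>) * ((norm E)\<^sup>2 * (v * \<sigma>)) = (8 * Y * v) * (norm E)\<^sup>2" using \<sigma> by simp
      also have "(4 * Y * v) * (norm E)\<^sup>2 + (8 * Y * v) * (norm E)\<^sup>2 = (12 * Y * v) * (norm E)\<^sup>2" by (simp add: algebra_simps)
      finally have 1: "\<tau> \<le> (12 * Y * v) * (norm E)\<^sup>2 + \<gamma>0 / 4" by simp
      have "(norm E)\<^sup>2 \<le> (3 * d)\<^sup>2" using nE by (intro power_mono) auto
      also have "\<dots> = 9 * d\<^sup>2" by (simp add: power_mult_distrib)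
      also have "\<dots> \<le> 9 * (16 / (L\<^sup>2 * (norm \<xi>)\<^sup>2))" using d2 by simp
      finally have "(12 * Y * v) * (norm E)\<^sup>2 \<le> (12 * Y * v) * (9 * (16 / (L\<^sup>2 * (norm \<xi>)\<^sup>2)))"
        using Y v0 by (intro mult_left_mono) auto
      also have "\<dots> = 108 / (L\<^sup>2 * (Y * v\<^sup>2 * \<sigma>))"
        unfolding n\<xi> using Y v0 \<sigma> L by (simp add: field_simps power2_eq_square power3_eq_cube)
      also have "\<dots> \<le> 108 / (L\<^sup>2 * (C / 8 * k powr (9 / 8)))"
      proof (intro divide_left_mono mult_left_mono mult_pos_pos)
        have "C / 8 * k powr (9 / 8) \<le> C / 8 * G powr (9 / 8)"
          using C G k by (intro mult_left_mono powr_mono2) auto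
        also have "G powr (9 / 8) = G powr (- 7 / 8) * G\<^sup>2"
        proof -
          have "G powr (- 7 / 8) * G\<^sup>2 = G powr (- 7 / 8) * G powr 2" using G by (simp add: powr_numeral)
          also have "\<dots> = G powr (9 / 8)" by (simp only: powr_add[symmetric]) simp
          finally show ?thesis ..
        qed
        also have "C / 8 * (G powr (- 7 / 8) * G\<^sup>2) \<le> C / 8 * (G powr (- 7 / 8) * v\<^sup>2)"
          using C G regular by (intro mult_left_mono power_mono) auto
        also have "\<dots> = Y * v\<^sup>2 * \<sigma>" unfolding Y_def \<sigma>_def[symmetric] using \<sigma> by simp
        finally show "C / 8 * k powr (9 / 8) \<le> Y * v\<^sup>2 * \<sigma>" .
      qed (use C k L Y v0 \<sigma> in auto)
      also have "\<dots> \<le> \<gamma>' / 8"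
      proof -
        have "108 * 8 * 128 / (L\<^sup>2 * C * D) \<le> k powr (5 / 4) / \<sigma>" using L3 kS by linarith
        also have "k powr (5 / 4) = k powr (1 / 8) * k powr (9 / 8)" by (simp add: powr_add[symmetric])
        finally have "108 * 8 * 128 * \<sigma> \<le> k powr (1 / 8) * k powr (9 / 8) * (L\<^sup>2 * C * D)"
          using L C D0 \<sigma> by (simp add: field_simps)
        then have "108 * (8 * 128 * \<sigma>) \<le> (D * k powr (1 / 8)) * (L\<^sup>2 * (C * k powr (9 / 8)))" by (simp add: ac_simps)
        moreover have "0 < L\<^sup>2 * (C * k powr (9 / 8))" using L C k by simp
        ultimately have "108 / (L\<^sup>2 * (C * k powr (9 / 8))) \<le> (D * k powr (1 / 8)) / (8 * 128 * \<sigma>)"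
          by (rule divide_le_divide_of_cross) (use \<sigma> in simp)
        then show ?thesis unfolding \<gamma>'_def \<sigma>_def[symmetric] by (simp add: field_simps)
      qed
      finally have 2: "(12 * Y * v) * (norm E)\<^sup>2 \<le> \<gamma>' / 8" .
      have "Y * v\<^sup>2 \<le> Y * G" using G Y by (intro mult_left_mono) auto
      moreover have "4 * (Y * G) \<le> 2 * Q * (Y * G)" using Q Y G by (intro mult_right_mono) auto
      ultimately have "2 * Y * v\<^sup>2 \<le> \<gamma>' / 2" using YG[OF True] by linarith
      then show False using 1 2 \<tau>_ge \<gamma>' \<gamma>0 by linarith
    next
      case False
      define M where "M = stretch b c n1 - stretch b (- c) n"
      have ME: "M = E + (2 * c) *\<^sub>R tensor n n" unfolding M_def E_def stretch_def by (simp add: vec_eq_iff algebra_simps)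
      have tM: "transpose M = M" unfolding M_def by (simp add: transpose_def vec_eq_iff stretch_def mat_def tensor_def mult.commute)
      have dc: "d \<le> c / 150"
      proof -
        have "d\<^sup>2 \<le> (1 - a) / 22500" using d2 small by linarith
        also have "\<dots> \<le> (c / 150)\<^sup>2" using bc \<epsilon> by (simp add: power_divide)
        finally show ?thesis using bc by (intro power2_le_imp_le[of d]) auto
      qed
      have ME1: "norm M \<le> 101 / 50 * c"
      proof -
        have "norm M \<le> norm E + norm ((2 * c) *\<^sub>R tensor n n)" unfolding ME by (rule norm_triangle_ineq)
        then show ?thesis using nE dc bc n by (simp add: norm_tensor)
      qed
      have ME2: "99 / 50 * c \<le> norm (M *v n)"
      proof -
        have nn: "n \<bullet> n = 1" using n by (simp add: power2_norm_eq_inner[symmetric])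
        have "M *v n = (2 * c) *\<^sub>R n - (- (E *v n))"
          unfolding ME by (simp add: matrix_vector_mult_add_rdistrib scaleR_matrix_vector_assoc[symmetric] tensor_vector nn)
        then have "norm ((2 * c) *\<^sub>R n) - norm (- (E *v n)) \<le> norm (M *v n)" by (metis norm_triangle_ineq2)
        moreover have "norm (E *v n) \<le> norm E" using norm_matrix_vector_le[of E n] n by simp
        ultimately show ?thesis using nE dc bc n by simp
      qed
      have nM: "(norm M)\<^sup>2 \<le> (101 / 50)\<^sup>2 * c\<^sup>2"
        using power_mono[OF ME1 norm_ge_zero, of 2] by (simp only: power_mult_distrib)
      have nMn: "(99 / 50)\<^sup>2 * c\<^sup>2 \<le> (norm (M *v n))\<^sup>2"
      proof -
        have "(99 / 50 * c)\<^sup>2 \<le> (norm (M *v n))\<^sup>2" by (rule power_mono[OF ME2]) (use bc in simp)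
        then show ?thesis by (simp only: power_mult_distrib)
      qed
      have "\<tau> \<le> (4 * Y * v) * (norm M)\<^sup>2 + \<beta> * (norm (transpose M *v q))\<^sup>2 + \<gamma>0 / 4"
        by (rule main[OF M_def]) (use bc in auto)
      also have "\<beta> * (norm (transpose M *v q))\<^sup>2 = (Y * v) * ((8 - 14 * v\<^sup>2 / G) * (norm (M *v n))\<^sup>2)"
      proof -
        have "(norm (M *v q))\<^sup>2 = (norm q)\<^sup>2 * (norm (M *v n))\<^sup>2"
          by (subst qn) (simp add: matrix_vector_mult_scaleR power_mult_distrib)
        then show ?thesis unfolding tM qv \<beta>_def \<sigma>_def[symmetric] using \<sigma> by simp
      qed
      also have "(8 - 14 * v\<^sup>2 / G) * (norm (M *v n))\<^sup>2 \<le> (- 64 / 13) * ((99 / 50)\<^sup>2 * c\<^sup>2)"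
      proof -
        have "12 / 13 \<le> v\<^sup>2 / G" using False G unfolding G_def by (simp add: field_simps)
        then have "(8 - 14 * v\<^sup>2 / G) * (norm (M *v n))\<^sup>2 \<le> (- 64 / 13) * (norm (M *v n))\<^sup>2"
          by (intro mult_right_mono) auto
        then show ?thesis using nMn by linarith
      qed
      also have "(4 * Y * v) * (norm M)\<^sup>2 \<le> (4 * Y * v) * ((101 / 50)\<^sup>2 * c\<^sup>2)" using nM Y v by (intro mult_left_mono) auto
      finally have "\<tau> \<le> (4 * Y * v) * ((101 / 50)\<^sup>2 * c\<^sup>2) + (Y * v) * ((- 64 / 13) * ((99 / 50)\<^sup>2 * c\<^sup>2)) + \<gamma>0 / 4"
        using Y v by (smt (verit) mult_left_mono mult_nonneg_nonneg)
      moreover have "(4 * Y * v) * ((101 / 50)\<^sup>2 * c\<^sup>2) + (Y * v) * ((- 64 / 13) * ((99 / 50)\<^sup>2 * c\<^sup>2)) \<le> - 2 * ((Y * v) * c\<^sup>2)"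
      proof -
        have "0 \<le> (Y * v) * c\<^sup>2" using Y v by simp
        moreover have "(4 * Y * v) * ((101 / 50)\<^sup>2 * c\<^sup>2) + (Y * v) * ((- 64 / 13) * ((99 / 50)\<^sup>2 * c\<^sup>2)) = (4 * (101 / 50)\<^sup>2 - 64 / 13 * (99 / 50)\<^sup>2) * ((Y * v) * c\<^sup>2)"
          by (simp add: algebra_simps)
        moreover have "(4 * (101 / 50)\<^sup>2 - 64 / 13 * (99 / 50)\<^sup>2 :: real) \<le> - 2" by (simp add: power2_eq_square)
        ultimately show ?thesis by (metis mult_right_mono)
      qed
      moreover have "(Y * v) * (1 - a) \<le> (Y * v) * c\<^sup>2" using bc \<epsilon> Y v by (intro mult_left_mono) auto
      moreover have "2 * Y * v\<^sup>2 \<le> (Y * v) * (1 - a)"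
      proof -
        have "(Y * v) * (2 * v) \<le> (Y * v) * (1 - a)" using v Y by (intro mult_left_mono) auto
        then show ?thesis by (simp add: power2_eq_square)
      qed
      moreover have "0 \<le> (Y * v) * (1 - a)" using Y v a by simp
      ultimately have "\<gamma>' \<le> \<gamma>0 / 4" using \<tau>_ge by linarith
      then show False using \<gamma>' \<gamma>0 by linarith
    qed
  qed
qed

section \<open>Nonnegativity of the solution\<close>

lemma powr_eighth: "0 \<le> (x::real) \<Longrightarrow> (x ^ 8) powr (1 / 8) = x"
proof -
  assume "0 \<le> x"
  then show ?thesis
  proof (cases "x = 0")
    case False
    with \<open>0 \<le> x\<close> have "0 < x" by simp
    then have "(x ^ 8) powr (1 / 8) = (x powr 8) powr (1 / 8)" by (simp add: powr_numeral)
    also have "\<dots> = x" using \<open>0 < x\<close> by (simp only: powr_powr) simp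
    finally show ?thesis .
  qed simp
qed

lemma kernel_nonneg:
  assumes "0 < snd z + \<mu>" "0 \<le> C" "0 \<le> D"
  shows "0 \<le> kernel C D \<kappa> \<mu> z"
  unfolding kernel_def using assms by simp

text \<open>
  Where the kernel is below 1, the quotient \<open>v\<close> is below \<open>1 / C\<close>; this is the smallness of \<open>v\<close> used at an interior
  maximum, since functions with values at most 1 have a sum at most 2.
\<close>

lemma kernel_ge_one:
  assumes s: "0 < snd z + \<mu>" and C: "1 \<le> C" and D: "0 \<le> D" and \<kappa>: "0 < \<kappa>"
    and v: "1 / C \<le> (fst z \<bullet> fst z) / (snd z + \<mu>)"
  shows "1 \<le> kernel C D \<kappa> \<mu> z"
proof -
  define v where "v = (fst z \<bullet> fst z) / (snd z + \<mu>)"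
  have "(1 / C) ^ 8 \<le> (1 / C) ^ 2" using C by (intro power_decreasing) auto
  also have "\<dots> \<le> v\<^sup>2" using v C unfolding v_def by (intro power_mono) auto
  also have "v\<^sup>2 \<le> v\<^sup>2 + \<kappa> * sqrt (snd z + \<mu>)" using \<kappa> s by simp
  finally have "((1 / C) ^ 8) powr (1 / 8) \<le> (v\<^sup>2 + \<kappa> * sqrt (snd z + \<mu>)) powr (1 / 8)" using C by (intro powr_mono2) auto
  then have "1 / C \<le> (v\<^sup>2 + \<kappa> * sqrt (snd z + \<mu>)) powr (1 / 8)" using powr_eighth[of "1 / C"] C by simp
  then have "1 \<le> C * (v\<^sup>2 + \<kappa> * sqrt (snd z + \<mu>)) powr (1 / 8)" using C by (simp add: field_simps)
  moreover have "0 \<le> D * (\<kappa> * sqrt (snd z + \<mu>)) powr (1 / 8)" using D by simp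
  ultimately show ?thesis unfolding kernel_def v_def power_divide by linarith
qed

lemma kernel_isCont:
  fixes z :: "(real^'n) \<times> real"
  assumes "0 < snd z + \<mu>" "0 < \<kappa>"
  shows "isCont (kernel C D \<kappa> \<mu>) z"
  using has_jet_isCont[OF kernel_jet[of "snd z" \<mu> \<kappa> _ _ "fst z", OF assms refl refl refl refl]] by simp

text \<open>
  The constants are fixed in the order \<open>C\<close>, \<open>D\<close>, \<open>\<kappa>\<close>, \<open>L\<close>, all before the functions; only \<open>\<mu>\<close> depends on \<open>\<rho>\<close>. The constant \<open>\<kappa>\<close> makes the kernel at most
  \<open>1 / 4\<close> on the diagonal, and \<open>\<mu> \<le> \<rho>\<^sup>2\<close> makes it at least 1 at time 0 for points at distance \<open>\<rho>\<close>. So a sum above \<open>3 / 2\<close> at \<open>x1\<close>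
  forces an interior maximum of positive value, where moreover both functions are positive and hence subsolutions.
\<close>

lemma doubling_bound:
  fixes x1 :: "real^'n"
  assumes a: "0 \<le> a" "a < 1" and T: "0 < T"
  obtains L where "0 < L" "\<And>\<rho> S1 S2 K. 0 < \<rho> \<Longrightarrow> 0 \<le> K \<Longrightarrow> semiconvex K S1 \<Longrightarrow> semiconvex K S2 \<Longrightarrow>
     (\<And>z. S1 z \<le> 1) \<Longrightarrow> (\<And>z. S2 z \<le> 1) \<Longrightarrow>
     (\<And>x t. 0 \<le> t \<Longrightarrow> 0 < S1 (x, t) \<Longrightarrow> jsub a S1 (x, t)) \<Longrightarrow> (\<And>x t. 0 \<le> t \<Longrightarrow> 0 < S2 (x, t) \<Longrightarrow> jsub a S2 (x, t)) \<Longrightarrow>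
     (\<And>x y. norm (x - x1) \<le> L \<Longrightarrow> norm (x - y) < \<rho> \<Longrightarrow> S1 (x, 0) \<le> 1 / 8 \<or> S2 (y, 0) \<le> 1 / 8) \<Longrightarrow>
     S1 (x1, T) + S2 (x1, T) \<le> 3 / 2"
proof -
  define N1 NI where "N1 = real CARD('n) + 1" and "NI = norm (mat 1 :: real^'n^'n)"
  define C where "C = 3 + 2 / (1 - a)"
  define D where "D = 8 * C * (2 * N1 * (4 * NI + 8) + 2)"
  define S where "S = T + 2"
  define \<kappa> where "\<kappa> = (1 / (4 * (C + D))) ^ 8 / sqrt S"
  define m1 where "m1 = D / 128 * ((\<kappa> * sqrt S) powr (1 / 8) / S)"
  define m2 where "m2 = (\<kappa> * sqrt S) powr (5 / 4) / S"
  define X where "X = N1 * NI + (2 * NI + 2)\<^sup>2"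
  define L where "L = 1 + 2 * X / m1 + 16 / (C\<^sup>2 / 4 * m2) / ((1 - a) / 22500) + 108 * 8 * 128 / (C * D) / m2"
  have N1: "1 \<le> N1" "0 \<le> NI" unfolding N1_def NI_def by auto
  have C: "3 \<le> C" "2 / (1 - a) \<le> C" "1 \<le> C" unfolding C_def using a by auto
  have D: "0 < D" unfolding D_def using C N1 by (intro mult_pos_pos add_nonneg_pos) auto
  have S: "0 < S" "2 \<le> S" unfolding S_def using T by auto
  have \<kappa>: "0 < \<kappa>" unfolding \<kappa>_def using C D S by simp
  have m: "0 < m1" "0 < m2" unfolding m1_def m2_def using D \<kappa> S by auto
  have X: "0 \<le> X" unfolding X_def using N1 by simp
  define e1 e2 e3 where "e1 = 2 * X / m1" and "e2 = 16 / (C\<^sup>2 / 4 * m2) / ((1 - a) / 22500)" and "e3 = 108 * 8 * 128 / (C * D) / m2"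
  have e: "0 \<le> e1" "0 \<le> e2" "0 \<le> e3" unfolding e1_def e2_def e3_def using X m C D a by auto
  have L: "1 \<le> L" "e1 < L" "e2 \<le> L" "e3 \<le> L" using e unfolding L_def e1_def[symmetric] e2_def[symmetric] e3_def[symmetric] by auto
  have LL: "L \<le> L\<^sup>2" using L(1) mult_mono[OF L(1) order_refl[of L]] by (simp add: power2_eq_square)
  have L1: "2 / L\<^sup>2 * X < m1"
  proof -
    have "2 * X = e1 * m1" unfolding e1_def using m by simp
    also have "\<dots> < L\<^sup>2 * m1" using L LL m by (intro mult_strict_right_mono) auto
    finally show ?thesis using L by (simp add: field_simps)
  qed
  have L2: "16 / (L\<^sup>2 * (C\<^sup>2 / 4 * m2)) \<le> (1 - a) / 22500"
  proof -
    have c: "0 < C\<^sup>2 / 4 * m2" "0 < (1 - a) / 22500" using C m a by auto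
    have "16 / w / z \<le> l \<Longrightarrow> 0 < w \<Longrightarrow> 0 < z \<Longrightarrow> 0 < l \<Longrightarrow> 16 / (l * w) \<le> z" for w z l :: real by (simp add: field_simps)
    from this[OF _ c, of "L\<^sup>2"] show ?thesis using L LL unfolding e2_def by simp
  qed
  have L3: "108 * 8 * 128 / (L\<^sup>2 * C * D) \<le> m2"
  proof -
    have c: "0 < C * D" using C D by simp
    have "110592 / w / z \<le> l \<Longrightarrow> 0 < w \<Longrightarrow> 0 < z \<Longrightarrow> 0 < l \<Longrightarrow> 110592 / (l * w) \<le> z" for w z l :: real by (simp add: field_simps)
    from this[OF _ c m(2), of "L\<^sup>2"] show ?thesis using L LL unfolding e3_def by (simp add: mult.assoc)
  qed
  show thesis
  proof (rule that[of L])
    show "0 < L" using L by simp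
    fix \<rho> K and S1 S2 :: "(real^'n) \<times> real \<Rightarrow> real"
    assume \<rho>: "0 < \<rho>" and K: "0 \<le> K" and sc: "semiconvex K S1" "semiconvex K S2"
      and le1: "\<And>z. S1 z \<le> 1" "\<And>z. S2 z \<le> 1"
      and js: "\<And>x t. 0 \<le> t \<Longrightarrow> 0 < S1 (x, t) \<Longrightarrow> jsub a S1 (x, t)" "\<And>x t. 0 \<le> t \<Longrightarrow> 0 < S2 (x, t) \<Longrightarrow> jsub a S2 (x, t)"
      and ini: "\<And>x y. norm (x - x1) \<le> L \<Longrightarrow> norm (x - y) < \<rho> \<Longrightarrow> S1 (x, 0) \<le> 1 / 8 \<or> S2 (y, 0) \<le> 1 / 8"
    show "S1 (x1, T) + S2 (x1, T) \<le> 3 / 2"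
    proof (rule ccontr)
      assume "\<not> ?thesis"
      then have big: "3 / 2 < S1 (x1, T) + S2 (x1, T)" by simp
      define \<mu> where "\<mu> = min 1 (\<rho>\<^sup>2)"
      have \<mu>: "0 < \<mu>" "\<mu> \<le> 1" "\<mu> \<le> \<rho>\<^sup>2" unfolding \<mu>_def using \<rho> by auto
      define \<Psi> where "\<Psi> = (kernel C D \<kappa> \<mu> :: (real^'n) \<times> real \<Rightarrow> real)"
      define \<Phi> where "\<Phi> z = S1 (fst (fst z), snd z) + S2 (snd (fst z), snd z) - 9 / 8 - \<Psi> (fst (fst z) - snd (fst z), snd z)
          - (fst (fst z) - x1) \<bullet> (fst (fst z) - x1) / L\<^sup>2" for z
      have \<Psi>0: "0 \<le> \<Psi> (q, t)" if "0 \<le> t" for q t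
        unfolding \<Psi>_def by (rule kernel_nonneg) (use that \<mu> C D in auto)
      have \<Psi>1: "1 \<le> \<Psi> (q, t)" if "0 \<le> t" "1 / C \<le> (q \<bullet> q) / (t + \<mu>)" for q t
        unfolding \<Psi>_def by (rule kernel_ge_one) (use that \<mu> C D \<kappa> in auto)
      have P0: "0 \<le> (x - x1) \<bullet> (x - x1) / L\<^sup>2" for x by simp
      have c1C: "1 / C \<le> 1" using C by simp
      have \<Phi>c: "continuous_on (A \<times> {0..<T + 1}) \<Phi>" for A
      proof -
        have "continuous_on {z. 0 \<le> snd z} \<Psi>" unfolding \<Psi>_def
          by (intro continuous_at_imp_continuous_on ballI kernel_isCont) (use \<mu> \<kappa> in auto)
        then have "continuous_on (A \<times> {0..<T + 1}) (\<lambda>z. \<Psi> (fst (fst z) - snd (fst z), snd z))"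
          by (rule continuous_on_compose2) (auto intro!: continuous_intros)
        moreover have "continuous_on (A \<times> {0..<T + 1}) (\<lambda>z. S1 (fst (fst z), snd z))" "continuous_on (A \<times> {0..<T + 1}) (\<lambda>z. S2 (snd (fst z), snd z))"
          by (rule continuous_on_compose2[OF semiconvex_continuous[OF sc(1), of UNIV]], auto intro!: continuous_intros)
             (rule continuous_on_compose2[OF semiconvex_continuous[OF sc(2), of UNIV]], auto intro!: continuous_intros)
        ultimately show ?thesis unfolding \<Phi>_def[abs_def] using L by (intro continuous_intros) auto
      qed
      obtain xy s0 where xy: "xy \<in> cball x1 L \<times> cball x1 (L + S)" "xy \<in> ball x1 L \<times> ball x1 (L + S)"
        and s0: "0 < s0" "s0 < T + 1" and pos: "0 < \<Phi> (xy, s0) - (1 / 16) / (T + 1 - s0)"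
        and mx: "\<And>z t. z \<in> cball x1 L \<times> cball x1 (L + S) \<Longrightarrow> 0 \<le> t \<Longrightarrow> t < T + 1 \<Longrightarrow>
           \<Phi> (z, t) - (1 / 16) / (T + 1 - t) \<le> \<Phi> (xy, s0) - (1 / 16) / (T + 1 - s0)"
      proof (rule parabolic_max[of "cball x1 L \<times> cball x1 (L + S)" 0 "T + 1" \<Phi> 2 "1 / 16" "ball x1 L \<times> ball x1 (L + S)" "(x1, x1)" T])
        show "compact (cball x1 L \<times> cball x1 (L + S))" by (intro compact_Times) auto
        show "\<Phi> (z, t) \<le> 2" if "0 \<le> t" for z t
          using le1(1)[of "(fst z, t)"] le1(2)[of "(snd z, t)"] \<Psi>0[OF that, of "fst z - snd z"] P0[of "fst z"]
          unfolding \<Phi>_def fst_conv snd_conv by linarith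
        show "\<Phi> (z, t) \<le> 0" if z: "z \<in> cball x1 L \<times> cball x1 (L + S) - ball x1 L \<times> ball x1 (L + S)" and t: "0 \<le> t" "t < T + 1" for z t
        proof -
          consider "norm (fst z - x1) = L" | "norm (snd z - x1) = L + S" "norm (fst z - x1) \<le> L"
            using z by (cases z) (auto simp: dist_norm norm_minus_commute)
          then have "1 \<le> \<Psi> (fst z - snd z, t) + (fst z - x1) \<bullet> (fst z - x1) / L\<^sup>2"
          proof cases
            case 1
            then have "(fst z - x1) \<bullet> (fst z - x1) / L\<^sup>2 = 1" using L by (simp add: power2_norm_eq_inner[symmetric])
            then show ?thesis using \<Psi>0[OF t(1), of "fst z - snd z"] by linarith
          next
            case 2
            have "norm (snd z - x1) \<le> norm (snd z - fst z) + norm (fst z - x1)" using norm_triangle_ineq[of "snd z - fst z" "fst z - x1"] by simp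
            then have "S \<le> norm (fst z - snd z)" using 2 by (simp add: norm_minus_commute)
            then have "S\<^sup>2 \<le> (fst z - snd z) \<bullet> (fst z - snd z)" using S unfolding power2_norm_eq_inner[symmetric] by (intro power_mono) auto
            moreover have "t + \<mu> \<le> S" using t \<mu> unfolding S_def by simp
            then have "1 * (t + \<mu>) \<le> S * S" using S t \<mu> by (intro mult_mono) auto
            ultimately have "1 \<le> (fst z - snd z) \<bullet> (fst z - snd z) / (t + \<mu>)" using t \<mu> by (simp add: power2_eq_square field_simps)
            then have "1 / C \<le> (fst z - snd z) \<bullet> (fst z - snd z) / (t + \<mu>)" using c1C by linarith
            from \<Psi>1[OF t(1) this] show ?thesis using P0[of "fst z"] by linarith
          qed
          then show ?thesis using le1(1)[of "(fst z, t)"] le1(2)[of "(snd z, t)"] unfolding \<Phi>_def fst_conv snd_conv by linarith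
        qed
        show "\<Phi> (z, 0) \<le> 0" if z: "z \<in> cball x1 L \<times> cball x1 (L + S)" for z
        proof (cases "norm (fst z - snd z) < \<rho>")
          case True
          have "norm (fst z - x1) \<le> L" using z by (cases z) (auto simp: dist_norm norm_minus_commute)
          then have "S1 (fst z, 0) + S2 (snd z, 0) \<le> 9 / 8"
            using ini[OF _ True] le1(1)[of "(fst z, 0)"] le1(2)[of "(snd z, 0)"] by fastforce
          then show ?thesis using \<Psi>0[of 0 "fst z - snd z"] P0[of "fst z"] unfolding \<Phi>_def fst_conv snd_conv by linarith
        next
          case False
          then have "\<rho>\<^sup>2 \<le> (fst z - snd z) \<bullet> (fst z - snd z)" using \<rho> unfolding power2_norm_eq_inner[symmetric] by (intro power_mono) auto
          then have "1 \<le> (fst z - snd z) \<bullet> (fst z - snd z) / (0 + \<mu>)" using \<mu> by (simp add: field_simps)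
          then have "1 \<le> \<Psi> (fst z - snd z, 0)" using \<Psi>1[of 0 "fst z - snd z"] c1C by simp
          then show ?thesis using le1(1)[of "(fst z, 0)"] le1(2)[of "(snd z, 0)"] P0[of "fst z"] unfolding \<Phi>_def fst_conv snd_conv by linarith
        qed
        show "(1 / 16) / (T + 1 - T) < \<Phi> ((x1, x1), T)"
        proof -
          have "\<kappa> * sqrt (T + \<mu>) \<le> \<kappa> * sqrt S" using \<kappa> \<mu> unfolding S_def by simp
          also have "\<dots> = (1 / (4 * (C + D))) ^ 8" unfolding \<kappa>_def using S by simp
          finally have "(\<kappa> * sqrt (T + \<mu>)) powr (1 / 8) \<le> ((1 / (4 * (C + D))) ^ 8) powr (1 / 8)"
            using \<kappa> T \<mu> by (intro powr_mono2) auto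
          also have "\<dots> = 1 / (4 * (C + D))" using C D by (intro powr_eighth) simp
          finally have "(C + D) * (\<kappa> * sqrt (T + \<mu>)) powr (1 / 8) \<le> (C + D) * (1 / (4 * (C + D)))"
            using C D by (intro mult_left_mono) auto
          also have "\<dots> = 1 / 4" using C D by simp
          finally have "\<Psi> (0, T) \<le> 1 / 4" unfolding \<Psi>_def kernel_def by (simp add: distrib_right)
          then show ?thesis using big unfolding \<Phi>_def by simp
        qed
      qed (use L T \<Phi>c S in auto)
      obtain x y where xy_eq: "xy = (x, y)" by (cases xy)
      have x: "norm (x - x1) < L" and y: "norm (y - x1) < L + S" using xy(2) unfolding xy_eq by (auto simp: dist_norm norm_minus_commute)
      have pen: "0 \<le> (1 / 16) / (T + 1 - s0)" using s0 by simp
      have P: "9 / 8 + \<Psi> (x - y, s0) + (x - x1) \<bullet> (x - x1) / L\<^sup>2 < S1 (x, s0) + S2 (y, s0)"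
        using pos pen unfolding xy_eq \<Phi>_def fst_conv snd_conv by linarith
      have \<Psi>lt: "\<Psi> (x - y, s0) < 1" using P le1(1)[of "(x, s0)"] le1(2)[of "(y, s0)"] P0[of x] by linarith
      have v: "(x - y) \<bullet> (x - y) / (s0 + \<mu>) < 1 / C" using \<Psi>1[of s0 "x - y"] \<Psi>lt s0 by force
      have pos12: "0 < S1 (x, s0)" "0 < S2 (y, s0)"
        using P le1(1)[of "(x, s0)"] le1(2)[of "(y, s0)"] P0[of x] \<Psi>0[of s0 "x - y"] s0 by linarith+
      have near: "\<exists>r>0. \<forall>w s. norm w < r \<longrightarrow> \<bar>s\<bar> < r \<longrightarrow> 0 < F (x' + w, s0 + s)"
        if F: "semiconvex K F" "0 < F (x', s0)" for F :: "(real^'n) \<times> real \<Rightarrow> real" and x'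
      proof -
        have "open {z. 0 < F z}" by (intro open_Collect_less continuous_intros semiconvex_continuous[OF F(1)])
        then obtain d where d: "0 < d" "ball (x', s0) d \<subseteq> {z. 0 < F z}" using F(2) open_contains_ball by (metis mem_Collect_eq)
        show ?thesis
        proof (intro exI[of _ "d / 2"] conjI allI impI)
          fix w :: "real^'n" and s :: real assume "norm w < d / 2" "\<bar>s\<bar> < d / 2"
          then have "dist (x', s0) (x' + w, s0 + s) < d"
            using norm_Pair_le[of w s] by (simp add: dist_norm norm_minus_commute norm_Pair)
          then show "0 < F (x' + w, s0 + s)" using d(2) by auto
        qed (use d in simp)
      qed
      obtain ra where ra: "0 < ra" "\<And>w s. norm w < ra \<Longrightarrow> \<bar>s\<bar> < ra \<Longrightarrow> 0 < S1 (x + w, s0 + s)" using near[OF sc(1) pos12(1)] by blast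
      obtain rb where rb: "0 < rb" "\<And>w s. norm w < rb \<Longrightarrow> \<bar>s\<bar> < rb \<Longrightarrow> 0 < S2 (y + w, s0 + s)" using near[OF sc(2) pos12(2)] by blast
      define r where "r = min (min ra rb) (min (min s0 (T + 1 - s0)) (min (L - norm (x - x1)) (L + S - norm (y - x1))))"
      have r: "0 < r" "r \<le> ra" "r \<le> rb" "r \<le> s0" "r \<le> T + 1 - s0" "r \<le> L - norm (x - x1)" "r \<le> L + S - norm (y - x1)"
        unfolding r_def using ra(1) rb(1) s0 x y by (simp_all add: min_le_iff_disj)
      show False
      proof (rule doubled_kernel_max_absurd[where x = x and y = y and t = s0 and C = C and D = D and \<kappa> = \<kappa> and \<mu> = \<mu> and L = L and xc = x1
            and \<delta> = "1 / 16" and Te = "T + 1" and r = r and S = S, OF a K sc r(1)])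
        show "jsub a S1 (x + w, s0 + s)" if "norm w < r" "\<bar>s\<bar> < r" for w s
          by (rule js(1)) (use that r ra(2)[of w s] in auto)
        show "jsub a S2 (y + w, s0 + s)" if "norm w < r" "\<bar>s\<bar> < r" for w s
          by (rule js(2)) (use that r rb(2)[of w s] in auto)
        show "S1 (x + w, s0 + s) + S2 (y + w', s0 + s) - (kernel C D \<kappa> \<mu> (x - y + (w - w'), s0 + s) + (x + w - x1) \<bullet> (x + w - x1) / L\<^sup>2 + (1 / 16) / (T + 1 - (s0 + s)))
          \<le> S1 (x, s0) + S2 (y, s0) - (kernel C D \<kappa> \<mu> (x - y, s0) + (x - x1) \<bullet> (x - x1) / L\<^sup>2 + (1 / 16) / (T + 1 - s0))"
          if w: "norm w < r" "norm w' < r" "\<bar>s\<bar> < r" for w w' s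
        proof -
          have "norm (x + w - x1) \<le> L" using norm_triangle_ineq[of "x - x1" w] w r by (simp add: algebra_simps)
          moreover have "norm (y + w' - x1) \<le> L + S" using norm_triangle_ineq[of "y - x1" w'] w r by (simp add: algebra_simps)
          ultimately have "(x + w, y + w') \<in> cball x1 L \<times> cball x1 (L + S)" by (simp add: dist_norm norm_minus_commute)
          from mx[OF this, of "s0 + s"] have "\<Phi> ((x + w, y + w'), s0 + s) - (1 / 16) / (T + 1 - (s0 + s)) \<le> \<Phi> ((x, y), s0) - (1 / 16) / (T + 1 - s0)"
            using w r unfolding xy_eq by simp
          moreover have "x + w - (y + w') = x - y + (w - w')" by simp
          ultimately show ?thesis unfolding \<Phi>_def \<Psi>_def fst_conv snd_conv by simp
        qed
        have "1 / C \<le> (1 - a) / 2" using C a by (simp add: field_simps)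
        then show "(x - y) \<bullet> (x - y) / (s0 + \<mu>) \<le> (1 - a) / 2" using v by linarith
        have "1 / C \<le> 1 / 3" using C by (simp add: field_simps)
        then show "(x - y) \<bullet> (x - y) / (s0 + \<mu>) < 12 / 13" using v by linarith
        show "s0 + \<mu> \<le> S" using s0 \<mu> unfolding S_def by simp
        show "8 * C * (2 * (real CARD('n) + 1) * (4 * norm (mat 1 :: real^'n^'n) + 8) + 2) \<le> D" unfolding D_def N1_def NI_def by simp
        show "2 / L\<^sup>2 * ((real CARD('n) + 1) * norm (mat 1 :: real^'n^'n) + (2 * norm (mat 1 :: real^'n^'n) + 2)\<^sup>2) < D / 128 * ((\<kappa> * sqrt S) powr (1 / 8) / S)"
          using L1 unfolding X_def m1_def N1_def NI_def .
        show "16 / (L\<^sup>2 * (C\<^sup>2 / 4 * ((\<kappa> * sqrt S) powr (5 / 4) / S))) \<le> (1 - a) / 22500" using L2 unfolding m2_def .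
        show "108 * 8 * 128 / (L\<^sup>2 * C * D) \<le> (\<kappa> * sqrt S) powr (5 / 4) / S" using L3 unfolding m2_def .
      qed (use s0 \<mu> \<kappa> C L x in auto)
    qed
  qed
qed

text \<open>
  A function with values in \<open>[0, 1]\<close> of this kind gains a fixed factor. Applied to a function normalised by its
  supremum this is a contradiction unless the function vanishes.
\<close>

lemma at_most_three_quarters:
  fixes V :: "(real^'n) \<times> real \<Rightarrow> real" and \<Gamma> :: "(real^'n) set"
  assumes a: "0 \<le> a" "a < 1"
    and V01: "\<And>z. 0 \<le> V z" "\<And>z. V z \<le> 1" and cont: "continuous_on (UNIV \<times> {0<..}) V"
    and jV: "\<And>x t. 0 < t \<Longrightarrow> 0 < V (x, t) \<Longrightarrow> jsub a V (x, t)"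
    and \<Gamma>: "\<Gamma> \<noteq> {}" and V\<Gamma>: "\<And>x t. x \<in> \<Gamma> \<Longrightarrow> 0 < t \<Longrightarrow> V (x, t) = 0"
    and ini: "\<And>K e. compact K \<Longrightarrow> K \<inter> \<Gamma> = {} \<Longrightarrow> 0 < e \<Longrightarrow> \<exists>\<tau>>0. \<forall>x\<in>K. \<forall>t. 0 < t \<longrightarrow> t < \<tau> \<longrightarrow> V (x, t) \<le> e"
    and T: "0 < T"
  shows "V (x1, T) \<le> 3 / 4"
proof (rule ccontr)
  assume "\<not> ?thesis"
  then have big: "3 / 4 < V (x1, T)" by simp
  have "isCont V (x1, T)"
    using cont T by (subst (asm) continuous_on_eq_continuous_at) (auto intro: open_Times)
  then have "isCont (\<lambda>s. V (x1, s)) T"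
    by (rule continuous_within_compose3[where f = "\<lambda>s. (x1, s)"]) (auto intro!: continuous_intros)
  then have "\<forall>\<^sub>F s in at T. 3 / 4 < V (x1, s)"
    using big unfolding isCont_def by (rule order_tendstoD)
  then obtain d where d: "0 < d" "\<And>s. s \<noteq> T \<Longrightarrow> dist s T < d \<Longrightarrow> 3 / 4 < V (x1, s)"
    unfolding eventually_at by auto
  obtain L where L: "0 < L" and bnd: "\<And>\<rho> S1 S2 K. 0 < \<rho> \<Longrightarrow> 0 \<le> K \<Longrightarrow> semiconvex K S1 \<Longrightarrow> semiconvex K S2 \<Longrightarrow>
     (\<And>z. S1 z \<le> 1) \<Longrightarrow> (\<And>z. S2 z \<le> 1) \<Longrightarrow>
     (\<And>x t. 0 \<le> t \<Longrightarrow> 0 < S1 (x, t) \<Longrightarrow> jsub a S1 (x, t)) \<Longrightarrow> (\<And>x t. 0 \<le> t \<Longrightarrow> 0 < S2 (x, t) \<Longrightarrow> jsub a S2 (x, t)) \<Longrightarrow>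
     (\<And>x y. norm (x - x1) \<le> L \<Longrightarrow> norm (x - y) < \<rho> \<Longrightarrow> S1 (x, 0) \<le> 1 / 8 \<or> S2 (y, 0) \<le> 1 / 8) \<Longrightarrow>
     S1 (x1, T) + S2 (x1, T) \<le> 3 / 2"
    using doubling_bound[OF a T, of x1] by blast
  have d2: "0 < d / 2" using d by simp
  obtain \<rho> where \<rho>: "0 < \<rho>" and dat: "\<And>\<eta>0. 0 < \<eta>0 \<Longrightarrow> \<exists>\<eta> S1 S2 K. 0 < \<eta> \<and> \<eta> < \<eta>0 \<and> 0 \<le> K \<and> semiconvex K S1 \<and> semiconvex K S2 \<and>
     (\<forall>z. S1 z \<le> 1 \<and> S2 z \<le> 1) \<and> (\<forall>x t. 0 < t \<longrightarrow> V (x, t + \<eta>) \<le> S1 (x, t) \<and> V (x, t + d / 2) \<le> S2 (x, t)) \<and>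
     (\<forall>x t. 0 \<le> t \<longrightarrow> (0 < S1 (x, t) \<longrightarrow> jsub a S1 (x, t)) \<and> (0 < S2 (x, t) \<longrightarrow> jsub a S2 (x, t))) \<and>
     (\<forall>x y. norm (x - x1) \<le> L \<longrightarrow> norm (x - y) < \<rho> \<longrightarrow> S1 (x, 0) \<le> 1 / 8 \<or> S2 (y, 0) \<le> 1 / 8)"
    by (rule doubling_data[OF V01 cont jV \<Gamma> V\<Gamma> ini d2 _ L, of "1 / 8" x1]) auto
  obtain \<eta> S1 S2 K where \<eta>: "0 < \<eta>" "\<eta> < d" and K: "0 \<le> K" and sc: "semiconvex K S1" "semiconvex K S2"
     and le: "\<And>z. S1 z \<le> 1" "\<And>z. S2 z \<le> 1" and V: "\<And>x t. 0 < t \<Longrightarrow> V (x, t + \<eta>) \<le> S1 (x, t)" "\<And>x t. 0 < t \<Longrightarrow> V (x, t + d / 2) \<le> S2 (x, t)"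
     and js: "\<And>x t. 0 \<le> t \<Longrightarrow> 0 < S1 (x, t) \<Longrightarrow> jsub a S1 (x, t)" "\<And>x t. 0 \<le> t \<Longrightarrow> 0 < S2 (x, t) \<Longrightarrow> jsub a S2 (x, t)"
     and i: "\<And>x y. norm (x - x1) \<le> L \<Longrightarrow> norm (x - y) < \<rho> \<Longrightarrow> S1 (x, 0) \<le> 1 / 8 \<or> S2 (y, 0) \<le> 1 / 8"
    using dat[OF d(1)] by auto
  have "S1 (x1, T) + S2 (x1, T) \<le> 3 / 2" by (rule bnd[OF \<rho> K sc le js i])
  moreover have "3 / 4 < V (x1, T + \<eta>)" "3 / 4 < V (x1, T + d / 2)"
    by (rule d(2); use d \<eta> in \<open>simp add: dist_real_def\<close>)+
  ultimately show False using V[OF T, of x1] by linarith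
qed

lemma jsub_scale:
  fixes v :: "(real^'n) \<times> real \<Rightarrow> real"
  assumes j: "jsub a v z" and k: "0 < k"
  shows "jsub a (\<lambda>z. v z / k) z"
  unfolding jsub_def
proof (intro allI impI)
  fix c \<xi> and X :: "real^'n^'n" and b
  assume X: "transpose X = X" and t: "touch_above (\<lambda>z. v z / k) z c \<xi> X"
    and b: "\<exists>\<delta>>0. \<forall>\<eta> Y. \<eta> \<noteq> 0 \<longrightarrow> transpose Y = Y \<longrightarrow> norm (\<eta> - \<xi>) < \<delta> \<longrightarrow> norm (Y - X) < \<delta> \<longrightarrow> Lop a \<eta> Y \<le> b"
  obtain x t0 where z: "z = (x, t0)" by (cases z)
  have "touch_above v (x, t0) (0 + k * (1 * c)) (0 + k *\<^sub>R (transpose (mat 1) *v \<xi>)) (k *\<^sub>R (transpose (mat 1) ** X ** mat 1))"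
    by (rule touch_above_affine[where Ca = 0 and ow = 0 and m = 0 and B = "\<lambda>z. v z / k"]) (use k t z in auto)
  then have t': "touch_above v z (k * c) (k *\<^sub>R \<xi>) (k *\<^sub>R X)" by (simp add: transpose_mat z)
  obtain \<delta> where \<delta>: "0 < \<delta>" and D: "\<And>\<eta> Y. \<eta> \<noteq> 0 \<Longrightarrow> transpose Y = Y \<Longrightarrow> norm (\<eta> - \<xi>) < \<delta> \<Longrightarrow> norm (Y - X) < \<delta> \<Longrightarrow> Lop a \<eta> Y \<le> b"
    using b by blast
  have "k * c \<le> k * b"
  proof (rule j[unfolded jsub_def, rule_format, OF _ t'], goal_cases)
    case 1
    show ?case by (simp add: transpose_scale X)
  next
    case 2
    show ?case
    proof (intro exI[of _ "k * \<delta>"] conjI allI impI)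
      show "0 < k * \<delta>" using k \<delta> by simp
      fix \<eta> and Y :: "real^'n^'n"
      assume Y: "\<eta> \<noteq> 0" "transpose Y = Y" "norm (\<eta> - k *\<^sub>R \<xi>) < k * \<delta>" "norm (Y - k *\<^sub>R X) < k * \<delta>"
      have s: "norm ((1 / k) *\<^sub>R A - B) < \<delta>" if "norm (A - k *\<^sub>R B) < k * \<delta>" for A B :: "'z::real_normed_vector"
      proof -
        have "(1 / k) *\<^sub>R A - B = (1 / k) *\<^sub>R (A - k *\<^sub>R B)" using k by (simp add: scaleR_diff_right)
        then have "k * norm ((1 / k) *\<^sub>R A - B) = norm (A - k *\<^sub>R B)" using k by simp
        then have "k * norm ((1 / k) *\<^sub>R A - B) < k * \<delta>" using that by linarith
        then show ?thesis using k by simp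
      qed
      have "Lop a ((1 / k) *\<^sub>R \<eta>) ((1 / k) *\<^sub>R Y) \<le> b"
        by (rule D) (use Y s k in \<open>auto simp: transpose_scale\<close>)
      moreover have "Lop a ((1 / k) *\<^sub>R \<eta>) W = Lop a \<eta> W" for W :: "real^'n^'n"
        unfolding Lop_sgn using k by (simp add: sgn_scaleR)
      ultimately show "Lop a \<eta> Y \<le> k * b" using k by (simp add: Lop_scaleR field_simps)
    qed
  qed
  then show "c \<le> b" using k by simp
qed

text \<open>
  The negative part of \<open>u\<close> vanishes on the boundary, where \<open>u = 1\<close>, so that its extension by zero is continuous for positive times. Where it is
  positive it equals \<open>- u\<close>, a subsolution.
\<close>

lemma solution_nonneg:
  fixes u :: "(real^'n) \<times> real \<Rightarrow> real"
  assumes p: "1 < p" and \<Omega>: "open \<Omega>" and fr: "frontier \<Omega> \<noteq> {}" and u: "visc_supersolution p \<Omega> u"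
    and b: "bounded (u ` (\<Omega> \<times> {0<..}))" and d: "attains_data \<Omega> u"
    and x: "x \<in> \<Omega>" "0 < t"
  shows "0 \<le> u (x, t)"
proof (rule ccontr)
  assume neg: "\<not> 0 \<le> u (x, t)"
  define a where "a = recip p"
  have a: "0 \<le> a" "a < 1" using recip_bounds[OF p] unfolding a_def by auto
  define c where "c = (SUP z\<in>\<Omega> \<times> {0<..}. - u z)"
  obtain M where M: "\<And>z. z \<in> \<Omega> \<times> {0<..} \<Longrightarrow> \<bar>u z\<bar> \<le> M" using b unfolding bounded_iff by auto
  have bdd: "bdd_above ((\<lambda>z. - u z) ` (\<Omega> \<times> {0<..}))"
    by (rule bdd_aboveI2[where M = M]) (use M in \<open>force simp: abs_le_iff\<close>)
  have le_c: "- u z \<le> c" if "z \<in> \<Omega> \<times> {0<..}" for z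
    unfolding c_def by (rule cSUP_upper[OF that bdd])
  have c: "0 < c" using le_c[of "(x, t)"] x neg by auto
  have cont: "continuous_on (closure \<Omega> \<times> {0..} - frontier \<Omega> \<times> {0}) u"
    and u0: "\<And>x. x \<in> \<Omega> \<Longrightarrow> u (x, 0) = 0" and u1: "\<And>x t. x \<in> frontier \<Omega> \<Longrightarrow> 0 < t \<Longrightarrow> u (x, t) = 1"
    using d unfolding attains_data_def by auto
  have disj: "frontier \<Omega> \<inter> \<Omega> = {}" using \<Omega> by (simp add: frontier_def interior_open Int_commute Diff_disjoint)
  define V where "V z = (if fst z \<in> \<Omega> then (if 0 < snd z then max (- u z) 0 / c else 0) else 0)" for z
  have V0: "0 \<le> V z" for z unfolding V_def using c by auto
  have V1: "V z \<le> 1" for z unfolding V_def using c le_c[of z] by (cases z) auto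
  have "V (x, t) \<le> 3 / 4" if t: "0 < t" for x t
  proof (rule at_most_three_quarters[OF a V0 V1 _ _ fr _ _ t])
    show "continuous_on (UNIV \<times> {0<..}) V"
    proof -
      let ?U = "(UNIV :: (real^'n) set) \<times> {0 :: real<..}"
      have 1: "continuous_on (closure \<Omega> \<times> {0<..}) (\<lambda>z. max (- u z) 0 / c)"
        using c by (intro continuous_intros continuous_on_subset[OF cont]) auto
      have "closedin (top_of_set ?U) (?U \<inter> closure \<Omega> \<times> UNIV)" "closedin (top_of_set ?U) (?U \<inter> (- \<Omega>) \<times> UNIV)"
        using \<Omega> by (intro closedin_closed_Int closed_Times; simp add: closed_Compl)+
      moreover have "?U \<inter> closure \<Omega> \<times> UNIV = closure \<Omega> \<times> {0<..}" "?U \<inter> (- \<Omega>) \<times> UNIV = (- \<Omega>) \<times> {0<..}" by auto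
      moreover have un: "closure \<Omega> \<times> {0<..} \<union> (- \<Omega>) \<times> {0<..} = ?U" using closure_subset[of \<Omega>] by auto
      ultimately have "continuous_on (closure \<Omega> \<times> {0<..} \<union> (- \<Omega>) \<times> {0<..}) (\<lambda>z. if fst z \<in> \<Omega> then max (- u z) 0 / c else 0)"
      proof (intro continuous_on_cases_local 1)
        fix z :: "(real^'n) \<times> real" assume "z \<in> closure \<Omega> \<times> {0<..} \<and> fst z \<notin> \<Omega> \<or> z \<in> (- \<Omega>) \<times> {0<..} \<and> fst z \<in> \<Omega>"
        then have "fst z \<in> frontier \<Omega>" "0 < snd z" using \<Omega> by (auto simp: frontier_def interior_open)
        then show "max (- u z) 0 / c = 0" using u1[of "fst z" "snd z"] by simp
      qed (auto simp: un)
      then show ?thesis unfolding un by (rule continuous_on_eq) (auto simp: V_def)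
    qed
    show "jsub a V (x, t)" if t: "0 < t" and pos: "0 < V (x, t)" for x t
    proof -
      have x: "x \<in> \<Omega>" and neg: "0 < - u (x, t)" using pos c unfolding V_def by (auto split: if_splits simp: zero_less_divide_iff max_def)
      have "open (\<Omega> \<times> {0::real<..})" using \<Omega> by (intro open_Times) auto
      then obtain r where r: "0 < r" "ball (x, t) r \<subseteq> \<Omega> \<times> {0<..}" using x t open_contains_ball by (metis SigmaI greaterThan_iff)
      have "jsub a (\<lambda>z. - u z) (x, t)" unfolding a_def
        by (rule jsub_of_supersolution[OF p u, where M = c]) (use x t le_c in auto)
      from jsub_scale[OF this c]
      show ?thesis
      proof (rule jsub_translate[where d = "r / 2" and k = 0])
        show "- u (x, t) / c + 0 = V (x, t)" unfolding V_def using x t neg by simp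
        fix w :: "real^'n" and s :: real assume ws: "norm w < r / 2" "\<bar>s\<bar> < r / 2"
        then have "dist (x, t) (x + w, t + s) < r"
          using norm_Pair_le[of w s] by (simp add: dist_norm norm_Pair)
        then have mem: "x + w \<in> \<Omega>" "0 < t + s" using r(2) by auto
        show "- u (fst (x, t) + w, snd (x, t) + s) / c + 0 \<le> V (fst (x, t) + w, snd (x, t) + s)"
          unfolding V_def fst_conv snd_conv if_P[OF mem(1)] if_P[OF mem(2)] add_0_right
          by (rule divide_right_mono) (use c in auto)
      qed (use r in simp)
    qed
    show "V (x, t) = 0" if "x \<in> frontier \<Omega>" for x t using that disj unfolding V_def by auto
    fix K :: "(real^'n) set" and e :: real assume K: "compact K" "K \<inter> frontier \<Omega> = {}" and e: "0 < e"
    define Q where "Q = (K \<inter> closure \<Omega>) \<times> {0..1::real}"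
    have "compact Q" unfolding Q_def using K by (intro compact_Times compact_Int_closed) auto
    then have "uniformly_continuous_on Q u"
      by (rule compact_uniformly_continuous[rotated]) (rule continuous_on_subset[OF cont], use K in \<open>auto simp: Q_def\<close>)
    moreover have "0 < e * c" using e c by simp
    ultimately obtain \<delta> where \<delta>: "0 < \<delta>" "\<And>z z'. z \<in> Q \<Longrightarrow> z' \<in> Q \<Longrightarrow> dist z' z < \<delta> \<Longrightarrow> dist (u z') (u z) < e * c"
      unfolding uniformly_continuous_on_def by metis
    show "\<exists>\<tau>>0. \<forall>x\<in>K. \<forall>t. 0 < t \<longrightarrow> t < \<tau> \<longrightarrow> V (x, t) \<le> e"
    proof (intro exI[of _ "min \<delta> 1"] conjI ballI allI impI)
      fix x t assume x: "x \<in> K" and t: "0 < t" "t < min \<delta> 1"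
      show "V (x, t) \<le> e"
      proof (cases "x \<in> \<Omega>")
        case True
        then have Q: "(x, t) \<in> Q" "(x, 0) \<in> Q" unfolding Q_def using x t closure_subset[of \<Omega>] by auto
        have "dist (x, t) (x, 0) < \<delta>" using t by (simp add: dist_Pair_Pair)
        then have "- u (x, t) \<le> e * c" using \<delta>(2)[OF Q(2,1)] u0[OF True] by (simp add: dist_real_def)
        then show ?thesis unfolding V_def using True t c e by (simp add: field_simps)
      qed (use e in \<open>simp add: V_def\<close>)
    qed (use \<delta> in simp)
  qed
  then have "- u z \<le> 3 / 4 * c" if "z \<in> \<Omega> \<times> {0<..}" for z
  proof -
    obtain x t where z: "z = (x, t)" by (cases z)
    have "V (x, t) = max (- u z) 0 / c" using that unfolding V_def z by simp
    then have "max (- u z) 0 / c \<le> 3 / 4" using \<open>\<And>t x. 0 < t \<Longrightarrow> V (x, t) \<le> 3 / 4\<close>[of t x] that unfolding z by simp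
    then have "max (- u z) 0 \<le> 3 / 4 * c" using c by (simp add: pos_divide_le_eq)
    then show ?thesis by simp
  qed
  then have "c \<le> 3 / 4 * c" unfolding c_def[of] by (intro cSUP_least) (use x in auto)
  then show False using c by simp
qed

section \<open>Gaussian barriers\<close>

text \<open>
  With \<open>H\<close> the identity this is the Gaussian of the lower barrier; the upper barrier needs a rounded \<open>H\<close>.
\<close>

lemma gauss_jet:
  fixes x :: "real^'n"
  assumes t: "0 < t" and H: "taylor2 H ((x - xc) \<bullet> (x - xc)) H1 H2"
    and E: "E = exp (- \<nu> / 4 * (H ((x - xc) \<bullet> (x - xc)) / t))"
  shows "has_jet (\<lambda>z. exp (- \<nu> / 4 * (H ((fst z - xc) \<bullet> (fst z - xc)) / snd z))) (x, t)
     (E * (\<nu> / (4 * t)) * (H ((x - xc) \<bullet> (x - xc)) / t)) ((- E * (\<nu> / (4 * t)) * (2 * H1)) *\<^sub>R (x - xc))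
     ((- E * (\<nu> / (4 * t)) * (2 * H1)) *\<^sub>R mat 1
       + (E * (\<nu> / (4 * t)) * (\<nu> / t * H1\<^sup>2 - 4 * H2)) *\<^sub>R tensor (x - xc) (x - xc))"
proof -
  define y where "y = x - xc"
  define h where "h = H (y \<bullet> y)"
  have "has_jet (\<lambda>z. (fst z - xc) \<bullet> (fst z - xc)) (x, t) 0 (2 *\<^sub>R y) (2 *\<^sub>R mat 1)"
    using has_jet_dist_square[of xc "(x, t)"] unfolding y_def by simp
  from has_jet_compose[OF this, of H H1 H2]
  have jH: "has_jet (\<lambda>z. H ((fst z - xc) \<bullet> (fst z - xc))) (x, t) 0 ((2 * H1) *\<^sub>R y) ((2 * H1) *\<^sub>R mat 1 + (4 * H2) *\<^sub>R tensor y y)"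
    using H by (simp add: tensor_scaleR_left tensor_scaleR_right mult.commute)
  have ji: "has_jet (\<lambda>z :: (real^'n) \<times> real. inverse (snd z)) (x, t) (- (1 / t\<^sup>2)) 0 0"
  proof -
    have d: "(inverse has_real_derivative - (1 / s\<^sup>2)) (at s)" if "0 < s" for s :: real
      using DERIV_inverse[of s] that by (simp add: power2_eq_square divide_inverse)
    have d2: "((\<lambda>s. - (1 / s\<^sup>2)) has_real_derivative 2 / t ^ 3) (at t)"
      using t by (auto intro!: derivative_eq_intros simp: power2_eq_square power3_eq_cube field_simps)
    have "taylor2 inverse (snd (x, t)) (- (1 / t\<^sup>2)) (2 / t ^ 3)"
      unfolding snd_conv by (rule taylor2_DERIV[of t t _ "\<lambda>s. - (1 / s\<^sup>2)"]) (use t d d2 in \<open>auto simp: abs_less_iff\<close>)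
    from has_jet_compose[OF has_jet_time this] show ?thesis by (simp add: tensor_def zero_vec_def[symmetric])
  qed
  have t0: "tensor z (0 :: real^'n) = 0" "tensor (0 :: real^'n) z = 0" for z :: "real^'n" by (simp_all add: vec_eq_iff tensor_def)
  define k where "k = \<nu> / (4 * t)"
  have jq: "has_jet (\<lambda>z. - \<nu> / 4 * (H ((fst z - xc) \<bullet> (fst z - xc)) * inverse (snd z))) (x, t)
     (k * (h / t)) ((- k * (2 * H1)) *\<^sub>R y) ((- k) *\<^sub>R ((2 * H1) *\<^sub>R mat 1 + (4 * H2) *\<^sub>R tensor y y))"
  proof (rule has_jet_cong[OF has_jet_cmult[OF has_jet_mult[OF jH ji], of "- \<nu> / 4"]], goal_cases)
    case 2
    show ?case unfolding fst_conv snd_conv y_def[symmetric] h_def[symmetric] k_def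
      using t by (simp add: field_simps power2_eq_square)
  next
    case 3
    show ?case unfolding snd_conv k_def by (simp add: inverse_eq_divide)
  next
    case 4
    show ?case unfolding snd_conv k_def by (simp add: t0 inverse_eq_divide)
  qed simp
  have E': "exp (- \<nu> / 4 * (H ((fst (x, t) - xc) \<bullet> (fst (x, t) - xc)) * inverse (snd (x, t)))) = E"
    unfolding E fst_conv snd_conv divide_inverse ..
  have "taylor2 exp (- \<nu> / 4 * (H ((fst (x, t) - xc) \<bullet> (fst (x, t) - xc)) * inverse (snd (x, t)))) E E"
    using taylor2_exp[of "- \<nu> / 4 * (H ((fst (x, t) - xc) \<bullet> (fst (x, t) - xc)) * inverse (snd (x, t)))"] unfolding E' .
  from has_jet_compose[OF jq this]
  show ?thesis
  proof (rule has_jet_cong, goal_cases)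
    case 4
    have c: "E * (- k * (4 * H2)) + E * (k * (2 * H1) * (k * (2 * H1))) = E * k * (\<nu> / t * H1\<^sup>2 - 4 * H2)"
      unfolding k_def using t by (simp add: field_simps power2_eq_square)
    have "E *\<^sub>R ((- k) *\<^sub>R ((2 * H1) *\<^sub>R mat 1 + (4 * H2) *\<^sub>R tensor y y)) + E *\<^sub>R tensor ((- k * (2 * H1)) *\<^sub>R y) ((- k * (2 * H1)) *\<^sub>R y)
      = (- E * k * (2 * H1)) *\<^sub>R mat 1 + (E * (- k * (4 * H2)) + E * (k * (2 * H1) * (k * (2 * H1)))) *\<^sub>R tensor y y"
      unfolding tensor_scaleR_left tensor_scaleR_right by (simp add: scaleR_add_right scaleR_add_left scaleR_diff_left scaleR_diff_right mult.assoc)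
    then show ?case unfolding c y_def[symmetric] k_def[symmetric] .
  qed (simp_all add: inverse_eq_divide y_def[symmetric] h_def[symmetric] k_def)
qed

text \<open>
  For Hessians of radial functions the operator has the explicit value on the right. At the centre \<open>y = 0\<close> the gradient vanishes, but the Hessian is a multiple of the
  identity, on which the operator does not depend on the direction of the gradient.
\<close>

lemma jsub_radial:
  fixes y :: "real^'n"
  assumes a: "0 \<le> a" "a < 1" and j: "jsub a v z" and \<alpha>: "\<alpha> \<noteq> 0"
    and t: "touch_above v z c (\<alpha> *\<^sub>R y) (\<kappa> *\<^sub>R mat 1 + \<beta> *\<^sub>R tensor y y)"
  shows "c \<le> \<kappa> * (a * real CARD('n) + 1 - 2 * a) + \<beta> * ((1 - a) * (y \<bullet> y))"
proof -
  define X where "X = \<kappa> *\<^sub>R (mat 1 :: real^'n^'n) + \<beta> *\<^sub>R tensor y y"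
  have X: "transpose X = X" unfolding X_def by (simp add: transpose_plus transpose_scale transpose_tensor transpose_mat)
  have tI: "trace (mat 1 :: real^'n^'n) = real CARD('n)" by (simp add: trace_I)
  have LI: "Lop a \<eta> (\<kappa> *\<^sub>R mat 1) = \<kappa> * (a * real CARD('n) + 1 - 2 * a)" if "\<eta> \<noteq> 0" for \<eta> :: "real^'n"
  proof -
    have "sgn \<eta> \<bullet> sgn \<eta> = 1" using that by (simp add: power2_norm_eq_inner[symmetric] norm_sgn)
    then have "Lop a \<eta> (mat 1) = a * real CARD('n) + 1 - 2 * a" unfolding Lop_sgn by (simp add: tI)
    then show ?thesis by (simp add: Lop_scaleR)
  qed
  show ?thesis
  proof (cases "y = 0")
    case True
    have X0: "X = \<kappa> *\<^sub>R mat 1" unfolding X_def True by (simp add: vec_eq_iff tensor_def)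
    define N where "N = real CARD('n) + 1"
    have N: "0 < N" unfolding N_def by (simp add: add_nonneg_pos)
    have "c \<le> \<kappa> * (a * real CARD('n) + 1 - 2 * a)"
    proof (rule field_le_epsilon)
      fix e :: real assume e: "0 < e"
      show "c \<le> \<kappa> * (a * real CARD('n) + 1 - 2 * a) + e"
      proof (rule j[unfolded jsub_def, rule_format, OF X t[folded X_def]], intro exI[of _ "e / N"] conjI allI impI)
        fix \<eta> :: "real^'n" and Y :: "real^'n^'n" assume \<eta>: "\<eta> \<noteq> 0" and Y: "norm (Y - X) < e / N"
        have "Lop a \<eta> Y - Lop a \<eta> X = Lop a \<eta> (Y - X)" by (simp add: Lop_diff)
        also have "\<dots> \<le> N * norm (Y - X)" using abs_Lop_le[OF a, of \<eta> "Y - X"] unfolding N_def by simp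
        also have "\<dots> \<le> N * (e / N)" using N Y by (intro mult_left_mono) auto
        finally have "Lop a \<eta> Y \<le> Lop a \<eta> X + e" using N by simp
        then show "Lop a \<eta> Y \<le> \<kappa> * (a * real CARD('n) + 1 - 2 * a) + e" unfolding X0 LI[OF \<eta>] .
      qed (use e N in simp)
    qed
    then show ?thesis using True by simp
  next
    case False
    then have g: "\<alpha> *\<^sub>R y \<noteq> 0" using \<alpha> by simp
    have "c \<le> Lop a (\<alpha> *\<^sub>R y) X"
      using jsub_frozen[OF a g j t[folded X_def] X] by simp
    also have "Lop a (\<alpha> *\<^sub>R y) X = Lop a (\<alpha> *\<^sub>R y) (\<kappa> *\<^sub>R mat 1) + \<beta> * Lop a (\<alpha> *\<^sub>R y) (tensor y y)"
      unfolding X_def by (simp add: Lop_add Lop_scaleR)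
    also have "Lop a (\<alpha> *\<^sub>R y) (tensor y y) = (1 - a) * (y \<bullet> y)"
    proof -
      have s: "sgn (\<alpha> *\<^sub>R y) = sgn \<alpha> *\<^sub>R sgn y" by (simp add: sgn_scaleR)
      have "y \<bullet> sgn y = norm y" using False by (simp add: sgn_div_norm power2_norm_eq_inner[symmetric] power2_eq_square)
      then have "sgn (\<alpha> *\<^sub>R y) \<bullet> (tensor y y *v sgn (\<alpha> *\<^sub>R y)) = y \<bullet> y"
        unfolding s tensor_vector using \<alpha> by (simp add: inner_commute sgn_if power2_norm_eq_inner[symmetric] power2_eq_square)
      then show ?thesis unfolding Lop_sgn by (simp add: trace_tensor algebra_simps)
    qed
    finally show ?thesis unfolding LI[OF g] .
  qed
qed

text \<open>
  The exponent is \<open>H\<close> of the squared distance to the centre, where \<open>H\<close> is the square of \<open>\<rho> - sqrt (\<epsilon>\<^sup>2 + |x - xc|\<^sup>2)\<close>. It vanishes on the sphere of radius \<open>R\<close>, the square of its gradient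
  is at most four times its value, as for a squared distance, and it is smooth at the centre.
\<close>

lemma heat_kernel_upper_bound:
  fixes u :: "(real^'n) \<times> real \<Rightarrow> real"
  assumes N: "2 \<le> CARD('n)" and a: "0 \<le> a" "a < 1" and R: "0 < R" and \<epsilon>: "0 < \<epsilon>" and \<nu>: "0 < \<nu>" "\<nu> * (1 - a) < 1" and M: "0 < M"
    and j: "\<And>x t. norm (x - xc) < R \<Longrightarrow> 0 < t \<Longrightarrow> jsub a u (x, t)"
    and le: "\<And>x t. norm (x - xc) \<le> R \<Longrightarrow> 0 < t \<Longrightarrow> u (x, t) \<le> M"
    and cont: "continuous_on (cball xc R \<times> {0..}) u" and ini: "\<And>x. norm (x - xc) \<le> R \<Longrightarrow> u (x, 0) = 0"
  obtains T where "0 < T" "\<And>t. 0 < t \<Longrightarrow> t < T \<Longrightarrow> u (xc, t) \<le> M * exp (- \<nu> / 4 * ((sqrt (\<epsilon>\<^sup>2 + R\<^sup>2) - \<epsilon>)\<^sup>2 / t))"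
proof -
  define C1 where "C1 = a * real CARD('n) + 1 - 2 * a"
  have "a * 2 \<le> a * real CARD('n)" using N a by (intro mult_left_mono) auto
  then have C1: "0 < C1" unfolding C1_def by simp
  define \<rho> where "\<rho> = sqrt (\<epsilon>\<^sup>2 + R\<^sup>2)"
  define g where "g s = sqrt (\<epsilon>\<^sup>2 + s)" for s
  define H where "H s = (\<rho> - g s)\<^sup>2" for s
  define \<theta> where "\<theta> = 1 - \<nu> * (1 - a)"
  have \<theta>: "0 < \<theta>" unfolding \<theta>_def using \<nu> by simp
  have \<rho>: "\<epsilon> < \<rho>" "R < \<rho>" "0 < \<rho>" "\<rho>\<^sup>2 = \<epsilon>\<^sup>2 + R\<^sup>2"
    unfolding \<rho>_def using \<epsilon> R by (auto intro!: real_less_rsqrt simp: add_pos_pos)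
  have g: "\<epsilon> \<le> g s" "0 < g s" "(g s)\<^sup>2 = \<epsilon>\<^sup>2 + s" if "0 \<le> s" for s
    unfolding g_def using that \<epsilon> by (auto intro!: real_le_rsqrt simp: add_pos_nonneg)
  have g_le: "g s \<le> \<rho>" if "s \<le> R\<^sup>2" for s unfolding g_def \<rho>_def using that by simp
  have tH: "taylor2 H s (1 - \<rho> / g s) (\<rho> / (2 * (g s) ^ 3))" if "0 \<le> s" for s
  proof (rule taylor2_DERIV[of "\<epsilon>\<^sup>2" s H "\<lambda>s. 1 - \<rho> / g s"])
    have dg: "(g has_real_derivative 1 / (2 * g x)) (at x)" if "0 < \<epsilon>\<^sup>2 + x" for x
    proof -
      have e: "1 / (2 * g x) = inverse (sqrt (\<epsilon>\<^sup>2 + x)) / 2 * (0 + 1)" unfolding g_def by (simp add: inverse_eq_divide)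
      show ?thesis unfolding e unfolding g_def[abs_def]
        by (rule DERIV_chain2[OF DERIV_real_sqrt[OF that] DERIV_add[OF DERIV_const DERIV_ident]])
    qed
    have gp: "0 < g x" if "0 < \<epsilon>\<^sup>2 + x" for x unfolding g_def using that by simp
    show "(H has_real_derivative 1 - \<rho> / g x) (at x)" if "\<bar>x - s\<bar> < \<epsilon>\<^sup>2" for x
    proof -
      have "0 < \<epsilon>\<^sup>2 + x" using that \<open>0 \<le> s\<close> by (simp add: abs_less_iff)
      note dx = dg[OF this] and gx = gp[OF this]
      show ?thesis unfolding H_def[abs_def] using gx
        by (auto intro!: derivative_eq_intros dx simp: field_simps)
    qed
    have "0 < \<epsilon>\<^sup>2 + s" using \<epsilon> that by (simp add: add_pos_nonneg)
    note ds = dg[OF this] and gs = gp[OF this]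
    show "((\<lambda>s. 1 - \<rho> / g s) has_real_derivative \<rho> / (2 * g s ^ 3)) (at s)" using gs
      by (auto intro!: derivative_eq_intros ds simp: field_simps power3_eq_cube)
  qed (use \<epsilon> in simp)
  define g0 where "g0 = sqrt (\<epsilon>\<^sup>2 + R\<^sup>2 / 2)"
  have g0: "g0 < \<rho>" unfolding g0_def \<rho>_def using R by simp
  define \<kappa> where "\<kappa> = (1 - a) * R\<^sup>2 / \<rho>\<^sup>2"
  have \<kappa>: "0 < \<kappa>" unfolding \<kappa>_def by (intro divide_pos_pos mult_pos_pos zero_less_power) (use a R \<rho> in auto)
  define T where "T = min (\<theta> * \<kappa> * \<epsilon>\<^sup>2 / C1\<^sup>2) (\<theta> * (\<rho> - g0) * \<epsilon> / (2 * C1))"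
  have T: "0 < T" unfolding T_def using \<theta> \<kappa> \<epsilon> C1 g0 by simp
  \<comment> \<open>The barrier is a supersolution: away from the sphere the term in \<open>1 / t\<close> dominates, near the sphere the convexity of \<open>H\<close>.\<close>
  have super: "\<nu> / t * (1 - \<rho> / g s)\<^sup>2 * ((1 - a) * s) - 4 * (\<rho> / (2 * g s ^ 3)) * ((1 - a) * s) - 2 * (1 - \<rho> / g s) * C1 \<le> H s / t"
    if s: "0 \<le> s" "s \<le> R\<^sup>2" and t: "0 < t" "t < T" for s t
  proof -
    define m where "m = \<rho> - g s"
    have m: "0 \<le> m" unfolding m_def using g_le[OF s(2)] by simp
    note gs = g[OF s(1)]
    have h1: "1 - \<rho> / g s = - (m / g s)" unfolding m_def using gs by (simp add: field_simps)
    have "s \<le> (g s)\<^sup>2" unfolding gs(3) by simp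
    then have "(m / g s)\<^sup>2 * s \<le> (m / g s)\<^sup>2 * (g s)\<^sup>2" by (intro mult_left_mono) auto
    also have "\<dots> = m\<^sup>2" using gs(2) by (simp add: power_divide)
    finally have "(m / g s)\<^sup>2 * s \<le> m\<^sup>2" .
    then have "\<nu> / t * (1 - a) * ((m / g s)\<^sup>2 * s) \<le> \<nu> / t * (1 - a) * m\<^sup>2"
      using \<nu> t a by (intro mult_left_mono) auto
    then have 1: "\<nu> / t * (1 - \<rho> / g s)\<^sup>2 * ((1 - a) * s) \<le> (\<nu> * (1 - a)) * (m\<^sup>2 / t)"
      unfolding h1 by (simp add: ac_simps)
    have Ht: "H s / t = (\<nu> * (1 - a)) * (m\<^sup>2 / t) + \<theta> * (m\<^sup>2 / t)"
      unfolding H_def m_def[symmetric] \<theta>_def distrib_right[symmetric] by simp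
    have "m / g s \<le> m / \<epsilon>" using gs m \<epsilon> by (intro divide_left_mono) auto
    then have "2 * C1 * (m / g s) \<le> 2 * C1 * (m / \<epsilon>)" using C1 by (intro mult_left_mono) auto
    moreover have "- 2 * (1 - \<rho> / g s) * C1 = 2 * C1 * (m / g s)" unfolding h1 by simp
    ultimately have 2: "- 2 * (1 - \<rho> / g s) * C1 \<le> 2 * C1 * (m / \<epsilon>)" by linarith
    have "2 * C1 * (m / \<epsilon>) \<le> \<theta> * (m\<^sup>2 / t) + 4 * (\<rho> / (2 * g s ^ 3)) * ((1 - a) * s)"
    proof (cases "R\<^sup>2 / 2 \<le> s")
      case True
      have "\<kappa> \<le> 4 * (\<rho> / (2 * g s ^ 3)) * ((1 - a) * s)"
      proof -
        have "\<kappa> = 4 * (\<rho> / (2 * \<rho> ^ 3)) * ((1 - a) * (R\<^sup>2 / 2))" unfolding \<kappa>_def using \<rho>(3) by (simp add: power2_eq_square power3_eq_cube)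
        also have "\<dots> \<le> 4 * (\<rho> / (2 * g s ^ 3)) * ((1 - a) * s)"
          using True gs g_le[OF s(2)] \<rho> a by (intro mult_mono mult_left_mono divide_left_mono power_mono) auto
        finally show ?thesis .
      qed
      moreover have "2 * C1 * (m / \<epsilon>) \<le> \<theta> * (m\<^sup>2 / t) + \<kappa>"
      proof -
        have "t \<le> \<theta> * \<kappa> * \<epsilon>\<^sup>2 / C1\<^sup>2" using t unfolding T_def by simp
        then have "t * C1\<^sup>2 \<le> \<theta> * \<kappa> * \<epsilon>\<^sup>2" using C1 by (simp add: field_simps)
        then have k: "C1\<^sup>2 * t / (\<theta> * \<epsilon>\<^sup>2) \<le> \<kappa>" using \<theta> \<epsilon> by (simp add: field_simps)
        have "0 \<le> \<theta> / t * (m - C1 * t / (\<theta> * \<epsilon>))\<^sup>2" using \<theta> t by simp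
        also have "\<dots> = \<theta> * (m\<^sup>2 / t) - 2 * C1 * (m / \<epsilon>) + C1\<^sup>2 * t / (\<theta> * \<epsilon>\<^sup>2)"
          using \<theta> t \<epsilon> by (simp add: field_simps power2_eq_square)
        finally show ?thesis using k by linarith
      qed
      ultimately show ?thesis by linarith
    next
      case False
      then have "g s \<le> g0" unfolding g_def g0_def by simp
      then have mm: "\<rho> - g0 \<le> m" unfolding m_def by simp
      have "t \<le> \<theta> * (\<rho> - g0) * \<epsilon> / (2 * C1)" using t unfolding T_def by simp
      then have "2 * C1 * t \<le> \<theta> * (\<rho> - g0) * \<epsilon>" using C1 by (simp add: field_simps)
      also have "\<dots> \<le> \<theta> * m * \<epsilon>" using mm \<theta> \<epsilon> by (intro mult_right_mono mult_left_mono) auto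
      finally have "m * (2 * C1 * t) \<le> m * (\<theta> * m * \<epsilon>)" using m by (intro mult_left_mono) auto
      then have "2 * C1 * (m / \<epsilon>) \<le> \<theta> * (m\<^sup>2 / t)" using t \<epsilon> by (simp add: field_simps power2_eq_square)
      moreover have "0 \<le> 4 * (\<rho> / (2 * g s ^ 3)) * ((1 - a) * s)" using gs \<rho> a s by (intro mult_nonneg_nonneg divide_nonneg_nonneg) auto
      ultimately show ?thesis by linarith
    qed
    then show ?thesis using 1 2 Ht by linarith
  qed
  define W where "W z = M * exp (- \<nu> / 4 * (H ((fst z - xc) \<bullet> (fst z - xc)) / snd z))" for z :: "(real^'n) \<times> real"
  have W0: "0 < W z" for z unfolding W_def using M by simp
  have sR: "(x - xc) \<bullet> (x - xc) \<le> R\<^sup>2" if "norm (x - xc) \<le> R" for x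
    using that unfolding power2_norm_eq_inner[symmetric] by (intro power_mono) auto
  show thesis
  proof (rule that[OF T])
    fix t assume t: "0 < t" "t < T"
    have "u (xc, t) \<le> W (xc, t)"
    proof (rule field_le_epsilon)
      fix \<eta> :: real assume \<eta>: "0 < \<eta>"
      have "uniformly_continuous_on (cball xc R \<times> {0..1}) u"
        by (intro compact_uniformly_continuous continuous_on_subset[OF cont] compact_Times) auto
      then obtain d where d: "0 < d" "\<And>z z'. z \<in> cball xc R \<times> {0..1} \<Longrightarrow> z' \<in> cball xc R \<times> {0..1} \<Longrightarrow> dist z' z < d \<Longrightarrow> dist (u z') (u z) < \<eta>"
        unfolding uniformly_continuous_on_def using \<eta> by metis
      define t1 where "t1 = min (d / 2) (min 1 (t / 2))"
      have t1: "0 < t1" "t1 < d" "t1 \<le> 1" "t1 < t" unfolding t1_def using d t by (auto simp: min_less_iff_disj)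
      have u1: "u (x, t1) \<le> \<eta>" if x: "norm (x - xc) \<le> R" for x
      proof -
        have "dist (u (x, t1)) (u (x, 0)) < \<eta>"
          by (rule d(2)) (use x t1 in \<open>auto simp: dist_norm norm_minus_commute dist_Pair_Pair\<close>)
        then show ?thesis using ini[OF x] by (simp add: dist_real_def)
      qed
      define \<Phi> where "\<Phi> z = u z - W z - \<eta>" for z
      show "u (xc, t) \<le> W (xc, t) + \<eta>"
      proof (rule ccontr)
        assume "\<not> ?thesis"
        then have pos: "0 < \<Phi> (xc, t)" unfolding \<Phi>_def by simp
        define \<delta> where "\<delta> = (T - t) * \<Phi> (xc, t) / 2"
        have \<delta>: "0 < \<delta>" unfolding \<delta>_def using pos t by simp
        obtain x s where x: "x \<in> cball xc R" "x \<in> ball xc R" and s: "t1 < s" "s < T"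
          and mx: "\<And>x' s'. x' \<in> cball xc R \<Longrightarrow> t1 \<le> s' \<Longrightarrow> s' < T \<Longrightarrow> \<Phi> (x', s') - \<delta> / (T - s') \<le> \<Phi> (x, s) - \<delta> / (T - s)"
        proof (rule parabolic_max[of "cball xc R" t1 T \<Phi> M \<delta> "ball xc R" xc t])
          have gc: "continuous_on A g" if "\<And>s. s \<in> A \<Longrightarrow> 0 \<le> s" for A
            unfolding g_def[abs_def] by (intro continuous_intros)
          show "continuous_on (cball xc R \<times> {t1..<T}) \<Phi>"
            unfolding \<Phi>_def[abs_def] W_def[abs_def] H_def g_def
            by (intro continuous_intros continuous_on_subset[OF cont]) (use t1 in auto)
          show "\<Phi> (x, s) \<le> M" if "x \<in> cball xc R" "t1 \<le> s" for x s
            using le[of x s] that t1 W0[of "(x, s)"] \<eta> unfolding \<Phi>_def by (simp add: dist_norm norm_minus_commute)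
          show "\<Phi> (x, s) \<le> 0" if x: "x \<in> cball xc R - ball xc R" and s: "t1 \<le> s" for x s
          proof -
            have n: "norm (x - xc) = R" using x by (auto simp: dist_norm norm_minus_commute)
            then have "(x - xc) \<bullet> (x - xc) = R\<^sup>2" by (simp add: power2_norm_eq_inner[symmetric])
            then have "W (x, s) = M" unfolding W_def H_def g_def \<rho>_def by simp
            then show ?thesis using le[of x s] n s t1 \<eta> unfolding \<Phi>_def by simp
          qed
          show "\<Phi> (x, t1) \<le> 0" if "x \<in> cball xc R" for x
            using u1[of x] that W0[of "(x, t1)"] unfolding \<Phi>_def by (simp add: dist_norm norm_minus_commute)
          show "\<delta> / (T - t) < \<Phi> (xc, t)"
          proof -
            have "0 < (T - t) * \<Phi> (xc, t)" using t pos by simp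
            then have "\<delta> < \<Phi> (xc, t) * (T - t)" unfolding \<delta>_def mult.commute[of "\<Phi> (xc, t)"] by linarith
            then show ?thesis using t by (simp add: pos_divide_less_eq)
          qed
        qed (use \<delta> t t1 R in auto)
        have s0: "0 < s" using s t1 by simp
        define y where "y = x - xc"
        have ny: "norm y < R" using x(2) unfolding y_def by (simp add: dist_norm norm_minus_commute)
        define E where "E = exp (- \<nu> / 4 * (H (y \<bullet> y) / s))"
        define k where "k = M * (E * (\<nu> / (4 * s)))"
        have k: "0 < k" unfolding k_def E_def using M \<nu> s0 by simp
        define h1 h2 where "h1 = 1 - \<rho> / g (y \<bullet> y)" and "h2 = \<rho> / (2 * g (y \<bullet> y) ^ 3)"
        have jW: "has_jet W (x, s) (k * (H (y \<bullet> y) / s)) ((- k * (2 * h1)) *\<^sub>R y)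
            ((- k * (2 * h1)) *\<^sub>R mat 1 + (k * (\<nu> / s * h1\<^sup>2 - 4 * h2)) *\<^sub>R tensor y y)"
          unfolding W_def[abs_def]
          by (rule has_jet_cong[OF has_jet_cmult[OF gauss_jet[OF s0 tH E_def[unfolded y_def]], of M]])
             (auto simp: y_def[symmetric] k_def h1_def h2_def scaleR_add_right scaleR_diff_right mult.assoc)
        define f where "f z = W z + \<delta> / (T - snd z)" for z :: "(real^'n) \<times> real"
        have jf: "has_jet f (x, s) (k * (H (y \<bullet> y) / s) + \<delta> / (T - s)\<^sup>2) ((- k * (2 * h1)) *\<^sub>R y)
            ((- k * (2 * h1)) *\<^sub>R mat 1 + (k * (\<nu> / s * h1\<^sup>2 - 4 * h2)) *\<^sub>R tensor y y)"
          unfolding f_def[abs_def] using has_jet_add[OF jW has_jet_end_penalty[of "(x, s)" T \<delta>]] s by simp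
        obtain r where r: "0 < r" "ball (x, s) r \<subseteq> ball xc R \<times> {t1<..<T}"
        proof -
          have "open (ball xc R \<times> {t1<..<T})" by (intro open_Times) auto
          then show thesis using that x s open_contains_ball by (metis SigmaI greaterThanLessThan_iff)
        qed
        have touch: "touch_above u (x, s) (k * (H (y \<bullet> y) / s) + \<delta> / (T - s)\<^sup>2) ((- k * (2 * h1)) *\<^sub>R y)
            ((- k * (2 * h1)) *\<^sub>R mat 1 + (k * (\<nu> / s * h1\<^sup>2 - 4 * h2)) *\<^sub>R tensor y y)"
        proof (rule touch_above_local_max[OF jf, of "r / 2"])
          fix w :: "real^'n" and \<sigma> :: real assume "norm w < r / 2" "\<bar>\<sigma>\<bar> < r / 2"
          then have "dist (x, s) (x + w, s + \<sigma>) < r" using norm_Pair_le[of w \<sigma>] by (simp add: dist_norm norm_Pair)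
          then have "(x + w, s + \<sigma>) \<in> ball (x, s) r" by simp
          then have "(x + w, s + \<sigma>) \<in> ball xc R \<times> {t1<..<T}" using r(2) by blast
          then have "x + w \<in> cball xc R" "t1 \<le> s + \<sigma>" "s + \<sigma> < T" by auto
          from mx[OF this] show "u (fst (x, s) + w, snd (x, s) + \<sigma>) - f (fst (x, s) + w, snd (x, s) + \<sigma>) \<le> u (x, s) - f (x, s)"
            unfolding \<Phi>_def f_def by simp
        qed (use r in simp)
        have y2: "0 \<le> y \<bullet> y" "y \<bullet> y < R\<^sup>2" using power_strict_mono[OF ny, of 2] unfolding power2_norm_eq_inner by auto
        have "g (y \<bullet> y) < \<rho>" unfolding g_def \<rho>_def using y2 by simp
        then have "h1 \<noteq> 0" unfolding h1_def using g[OF y2(1)] by simp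
        then have \<alpha>: "- k * (2 * h1) \<noteq> 0" using k by simp
        have ju: "jsub a u (x, s)" by (rule j) (use ny s0 in \<open>auto simp: y_def\<close>)
        have "k * (H (y \<bullet> y) / s) + \<delta> / (T - s)\<^sup>2 \<le> (- k * (2 * h1)) * C1 + (k * (\<nu> / s * h1\<^sup>2 - 4 * h2)) * ((1 - a) * (y \<bullet> y))"
          unfolding C1_def by (rule jsub_radial[OF a ju \<alpha> touch])
        also have "\<dots> = k * (\<nu> / s * h1\<^sup>2 * ((1 - a) * (y \<bullet> y)) - 4 * h2 * ((1 - a) * (y \<bullet> y)) - 2 * h1 * C1)" by (simp add: algebra_simps)
        also have "\<dots> \<le> k * (H (y \<bullet> y) / s)"
          unfolding h1_def h2_def using k y2 s0 s by (intro mult_left_mono super) auto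
        finally have "\<delta> / (T - s)\<^sup>2 \<le> 0" by simp
        moreover have "0 < \<delta> / (T - s)\<^sup>2" using \<delta> s by simp
        ultimately show False by simp
      qed
    qed
    moreover have "H 0 = (\<rho> - \<epsilon>)\<^sup>2" unfolding H_def g_def using \<epsilon> by simp
    ultimately show "u (xc, t) \<le> M * exp (- \<nu> / 4 * ((sqrt (\<epsilon>\<^sup>2 + R\<^sup>2) - \<epsilon>)\<^sup>2 / t))"
      unfolding W_def \<rho>_def[symmetric] by simp
  qed
qed

text \<open>
  On the domain the squared distance to \<open>xc\<close> is at least \<open>r\<^sup>2\<close>, so that for small times the surplus
  \<open>(\<nu> * (1 - a) - 1) * |x - xc|\<^sup>2 / t\<close> beats the constant \<open>2 * C1\<close> coming from the Laplacian of the squared distance, and the Gaussian is a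
  subsolution. The comparison is made up to an error \<open>\<eta>\<close>, which takes care of small times and of
  infinity.
\<close>

lemma heat_kernel_lower_bound:
  fixes u :: "(real^'n) \<times> real \<Rightarrow> real"
  assumes N: "2 \<le> CARD('n)" and a: "0 \<le> a" "a < 1" and \<Omega>: "open \<Omega>" and r: "0 < r" and ext: "ball xc r \<inter> closure \<Omega> = {}"
    and \<nu>: "1 < \<nu> * (1 - a)"
    and j: "\<And>x t. x \<in> \<Omega> \<Longrightarrow> 0 < t \<Longrightarrow> jsub a (\<lambda>z. - u z) (x, t)"
    and ge: "\<And>x t. x \<in> closure \<Omega> \<Longrightarrow> 0 < t \<Longrightarrow> 0 \<le> u (x, t)"
    and bd: "\<And>x t. x \<in> frontier \<Omega> \<Longrightarrow> 0 < t \<Longrightarrow> u (x, t) = 1"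
    and cont: "continuous_on (closure \<Omega> \<times> {0<..}) u" and x0: "x0 \<in> \<Omega>"
  obtains T where "0 < T" "\<And>t. 0 < t \<Longrightarrow> t < T \<Longrightarrow> exp (- \<nu> / 4 * ((norm (x0 - xc))\<^sup>2 / t)) \<le> u (x0, t)"
proof -
  define C1 where "C1 = a * real CARD('n) + 1 - 2 * a"
  have "a * 2 \<le> a * real CARD('n)" using N a by (intro mult_left_mono) auto
  then have C1: "0 < C1" unfolding C1_def by simp
  have \<nu>0: "0 < \<nu>" using \<nu> a by (meson less_trans zero_less_one zero_less_mult_pos2 diff_gt_0_iff_gt)
  define T where "T = r\<^sup>2 * (\<nu> * (1 - a) - 1) / (2 * C1)"
  have T: "0 < T" unfolding T_def using r \<nu> C1 by simp
  have far: "r \<le> norm (x - xc)" if "x \<in> closure \<Omega>" for x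
  proof -
    have "x \<notin> ball xc r" using that ext by blast
    then show ?thesis by (simp add: dist_norm norm_minus_commute not_less)
  qed
  define W where "W z = exp (- \<nu> / 4 * ((fst z - xc) \<bullet> (fst z - xc) / snd z))" for z :: "(real^'n) \<times> real"
  have W1: "W (x, s) \<le> 1" if "0 < s" for x s unfolding W_def using that \<nu>0 by simp
  show thesis
  proof (rule that[OF T])
    fix t assume t: "0 < t" "t < T"
    have "W (x0, t) \<le> u (x0, t)"
    proof (rule field_le_epsilon)
      fix \<eta> :: real assume \<eta>: "0 < \<eta>"
      define B where "B = 4 / \<nu> * \<bar>ln \<eta>\<bar> + 1"
      have B: "0 < B" unfolding B_def using \<nu>0 by (simp add: add_nonneg_pos)
      have W\<eta>: "W (x, s) \<le> \<eta>" if "B \<le> (x - xc) \<bullet> (x - xc) / s" for x s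
      proof -
        have "\<nu> / 4 * B \<le> \<nu> / 4 * ((x - xc) \<bullet> (x - xc) / s)" using that \<nu>0 by (intro mult_left_mono) auto
        moreover have "\<nu> / 4 * B = \<bar>ln \<eta>\<bar> + \<nu> / 4" unfolding B_def using \<nu>0 by (simp add: field_simps)
        ultimately have "- \<nu> / 4 * ((x - xc) \<bullet> (x - xc) / s) \<le> ln \<eta>" using \<nu>0 by linarith
        then have "W (x, s) \<le> exp (ln \<eta>)" unfolding W_def by simp
        then show ?thesis using \<eta> by simp
      qed
      define t1 where "t1 = min (t / 2) (r\<^sup>2 / B)"
      have t1: "0 < t1" "t1 < t" "B * t1 \<le> r\<^sup>2" 
      proof -
        show "0 < t1" "t1 < t" unfolding t1_def using t r B by (auto simp: min_less_iff_disj)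
        have "B * t1 \<le> B * (r\<^sup>2 / B)" unfolding t1_def using B by (intro mult_left_mono) auto
        then show "B * t1 \<le> r\<^sup>2" using B by simp
      qed
      define \<rho> where "\<rho> = B * T + norm (x0 - xc) + 1"
      have BT: "0 < B * T" using B T by simp
      have \<rho>: "1 \<le> \<rho>" "B * T \<le> \<rho>" "norm (x0 - xc) < \<rho>" unfolding \<rho>_def using BT by auto
      have \<rho>2: "B * T \<le> \<rho>\<^sup>2" 
      proof -
        have "1 * \<rho> \<le> \<rho> * \<rho>" using \<rho>(1) by (intro mult_right_mono) auto
        then show ?thesis using \<rho>(2) by (simp add: power2_eq_square)
      qed
      define \<Phi> where "\<Phi> z = W z - u z - \<eta>" for z
      define K where "K = closure \<Omega> \<inter> cball xc \<rho>"
      show "W (x0, t) \<le> u (x0, t) + \<eta>"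
      proof (rule ccontr)
        assume "\<not> ?thesis"
        then have pos: "0 < \<Phi> (x0, t)" unfolding \<Phi>_def by simp
        define \<delta> where "\<delta> = (T - t) * \<Phi> (x0, t) / 2"
        have \<delta>: "0 < \<delta>" unfolding \<delta>_def using pos t by simp
        obtain x s where x: "x \<in> K" "x \<in> \<Omega> \<inter> ball xc \<rho>" and s: "t1 < s" "s < T"
          and mx: "\<And>x' s'. x' \<in> K \<Longrightarrow> t1 \<le> s' \<Longrightarrow> s' < T \<Longrightarrow> \<Phi> (x', s') - \<delta> / (T - s') \<le> \<Phi> (x, s) - \<delta> / (T - s)"
        proof (rule parabolic_max[of K t1 T \<Phi> 1 \<delta> "\<Omega> \<inter> ball xc \<rho>" x0 t])
          show "compact K" unfolding K_def by (metis compact_Int_closed compact_cball closed_closure Int_commute)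
          show "continuous_on (K \<times> {t1..<T}) \<Phi>"
            unfolding \<Phi>_def[abs_def] W_def[abs_def]
            by (intro continuous_intros continuous_on_subset[OF cont]) (use t1 in \<open>auto simp: K_def\<close>)
          show "\<Phi> (x, s) \<le> 1" if "x \<in> K" "t1 \<le> s" for x s
            using ge[of x s] that t1 W1[of s x] \<eta> unfolding \<Phi>_def K_def by simp
          show "\<Phi> (x, s) \<le> 0" if x: "x \<in> K - \<Omega> \<inter> ball xc \<rho>" and s: "t1 \<le> s" "s < T" for x s
          proof (cases "x \<in> \<Omega>")
            case True
            then have "norm (x - xc) = \<rho>" using x unfolding K_def by (auto simp: dist_norm norm_minus_commute)
            then have "(x - xc) \<bullet> (x - xc) = \<rho>\<^sup>2" by (simp add: power2_norm_eq_inner[symmetric])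
            moreover have "B * s \<le> \<rho>\<^sup>2" 
            proof -
              have "B * s \<le> B * T" using s B by (intro mult_left_mono) auto
              then show ?thesis using \<rho>2 by linarith
            qed
            ultimately have "W (x, s) \<le> \<eta>" using s t1 by (intro W\<eta>) (simp add: pos_le_divide_eq)
            then show ?thesis using ge[of x s] x s t1 unfolding \<Phi>_def K_def by simp
          next
            case False
            then have "x \<in> frontier \<Omega>" using x \<Omega> unfolding K_def frontier_def by (simp add: interior_open)
            then show ?thesis using bd[of x s] W1[of s x] s t1 \<eta> unfolding \<Phi>_def by simp
          qed
          show "\<Phi> (x, t1) \<le> 0" if x: "x \<in> K" for x
          proof -
            have "r\<^sup>2 \<le> (x - xc) \<bullet> (x - xc)"
              using far[of x] x r unfolding K_def power2_norm_eq_inner[symmetric] by (intro power_mono) auto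
            then have "W (x, t1) \<le> \<eta>" using t1 by (intro W\<eta>) (simp add: pos_le_divide_eq)
            then show ?thesis using ge[of x t1] x t1 unfolding \<Phi>_def K_def by simp
          qed
          show "x0 \<in> K" unfolding K_def using x0 closure_subset[of \<Omega>] \<rho> by (auto simp: dist_norm norm_minus_commute)
          show "\<delta> / (T - t) < \<Phi> (x0, t)"
          proof -
            have "0 < (T - t) * \<Phi> (x0, t)" using t pos by simp
            then have "\<delta> < \<Phi> (x0, t) * (T - t)" unfolding \<delta>_def mult.commute[of "\<Phi> (x0, t)"] by linarith
            then show ?thesis using t by (simp add: pos_divide_less_eq)
          qed
        qed (use \<delta> t t1 in auto)
        have s0: "0 < s" using s t1 by simp
        define y where "y = x - xc"
        have ny: "r\<^sup>2 \<le> y \<bullet> y"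
          using far[of x] x(1) r unfolding y_def K_def power2_norm_eq_inner[symmetric] by (intro power_mono) auto
        define k where "k = W (x, s) * (\<nu> / (4 * s))"
        have k: "0 < k" unfolding k_def W_def using \<nu>0 s0 by simp
        have tI: "taylor2 (\<lambda>x. x) q 1 0" for q
          unfolding taylor2_def by (auto intro!: exI[of _ 1])
        have jW: "has_jet W (x, s) (k * (y \<bullet> y / s)) ((- k * 2) *\<^sub>R y) ((- k * 2) *\<^sub>R mat 1 + (k * (\<nu> / s)) *\<^sub>R tensor y y)"
          unfolding W_def[abs_def]
          by (rule has_jet_cong[OF gauss_jet[OF s0 tI refl, where \<nu> = \<nu>]]) (auto simp: y_def k_def W_def)
        define f where "f z = - W z + \<delta> / (T - snd z)" for z :: "(real^'n) \<times> real"
        have jf: "has_jet f (x, s) (- (k * (y \<bullet> y / s)) + \<delta> / (T - s)\<^sup>2) ((k * 2) *\<^sub>R y) ((k * 2) *\<^sub>R mat 1 + (- (k * (\<nu> / s))) *\<^sub>R tensor y y)"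
          unfolding f_def[abs_def]
          by (rule has_jet_cong[OF has_jet_add[OF has_jet_uminus[OF jW] has_jet_end_penalty[of "(x, s)" T \<delta>]]]) (use s in auto)
        obtain d where d: "0 < d" "ball (x, s) d \<subseteq> (\<Omega> \<inter> ball xc \<rho>) \<times> {t1<..<T}"
        proof -
          have "open ((\<Omega> \<inter> ball xc \<rho>) \<times> {t1<..<T})" using \<Omega> by (intro open_Times open_Int) auto
          then show thesis using that x s open_contains_ball by (metis SigmaI greaterThanLessThan_iff)
        qed
        have touch: "touch_above (\<lambda>z. - u z) (x, s) (- (k * (y \<bullet> y / s)) + \<delta> / (T - s)\<^sup>2) ((k * 2) *\<^sub>R y) ((k * 2) *\<^sub>R mat 1 + (- (k * (\<nu> / s))) *\<^sub>R tensor y y)"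
        proof (rule touch_above_local_max[OF jf, of "d / 2"])
          fix w :: "real^'n" and \<sigma> :: real assume "norm w < d / 2" "\<bar>\<sigma>\<bar> < d / 2"
          then have "dist (x, s) (x + w, s + \<sigma>) < d" using norm_Pair_le[of w \<sigma>] by (simp add: dist_norm norm_Pair)
          then have "(x + w, s + \<sigma>) \<in> ball (x, s) d" by simp
          then have "(x + w, s + \<sigma>) \<in> (\<Omega> \<inter> ball xc \<rho>) \<times> {t1<..<T}" using d(2) by blast
          then have "x + w \<in> K" "t1 \<le> s + \<sigma>" "s + \<sigma> < T" unfolding K_def using closure_subset[of \<Omega>] by auto
          from mx[OF this] show "- u (fst (x, s) + w, snd (x, s) + \<sigma>) - f (fst (x, s) + w, snd (x, s) + \<sigma>) \<le> - u (x, s) - f (x, s)"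
            unfolding \<Phi>_def f_def by simp
        qed (use d in simp)
        have ju: "jsub a (\<lambda>z. - u z) (x, s)" by (rule j) (use x s0 in auto)
        have \<alpha>: "k * 2 \<noteq> 0" using k by simp
        have "- (k * (y \<bullet> y / s)) + \<delta> / (T - s)\<^sup>2 \<le> (k * 2) * C1 + (- (k * (\<nu> / s))) * ((1 - a) * (y \<bullet> y))"
          unfolding C1_def by (rule jsub_radial[OF a ju \<alpha> touch])
        moreover have "k * (2 * C1 - (\<nu> * (1 - a) - 1) * (y \<bullet> y) / s)
            = (k * 2) * C1 + (- (k * (\<nu> / s))) * ((1 - a) * (y \<bullet> y)) + k * (y \<bullet> y / s)"
          by (simp add: algebra_simps diff_divide_distrib add_divide_distrib)
        ultimately have "\<delta> / (T - s)\<^sup>2 \<le> k * (2 * C1 - (\<nu> * (1 - a) - 1) * (y \<bullet> y) / s)" by linarith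
        moreover have "2 * C1 \<le> (\<nu> * (1 - a) - 1) * (y \<bullet> y) / s"
        proof -
          have "2 * C1 * s \<le> 2 * C1 * T" using C1 s by (intro mult_left_mono) auto
          also have "\<dots> = r\<^sup>2 * (\<nu> * (1 - a) - 1)" unfolding T_def using C1 by simp
          also have "\<dots> \<le> (y \<bullet> y) * (\<nu> * (1 - a) - 1)" using ny \<nu> by (intro mult_right_mono) auto
          finally show ?thesis using s0 by (simp add: field_simps)
        qed
        then have "k * (2 * C1 - (\<nu> * (1 - a) - 1) * (y \<bullet> y) / s) \<le> 0" using k by (simp add: mult_le_0_iff)
        moreover have "0 < \<delta> / (T - s)\<^sup>2" using \<delta> s by simp
        ultimately show False by linarith
      qed
    qed
    then show "exp (- \<nu> / 4 * ((norm (x0 - xc))\<^sup>2 / t)) \<le> u (x0, t)"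
      unfolding W_def power2_norm_eq_inner by simp
  qed
qed

section \<open>The short-time limit\<close>

theorem theorem3p5:
  fixes p :: ereal
    and \<Omega> :: "(real^'n) set"
    and u :: "(real^'n) \<times> real \<Rightarrow> real"
  assumes "CARD('n) \<ge> 2"
    and "1 < p"
    and "open \<Omega>" and "connected \<Omega>" and "frontier \<Omega> \<noteq> {}"
    and "frontier \<Omega> = frontier (- closure \<Omega>)"
    and "visc_solution p \<Omega> u"
    and "bounded (u ` (\<Omega> \<times> {0<..}))"
    and "attains_data \<Omega> u"
  shows "\<forall>x\<in>closure \<Omega>.
           (\<forall>\<^sub>F t in at_right 0. 0 < u (x, t)) \<and>
           ((\<lambda>t. 4 * t * ln (u (x, t))) \<longlongrightarrow>
              - conj_exponent p * (infdist x (frontier \<Omega>))\<^sup>2) (at_right 0)"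
proof
  fix x assume x: "x \<in> closure \<Omega>"
  define a where "a = recip p"
  define q where "q = conj_exponent p"
  have a: "0 \<le> a" "a < 1" and q: "q = 1 / (1 - a)" "0 < q"
    using recip_bounds[OF assms(2)] unfolding a_def q_def by auto
  have sub: "visc_subsolution p \<Omega> u" and sup: "visc_supersolution p \<Omega> u"
    using assms(7) unfolding visc_solution_def by auto
  obtain M0 where M0: "\<And>z. z \<in> \<Omega> \<times> {0<..} \<Longrightarrow> \<bar>u z\<bar> \<le> M0" using assms(8) unfolding bounded_iff by auto
  define M where "M = max M0 1"
  have M: "1 \<le> M" "\<And>z. z \<in> \<Omega> \<times> {0<..} \<Longrightarrow> u z \<le> M" "\<And>z. z \<in> \<Omega> \<times> {0<..} \<Longrightarrow> - u z \<le> M"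
    using M0 unfolding M_def by (force simp: abs_le_iff)+
  have j1: "jsub a u (x, t)" and j2: "jsub a (\<lambda>z. - u z) (x, t)" if "x \<in> \<Omega>" "0 < t" for x t
    unfolding a_def using that
    by (auto intro!: jsub_of_subsolution[OF assms(2) sub M(2)] jsub_of_supersolution[OF assms(2) sup M(3)])
  have cont: "continuous_on (closure \<Omega> \<times> {0..} - frontier \<Omega> \<times> {0}) u"
    and u0: "\<And>x. x \<in> \<Omega> \<Longrightarrow> u (x, 0) = 0" and u1: "\<And>x t. x \<in> frontier \<Omega> \<Longrightarrow> 0 < t \<Longrightarrow> u (x, t) = 1"
    using assms(9) unfolding attains_data_def by auto
  have pos: "0 \<le> u (x, t)" if "x \<in> \<Omega>" "0 < t" for x t
    by (rule solution_nonneg[OF assms(2,3,5) sup assms(8,9) that])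
  have cl: "closure \<Omega> = \<Omega> \<union> frontier \<Omega>" and disj: "\<Omega> \<inter> frontier \<Omega> = {}"
    using assms(3) closure_subset[of \<Omega>] by (auto simp: frontier_def interior_open)
  have posc: "0 \<le> u (x, t)" if "x \<in> closure \<Omega>" "0 < t" for x t
    using that pos u1 unfolding cl by fastforce
  define d where "d = infdist x (frontier \<Omega>)"
  show "(\<forall>\<^sub>F t in at_right 0. 0 < u (x, t)) \<and>
        ((\<lambda>t. 4 * t * ln (u (x, t))) \<longlongrightarrow> - conj_exponent p * (infdist x (frontier \<Omega>))\<^sup>2) (at_right 0)"
  proof (cases "x \<in> \<Omega>")
    case False
    then have fr: "x \<in> frontier \<Omega>" using x unfolding cl by simp
    have ev: "\<forall>\<^sub>F t in at_right 0. u (x, t) = 1"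
      using eventually_at_right_less[of "0::real"] by eventually_elim (rule u1[OF fr])
    have "\<forall>\<^sub>F t in at_right 0. 4 * t * ln (u (x, t)) = - conj_exponent p * (infdist x (frontier \<Omega>))\<^sup>2"
      using ev by eventually_elim (simp add: infdist_zero[OF fr])
    moreover have "\<forall>\<^sub>F t in at_right 0. 0 < u (x, t)" using ev by eventually_elim simp
    ultimately show ?thesis by (auto intro: tendsto_eventually)
  next
    case True
    have lower: "\<exists>T>0. \<forall>t. 0 < t \<longrightarrow> t < T \<longrightarrow> exp (- \<nu> / 4 * ((d + e)\<^sup>2 / t)) \<le> u (x, t)"
      if \<nu>: "q < \<nu>" and e: "0 < e" for \<nu> e
    proof -
      obtain y where y: "y \<in> frontier \<Omega>" "d = dist x y"
        unfolding d_def by (rule infdist_attains_inf[OF frontier_closed assms(5)]) blast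
      have "y \<in> frontier (- closure \<Omega>)" by (subst assms(6)[symmetric]) (rule y(1))
      then have "y \<in> closure (- closure \<Omega>)" unfolding frontier_def by blast
      then obtain z where z: "z \<in> - closure \<Omega>" "dist z y < e" unfolding closure_approachable using e by auto
      have "open (- closure \<Omega>)" by (simp add: open_Compl)
      then obtain r where r: "0 < r" "ball z r \<subseteq> - closure \<Omega>" using z(1) open_contains_ball by metis
      have ext: "ball z r \<inter> closure \<Omega> = {}" using r(2) by auto
      have \<nu>1: "1 < \<nu> * (1 - a)" using \<nu> a unfolding q by (simp add: field_simps)
      obtain T where T: "0 < T" "\<And>t. 0 < t \<Longrightarrow> t < T \<Longrightarrow> exp (- \<nu> / 4 * ((norm (x - z))\<^sup>2 / t)) \<le> u (x, t)"
      proof (rule heat_kernel_lower_bound[OF assms(1) a assms(3) r(1) ext \<nu>1 j2 posc u1 _ True])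
        show "continuous_on (closure \<Omega> \<times> {0<..}) u" by (rule continuous_on_subset[OF cont]) auto
      qed auto
      have "norm (x - z) \<le> d + e"
        using dist_triangle[of x z y] y z unfolding dist_norm by (simp add: norm_minus_commute)
      then have n: "(norm (x - z))\<^sup>2 \<le> (d + e)\<^sup>2" by (intro power_mono) auto
      have "exp (- \<nu> / 4 * ((d + e)\<^sup>2 / t)) \<le> u (x, t)" if t: "0 < t" "t < T" for t
      proof -
        have "\<nu> / 4 * ((norm (x - z))\<^sup>2 / t) \<le> \<nu> / 4 * ((d + e)\<^sup>2 / t)"
          using n t less_trans[OF q(2) \<nu>] by (intro mult_left_mono divide_right_mono) auto
        then have "exp (- \<nu> / 4 * ((d + e)\<^sup>2 / t)) \<le> exp (- \<nu> / 4 * ((norm (x - z))\<^sup>2 / t))" by simp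
        then show ?thesis using T(2)[OF t] by linarith
      qed
      then show ?thesis using T(1) by blast
    qed
    have upper: "\<exists>T>0. \<forall>t. 0 < t \<longrightarrow> t < T \<longrightarrow> u (x, t) \<le> M * exp (- \<nu> / 4 * ((sqrt (e\<^sup>2 + R\<^sup>2) - e)\<^sup>2 / t))"
      if \<nu>: "0 < \<nu>" "\<nu> < q" and R: "0 < R" "R < d" and e: "0 < e" for \<nu> R e
    proof -
      have away: "cball x R \<inter> frontier \<Omega> = {}"
      proof -
        have "dist x y > R" if "y \<in> frontier \<Omega>" for y using infdist_le[OF that, of x] R unfolding d_def by linarith
        then show ?thesis by force
      qed
      have in\<Omega>: "cball x R \<subseteq> \<Omega>"
      proof (rule ccontr)
        assume "\<not> ?thesis"
        then have out: "cball x R - \<Omega> \<noteq> {}" by blast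
        have "x \<in> cball x R \<inter> \<Omega>" using True R by simp
        then have "cball x R \<inter> \<Omega> \<noteq> {}" by blast
        from connected_Int_frontier[OF connected_cball this out] have "cball x R \<inter> frontier \<Omega> \<noteq> {}" .
        then show False using away by simp
      qed
      then have mem: "y \<in> \<Omega>" if "norm (y - x) \<le> R" for y using that by (auto simp: dist_norm norm_minus_commute subset_iff)
      have \<nu>1: "\<nu> * (1 - a) < 1" using \<nu> a unfolding q by (simp add: field_simps)
      have M0: "0 < M" using M by simp
      obtain T where "0 < T" "\<And>t. 0 < t \<Longrightarrow> t < T \<Longrightarrow> u (x, t) \<le> M * exp (- \<nu> / 4 * ((sqrt (e\<^sup>2 + R\<^sup>2) - e)\<^sup>2 / t))"
      proof (rule heat_kernel_upper_bound[OF assms(1) a R(1) e \<nu>(1) \<nu>1 M0, of x u])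
        show "continuous_on (cball x R \<times> {0..}) u"
          by (rule continuous_on_subset[OF cont]) (use in\<Omega> disj closure_subset[of \<Omega>] in auto)
      qed (use mem j1 M(2) u0 in auto)
      then show ?thesis by blast
    qed
    have d: "0 < d" unfolding d_def
      by (rule infdist_pos_not_in_closed[OF frontier_closed assms(5)]) (use True disj in auto)
    have evT: "\<forall>\<^sub>F t in at_right (0::real). P t" if "\<exists>T>0. \<forall>t. 0 < t \<longrightarrow> t < T \<longrightarrow> P t" for P
      using that unfolding eventually_at_right_field by blast
    have evpos: "\<forall>\<^sub>F t in at_right 0. 0 < u (x, t)"
    proof -
      have "\<forall>\<^sub>F t in at_right 0. exp (- (q + 1) / 4 * ((d + 1)\<^sup>2 / t)) \<le> u (x, t)"
        by (rule evT[OF lower]) auto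
      then show ?thesis by eventually_elim (rule less_le_trans[OF exp_gt_zero])
    qed
    have small: "\<exists>e>0. P e" if "\<forall>\<^sub>F e in at_right (0::real). P e" for P
      using eventually_happens[OF eventually_conj[OF that eventually_at_right_less[of "0::real"]]] by auto
    have "((\<lambda>t. 4 * t * ln (u (x, t))) \<longlongrightarrow> - q * d\<^sup>2) (at_right 0)"
    proof (rule order_tendstoI)
      fix l assume l: "l < - q * d\<^sup>2"
      have "((\<lambda>e. (q + e) * (d + e)\<^sup>2) \<longlongrightarrow> q * d\<^sup>2) (at_right 0)" by (auto intro!: tendsto_eq_intros)
      then have "\<forall>\<^sub>F e in at_right 0. (q + e) * (d + e)\<^sup>2 < - l" by (rule order_tendstoD) (use l in simp)
      then obtain e where e: "0 < e" "(q + e) * (d + e)\<^sup>2 < - l" using small by blast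
      have "\<forall>\<^sub>F t in at_right 0. exp (- (q + e) / 4 * ((d + e)\<^sup>2 / t)) \<le> u (x, t)"
        by (rule evT[OF lower]) (use e in auto)
      then show "\<forall>\<^sub>F t in at_right 0. l < 4 * t * ln (u (x, t))"
        using evpos eventually_at_right_less[of "0::real"]
      proof eventually_elim
        case (elim t)
        have "- (q + e) / 4 * ((d + e)\<^sup>2 / t) \<le> ln (u (x, t))" using elim by (simp add: ln_ge_iff)
        then have "4 * t * (- (q + e) / 4 * ((d + e)\<^sup>2 / t)) \<le> 4 * t * ln (u (x, t))" using elim by (intro mult_left_mono) auto
        moreover have "4 * t * (- (q + e) / 4 * ((d + e)\<^sup>2 / t)) = - ((q + e) * (d + e)\<^sup>2)" using elim by (simp add: field_simps)
        ultimately show ?case using e(2) by linarith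
      qed
    next
      fix l assume l: "- q * d\<^sup>2 < l"
      have "((\<lambda>e. (q - e) * (sqrt (e\<^sup>2 + (d - e)\<^sup>2) - e)\<^sup>2) \<longlongrightarrow> q * d\<^sup>2) (at_right 0)"
        using d by (auto intro!: tendsto_eq_intros)
      then have 1: "\<forall>\<^sub>F e in at_right 0. - l < (q - e) * (sqrt (e\<^sup>2 + (d - e)\<^sup>2) - e)\<^sup>2" by (rule order_tendstoD) (use l in simp)
      have 2: "\<forall>\<^sub>F e in at_right 0. e < min d q" by (rule evT) (use d q in \<open>auto intro!: exI[of _ "min d q"]\<close>)
      obtain e where e: "0 < e" "- l < (q - e) * (sqrt (e\<^sup>2 + (d - e)\<^sup>2) - e)\<^sup>2" "e < d" "e < q"
        using small[OF eventually_conj[OF 1 2]] by auto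
      define A where "A = (q - e) * (sqrt (e\<^sup>2 + (d - e)\<^sup>2) - e)\<^sup>2"
      have A: "0 < l + A" using e unfolding A_def by simp
      have "((\<lambda>t. 4 * t * ln M) \<longlongrightarrow> 0) (at_right 0)" by (auto intro!: tendsto_eq_intros)
      then have 3: "\<forall>\<^sub>F t in at_right 0. 4 * t * ln M < l + A" by (rule order_tendstoD) (use A in simp)
      have 4: "\<forall>\<^sub>F t in at_right 0. u (x, t) \<le> M * exp (- (q - e) / 4 * ((sqrt (e\<^sup>2 + (d - e)\<^sup>2) - e)\<^sup>2 / t))"
        by (rule evT[OF upper]) (use e in auto)
      show "\<forall>\<^sub>F t in at_right 0. 4 * t * ln (u (x, t)) < l"
        using 3 4 evpos eventually_at_right_less[of "0::real"]
      proof eventually_elim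
        case (elim t)
        have "ln (u (x, t)) \<le> ln (M * exp (- (q - e) / 4 * ((sqrt (e\<^sup>2 + (d - e)\<^sup>2) - e)\<^sup>2 / t)))"
          using elim M(1) by (subst ln_le_cancel_iff) auto
        also have "\<dots> = ln M + (- (q - e) / 4 * ((sqrt (e\<^sup>2 + (d - e)\<^sup>2) - e)\<^sup>2 / t))" using M(1) by (subst ln_mult) auto
        finally have "4 * t * ln (u (x, t)) \<le> 4 * t * (ln M + (- (q - e) / 4 * ((sqrt (e\<^sup>2 + (d - e)\<^sup>2) - e)\<^sup>2 / t)))"
          using elim by (intro mult_left_mono) auto
        also have "\<dots> = 4 * t * ln M - A"
        proof -
          have g: "4 * t * (- c / 4 * (b / t)) = - (c * b)" for b c :: real using elim(4) by (simp add: field_simps)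
          show ?thesis unfolding distrib_left g A_def by (rule diff_conv_add_uminus[symmetric])
        qed
        finally show ?case using elim(1) by linarith
      qed
    qed
    then show ?thesis using evpos unfolding q_def d_def by simp
  qed
qed

end
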